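(* Let $-A$ be the generator of a $C_0$-semigroup $(T(t))_{t\ge0}$ on a Banach space $X$, and assume $A$ has resolvent growth $(\alpha,\beta)$ for some $\alpha,\beta\in[0,\infty)$. Let $n\in\mathbb N_0$ and let $Y$ be an $(A,n)$-admissible space. Then the following are equivalent: (1) $\sup_{t\ge0}\|t^nT(t)\|_{\mathcal L(Y,X)}<\infty$; (2) there exist $\psi\in C_c^\infty(\mathbb R)$, $p\in[1,\infty)$ and $q\in[p,\infty]$ such that $\psi(\cdot)R(i\cdot,A)^k\in\mathcal M_{1,\infty}(\mathbb R;\mathcal L(Y,X))$ and $(1-\psi(\cdot))R(i\cdot,A)^k\in\mathcal M_{p,q}(\mathbb R;\mathcal L(Y,X))$ for all $k\in\{n-1,n,n+1\}\cap\mathbb N$. Moreover, if (1) or (2) holds, then $R(i\cdot,A)^k\in\mathcal M_{p,q}(\mathbb R;\mathcal L(Y,X))$ in each of the following cases: (i) $n\ge2$, $k\in\{1,\dots,n-1\}$ and $1\le p\le q\le\infty$ (with $p<\infty$); (ii) $k=n\ge1$ and $1\le p<q\le\infty$; (iii) $k=n+1$, $p=1$, $q=\infty$.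
   Context: All Banach spaces are complex; $R(\lambda,A)=(\lambda-A)^{-1}$; $\mathbb C_\pm=\{\pm\Re\lambda>0\}$. An operator $A$ has resolvent growth $(\alpha,\beta)$ ($\alpha,\beta\ge0$) if $-A$ generates a $C_0$-semigroup $(T(t))_{t\ge0}$ on $X$ (not assumed bounded), $\overline{\mathbb C_-}\setminus\{0\}\subseteq\rho(A)$, and $\{\lambda^\alpha(1+\lambda)^{-\alpha-\beta}(\lambda+A)^{-1}\mid\lambda\in\overline{\mathbb C_+}\setminus\{0\}\}\subseteq\mathcal L(X)$ is uniformly bounded. For $n\in\mathbb N_0$, a Banach space $Y$ continuously embedded in $X$ is $(A,n)$-admissible if (i) there is $C_T\ge0$ with $T(t)Y\subseteq Y$ and $\|T(t)|_Y\|_{\mathcal L(Y)}\le C_T\|T(t)\|_{\mathcal L(X)}$ for all $t\ge0$, and (ii) there is a dense subspace $Y_0\subseteq Y$ such that $t\mapsto t^nT(t)y$ belongs to $L^1([0,\infty);X)$ for all $y\in Y_0$. Fourier multipliers: $\widehat g(\xi)=\int e^{-i\xi t}g(t)dt$; $\dot{\mathcal S}(\mathbb R;Y)$ is the set of $Y$-valued Schwartz functions whose Fourier transforms vanish to infinite order at $0$; for $m:\mathbb R\setminus\{0\}\to\mathcal L(Y,X)$ strongly measurable with moderate growth (there are $a\ge0$, $g\in L^1(\mathbb R)$ with $|\xi|^a(1+|\xi|)^{-2a}\|m(\xi)\|\le g(\xi)$), $T_mf:=\mathcal F^{-1}(m\widehat f)$ for $f\in\dot{\mathcal S}(\mathbb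 R;Y)$, and $m\in\mathcal M_{p,q}(\mathbb R;\mathcal L(Y,X))$ ($p\in[1,\infty)$, $q\in[1,\infty]$) means $T_m$ extends to a bounded operator $L^p(\mathbb R;Y)\to L^q(\mathbb R;X)$. *)

theory Defs
  imports "HOL-Analysis.Analysis"
begin

class complex_normed_vector = real_normed_vector +
  fixes scaleC :: "complex \<Rightarrow> 'a \<Rightarrow> 'a"
  assumes scaleC_of_real: "scaleC (of_real r) x = scaleR r x"
    and scaleC_add_right: "scaleC a (x + y) = scaleC a x + scaleC a y"
    and scaleC_add_left: "scaleC (a + b) x = scaleC a x + scaleC b x"
    and scaleC_scaleC: "scaleC a (scaleC b x) = scaleC (a * b) x"
    and norm_scaleC: "norm (scaleC a x) = cmod a * norm x"

instantiation complex :: complex_normed_vector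
begin
definition scaleC_complex_def: "scaleC a (x::complex) = a * x"
instance
  by standard (auto simp: scaleC_complex_def scaleR_conv_of_real algebra_simps norm_mult)
end

definition clinear :: "('a::complex_normed_vector \<Rightarrow> 'b::complex_normed_vector) \<Rightarrow> bool" where
  "clinear f \<longleftrightarrow> (\<forall>x y. f (x + y) = f x + f y) \<and> (\<forall>c x. f (scaleC c x) = scaleC c (f x))"

definition bounded_clinear :: "('a::complex_normed_vector \<Rightarrow> 'b::complex_normed_vector) \<Rightarrow> bool" where
  "bounded_clinear f \<longleftrightarrow> clinear f \<and> (\<exists>K. \<forall>x. norm (f x) \<le> norm x * K)"

definition csubspace :: "'a::complex_normed_vector set \<Rightarrow> bool" where
  "csubspace S \<longleftrightarrow> 0 \<in> S \<and> (\<forall>x\<in>S. \<forall>y\<in>S. x + y \<in> S) \<and> (\<forall>c. \<forall>x\<in>S. scaleC c x \<in> S)"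

definition c0_semigroup :: "(real \<Rightarrow> 'x::{complex_normed_vector,banach} \<Rightarrow> 'x) \<Rightarrow> bool" where
  "c0_semigroup T \<longleftrightarrow>
     (\<forall>t\<ge>0. bounded_clinear (T t)) \<and> T 0 = id \<and>
     (\<forall>s\<ge>0. \<forall>t\<ge>0. T (s + t) = T s \<circ> T t) \<and>
     (\<forall>x. continuous_on {0..} (\<lambda>t. T t x))"

definition generator :: "(real \<Rightarrow> 'x::{complex_normed_vector,banach} \<Rightarrow> 'x) \<Rightarrow> ('x \<Rightarrow> 'x) \<Rightarrow> 'x set \<Rightarrow> bool" where
  "generator T B D \<longleftrightarrow>
     (\<forall>x. x \<in> D \<longleftrightarrow> (\<exists>y. ((\<lambda>h. (1 / h) *\<^sub>R (T h x - x)) \<longlongrightarrow> y) (at_right 0))) \<and>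
     (\<forall>x\<in>D. ((\<lambda>h. (1 / h) *\<^sub>R (T h x - x)) \<longlongrightarrow> B x) (at_right 0))"

definition is_resolvent :: "('x::complex_normed_vector \<Rightarrow> 'x) \<Rightarrow> 'x set \<Rightarrow> complex \<Rightarrow> ('x \<Rightarrow> 'x) \<Rightarrow> bool" where
  "is_resolvent A D l R \<longleftrightarrow> bounded_clinear R \<and>
     (\<forall>x. R x \<in> D \<and> scaleC l (R x) - A (R x) = x) \<and>
     (\<forall>x\<in>D. R (scaleC l x - A x) = x)"

definition resolvent_set :: "('x::complex_normed_vector \<Rightarrow> 'x) \<Rightarrow> 'x set \<Rightarrow> complex set" where
  "resolvent_set A D = {l. \<exists>R. is_resolvent A D l R}"

definition resolvent :: "('x::complex_normed_vector \<Rightarrow> 'x) \<Rightarrow> 'x set \<Rightarrow> complex \<Rightarrow> 'x \<Rightarrow> 'x" where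
  "resolvent A D l = (THE R. is_resolvent A D l R)"

text \<open>A (domain D) has resolvent growth (alpha, beta) w.r.t. the semigroup T generated by -A.
  Note (l + A)^(-1) = - R(-l, A), so its norm equals that of R(-l,A).\<close>
definition resolvent_growth ::
  "(real \<Rightarrow> 'x::{complex_normed_vector,banach} \<Rightarrow> 'x) \<Rightarrow> ('x \<Rightarrow> 'x) \<Rightarrow> 'x set \<Rightarrow> real \<Rightarrow> real \<Rightarrow> bool" where
  "resolvent_growth T A D \<alpha> \<beta> \<longleftrightarrow> \<alpha> \<ge> 0 \<and> \<beta> \<ge> 0 \<and>
     c0_semigroup T \<and> generator T (\<lambda>x. - A x) D \<and>
     {l. Re l \<le> 0 \<and> l \<noteq> 0} \<subseteq> resolvent_set A D \<and>
     (\<exists>C. \<forall>l. Re l \<ge> 0 \<and> l \<noteq> 0 \<longrightarrow> (\<forall>x.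
        cmod l powr \<alpha> * cmod (1 + l) powr (- \<alpha> - \<beta>) * norm (resolvent A D (- l) x) \<le> C * norm x))"

definition strongly_measurable :: "'a measure \<Rightarrow> ('a \<Rightarrow> 'b::real_normed_vector) \<Rightarrow> bool" where
  "strongly_measurable M f \<longleftrightarrow>
     (\<exists>s :: nat \<Rightarrow> 'a \<Rightarrow> 'b. (\<forall>i. s i \<in> borel_measurable M \<and> finite (s i ` space M)) \<and>
        (\<forall>x\<in>space M. (\<lambda>i. s i x) \<longlonglongrightarrow> f x))"

definition bochner_L1_on :: "real set \<Rightarrow> (real \<Rightarrow> 'b::real_normed_vector) \<Rightarrow> bool" where
  "bochner_L1_on S f \<longleftrightarrow> strongly_measurable (lebesgue_on S) f \<and>
     integrable (lebesgue_on S) (\<lambda>t. norm (f t))"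

definition in_Lp :: "real \<Rightarrow> (real \<Rightarrow> 'b::real_normed_vector) \<Rightarrow> bool" where
  "in_Lp p f \<longleftrightarrow> strongly_measurable lebesgue f \<and> integrable lebesgue (\<lambda>t. norm (f t) powr p)"

definition Lp_norm :: "real \<Rightarrow> (real \<Rightarrow> 'b::real_normed_vector) \<Rightarrow> real" where
  "Lp_norm p f = (\<integral>t. norm (f t) powr p \<partial>lebesgue) powr (1 / p)"

definition Lq_bounded :: "ereal \<Rightarrow> (real \<Rightarrow> 'b::real_normed_vector) \<Rightarrow> real \<Rightarrow> bool" where
  "Lq_bounded q g K \<longleftrightarrow>
     (if q = \<infinity> then strongly_measurable lebesgue g \<and> (AE t in lebesgue. norm (g t) \<le> K)
      else in_Lp (real_of_ereal q) g \<and> Lp_norm (real_of_ereal q) g \<le> K)"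

definition nderiv :: "nat \<Rightarrow> (real \<Rightarrow> 'b::real_normed_vector) \<Rightarrow> real \<Rightarrow> 'b" where
  "nderiv k f = ((\<lambda>g t. vector_derivative g (at t)) ^^ k) f"

definition smooth :: "(real \<Rightarrow> 'b::real_normed_vector) \<Rightarrow> bool" where
  "smooth f \<longleftrightarrow> (\<forall>k t. (nderiv k f has_vector_derivative nderiv (Suc k) f t) (at t))"

definition Cc_infty :: "(real \<Rightarrow> 'b::real_normed_vector) \<Rightarrow> bool" where
  "Cc_infty f \<longleftrightarrow> smooth f \<and> compact (closure {t. f t \<noteq> 0})"

definition schwartz :: "(real \<Rightarrow> 'b::real_normed_vector) \<Rightarrow> bool" where
  "schwartz f \<longleftrightarrow> smooth f \<and> (\<forall>j k. \<exists>C. \<forall>t. \<bar>t\<bar> ^ j * norm (nderiv k f t) \<le> C)"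

definition fourier :: "(real \<Rightarrow> 'b::complex_normed_vector) \<Rightarrow> real \<Rightarrow> 'b" where
  "fourier f \<xi> = integral UNIV (\<lambda>t. scaleC (cis (- (\<xi> * t))) (f t))"

definition inv_fourier :: "(real \<Rightarrow> 'b::complex_normed_vector) \<Rightarrow> real \<Rightarrow> 'b" where
  "inv_fourier g t = (1 / (2 * pi)) *\<^sub>R integral UNIV (\<lambda>\<xi>. scaleC (cis (\<xi> * t)) (g \<xi>))"

definition dot_schwartz :: "(real \<Rightarrow> 'b::complex_normed_vector) \<Rightarrow> bool" where
  "dot_schwartz f \<longleftrightarrow> schwartz f \<and> (\<forall>k. nderiv k (fourier f) 0 = 0)"

definition multiplier_op :: "(real \<Rightarrow> 'y::complex_normed_vector \<Rightarrow> 'x::complex_normed_vector) \<Rightarrow> (real \<Rightarrow> 'y) \<Rightarrow> real \<Rightarrow> 'x" where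
  "multiplier_op m f = inv_fourier (\<lambda>\<xi>. m \<xi> (fourier f \<xi>))"

definition fourier_multiplier ::
  "real \<Rightarrow> ereal \<Rightarrow> (real \<Rightarrow> 'y::{complex_normed_vector,banach} \<Rightarrow> 'x::{complex_normed_vector,banach}) \<Rightarrow> bool" where
  "fourier_multiplier p q m \<longleftrightarrow>
     (\<forall>\<xi>. \<xi> \<noteq> 0 \<longrightarrow> bounded_clinear (m \<xi>)) \<and>
     (\<forall>y. strongly_measurable lebesgue (\<lambda>\<xi>. m \<xi> y)) \<and>
     (\<exists>a g. a \<ge> 0 \<and> integrable lborel g \<and>
        (\<forall>\<xi>. \<xi> \<noteq> 0 \<longrightarrow> \<bar>\<xi>\<bar> powr a * (1 + \<bar>\<xi>\<bar>) powr (- 2 * a) * onorm (m \<xi>) \<le> g \<xi>)) \<and>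
     (\<exists>(E :: (real \<Rightarrow> 'y) \<Rightarrow> real \<Rightarrow> 'x) C.
        (\<forall>f. in_Lp p f \<longrightarrow> Lq_bounded q (E f) (C * Lp_norm p f)) \<and>
        (\<forall>f g c. in_Lp p f \<longrightarrow> in_Lp p g \<longrightarrow>
           (AE t in lebesgue. E (\<lambda>s. f s + scaleC c (g s)) t = E f t + scaleC c (E g t))) \<and>
        (\<forall>f. dot_schwartz f \<longrightarrow> (AE t in lebesgue. E f t = multiplier_op m f t)))"

text \<open>Y is continuously embedded in X via the injective bounded complex-linear map J.
  The restriction of T(t) to Y maps J y to the (unique) y' with T t (J y) = J y'.\<close>
definition admissible ::
  "(real \<Rightarrow> 'x::{complex_normed_vector,banach} \<Rightarrow> 'x) \<Rightarrow> ('y::{complex_normed_vector,banach} \<Rightarrow> 'x) \<Rightarrow> nat \<Rightarrow> bool" where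
  "admissible T J n \<longleftrightarrow>
     (\<exists>CT\<ge>0. \<forall>t\<ge>0. (\<forall>y. \<exists>y'. T t (J y) = J y') \<and>
        (\<forall>y y'. T t (J y) = J y' \<longrightarrow> norm y' \<le> CT * onorm (T t) * norm y)) \<and>
     (\<exists>Y0. csubspace Y0 \<and> closure Y0 = UNIV \<and>
        (\<forall>y\<in>Y0. bochner_L1_on {0..} (\<lambda>t. (t ^ n) *\<^sub>R T t (J y))))"

end

(*
  With respect to the imaginary axis, R(i., A)^(m+1) J is (-1)^(m+1) times the symbol of the
  anti-causal convolution f |-> (t |-> int_0^oo s^m/m! T(s) J f(t+s) ds); this is shown by
  regularising with exp(-e s), where the kernel is a Laplace transform, and Fourier inversion.
  Decay of t^n T(t) J thus bounds the kernel by (1+s)^(m-n), and the multiplier properties are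
  Young's and Hoelder's inequalities.

  Conversely only the power n+1 is needed. One would like to apply the operator to an approximate
  identity times y, but test functions must have vanishing moments and bounded L^p norm for p > 1.
  The first problem is solved by bumps built from a Stieltjes-type function theta on (0,oo) with
  nonzero integral and vanishing higher moments, the second one by replacing the bump at 0 with the
  average over j < N of the bumps at -j/N times T(j/N) y. In the limit the operator then produces
  at -t a multiple of w(t) T(t) J y with w(t) >= (t-1)^n/n!, and averaging the L^oo and L^q bounds
  over a unit interval gives the decay on the dense subspace, hence everywhere.
*)
theory Submission
  imports Defs "HOL-Probability.Probability"
begin

section \<open>Strong measurability\<close>

text \<open>Values lie in Banach spaces of any size and \<open>fourier\<close> is a gauge integral.
  So functions are strongly measurable, their norms have Lebesgue integrals, and they themselves are
  integrated by gauges.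

  For p > 1 one approximate identity N theta(N u) has L^p norm of order N^(1 - 1/p); N copies at
  spacing 1/N with weight 1/N behave like a Riemann sum and stay bounded. Invariance of Y permits
  this spreading: a bump at -q carrying T(q) y contributes T(s) T(q) J y at s = v - q, so every copy
  yields the same vector T(v) J y and only the scalar (v - q)^n / n! varies. These scalars are
  nonnegative and cannot cancel.

  theta needs a nonzero integral, the bumps need integral 0. The integral is removed by a second
  copy of theta, stretched by N: its higher moments vanish as well, and its height 1/N makes it
  disappear against an orbit integrable with weight t^n. This is where the dense subspace enters.
  Orbit bounds hold there only vector by vector, hence the convolution formula is applied to scalar
  functions times a fixed vector.\<close>

lemma strongly_measurableI:
  assumes "\<And>i. s i \<in> borel_measurable M" "\<And>i. finite (s i ` space M)"
    "\<And>x. x \<in> space M \<Longrightarrow> (\<lambda>i. s i x) \<longlonglongrightarrow> f x"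
  shows "strongly_measurable M f"
  unfolding strongly_measurable_def using assms by blast

lemma strongly_measurable_borel:
  "strongly_measurable M f \<Longrightarrow> f \<in> borel_measurable M"
  unfolding strongly_measurable_def using borel_measurable_LIMSEQ_metric by blast

text \<open>Finite ranges turn every preimage into a finite union of intersections of fibres, so
  \<open>h\<close> may be arbitrary. This avoids the Borel sets of a product of nonseparable spaces,
  which products of Borel sets need not generate.\<close>

lemma measurable_finite_range2:
  fixes f :: "'a \<Rightarrow> 'b::real_normed_vector" and g :: "'a \<Rightarrow> 'c::real_normed_vector"
  assumes "f \<in> borel_measurable M" "finite (f ` space M)"
    "g \<in> borel_measurable M" "finite (g ` space M)"
  shows "(\<lambda>x. h (f x) (g x)) \<in> borel_measurable M"
proof (rule measurableI)
  fix A
  have m: "f -` {a} \<inter> space M \<in> sets M" "g -` {b} \<inter> space M \<in> sets M" for a b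
    using assms by (auto intro!: measurable_sets)
  have "(\<lambda>x. h (f x) (g x)) -` A \<inter> space M =
     (\<Union>a\<in>f ` space M. \<Union>b\<in>g ` space M.
        if h a b \<in> A then (f -` {a} \<inter> space M) \<inter> (g -` {b} \<inter> space M) else {})"
    by (auto split: if_splits)
  also have "\<dots> \<in> sets M"
    using assms m by (intro sets.finite_UN) auto
  finally show "(\<lambda>x. h (f x) (g x)) -` A \<inter> space M \<in> sets M" .
qed auto

lemma finite_range2:
  assumes "finite (f ` S)" "finite (g ` S)"
  shows "finite ((\<lambda>x. h (f x) (g x)) ` S)"
proof -
  have "(\<lambda>x. h (f x) (g x)) ` S \<subseteq> (\<lambda>(a,b). h a b) ` ((f ` S) \<times> (g ` S))" by auto
  then show ?thesis using assms by (meson finite_SigmaI finite_imageI finite_subset)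
qed

text \<open>Simple approximants are combined pointwise by \<open>h\<close> and converge by joint
  continuity. Sums, scalar multiples and semigroup orbits of functions are all instances.\<close>

lemma strongly_measurable_compose2:
  assumes f: "strongly_measurable M f" and g: "strongly_measurable M g"
    and h: "continuous_on UNIV (\<lambda>(a,b). h a b)"
  shows "strongly_measurable M (\<lambda>x. h (f x) (g x))"
proof -
  obtain s where s: "\<And>i. s i \<in> borel_measurable M" "\<And>i. finite (s i ` space M)"
    "\<And>x. x \<in> space M \<Longrightarrow> (\<lambda>i. s i x) \<longlonglongrightarrow> f x"
    using f unfolding strongly_measurable_def by blast
  obtain r where r: "\<And>i. r i \<in> borel_measurable M" "\<And>i. finite (r i ` space M)"
    "\<And>x. x \<in> space M \<Longrightarrow> (\<lambda>i. r i x) \<longlonglongrightarrow> g x"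
    using g unfolding strongly_measurable_def by blast
  show ?thesis
  proof (rule strongly_measurableI[where s="\<lambda>i x. h (s i x) (r i x)"])
    fix x assume x: "x \<in> space M"
    have "isCont (\<lambda>(a,b). h a b) (f x, g x)"
      using h by (simp add: continuous_on_eq_continuous_at)
    from isCont_tendsto_compose[OF this tendsto_Pair[OF s(3)[OF x] r(3)[OF x]]]
    show "(\<lambda>i. h (s i x) (r i x)) \<longlonglongrightarrow> h (f x) (g x)" by simp
  next
    show "(\<lambda>x. h (s i x) (r i x)) \<in> borel_measurable M" for i
      by (rule measurable_finite_range2[OF s(1,2) r(1,2)])
    show "finite ((\<lambda>x. h (s i x) (r i x)) ` space M)" for i
      by (rule finite_range2[OF s(2) r(2)])
  qed
qed

lemma strongly_measurable_const: "strongly_measurable M (\<lambda>x. c)"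
  by (rule strongly_measurableI[where s="\<lambda>i x. c"]) (auto simp: image_constant_conv)

lemma strongly_measurable_compose:
  assumes "strongly_measurable M f" and h: "continuous_on UNIV h"
  shows "strongly_measurable M (\<lambda>x. h (f x))"
proof (rule strongly_measurable_compose2[where h="\<lambda>a b::real. h a", OF assms(1)])
  show "strongly_measurable M (\<lambda>x. 0::real)" by (rule strongly_measurable_const)
  show "continuous_on UNIV (\<lambda>(a, b::real). h a)"
    unfolding case_prod_beta by (intro continuous_on_compose2[OF h] continuous_intros) auto
qed

lemma strongly_measurable_norm: "strongly_measurable M f \<Longrightarrow> (\<lambda>x. norm (f x)) \<in> borel_measurable M"
  by (rule strongly_measurable_borel[OF strongly_measurable_compose[where h=norm]]) (auto intro: continuous_intros)

lemma strongly_measurable_add: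
  "strongly_measurable M f \<Longrightarrow> strongly_measurable M g \<Longrightarrow> strongly_measurable M (\<lambda>x. f x + g x)"
  by (rule strongly_measurable_compose2) (auto simp: case_prod_beta intro!: continuous_intros)

lemma strongly_measurable_diff:
  "strongly_measurable M f \<Longrightarrow> strongly_measurable M g \<Longrightarrow> strongly_measurable M (\<lambda>x. f x - g x)"
  by (rule strongly_measurable_compose2) (auto simp: case_prod_beta intro!: continuous_intros)

lemma strongly_measurable_scaleR:
  "strongly_measurable M f \<Longrightarrow> strongly_measurable M g \<Longrightarrow> strongly_measurable M (\<lambda>x. f x *\<^sub>R g x)"
  by (rule strongly_measurable_compose2) (auto simp: case_prod_beta intro!: continuous_intros)

lemma strongly_measurable_cong:
  "(\<And>x. x \<in> space M \<Longrightarrow> f x = g x) \<Longrightarrow> strongly_measurable M f \<longleftrightarrow> strongly_measurable M g"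
  unfolding strongly_measurable_def by auto

text \<open>Pettis' description, with Borel measurability for the norm. It is the form that survives
  pointwise limits, since a countable union of countable sets is countable.\<close>

lemma strongly_measurable_separable:
  fixes f :: "'a \<Rightarrow> 'b::real_normed_vector"
  shows "strongly_measurable M f \<longleftrightarrow>
    f \<in> borel_measurable M \<and> (\<exists>Q. countable Q \<and> f ` space M \<subseteq> closure Q)"
proof safe
  assume f: "strongly_measurable M f"
  then show "f \<in> borel_measurable M" by (rule strongly_measurable_borel)
  obtain s where s: "\<And>i::nat. finite (s i ` space M)"
    "\<And>x. x \<in> space M \<Longrightarrow> (\<lambda>i. s i x) \<longlonglongrightarrow> f x"
    using f unfolding strongly_measurable_def by blast
  show "\<exists>Q. countable Q \<and> f ` space M \<subseteq> closure Q"
  proof (intro exI conjI)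
    show "countable (\<Union>i. s i ` space M)" using s by (auto intro: countable_finite)
    show "f ` space M \<subseteq> closure (\<Union>i. s i ` space M)"
    proof clarify
      fix x assume x: "x \<in> space M"
      then have "\<forall>i. s i x \<in> (\<Union>i. s i ` space M)" by auto
      with s(2)[OF x] show "f x \<in> closure (\<Union>i. s i ` space M)"
        unfolding closure_sequential by (intro exI[of _ "\<lambda>i. s i x"] conjI)
    qed
  qed
next
  fix Q assume f[measurable]: "f \<in> borel_measurable M" and Q: "countable Q" "f ` space M \<subseteq> closure Q"
  show "strongly_measurable M f"
  proof (cases "space M = {}")
    case True
    then show ?thesis by (intro strongly_measurableI[where s="\<lambda>i x. 0"]) auto
  next
    case False
    then have "Q \<noteq> {}" using Q by auto
    define q where "q = from_nat_into Q"
    have q: "range q = Q" unfolding q_def using \<open>Q \<noteq> {}\<close> Q(1) by (rule range_from_nat_into)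
    \<comment> \<open>Among the first i + 1 points of \<open>Q\<close>, the first index of a point
      nearest to \<open>f x\<close>. Only countably many distances enter, so the index is
      measurable.\<close>
    define k where "k = (\<lambda>i x. LEAST j. j \<le> (i::nat) \<and> (\<forall>l\<le>i. dist (f x) (q j) \<le> dist (f x) (q l)))"
    have kP: "k i x \<le> i \<and> (\<forall>l\<le>i. dist (f x) (q (k i x)) \<le> dist (f x) (q l))" for i x
    proof -
      have "\<exists>j\<in>{..i}. \<forall>l\<in>{..i}. dist (f x) (q j) \<le> dist (f x) (q l)"
        using ex_is_arg_min_if_finite[of "{..i}" "\<lambda>j. dist (f x) (q j)"]
        by (auto simp: is_arg_min_linorder)
      then obtain j where "j \<le> i \<and> (\<forall>l\<le>i. dist (f x) (q j) \<le> dist (f x) (q l))" by auto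
      then show ?thesis unfolding k_def by (rule LeastI)
    qed
    have dm[measurable]: "(\<lambda>x. dist (f x) c) \<in> borel_measurable M" for c
      by (rule measurable_compose[OF f]) (intro borel_measurable_continuous_onI continuous_intros)
    have km[measurable]: "k i \<in> measurable M (count_space UNIV)" for i
      unfolding k_def by measurable
    show ?thesis
    proof (rule strongly_measurableI[where s="\<lambda>i x. q (k i x)"])
      show "(\<lambda>x. q (k i x)) \<in> borel_measurable M" for i
        by (rule measurable_compose[OF km]) auto
      show "finite ((\<lambda>x. q (k i x)) ` space M)" for i
        by (rule finite_subset[of _ "q ` {..i}"]) (use kP in auto)
      fix x assume x: "x \<in> space M"
      show "(\<lambda>i. q (k i x)) \<longlonglongrightarrow> f x"
      proof (rule LIMSEQ_I)
        fix e :: real assume "e > 0"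
        then obtain y where "y \<in> Q" "dist y (f x) < e"
          using Q(2) x closure_approachable by blast
        then obtain l where l: "dist (f x) (q l) < e" using q by (metis dist_commute rangeE)
        have "norm (q (k i x) - f x) < e" if "i \<ge> l" for i
          using kP[of i x] that l by (metis dist_commute dist_norm order_le_less_trans)
        then show "\<exists>no. \<forall>n\<ge>no. norm (q (k n x) - f x) < e" by blast
      qed
    qed
  qed
qed

lemma strongly_measurable_limit:
  fixes g :: "nat \<Rightarrow> 'a \<Rightarrow> 'b::real_normed_vector"
  assumes "\<And>i. strongly_measurable M (g i)" "\<And>x. x \<in> space M \<Longrightarrow> (\<lambda>i. g i x) \<longlonglongrightarrow> f x"
  shows "strongly_measurable M f"
  unfolding strongly_measurable_separable
proof
  show "f \<in> borel_measurable M"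
    using assms strongly_measurable_borel borel_measurable_LIMSEQ_metric by blast
  have "\<forall>i. \<exists>Q. countable Q \<and> g i ` space M \<subseteq> closure Q"
    using assms strongly_measurable_separable by blast
  then obtain Q where Q: "\<And>i. countable (Q i)" "\<And>i. g i ` space M \<subseteq> closure (Q i)" by metis
  show "\<exists>Q. countable Q \<and> f ` space M \<subseteq> closure Q"
  proof (intro exI conjI)
    show "countable (\<Union>i. Q i)" using Q by auto
    show "f ` space M \<subseteq> closure (\<Union>i. Q i)"
    proof clarify
      fix x assume x: "x \<in> space M"
      have "g i x \<in> closure (\<Union>i. Q i)" for i
        using Q(2)[of i] x closure_mono[of "Q i" "\<Union>i. Q i"] by blast
      then show "f x \<in> closure (\<Union>i. Q i)"
        by (intro closed_sequentially[OF closed_closure _ assms(2)[OF x]]) auto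
    qed
  qed
qed

lemma strongly_measurable_continuous:
  fixes f :: "real \<Rightarrow> 'b::real_normed_vector"
  assumes f: "continuous_on UNIV f"
  shows "strongly_measurable lebesgue f"
  unfolding strongly_measurable_separable
proof
  show "f \<in> borel_measurable lebesgue"
    using continuous_imp_measurable_on_sets_lebesgue[OF f] by (simp add: lebesgue_on_UNIV_eq)
  have "f ` UNIV \<subseteq> closure (f ` \<rat>)"
    using image_closure_subset[of "\<rat>" f "closure (f ` \<rat>)"] f closure_subset[of "f ` \<rat>"]
    by (simp add: Rats_closure_real)
  then show "\<exists>Q. countable Q \<and> f ` space lebesgue \<subseteq> closure Q"
    using countable_rat by (intro exI[of _ "f ` \<rat>"]) auto
qed

lemma strongly_measurable_real: "(f :: 'a \<Rightarrow> real) \<in> borel_measurable M \<Longrightarrow> strongly_measurable M f"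
  unfolding strongly_measurable_separable
  by (auto intro!: exI[of _ "\<rat>"] countable_rat simp: Rats_closure_real)

lemma strongly_measurable_if:
  assumes "strongly_measurable M f" "strongly_measurable M g" "A \<in> sets M"
  shows "strongly_measurable M (\<lambda>x. if x \<in> A then f x else g x)"
proof -
  have "strongly_measurable M (\<lambda>x. indicat_real A x *\<^sub>R f x + indicat_real (space M - A) x *\<^sub>R g x)"
    using assms by (intro strongly_measurable_add strongly_measurable_scaleR strongly_measurable_real) auto
  then show ?thesis
    by (rule strongly_measurable_cong[THEN iffD1, rotated]) auto
qed

text \<open>Resolvents along the imaginary axis are continuous except at 0, where the value of
  \<open>resolvent\<close> is not controlled. One exceptional value enlarges the countable set by
  one point.\<close>

lemma strongly_measurable_off_point:
  fixes f :: "real \<Rightarrow> 'b::real_normed_vector"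
  assumes "continuous_on (- {a}) f"
  shows "strongly_measurable lebesgue f"
  unfolding strongly_measurable_separable
proof
  have "f \<in> borel_measurable (lebesgue_on (- {a}))"
    using continuous_imp_measurable_on_sets_lebesgue[OF assms] by simp
  then have "(\<lambda>x. if x \<in> - {a} then f x else f a) \<in> borel_measurable lebesgue"
    by (intro measurable_If_restrict_space_iff[THEN iffD2]) (auto simp: Compl_eq)
  moreover have "(\<lambda>x. if x \<in> - {a} then f x else f a) = f" by auto
  ultimately show "f \<in> borel_measurable lebesgue" by simp
  obtain Q where Q: "countable Q" "Q \<subseteq> - {a}" "- {a} \<subseteq> closure Q"
    using separable[of "- {a}"] by metis
  have "f ` (- {a}) \<subseteq> closure (f ` Q)"
  proof
    fix y assume "y \<in> f ` (- {a})"
    then obtain x where x: "x \<noteq> a" "y = f x" by auto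
    then obtain s where s: "\<And>n. s n \<in> Q" "s \<longlonglongrightarrow> x" using Q(3) closure_sequential by blast
    have "(\<lambda>n. f (s n)) \<longlonglongrightarrow> f x"
      using assms s Q(2) x(1) unfolding continuous_on_sequentially comp_def by blast
    moreover have "\<forall>n. f (s n) \<in> f ` Q" using s(1) by auto
    ultimately have "\<exists>u. (\<forall>n. u n \<in> f ` Q) \<and> u \<longlonglongrightarrow> f x" by (rule_tac x="\<lambda>n. f (s n)" in exI) auto
    then show "y \<in> closure (f ` Q)" unfolding closure_sequential x(2) .
  qed
  also have "\<dots> \<subseteq> closure (insert (f a) (f ` Q))" by (intro closure_mono) auto
  finally have "f ` UNIV \<subseteq> closure (insert (f a) (f ` Q))"
    using closure_subset[of "insert (f a) (f ` Q)"] by auto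
  then show "\<exists>Q. countable Q \<and> f ` space lebesgue \<subseteq> closure Q"
    using Q(1) by (intro exI[of _ "insert (f a) (f ` Q)"]) auto
qed

lemma lebesgue_measurable_affine:
  fixes a c :: real assumes "c \<noteq> 0"
  shows "(\<lambda>x. a + c * x) \<in> lebesgue \<rightarrow>\<^sub>M lebesgue"
  using lebesgue_affine_measurable[where c="\<lambda>x::real. c" and t=a] assms by simp

lemma strongly_measurable_affine:
  fixes f :: "real \<Rightarrow> 'b::real_normed_vector"
  assumes "strongly_measurable lebesgue f" "c \<noteq> 0"
  shows "strongly_measurable lebesgue (\<lambda>x. f (a + c * x))"
proof -
  obtain s where s: "\<And>i. s i \<in> borel_measurable lebesgue" "\<And>i::nat. finite (s i ` UNIV)"
    "\<And>x. (\<lambda>i. s i x) \<longlonglongrightarrow> f x"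
    using assms unfolding strongly_measurable_def by auto
  show ?thesis
  proof (rule strongly_measurableI[where s="\<lambda>i x. s i (a + c * x)"])
    show "(\<lambda>x. s i (a + c * x)) \<in> borel_measurable lebesgue" for i
      using measurable_compose[OF lebesgue_measurable_affine[OF assms(2)] s(1)] .
    show "finite ((\<lambda>x. s i (a + c * x)) ` space lebesgue)" for i
      by (rule finite_subset[OF _ s(2)[of i]]) auto
  qed (use s in auto)
qed

section \<open>Vector-valued integration on the real line\<close>

text \<open>On one tagged division the Riemann sums of \<open>f\<close> and \<open>g n\<close>
  differ by at most the Riemann sum of \<open>norm (f x - g n x)\<close>, and a gauge fine enough
  for both integrals makes that close to \<open>H n\<close>. The integrals of the \<open>g i\<close>
  are Cauchy because they differ by at most \<open>H i + H j\<close>.\<close>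

lemma integrable_on_cbox_L1_limit:
  fixes f :: "'n::euclidean_space \<Rightarrow> 'b::banach"
  assumes f: "\<And>i. g i integrable_on cbox a b"
    and h: "\<And>i. (\<lambda>x. norm (f x - g i x)) integrable_on cbox a b"
    and lim: "(\<lambda>i::nat. integral (cbox a b) (\<lambda>x. norm (f x - g i x))) \<longlonglongrightarrow> 0"
  shows "f integrable_on cbox a b"
proof -
  define H where "H i = integral (cbox a b) (\<lambda>x. norm (f x - g i x))" for i
  define I where "I i = integral (cbox a b) (g i)" for i
  have IH: "norm (I i - I j) \<le> H i + H j" for i j
  proof -
    have "norm (integral (cbox a b) (\<lambda>x. g i x - g j x))
        \<le> integral (cbox a b) (\<lambda>x. norm (f x - g i x) + norm (f x - g j x))"
    proof (rule integral_norm_bound_integral)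
      show "norm (g i x - g j x) \<le> norm (f x - g i x) + norm (f x - g j x)" for x
        using norm_triangle_ineq4[of "f x - g j x" "f x - g i x"] by simp
    qed (use f h in \<open>auto intro: integrable_diff integrable_add\<close>)
    then show ?thesis unfolding I_def H_def using f h
      by (simp add: integral_diff integral_add)
  qed
  have lim': "H \<longlonglongrightarrow> 0" using lim unfolding H_def .
  have "Cauchy I"
  proof (rule CauchyI)
    fix e :: real assume "e > 0"
    then obtain N where N: "\<And>n. n \<ge> N \<Longrightarrow> norm (H n) < e/2"
      using LIMSEQ_D[OF lim', of "e/2"] by auto
    show "\<exists>M. \<forall>m\<ge>M. \<forall>n\<ge>M. norm (I m - I n) < e"
    proof (intro exI[of _ N] allI impI)
      fix m n assume "N \<le> m" "N \<le> n"
      with N[of m] N[of n] IH[of m n] show "norm (I m - I n) < e" by simp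
    qed
  qed
  then obtain L where L: "I \<longlonglongrightarrow> L" using Cauchy_convergent convergent_def by blast
  have "(f has_integral L) (cbox a b)"
    unfolding has_integral
  proof (intro allI impI)
    fix e :: real assume e: "e > 0"
    obtain N1 where N1: "\<And>n. n \<ge> N1 \<Longrightarrow> norm (H n) < e/5"
      using LIMSEQ_D[OF lim', of "e/5"] e by auto
    obtain N2 where N2: "\<And>n. n \<ge> N2 \<Longrightarrow> norm (I n - L) < e/5"
      using LIMSEQ_D[OF L, of "e/5"] e by auto
    define n where "n = max N1 N2"
    have "(g n has_integral I n) (cbox a b)" unfolding I_def using f by (rule integrable_integral)
    then have "\<exists>\<gamma>. gauge \<gamma> \<and> (\<forall>\<D>. \<D> tagged_division_of (cbox a b) \<and> \<gamma> fine \<D> \<longrightarrow>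
        norm ((\<Sum>(x, k)\<in>\<D>. Henstock_Kurzweil_Integration.content k *\<^sub>R g n x) - I n) < e/5)"
      unfolding has_integral by (rule allE[where x="e/5"]) (use e in simp)
    then obtain \<gamma>1 where \<gamma>1: "gauge \<gamma>1" "\<forall>\<D>. \<D> tagged_division_of (cbox a b) \<and> \<gamma>1 fine \<D> \<longrightarrow>
        norm ((\<Sum>(x, k)\<in>\<D>. Henstock_Kurzweil_Integration.content k *\<^sub>R g n x) - I n) < e/5"
      by (elim exE conjE)
    have "((\<lambda>x. norm (f x - g n x)) has_integral H n) (cbox a b)"
      unfolding H_def using h by (rule integrable_integral)
    then have "\<exists>\<gamma>. gauge \<gamma> \<and> (\<forall>\<D>. \<D> tagged_division_of (cbox a b) \<and> \<gamma> fine \<D> \<longrightarrow>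
        norm ((\<Sum>(x, k)\<in>\<D>. Henstock_Kurzweil_Integration.content k *\<^sub>R norm (f x - g n x)) - H n) < e/5)"
      unfolding has_integral by (rule allE[where x="e/5"]) (use e in simp)
    then obtain \<gamma>2 where \<gamma>2: "gauge \<gamma>2" "\<forall>\<D>. \<D> tagged_division_of (cbox a b) \<and> \<gamma>2 fine \<D> \<longrightarrow>
        norm ((\<Sum>(x, k)\<in>\<D>. Henstock_Kurzweil_Integration.content k *\<^sub>R norm (f x - g n x)) - H n) < e/5"
      by (elim exE conjE)
    show "\<exists>\<gamma>. gauge \<gamma> \<and> (\<forall>\<D>. \<D> tagged_division_of (cbox a b) \<and> \<gamma> fine \<D> \<longrightarrow>
        norm ((\<Sum>(x, k)\<in>\<D>. Henstock_Kurzweil_Integration.content k *\<^sub>R f x) - L) < e)"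
    proof (intro exI conjI allI impI)
      show "gauge (\<lambda>x. \<gamma>1 x \<inter> \<gamma>2 x)" using \<gamma>1(1) \<gamma>2(1) by (rule gauge_Int)
      fix \<D> assume "\<D> tagged_division_of (cbox a b) \<and> (\<lambda>x. \<gamma>1 x \<inter> \<gamma>2 x) fine \<D>"
      then have D: "\<D> tagged_division_of (cbox a b)" and fine: "\<gamma>1 fine \<D>" "\<gamma>2 fine \<D>"
        by (auto simp: fine_Int)
      let ?S = "\<lambda>u. \<Sum>(x, k)\<in>\<D>. Henstock_Kurzweil_Integration.content k *\<^sub>R u x"
      have "?S f - ?S (g n) = ?S (\<lambda>x. f x - g n x)"
        by (simp add: sum_subtractf[symmetric] case_prod_beta scaleR_diff_right)
      also have "norm \<dots> \<le> ?S (\<lambda>x. norm (f x - g n x))"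
        by (rule sum_norm_le) (auto simp: case_prod_beta content_pos_le)
      also have "\<dots> < H n + e/5" using \<gamma>2(2)[rule_format, OF conjI[OF D fine(2)]] by (simp add: abs_real_def split: if_splits)
      also have "H n < e/5" using N1[of n] by (simp add: n_def)
      finally have "norm (?S f - ?S (g n)) < e/5 + e/5" by simp
      moreover have "norm (?S (g n) - I n) < e/5" using \<gamma>1(2)[rule_format, OF conjI[OF D fine(1)]] .
      moreover have "norm (I n - L) < e/5" using N2[of n] by (simp add: n_def)
      moreover have "norm (?S f - L) \<le> norm (?S f - ?S (g n)) + norm (?S (g n) - I n) + norm (I n - L)"
        using norm_triangle_ineq[of "?S f - ?S (g n)" "?S (g n) - L"]
          norm_triangle_ineq[of "?S (g n) - I n" "I n - L"] by simp
      ultimately show "norm (?S f - L) < e" using e by simp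
    qed
  qed
  then show ?thesis by blast
qed

text \<open>Boxes come from the previous lemma. On the whole space the remainder outside a large box
  is that of one fixed \<open>g n\<close>, up to an error \<open>H n\<close> that is uniform in the
  box.\<close>

lemma integrable_on_L1_limit:
  fixes f :: "'n::euclidean_space \<Rightarrow> 'b::banach"
  assumes f: "\<And>i. g i integrable_on UNIV"
    and h: "\<And>i. (\<lambda>x. norm (f x - g i x)) integrable_on UNIV"
    and lim: "(\<lambda>i::nat. integral UNIV (\<lambda>x. norm (f x - g i x))) \<longlonglongrightarrow> 0"
  shows "f integrable_on UNIV"
proof -
  define H where "H i = integral UNIV (\<lambda>x. norm (f x - g i x))" for i
  define I where "I i = integral UNIV (g i)" for i
  have fc: "g i integrable_on cbox a b" for i a b
    using f integrable_on_subcbox by blast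
  have hc: "(\<lambda>x. norm (f x - g i x)) integrable_on cbox a b" for i a b
    using h integrable_on_subcbox by blast
  have hle: "integral (cbox a b) (\<lambda>x. norm (f x - g i x)) \<le> H i" for i a b
    unfolding H_def by (rule integral_subset_le[OF _ hc h]) auto
  have lim': "H \<longlonglongrightarrow> 0" using lim unfolding H_def .
  have fab: "f integrable_on cbox a b" for a b
  proof (rule integrable_on_cbox_L1_limit[OF fc hc])
    show "(\<lambda>i. integral (cbox a b) (\<lambda>x. norm (f x - g i x))) \<longlonglongrightarrow> 0"
      by (rule tendsto_sandwich[OF _ _ tendsto_const lim'])
        (auto intro!: always_eventually hle integral_nonneg hc)
  qed
  have IH: "norm (I i - I j) \<le> H i + H j" for i j
  proof -
    have "norm (integral UNIV (\<lambda>x. g i x - g j x))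
        \<le> integral UNIV (\<lambda>x. norm (f x - g i x) + norm (f x - g j x))"
    proof (rule integral_norm_bound_integral)
      show "norm (g i x - g j x) \<le> norm (f x - g i x) + norm (f x - g j x)" for x
        using norm_triangle_ineq4[of "f x - g j x" "f x - g i x"] by simp
    qed (use f h in \<open>auto intro: integrable_diff integrable_add\<close>)
    then show ?thesis unfolding I_def H_def using f h
      by (simp add: integral_diff integral_add)
  qed
  have "Cauchy I"
  proof (rule CauchyI)
    fix e :: real assume "e > 0"
    then obtain N where N: "\<And>n. n \<ge> N \<Longrightarrow> norm (H n) < e/2"
      using LIMSEQ_D[OF lim', of "e/2"] by auto
    show "\<exists>M. \<forall>m\<ge>M. \<forall>n\<ge>M. norm (I m - I n) < e"
    proof (intro exI[of _ N] allI impI)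
      fix m n assume "N \<le> m" "N \<le> n"
      with N[of m] N[of n] IH[of m n] show "norm (I m - I n) < e" by simp
    qed
  qed
  then obtain L where L: "I \<longlonglongrightarrow> L" using Cauchy_convergent convergent_def by blast
  have "(f has_integral L) UNIV"
    unfolding has_integral_alt'
  proof (intro conjI allI impI)
    fix e :: real assume e: "e > 0"
    obtain N1 where N1: "\<And>n. n \<ge> N1 \<Longrightarrow> norm (H n) < e/4"
      using LIMSEQ_D[OF lim', of "e/4"] e by auto
    obtain N2 where N2: "\<And>n. n \<ge> N2 \<Longrightarrow> norm (I n - L) < e/4"
      using LIMSEQ_D[OF L, of "e/4"] e by auto
    define n where "n = max N1 N2"
    have "(g n has_integral I n) UNIV" unfolding I_def using f by (rule integrable_integral)
    then obtain B where B: "B > 0" "\<And>a b. ball 0 B \<subseteq> cbox a b \<Longrightarrow>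
        norm (integral (cbox a b) (g n) - I n) < e/4"
      unfolding has_integral_alt' using e by (auto dest!: spec[of _ "e/4"])
    show "\<exists>B>0. \<forall>a b. ball 0 B \<subseteq> cbox a b \<longrightarrow>
            norm (integral (cbox a b) (\<lambda>x. if x \<in> UNIV then f x else 0) - L) < e"
    proof (intro exI[of _ B] conjI B(1) allI impI)
      fix a b :: 'n assume ab: "ball 0 B \<subseteq> cbox a b"
      have "norm (integral (cbox a b) f - integral (cbox a b) (g n)) \<le>
          integral (cbox a b) (\<lambda>x. norm (f x - g n x))"
        by (subst integral_diff[symmetric, OF fab fc])
          (intro integral_norm_bound_integral integrable_diff fab fc hc order_refl)
      also have "\<dots> \<le> H n" by (rule hle)
      also have "H n < e/4" using N1[of n] by (simp add: n_def)
      finally have "norm (integral (cbox a b) f - integral (cbox a b) (g n)) < e/4" .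
      moreover have "norm (integral (cbox a b) (g n) - I n) < e/4" by (rule B(2)[OF ab])
      moreover have "norm (I n - L) < e/4" using N2[of n] by (simp add: n_def)
      moreover have "norm (integral (cbox a b) f - L) \<le> norm (integral (cbox a b) f - integral (cbox a b) (g n))
          + norm (integral (cbox a b) (g n) - I n) + norm (I n - L)"
        using norm_triangle_ineq[of "integral (cbox a b) f - integral (cbox a b) (g n)" "integral (cbox a b) (g n) - L"]
          norm_triangle_ineq[of "integral (cbox a b) (g n) - I n" "I n - L"] by simp
      ultimately show "norm (integral (cbox a b) (\<lambda>x. if x \<in> UNIV then f x else 0) - L) < e"
        using e by simp
    qed
  qed (use fab in simp)
  then show ?thesis by blast
qed

text \<open>The norm is integrated as a real function over \<open>lebesgue\<close>, while the value
  of the integral is the gauge integral \<open>integral UNIV f\<close>, the one that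
  \<open>fourier\<close> and \<open>inv_fourier\<close> use.\<close>

definition bochner_integrable :: "(real \<Rightarrow> 'b::real_normed_vector) \<Rightarrow> bool" where
  "bochner_integrable f \<longleftrightarrow> strongly_measurable lebesgue f \<and> integrable lebesgue (\<lambda>t. norm (f t))"

section \<open>Calculus of norm-integrable functions with values in a Banach space\<close>

lemma bochner_integrableD:
  "bochner_integrable f \<Longrightarrow> strongly_measurable lebesgue f"
  "bochner_integrable f \<Longrightarrow> integrable lebesgue (\<lambda>t. norm (f t))"
  unfolding bochner_integrable_def by auto

lemma bochner_integrable_bound:
  assumes "strongly_measurable lebesgue f" "integrable lebesgue g" "AE t in lebesgue. norm (f t) \<le> g t"
  shows "bochner_integrable f"
  unfolding bochner_integrable_def
proof
  show "integrable lebesgue (\<lambda>t. norm (f t))"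
    by (rule Bochner_Integration.integrable_bound[OF assms(2)])
       (use assms strongly_measurable_norm in auto)
qed fact

lemma bochner_integrable_add:
  assumes "bochner_integrable f" "bochner_integrable g"
  shows "bochner_integrable (\<lambda>t. f t + g t)"
  by (rule bochner_integrable_bound[where g="\<lambda>t. norm (f t) + norm (g t)"])
    (use assms in \<open>auto dest: bochner_integrableD intro!: strongly_measurable_add norm_triangle_ineq\<close>)

lemma bochner_integrable_diff:
  assumes "bochner_integrable f" "bochner_integrable g"
  shows "bochner_integrable (\<lambda>t. f t - g t)"
  by (rule bochner_integrable_bound[where g="\<lambda>t. norm (f t) + norm (g t)"])
    (use assms in \<open>auto dest: bochner_integrableD intro!: strongly_measurable_diff norm_triangle_ineq4\<close>)

lemma bochner_integrable_linear:
  assumes "bochner_integrable f" "bounded_linear h"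
  shows "bochner_integrable (\<lambda>t. h (f t))"
proof -
  interpret h: bounded_linear h by fact
  obtain K where K: "\<And>x. norm (h x) \<le> norm x * K" using h.bounded by blast
  show ?thesis
  proof (rule bochner_integrable_bound)
    show "strongly_measurable lebesgue (\<lambda>t. h (f t))"
      by (rule strongly_measurable_compose[OF bochner_integrableD(1)[OF assms(1)]])
        (rule linear_continuous_on[OF assms(2)])
    show "integrable lebesgue (\<lambda>t. norm (f t) * K)"
      using bochner_integrableD(2)[OF assms(1)] by simp
    show "AE t in lebesgue. norm (h (f t)) \<le> norm (f t) * K" using K by simp
  qed
qed

text \<open>Resetting an approximant to 0 where it exceeds twice the norm of the limit keeps the
  range finite and supplies a dominating function. The factor 2 leaves room: where
  \<open>f x\<close> is nonzero the cut is eventually inactive.\<close>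

lemma truncated_approximation:
  fixes f :: "'a \<Rightarrow> 'b::real_normed_vector"
  assumes "strongly_measurable M f"
  obtains s where "\<And>i::nat. s i \<in> borel_measurable M" "\<And>i. finite (s i ` space M)"
    "\<And>x. x \<in> space M \<Longrightarrow> (\<lambda>i. s i x) \<longlonglongrightarrow> f x" "\<And>i x. norm (s i x) \<le> 2 * norm (f x)"
proof -
  obtain s where s: "\<And>i::nat. s i \<in> borel_measurable M" "\<And>i. finite (s i ` space M)"
    "\<And>x. x \<in> space M \<Longrightarrow> (\<lambda>i. s i x) \<longlonglongrightarrow> f x"
    using assms unfolding strongly_measurable_def by blast
  have nf[measurable]: "(\<lambda>x. norm (f x)) \<in> borel_measurable M"
    by (rule strongly_measurable_norm[OF assms])
  have ns[measurable]: "(\<lambda>x. norm (s i x)) \<in> borel_measurable M" for i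
    by (rule measurable_compose[OF s(1)]) (intro borel_measurable_continuous_onI continuous_intros)
  define r where "r = (\<lambda>i x. if norm (s i x) \<le> 2 * norm (f x) then s i x else 0)"
  show thesis
  proof (rule that[of r])
    have sm[measurable]: "s i \<in> borel_measurable M" for i by (rule s(1))
    show "r i \<in> borel_measurable M" for i
      unfolding r_def by measurable
    show "finite (r i ` space M)" for i
      by (rule finite_subset[of _ "insert 0 (s i ` space M)"]) (use s(2) in \<open>auto simp: r_def\<close>)
    show "norm (r i x) \<le> 2 * norm (f x)" for i x by (simp add: r_def)
    fix x assume x: "x \<in> space M"
    show "(\<lambda>i. r i x) \<longlonglongrightarrow> f x"
    proof (cases "f x = 0")
      case True
      then have "r i x = 0" for i by (auto simp: r_def)
      then show ?thesis using True by simp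
    next
      case False
      have "(\<lambda>i. norm (s i x)) \<longlonglongrightarrow> norm (f x)" by (intro tendsto_norm s(3) x)
      then have "eventually (\<lambda>i. norm (s i x) < 2 * norm (f x)) sequentially"
        by (rule order_tendstoD) (use False in simp)
      then have "eventually (\<lambda>i. s i x = r i x) sequentially"
        by eventually_elim (simp add: r_def)
      then show ?thesis using s(3)[OF x] by (rule Lim_transform_eventually[rotated])
    qed
  qed
qed

lemma finite_range_integrable_on:
  fixes s :: "real \<Rightarrow> 'b::banach"
  assumes s: "s \<in> borel_measurable lebesgue" "finite (range s)" "integrable lebesgue (\<lambda>x. norm (s x))"
  shows "s integrable_on UNIV"
proof -
  have eq: "s = (\<lambda>x. \<Sum>v\<in>range s - {0}. indicat_real (s -` {v}) x *\<^sub>R v)"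
  proof
    fix x
    show "s x = (\<Sum>v\<in>range s - {0}. indicat_real (s -` {v}) x *\<^sub>R v)"
    proof (cases "s x = 0")
      case True
      show ?thesis unfolding True by (intro sum.neutral[symmetric]) (use True in \<open>auto simp: indicator_def\<close>)
    next
      case False
      have "(\<Sum>v\<in>range s - {0}. indicat_real (s -` {v}) x *\<^sub>R v) = (\<Sum>v\<in>{s x}. indicat_real (s -` {v}) x *\<^sub>R v)"
        using s(2) False by (intro sum.mono_neutral_right) (auto simp: indicator_def)
      then show ?thesis by simp
    qed
  qed
  have "(\<lambda>x. \<Sum>v\<in>range s - {0}. indicat_real (s -` {v}) x *\<^sub>R v) integrable_on UNIV"
  proof (intro integrable_sum)
    show "finite (range s - {0})" using s(2) by auto
    fix v assume v: "v \<in> range s - {0}"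
    have m: "s -` {v} \<in> sets lebesgue" using measurable_sets[OF s(1), of "{v}"] by simp
    have "integrable lebesgue (\<lambda>x. indicat_real (s -` {v}) x)"
    proof (rule Bochner_Integration.integrable_bound)
      show "integrable lebesgue (\<lambda>x. norm (s x) / norm v)" using s(3) by simp
      show "AE x in lebesgue. norm (indicat_real (s -` {v}) x) \<le> norm (norm (s x) / norm v)"
        using v by (intro AE_I2) (auto simp: indicator_def)
    qed (use m in simp)
    then have "indicat_real (s -` {v}) integrable_on UNIV" by (rule integrable_on_lebesgue)
    then show "(\<lambda>x. indicat_real (s -` {v}) x *\<^sub>R v) integrable_on UNIV"
      by (rule integrable_on_scaleR_left)
  qed
  with eq show ?thesis by simp
qed

text \<open>Truncated simple functions converge to \<open>f\<close> in L^1, with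
  \<open>3 * norm (f x)\<close> as majorant of the distance, and gauge integrability passes to L^1
  limits.\<close>

theorem bochner_integrable_integrable_on:
  fixes f :: "real \<Rightarrow> 'b::banach"
  assumes "bochner_integrable f"
  shows "f integrable_on UNIV"
proof -
  have f: "strongly_measurable lebesgue f" and nf: "integrable lebesgue (\<lambda>x. norm (f x))"
    using assms by (auto dest: bochner_integrableD)
  obtain s where s: "\<And>i::nat. s i \<in> borel_measurable lebesgue" "\<And>i. finite (range (s i))"
    "\<And>x. (\<lambda>i. s i x) \<longlonglongrightarrow> f x" "\<And>i x. norm (s i x) \<le> 2 * norm (f x)"
    using truncated_approximation[OF f] by auto
  have sm: "strongly_measurable lebesgue (s i)" for i
    by (rule strongly_measurableI[where s="\<lambda>_. s i"]) (use s in auto)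
  have si: "bochner_integrable (s i)" for i
    by (rule bochner_integrable_bound[where g="\<lambda>x. 2 * norm (f x)"]) (use sm nf s(4) in auto)
  have di: "integrable lebesgue (\<lambda>x. norm (f x - s i x))" for i
    by (rule bochner_integrableD(2)[OF bochner_integrable_diff[OF assms si]])
  have dm: "(\<lambda>x. norm (f x - s i x)) \<in> borel_measurable lebesgue" for i
    using di by auto
  have lim: "(\<lambda>i. integral\<^sup>L lebesgue (\<lambda>x. norm (f x - s i x))) \<longlonglongrightarrow> integral\<^sup>L lebesgue (\<lambda>x::real. 0)"
  proof (rule integral_dominated_convergence[where w="\<lambda>x. 3 * norm (f x)"])
    show "AE x in lebesgue. (\<lambda>i. norm (f x - s i x)) \<longlonglongrightarrow> 0"
    proof (rule AE_I2)
      fix x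
      have "(\<lambda>i. norm (f x - s i x)) \<longlonglongrightarrow> norm (f x - f x)" by (intro tendsto_intros s(3))
      then show "(\<lambda>i. norm (f x - s i x)) \<longlonglongrightarrow> 0" by simp
    qed
    show "AE x in lebesgue. norm (norm (f x - s i x)) \<le> 3 * norm (f x)" for i
    proof (rule AE_I2)
      fix x show "norm (norm (f x - s i x)) \<le> 3 * norm (f x)"
        using norm_triangle_ineq4[of "f x" "s i x"] s(4)[of i x] by simp
    qed
  qed (use nf dm in auto)
  show ?thesis
  proof (rule integrable_on_L1_limit)
    show "s i integrable_on UNIV" for i
      by (rule finite_range_integrable_on[OF s(1,2) bochner_integrableD(2)[OF si]])
    show "(\<lambda>x. norm (f x - s i x)) integrable_on UNIV" for i
      using di by (rule integrable_on_lebesgue)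
    show "(\<lambda>i. integral UNIV (\<lambda>x. norm (f x - s i x))) \<longlonglongrightarrow> 0"
      using lim by (simp add: integral_lebesgue[OF di])
  qed
qed

lemma bochner_integral_norm_le:
  fixes f :: "real \<Rightarrow> 'b::banach"
  assumes "bochner_integrable f"
  shows "norm (integral UNIV f) \<le> integral\<^sup>L lebesgue (\<lambda>x. norm (f x))"
proof -
  have "integrable lebesgue (\<lambda>x. norm (f x))" using assms by (rule bochner_integrableD)
  then show ?thesis
    using integral_norm_bound_integral[OF bochner_integrable_integrable_on[OF assms] integrable_on_lebesgue]
    by (simp add: integral_lebesgue)
qed

lemma bochner_integral_bound:
  fixes f :: "real \<Rightarrow> 'b::banach"
  assumes "bochner_integrable f" "integrable lebesgue g" "AE t in lebesgue. norm (f t) \<le> g t"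
  shows "norm (integral UNIV f) \<le> integral\<^sup>L lebesgue g"
  using bochner_integral_norm_le[OF assms(1)]
    integral_mono_AE[OF bochner_integrableD(2)[OF assms(1)] assms(2,3)] by linarith

lemma bochner_integral_diff:
  fixes f :: "real \<Rightarrow> 'b::banach"
  assumes "bochner_integrable f" "bochner_integrable g"
  shows "integral UNIV (\<lambda>x. f x - g x) = integral UNIV f - integral UNIV g"
  by (rule integral_diff[OF assms[THEN bochner_integrable_integrable_on]])

lemma bochner_integral_add:
  fixes f :: "real \<Rightarrow> 'b::banach"
  assumes "bochner_integrable f" "bochner_integrable g"
  shows "integral UNIV (\<lambda>x. f x + g x) = integral UNIV f + integral UNIV g"
  by (rule integral_add[OF assms[THEN bochner_integrable_integrable_on]])

lemma bochner_integral_linear: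
  fixes f :: "real \<Rightarrow> 'b::banach" and h :: "'b \<Rightarrow> 'c::banach"
  assumes "bochner_integrable f" "bounded_linear h"
  shows "integral UNIV (\<lambda>x. h (f x)) = h (integral UNIV f)"
  using integral_linear[OF bochner_integrable_integrable_on[OF assms(1)] assms(2)] by (simp add: comp_def)

text \<open>Only the scalar theorem is used, applied to \<open>norm (f k t - g t)\<close> with
  majorant \<open>2 * h t\<close>.\<close>

lemma bochner_dominated_convergence:
  fixes f :: "nat \<Rightarrow> real \<Rightarrow> 'b::banach"
  assumes f: "\<And>k. strongly_measurable lebesgue (f k)" and g: "strongly_measurable lebesgue g"
    and h: "integrable lebesgue h"
    and le: "\<And>k. AE t in lebesgue. norm (f k t) \<le> h t"
    and lim: "AE t in lebesgue. (\<lambda>k. f k t) \<longlonglongrightarrow> g t"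
  shows "bochner_integrable g" "(\<lambda>k. integral UNIV (f k)) \<longlonglongrightarrow> integral UNIV g"
proof -
  have fb: "bochner_integrable (f k)" for k
    by (rule bochner_integrable_bound[OF f h le])
  have le': "AE t in lebesgue. \<forall>k. norm (f k t) \<le> h t" using le by (simp add: AE_all_countable)
  have gle: "AE t in lebesgue. norm (g t) \<le> h t"
    using le' lim
  proof eventually_elim
    case (elim t)
    have "(\<lambda>k. norm (f k t)) \<longlonglongrightarrow> norm (g t)" by (intro tendsto_norm elim)
    then show ?case by (rule LIMSEQ_le_const2) (use elim(1) in auto)
  qed
  show gb: "bochner_integrable g"
    by (rule bochner_integrable_bound[OF g h gle])
  have di: "integrable lebesgue (\<lambda>t. norm (f k t - g t))" for k
    by (rule bochner_integrableD(2)[OF bochner_integrable_diff[OF fb gb]])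
  have "(\<lambda>k. integral\<^sup>L lebesgue (\<lambda>t. norm (f k t - g t))) \<longlonglongrightarrow> integral\<^sup>L lebesgue (\<lambda>t::real. 0)"
  proof (rule integral_dominated_convergence[where w="\<lambda>t. 2 * h t"])
    show "AE t in lebesgue. (\<lambda>k. norm (f k t - g t)) \<longlonglongrightarrow> 0"
      using lim
    proof eventually_elim
      case (elim t)
      have "(\<lambda>k. norm (f k t - g t)) \<longlonglongrightarrow> norm (g t - g t)" by (intro tendsto_intros elim)
      then show ?case by simp
    qed
    show "AE t in lebesgue. norm (norm (f k t - g t)) \<le> 2 * h t" for k
      using le[of k] gle
    proof eventually_elim
      case (elim t) then show ?case using norm_triangle_ineq4[of "f k t" "g t"] by simp
    qed
  qed (use h di in auto)
  then have lim0: "(\<lambda>k. integral\<^sup>L lebesgue (\<lambda>t. norm (f k t - g t))) \<longlonglongrightarrow> 0" by simp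
  show "(\<lambda>k. integral UNIV (f k)) \<longlonglongrightarrow> integral UNIV g"
  proof (rule Lim_transform_bound[OF _ lim0, THEN LIM_zero_cancel])
    show "\<forall>\<^sub>F k in sequentially. norm (integral UNIV (f k) - integral UNIV g)
        \<le> norm (integral\<^sup>L lebesgue (\<lambda>t. norm (f k t - g t)))"
    proof (rule always_eventually, rule allI)
      fix k
      have "norm (integral UNIV (f k) - integral UNIV g) = norm (integral UNIV (\<lambda>t. f k t - g t))"
        by (simp add: bochner_integral_diff[OF fb gb])
      also have "\<dots> \<le> integral\<^sup>L lebesgue (\<lambda>t. norm (f k t - g t))"
        by (rule bochner_integral_norm_le[OF bochner_integrable_diff[OF fb gb]])
      finally show "norm (integral UNIV (f k) - integral UNIV g)
        \<le> norm (integral\<^sup>L lebesgue (\<lambda>t. norm (f k t - g t)))" by simp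
    qed
  qed
qed

lemma strongly_measurable_indicator:
  "strongly_measurable M f \<Longrightarrow> A \<in> sets M \<Longrightarrow> strongly_measurable M (\<lambda>x. indicat_real A x *\<^sub>R f x)"
  by (rule strongly_measurable_scaleR) (auto intro: strongly_measurable_real)

text \<open>Fubini for continuous kernels dominated by a product: on rectangles it is the theorem
  for continuous functions, and dominated convergence exhausts the plane by rectangles. Continuity
  replaces any measurability on the plane. The whole line serves Fourier inversion, the half line
  the semigroup.\<close>

lemma bochner_swap:
  fixes K :: "real \<Rightarrow> real \<Rightarrow> 'b::banach"
  assumes K: "continuous_on UNIV (\<lambda>(s,x). K s x)" and S: "S = UNIV \<or> S = {0..}"
    and a: "integrable lebesgue a" and b: "integrable lebesgue b"
    and le: "\<And>s x. s \<in> S \<Longrightarrow> norm (K s x) \<le> a s * b x"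
    and nn: "\<And>s. 0 \<le> a s" "\<And>x. 0 \<le> b x"
  shows "integral UNIV (\<lambda>s. indicator S s *\<^sub>R integral UNIV (\<lambda>x. K s x))
       = integral UNIV (\<lambda>x. integral UNIV (\<lambda>s. indicator S s *\<^sub>R K s x))"
    and "bochner_integrable (\<lambda>s. indicator S s *\<^sub>R integral UNIV (\<lambda>x. K s x))"
    and "bochner_integrable (\<lambda>x. integral UNIV (\<lambda>s. indicator S s *\<^sub>R K s x))"
proof -
  have Sm[measurable]: "S \<in> sets lebesgue" using S by auto
  \<comment> \<open>The left end is chosen so that \<open>S\<close> cut to [-N, N] is a closed
    interval for either shape of \<open>S\<close>.\<close>
  define l where "l N = (if S = UNIV then - real N else 0)" for N
  have box: "S \<inter> {- real N..real N} = cbox (l N) (real N)" for N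
    using S by (auto simp: l_def)
  have K1: "continuous_on UNIV (\<lambda>x. K s x)" for s
  proof -
    have "continuous_on UNIV (\<lambda>x. (s,x))" by (intro continuous_intros)
    from continuous_on_compose2[OF K this] show ?thesis by simp
  qed
  have K2: "continuous_on UNIV (\<lambda>s. K s x)" for x
  proof -
    have "continuous_on UNIV (\<lambda>s. (s,x))" by (intro continuous_intros)
    from continuous_on_compose2[OF K this] show ?thesis by simp
  qed
  have Kr: "continuous_on UNIV (\<lambda>(x,s). K s x)"
  proof -
    have "continuous_on UNIV (\<lambda>p::real\<times>real. (snd p, fst p))" by (intro continuous_intros)
    from continuous_on_compose2[OF K this] show ?thesis by (simp add: case_prod_beta)
  qed
  have smK: "strongly_measurable lebesgue (\<lambda>s. indicat_real S s *\<^sub>R K s x)" for x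
    by (intro strongly_measurable_indicator strongly_measurable_continuous K2) auto
  have smKc: "strongly_measurable lebesgue (\<lambda>s. indicat_real (cbox u v) s *\<^sub>R K s x)"
    "strongly_measurable lebesgue (\<lambda>x. indicat_real (cbox u v) x *\<^sub>R K s x)" for u v s x
    by (intro strongly_measurable_indicator strongly_measurable_continuous K1 K2; simp)+
  define A where "A N x = integral (cbox (l N) (real N)) (\<lambda>s. K s x)" for N x
  define B where "B N s = integral (cbox (- real N) (real N)) (\<lambda>x. K s x)" for N s
  have Ac: "continuous_on UNIV (A N)" for N
    unfolding A_def by (rule integral_continuous_on_param) (rule continuous_on_subset[OF Kr], simp)
  have Bc: "continuous_on UNIV (B N)" for N
    unfolding B_def by (rule integral_continuous_on_param) (rule continuous_on_subset[OF K], simp)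
  have A_alt: "A N x = integral UNIV (\<lambda>s. indicat_real (cbox (l N) (real N)) s *\<^sub>R K s x)" for N x
    unfolding A_def by (subst integral_restrict_UNIV[symmetric]) (auto simp: indicator_def intro!: integral_cong)
  have B_alt: "B N s = integral UNIV (\<lambda>x. indicat_real (cbox (- real N) (real N)) x *\<^sub>R K s x)" for N s
    unfolding B_def by (subst integral_restrict_UNIV[symmetric]) (auto simp: indicator_def intro!: integral_cong)
  have evS: "eventually (\<lambda>N. indicat_real (cbox (l N) (real N)) s = indicat_real S s) sequentially" for s
  proof -
    obtain N0 :: nat where "\<bar>s\<bar> \<le> real N0" using real_arch_simple by blast
    then have "indicat_real (cbox (l N) (real N)) s = indicat_real S s" if "N \<ge> N0" for N
      unfolding box[symmetric] using that by (auto simp: indicator_def)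
    then show ?thesis unfolding eventually_sequentially by blast
  qed
  have evU: "eventually (\<lambda>N. indicat_real (cbox (- real N) (real N)) s = 1) sequentially" for s
  proof -
    obtain N0 :: nat where "\<bar>s\<bar> \<le> real N0" using real_arch_simple by blast
    then have "indicat_real (cbox (- real N) (real N)) s = 1" if "N \<ge> N0" for N
      using that by (auto simp: indicator_def)
    then show ?thesis unfolding eventually_sequentially by blast
  qed
  have sub: "cbox (l N) (real N) \<subseteq> S" for N using box by blast
  define na where "na = integral\<^sup>L lebesgue a"
  define nb where "nb = integral\<^sup>L lebesgue b"
  have Alim: "(\<lambda>N. A N x) \<longlonglongrightarrow> integral UNIV (\<lambda>s. indicat_real S s *\<^sub>R K s x)" for x
    unfolding A_alt
  proof (rule bochner_dominated_convergence(2)[where h="\<lambda>s. a s * b x"])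
    show "AE s in lebesgue. (\<lambda>N. indicat_real (cbox (l N) (real N)) s *\<^sub>R K s x) \<longlonglongrightarrow> indicat_real S s *\<^sub>R K s x"
    proof (rule AE_I2)
      fix s show "(\<lambda>N. indicat_real (cbox (l N) (real N)) s *\<^sub>R K s x) \<longlonglongrightarrow> indicat_real S s *\<^sub>R K s x"
        by (rule tendsto_eventually) (use evS[of s] in \<open>auto elim: eventually_mono\<close>)
    qed
    show "AE s in lebesgue. norm (indicat_real (cbox (l N) (real N)) s *\<^sub>R K s x) \<le> a s * b x" for N
      using sub[of N] le nn by (intro AE_I2) (auto simp: indicator_def)
  qed (use a in \<open>simp_all only: smK smKc integrable_mult_left\<close>)
  have Ale: "norm (A N x) \<le> na * b x" for N x
  proof -
    have "bochner_integrable (\<lambda>s. indicat_real (cbox (l N) (real N)) s *\<^sub>R K s x)"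
      by (rule bochner_integrable_bound[OF smKc(1), where g="\<lambda>s. a s * b x"])
        (use sub[of N] a le nn in \<open>auto intro!: AE_I2 simp: indicator_def\<close>)
    then have "norm (A N x) \<le> integral\<^sup>L lebesgue (\<lambda>s. a s * b x)"
      unfolding A_alt by (rule bochner_integral_bound)
        (use sub[of N] a le nn in \<open>auto intro!: AE_I2 simp: indicator_def\<close>)
    then show ?thesis by (simp add: na_def)
  qed
  have Blim: "(\<lambda>N. indicat_real (cbox (l N) (real N)) s *\<^sub>R B N s)
      \<longlonglongrightarrow> indicat_real S s *\<^sub>R integral UNIV (\<lambda>x. K s x)" for s
  proof (cases "s \<in> S")
    case True
    have "(\<lambda>N. B N s) \<longlonglongrightarrow> integral UNIV (\<lambda>x. K s x)"
      unfolding B_alt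
    proof (rule bochner_dominated_convergence(2)[where h="\<lambda>x. a s * b x"])
      show "AE x in lebesgue. (\<lambda>N. indicat_real (cbox (- real N) (real N)) x *\<^sub>R K s x) \<longlonglongrightarrow> K s x"
      proof (rule AE_I2)
        fix x show "(\<lambda>N. indicat_real (cbox (- real N) (real N)) x *\<^sub>R K s x) \<longlonglongrightarrow> K s x"
          by (rule tendsto_eventually) (use evU[of x] in \<open>auto elim: eventually_mono\<close>)
      qed
      show "AE x in lebesgue. norm (indicat_real (cbox (- real N) (real N)) x *\<^sub>R K s x) \<le> a s * b x" for N
        using True le nn by (intro AE_I2) (auto simp: indicator_def)
    qed (use b in \<open>simp_all only: smKc strongly_measurable_continuous K1 integrable_mult_right\<close>)
    moreover have "(\<lambda>N. indicat_real (cbox (l N) (real N)) s) \<longlonglongrightarrow> indicat_real S s"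
      by (rule tendsto_eventually) (use evS[of s] in auto)
    ultimately show ?thesis by (intro tendsto_scaleR)
  next
    case False
    then have "indicat_real (cbox (l N) (real N)) s = 0" for N using sub[of N] by (auto simp: indicator_def)
    then show ?thesis using False by simp
  qed
  have Ble: "norm (indicat_real (cbox (l N) (real N)) s *\<^sub>R B N s) \<le> a s * nb" for N s
  proof (cases "s \<in> S")
    case True
    have "bochner_integrable (\<lambda>x. indicat_real (cbox (- real N) (real N)) x *\<^sub>R K s x)"
      by (rule bochner_integrable_bound[OF smKc(2), where g="\<lambda>x. a s * b x"])
        (use True b le nn in \<open>auto intro!: AE_I2 simp: indicator_def\<close>)
    then have "norm (B N s) \<le> integral\<^sup>L lebesgue (\<lambda>x. a s * b x)"
      unfolding B_alt by (rule bochner_integral_bound)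
        (use True b le nn in \<open>auto intro!: AE_I2 simp: indicator_def\<close>)
    then have "norm (B N s) \<le> a s * nb" by (simp add: nb_def)
    moreover have "0 \<le> a s * nb" using nn by (auto simp: nb_def)
    ultimately show ?thesis by (auto simp: indicator_def)
  next
    case False
    moreover have "0 \<le> a s * nb" using nn by (auto simp: nb_def)
    ultimately show ?thesis using sub[of N] by (auto simp: indicator_def)
  qed
  have smA: "strongly_measurable lebesgue (\<lambda>x. indicat_real (cbox (- real N) (real N)) x *\<^sub>R A N x)" for N
    by (intro strongly_measurable_indicator strongly_measurable_continuous Ac) auto
  have smB: "strongly_measurable lebesgue (\<lambda>s. indicat_real (cbox (l N) (real N)) s *\<^sub>R B N s)" for N
    by (intro strongly_measurable_indicator strongly_measurable_continuous Bc) auto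
  have limA: "(\<lambda>N. indicat_real (cbox (- real N) (real N)) x *\<^sub>R A N x)
      \<longlonglongrightarrow> integral UNIV (\<lambda>s. indicat_real S s *\<^sub>R K s x)" for x
    using tendsto_scaleR[OF tendsto_eventually[OF evU] Alim, of x] by simp
  have na0: "0 \<le> na" "0 \<le> nb" unfolding na_def nb_def using nn by (auto intro: integral_nonneg_AE)
  have Ale': "norm (indicat_real (cbox (- real N) (real N)) x *\<^sub>R A N x) \<le> na * b x" for N x
    using Ale[of N x] na0 nn by (auto simp: indicator_def)
  have gA: "strongly_measurable lebesgue (\<lambda>x. integral UNIV (\<lambda>s. indicat_real S s *\<^sub>R K s x))"
    by (rule strongly_measurable_limit[OF smA limA])
  have gB: "strongly_measurable lebesgue (\<lambda>s. indicat_real S s *\<^sub>R integral UNIV (\<lambda>x. K s x))"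
    by (rule strongly_measurable_limit[OF smB Blim])
  have hA: "integrable lebesgue (\<lambda>x. na * b x)" using b by simp
  have hB: "integrable lebesgue (\<lambda>s. a s * nb)" using a by simp
  have lA: "AE x in lebesgue. norm (indicat_real (cbox (- real N) (real N)) x *\<^sub>R A N x) \<le> na * b x" for N
    by (rule AE_I2) (rule Ale')
  have lB: "AE s in lebesgue. norm (indicat_real (cbox (l N) (real N)) s *\<^sub>R B N s) \<le> a s * nb" for N
    by (rule AE_I2) (rule Ble)
  have A3: "bochner_integrable (\<lambda>x. integral UNIV (\<lambda>s. indicat_real S s *\<^sub>R K s x))"
    "(\<lambda>N. integral UNIV (\<lambda>x. indicat_real (cbox (- real N) (real N)) x *\<^sub>R A N x)) \<longlonglongrightarrow>
      integral UNIV (\<lambda>x. integral UNIV (\<lambda>s. indicat_real S s *\<^sub>R K s x))"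
    by (fact bochner_dominated_convergence[OF smA gA hA lA AE_I2[OF limA]])+
  have B3: "bochner_integrable (\<lambda>s. indicat_real S s *\<^sub>R integral UNIV (\<lambda>x. K s x))"
    "(\<lambda>N. integral UNIV (\<lambda>s. indicat_real (cbox (l N) (real N)) s *\<^sub>R B N s)) \<longlonglongrightarrow>
      integral UNIV (\<lambda>s. indicat_real S s *\<^sub>R integral UNIV (\<lambda>x. K s x))"
    by (fact bochner_dominated_convergence[OF smB gB hB lB AE_I2[OF Blim]])+
  have "integral UNIV (\<lambda>x. indicat_real (cbox (- real N) (real N)) x *\<^sub>R A N x)
      = integral UNIV (\<lambda>s. indicat_real (cbox (l N) (real N)) s *\<^sub>R B N s)" for N
  proof -
    have "integral UNIV (\<lambda>x. indicat_real (cbox (- real N) (real N)) x *\<^sub>R A N x)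
        = integral (cbox (- real N) (real N)) (A N)"
      by (subst integral_restrict_UNIV[symmetric]) (auto simp: indicator_def intro!: integral_cong)
    also have "\<dots> = integral (cbox (l N) (real N)) (B N)"
      unfolding A_def B_def
      by (rule integral_swap_continuous[symmetric]) (rule continuous_on_subset[OF K], simp)
    also have "\<dots> = integral UNIV (\<lambda>s. indicat_real (cbox (l N) (real N)) s *\<^sub>R B N s)"
      by (subst integral_restrict_UNIV[symmetric]) (auto simp: indicator_def intro!: integral_cong)
    finally show ?thesis .
  qed
  then show "integral UNIV (\<lambda>s. indicat_real S s *\<^sub>R integral UNIV (\<lambda>x. K s x))
       = integral UNIV (\<lambda>x. integral UNIV (\<lambda>s. indicat_real S s *\<^sub>R K s x))"
    using A3(2) B3(2) LIMSEQ_unique by simp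
  show "bochner_integrable (\<lambda>s. indicat_real S s *\<^sub>R integral UNIV (\<lambda>x. K s x))"
    "bochner_integrable (\<lambda>x. integral UNIV (\<lambda>s. indicat_real S s *\<^sub>R K s x))" by fact+
qed

section \<open>Schwartz functions and the Fourier transform\<close>

lemma scaleC_one [simp]: "scaleC 1 x = (x :: 'a::complex_normed_vector)"
  using scaleC_of_real[of 1 x] by simp

lemma scaleC_zero_left [simp]: "scaleC 0 x = (0 :: 'a::complex_normed_vector)"
  using scaleC_of_real[of 0 x] by simp

lemma scaleC_zero_right [simp]: "scaleC c 0 = (0 :: 'a::complex_normed_vector)"
  using scaleC_scaleC[of c 0 "0::'a"] by simp

lemma scaleC_minus_one: "scaleC (-1) x = - (x :: 'a::complex_normed_vector)"
  using scaleC_of_real[of "-1" x] by simp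

lemma bounded_bilinear_scaleC:
  "bounded_bilinear (scaleC :: complex \<Rightarrow> 'a \<Rightarrow> 'a::complex_normed_vector)"
proof
  show "scaleC (r *\<^sub>R a) b = r *\<^sub>R scaleC a b" for r a and b :: 'a
    by (metis scaleC_of_real scaleC_scaleC scaleR_conv_of_real)
  show "scaleC a (r *\<^sub>R b) = r *\<^sub>R scaleC a b" for r a and b :: 'a
    by (metis scaleC_of_real scaleC_scaleC mult.commute)
  show "\<exists>K. \<forall>a b. norm (scaleC a (b::'a)) \<le> norm a * norm b * K"
    by (intro exI[of _ 1]) (simp add: norm_scaleC)
qed (simp_all add: scaleC_add_left scaleC_add_right)

lemmas continuous_on_scaleC [continuous_intros] = bounded_bilinear.continuous_on[OF bounded_bilinear_scaleC]
lemmas tendsto_scaleC [tendsto_intros] = bounded_bilinear.tendsto[OF bounded_bilinear_scaleC]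
lemmas bounded_linear_scaleC_right = bounded_bilinear.bounded_linear_right[OF bounded_bilinear_scaleC]
lemmas bounded_linear_scaleC_left = bounded_bilinear.bounded_linear_left[OF bounded_bilinear_scaleC]
lemmas has_vector_derivative_scaleC = bounded_bilinear.has_vector_derivative[OF bounded_bilinear_scaleC]
lemmas scaleC_diff_left = bounded_bilinear.diff_left[OF bounded_bilinear_scaleC]
lemmas scaleC_minus_left = bounded_bilinear.minus_left[OF bounded_bilinear_scaleC]
lemmas scaleC_scaleR_right = bounded_bilinear.scaleR_right[OF bounded_bilinear_scaleC]
lemmas scaleC_scaleR_left = bounded_bilinear.scaleR_left[OF bounded_bilinear_scaleC]

lemma bounded_clinear_bounded_linear: "bounded_clinear f \<Longrightarrow> bounded_linear f"
  unfolding bounded_clinear_def clinear_def bounded_linear_def bounded_linear_axioms_def linear_iff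
  by (metis scaleC_of_real)

lemma bounded_clinear_scaleC: "bounded_clinear f \<Longrightarrow> f (scaleC c x) = scaleC c (f x)"
  unfolding bounded_clinear_def clinear_def by blast

lemma strongly_measurable_scaleC:
  "strongly_measurable M f \<Longrightarrow> strongly_measurable M g \<Longrightarrow> strongly_measurable M (\<lambda>x. scaleC (f x) (g x))"
  by (rule strongly_measurable_compose2[where h=scaleC])
    (auto simp: case_prod_beta intro!: continuous_intros)

lemma bochner_integrable_cis:
  assumes "bochner_integrable f" "continuous_on UNIV u"
  shows "bochner_integrable (\<lambda>t. scaleC (cis (u t)) (f t))"
proof (rule bochner_integrable_bound[OF _ bochner_integrableD(2)[OF assms(1)]])
  show "strongly_measurable lebesgue (\<lambda>t. scaleC (cis (u t)) (f t))"
    by (intro strongly_measurable_scaleC strongly_measurable_continuous bochner_integrableD(1) assms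
        continuous_on_cis)
qed (simp add: norm_scaleC)

section \<open>Smooth functions and Schwartz functions\<close>

lemma nderiv_0 [simp]: "nderiv 0 f = f"
  by (simp add: nderiv_def)

text \<open>Derivatives are unique, so an explicit sequence of successive derivatives both proves
  smoothness and computes every \<open>nderiv k f\<close>. Schwartz functions below are handled
  through such sequences.\<close>

lemma smoothI:
  assumes "g 0 = f" "\<And>k t. (g k has_vector_derivative g (Suc k) t) (at t)"
  shows "smooth f" "\<And>k. nderiv k f = g k"
proof -
  show *: "nderiv k f = g k" for k
  proof (induction k)
    case (Suc k)
    have "nderiv (Suc k) f = (\<lambda>t. vector_derivative (nderiv k f) (at t))"
      by (simp add: nderiv_def)
    also have "\<dots> = g (Suc k)"
      unfolding Suc by (intro ext vector_derivative_at assms(2))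
    finally show ?case .
  qed (simp add: assms(1))
  show "smooth f" unfolding smooth_def * using assms(2) by blast
qed

lemma smoothD: "smooth f \<Longrightarrow> (nderiv k f has_vector_derivative nderiv (Suc k) f t) (at t)"
  unfolding smooth_def by blast

lemma smooth_continuous_on: "smooth f \<Longrightarrow> continuous_on UNIV (nderiv k f)"
  by (intro continuous_at_imp_continuous_on ballI has_vector_derivative_continuous[OF smoothD])

lemma integrable_inverse_1_plus_square_lebesgue:
  "integrable lebesgue (\<lambda>x::real. 1 / (1 + x\<^sup>2))"
proof -
  have "integrable lborel (\<lambda>x::real. inverse (1 + x\<^sup>2))"
    using integrable_inverse_1_plus_square by (simp add: set_integrable_def einterval_eq_UNIV)
  then have "integrable lebesgue (\<lambda>x::real. inverse (1 + x\<^sup>2))"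
    by (subst integrable_completion) auto
  then show ?thesis by (simp add: inverse_eq_divide)
qed

lemma schwartz_smooth: "schwartz f \<Longrightarrow> smooth f"
  by (simp add: schwartz_def)

lemma schwartz_continuous_on: "schwartz f \<Longrightarrow> continuous_on UNIV (nderiv k f)"
  by (simp add: schwartz_def smooth_continuous_on)

lemma schwartz_continuous: "schwartz f \<Longrightarrow> continuous_on UNIV f"
  using schwartz_continuous_on[of f 0] by simp

lemma schwartz_decay:
  assumes "schwartz f"
  shows "\<exists>C\<ge>0. \<forall>t. norm (nderiv k f t) \<le> C / (1 + t\<^sup>2)"
proof -
  obtain C0 where C0: "\<And>t. \<bar>t\<bar> ^ 0 * norm (nderiv k f t) \<le> C0"
    using assms unfolding schwartz_def by blast
  obtain C2 where C2: "\<And>t. \<bar>t\<bar> ^ 2 * norm (nderiv k f t) \<le> C2"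
    using assms unfolding schwartz_def by blast
  have "norm (nderiv k f t) \<le> (C0 + C2) / (1 + t\<^sup>2)" for t
  proof -
    have "(1 + t\<^sup>2) * norm (nderiv k f t) \<le> C0 + C2"
      using C0[of t] C2[of t] by (simp add: algebra_simps)
    then show ?thesis by (simp add: pos_le_divide_eq add_pos_nonneg mult.commute)
  qed
  moreover have "0 \<le> C0 + C2"
    using order_trans[OF _ C0[of 0], of 0] order_trans[OF _ C2[of 0], of 0] by simp
  ultimately show ?thesis by blast
qed

lemma schwartz_bochner_integrable:
  assumes "schwartz f"
  shows "bochner_integrable (nderiv k f)"
proof -
  obtain C where C: "\<And>t. norm (nderiv k f t) \<le> C / (1 + t\<^sup>2)" using schwartz_decay[OF assms] by blast
  show ?thesis
  proof (rule bochner_integrable_bound)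
    show "strongly_measurable lebesgue (nderiv k f)"
      by (intro strongly_measurable_continuous schwartz_continuous_on assms)
    show "integrable lebesgue (\<lambda>t. C * (1 / (1 + t\<^sup>2)))"
      using integrable_inverse_1_plus_square_lebesgue by (rule integrable_mult_right)
  qed (use C in simp)
qed

lemma nderiv_Suc': "nderiv (Suc k) f = nderiv k (nderiv 1 f)"
  unfolding nderiv_def by (simp add: funpow_Suc_right del: funpow.simps)

lemma schwartz_nderiv1:
  assumes "schwartz f" shows "schwartz (nderiv 1 f)"
  using assms unfolding schwartz_def smooth_def nderiv_Suc'[symmetric] by blast

lemma schwartzI:
  assumes "g 0 = f" "\<And>k t. (g k has_vector_derivative g (Suc k) t) (at t)"
    "\<And>j k. \<exists>C. \<forall>t. \<bar>t\<bar> ^ j * norm (g k t) \<le> C"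
  shows "schwartz f"
  using smoothI[OF assms(1,2)] assms(3) unfolding schwartz_def by simp

text \<open>Multiplication by -i t, the operation that corresponds to differentiation of the Fourier
  transform; its iterates give all derivatives of \<open>fourier f\<close>.\<close>

definition itimes :: "(real \<Rightarrow> 'a::complex_normed_vector) \<Rightarrow> real \<Rightarrow> 'a" where
  "itimes f t = scaleC (- (\<i> * complex_of_real t)) (f t)"

lemma schwartz_itimes:
  assumes f: "schwartz f"
  shows "schwartz (itimes f)"
proof (rule schwartzI)
  \<comment> \<open>Leibniz' rule: the factor -i t has constant derivative, so only two terms
    survive. For k = 0 the index k - 1 is again 0, but the coefficient k removes that term.\<close>
  define g where "g k t = scaleC (- (\<i> * complex_of_real t)) (nderiv k f t)
      + scaleC (- (\<i> * of_nat k)) (nderiv (k - 1) f t)" for k t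
  show "g 0 = itimes f" by (auto simp: g_def itimes_def)
  show "(g k has_vector_derivative g (Suc k) t) (at t)" for k t
  proof -
    have d: "(nderiv j f has_vector_derivative nderiv (Suc j) f t) (at t)" for j
      by (rule smoothD[OF schwartz_smooth[OF f]])
    have l: "((\<lambda>t. - (\<i> * complex_of_real t)) has_vector_derivative - \<i>) (at t)"
      by (auto intro!: derivative_eq_intros has_vector_derivative_real_field)
    have c: "((\<lambda>t. scaleC c (nderiv j f t)) has_vector_derivative scaleC c (nderiv (Suc j) f t)) (at t)" for c j
      using has_vector_derivative_scaleC[OF has_vector_derivative_const d] by simp
    show ?thesis
    proof (cases k)
      case 0
      show ?thesis unfolding g_def 0
        using has_vector_derivative_scaleC[OF l d[of 0]] by (simp add: add.commute)
    next
      case (Suc m)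
      have "(g k has_vector_derivative
         (scaleC (- (\<i> * complex_of_real t)) (nderiv (Suc k) f t) + scaleC (- \<i>) (nderiv k f t))
          + scaleC (- (\<i> * of_nat k)) (nderiv k f t)) (at t)"
        unfolding g_def
        using has_vector_derivative_add[OF has_vector_derivative_scaleC[OF l d[of k]] c[of "- (\<i> * of_nat k)" m]]
        by (simp add: Suc)
      also have "(scaleC (- (\<i> * complex_of_real t)) (nderiv (Suc k) f t) + scaleC (- \<i>) (nderiv k f t))
          + scaleC (- (\<i> * of_nat k)) (nderiv k f t) = g (Suc k) t"
        by (simp add: g_def add.assoc scaleC_add_left[symmetric] algebra_simps)
      finally show ?thesis .
    qed
  qed
  show "\<exists>C. \<forall>t. \<bar>t\<bar> ^ j * norm (g k t) \<le> C" for j k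
  proof -
    obtain C1 where C1: "\<And>t. \<bar>t\<bar> ^ Suc j * norm (nderiv k f t) \<le> C1"
      using f unfolding schwartz_def by blast
    obtain C2 where C2: "\<And>t. \<bar>t\<bar> ^ j * norm (nderiv (k - 1) f t) \<le> C2"
      using f unfolding schwartz_def by blast
    have "\<bar>t\<bar> ^ j * norm (g k t) \<le> C1 + real k * C2" for t
    proof -
      have "norm (g k t) \<le> \<bar>t\<bar> * norm (nderiv k f t) + real k * norm (nderiv (k - 1) f t)"
        unfolding g_def by (rule norm_triangle_le) (simp add: norm_scaleC norm_mult)
      then have "\<bar>t\<bar> ^ j * norm (g k t) \<le> \<bar>t\<bar> ^ j * (\<bar>t\<bar> * norm (nderiv k f t) + real k * norm (nderiv (k - 1) f t))"
        by (rule mult_left_mono) simp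
      also have "\<dots> = \<bar>t\<bar> ^ Suc j * norm (nderiv k f t) + real k * (\<bar>t\<bar> ^ j * norm (nderiv (k - 1) f t))"
        by (simp add: algebra_simps)
      also have "\<dots> \<le> C1 + real k * C2"
        by (intro add_mono mult_left_mono C1 C2) simp
      finally show ?thesis .
    qed
    then show ?thesis by blast
  qed
qed

lemma vector_derivative_bound:
  fixes g :: "real \<Rightarrow> 'b::real_normed_vector"
  assumes d: "\<And>x. x \<in> closed_segment a b \<Longrightarrow> (g has_vector_derivative g' x) (at x)"
    and B: "\<And>x. x \<in> closed_segment a b \<Longrightarrow> norm (g' x) \<le> B"
  shows "norm (g b - g a) \<le> B * \<bar>b - a\<bar>"
proof -
  have "norm (g b - g a) \<le> B * norm (b - a)"
  proof (rule differentiable_bound[where S="closed_segment a b" and f'="\<lambda>x h. h *\<^sub>R g' x"])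
    show "(g has_derivative (\<lambda>h. h *\<^sub>R g' x)) (at x within closed_segment a b)"
      if "x \<in> closed_segment a b" for x
      using d[OF that] unfolding has_vector_derivative_def by (rule has_derivative_at_withinI)
    show "onorm (\<lambda>h. h *\<^sub>R g' x) \<le> B" if "x \<in> closed_segment a b" for x
    proof (rule onorm_le)
      fix h :: real
      show "norm (h *\<^sub>R g' x) \<le> B * norm h"
        using mult_right_mono[OF B[OF that] norm_ge_zero[of h]] by (simp add: mult.commute)
    qed
  qed auto
  then show ?thesis by simp
qed

text \<open>A quadratic remainder estimate gives the derivative at once; it is applied to Fourier
  transforms and to the flat point 0 of \<open>thetak\<close>.\<close>

lemma has_vector_derivative_quadratic:
  assumes "\<And>y. norm (F y - F x - (y - x) *\<^sub>R D) \<le> C * (y - x)\<^sup>2"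
  shows "(F has_vector_derivative D) (at (x::real))"
  unfolding has_vector_derivative_def
proof (rule has_derivativeI_sandwich[where e=1 and H="\<lambda>y. C * norm (y - x)"])
  show "bounded_linear (\<lambda>h. h *\<^sub>R D)" by (rule bounded_linear_scaleR_left)
  fix y assume "y \<noteq> x"
  show "norm (F y - F x - (y - x) *\<^sub>R D) / norm (y - x) \<le> C * norm (y - x)"
  proof -
    have "(y - x)\<^sup>2 = norm (y - x) * norm (y - x)" by (simp add: power2_eq_square)
    then show ?thesis using assms[of y] \<open>y \<noteq> x\<close> by (simp add: pos_divide_le_eq mult.assoc)
  qed
next
  have "((\<lambda>y. C * norm (y - x)) \<longlongrightarrow> C * norm (x - x)) (at x)" by (intro tendsto_intros)
  then show "((\<lambda>y. C * norm (y - x)) \<longlongrightarrow> 0) (at x)" by simp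
qed simp

lemma cis_linear_approx: "cmod (cis x - 1 - \<i> * x) \<le> x\<^sup>2"
proof -
  have "cmod (iexp x - (\<Sum>k\<le>1. (\<i> * x) ^ k / fact k)) \<le> \<bar>x\<bar> ^ Suc 1 / fact (Suc 1)"
    by (rule iexp_approx1)
  then have "cmod (cis x - 1 - \<i> * x) \<le> x\<^sup>2 / 2"
    by (simp add: cis_conv_exp diff_diff_eq power2_eq_square abs_mult_self_eq)
  also have "\<dots> \<le> x\<^sup>2" by simp
  finally show ?thesis .
qed

text \<open>Differentiation under the integral through the Taylor remainder of \<open>cis\<close>,
  which is at most the square of its argument. The resulting factor t^2 is harmless because
  \<open>itimes (itimes f)\<close> is integrable.\<close>

lemma fourier_has_vector_derivative:
  fixes f :: "real \<Rightarrow> 'a::{complex_normed_vector,banach}"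
  assumes f: "schwartz f"
  shows "(fourier f has_vector_derivative fourier (itimes f) \<xi>) (at \<xi>)"
proof (rule has_vector_derivative_quadratic)
  fix \<eta>
  have b0: "bochner_integrable (\<lambda>t. scaleC (cis (- (\<xi> * t))) (f t))" for \<xi>
    using schwartz_bochner_integrable[OF f, of 0] by (intro bochner_integrable_cis) (auto intro!: continuous_intros)
  have b1: "bochner_integrable (\<lambda>t. scaleC (cis (- (\<xi> * t))) (itimes f t))" for \<xi>
    using schwartz_bochner_integrable[OF schwartz_itimes[OF f], of 0]
    by (intro bochner_integrable_cis) (auto intro!: continuous_intros)
  have b2: "bochner_integrable (itimes (itimes f))"
    using schwartz_bochner_integrable[OF schwartz_itimes[OF schwartz_itimes[OF f]], of 0] by simp
  let ?g = "\<lambda>t. scaleC (cis (- (\<eta> * t))) (f t) - scaleC (cis (- (\<xi> * t))) (f t)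
      - (\<eta> - \<xi>) *\<^sub>R scaleC (cis (- (\<xi> * t))) (itimes f t)"
  have bs: "bochner_integrable (\<lambda>t. (\<eta> - \<xi>) *\<^sub>R scaleC (cis (- (\<xi> * t))) (itimes f t))"
    by (rule bochner_integrable_linear[OF b1 bounded_linear_scaleR_right])
  have "fourier f \<eta> - fourier f \<xi> - (\<eta> - \<xi>) *\<^sub>R fourier (itimes f) \<xi> = integral UNIV ?g"
    unfolding fourier_def
    by (simp add: bochner_integral_diff bochner_integrable_diff b0 bs
        bochner_integral_linear[OF b1 bounded_linear_scaleR_right])
  also have "norm \<dots> \<le> integral\<^sup>L lebesgue (\<lambda>t. (\<eta> - \<xi>)\<^sup>2 * norm (itimes (itimes f) t))"
  proof (rule bochner_integral_bound)
    show "bochner_integrable ?g" by (intro bochner_integrable_diff b0 bs)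
    show "integrable lebesgue (\<lambda>t. (\<eta> - \<xi>)\<^sup>2 * norm (itimes (itimes f) t))"
      using bochner_integrableD(2)[OF b2] by simp
    show "AE t in lebesgue. norm (?g t) \<le> (\<eta> - \<xi>)\<^sup>2 * norm (itimes (itimes f) t)"
    proof (rule AE_I2)
      fix t
      let ?x = "- ((\<eta> - \<xi>) * t)"
      have "cis (- (\<eta> * t)) = cis (- (\<xi> * t)) * cis ?x"
        by (simp add: cis_mult algebra_simps)
      then have "?g t = scaleC (cis (- (\<xi> * t)) * (cis ?x - 1 - \<i> * ?x)) (f t)"
        by (simp add: itimes_def scaleC_diff_left scaleC_scaleC scaleC_scaleR_left[symmetric]
            right_diff_distrib scaleR_conv_of_real mult_ac)
      then have "norm (?g t) = cmod (cis ?x - 1 - \<i> * ?x) * norm (f t)"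
        by (simp add: norm_scaleC norm_mult)
      also have "\<dots> \<le> ?x\<^sup>2 * norm (f t)"
        by (intro mult_right_mono cis_linear_approx) simp
      also have "\<dots> = (\<eta> - \<xi>)\<^sup>2 * norm (itimes (itimes f) t)"
        by (simp add: itimes_def norm_scaleC norm_mult power2_eq_square abs_mult_self_eq mult_ac)
      finally show "norm (?g t) \<le> (\<eta> - \<xi>)\<^sup>2 * norm (itimes (itimes f) t)" .
    qed
  qed
  finally show "norm (fourier f \<eta> - fourier f \<xi> - (\<eta> - \<xi>) *\<^sub>R fourier (itimes f) \<xi>)
      \<le> integral\<^sup>L lebesgue (\<lambda>t. norm (itimes (itimes f) t)) * (\<eta> - \<xi>)\<^sup>2"
    by (simp add: mult.commute)
qed

lemma schwartz_itimes_funpow: "schwartz f \<Longrightarrow> schwartz ((itimes ^^ k) f)"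
  by (induction k) (auto intro: schwartz_itimes)

lemma nderiv_fourier:
  fixes f :: "real \<Rightarrow> 'a::{complex_normed_vector,banach}"
  assumes "schwartz f"
  shows "smooth (fourier f)" "nderiv k (fourier f) = fourier ((itimes ^^ k) f)"
  using smoothI[of "\<lambda>k. fourier ((itimes ^^ k) f)" "fourier f"]
    fourier_has_vector_derivative[OF schwartz_itimes_funpow[OF assms]] by auto

lemma itimes_funpow: "(itimes ^^ k) f t = scaleC ((- (\<i> * complex_of_real t)) ^ k) (f t)"
  by (induction k) (auto simp: itimes_def scaleC_scaleC)

lemma norm_fourier_le:
  fixes f :: "real \<Rightarrow> 'a::{complex_normed_vector,banach}"
  assumes "bochner_integrable f"
  shows "norm (fourier f \<xi>) \<le> integral\<^sup>L lebesgue (\<lambda>t. norm (f t))"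
  unfolding fourier_def
  using bochner_integral_norm_le[OF bochner_integrable_cis[OF assms, of "\<lambda>t. - (\<xi> * t)"]]
  by (simp add: norm_scaleC continuous_intros)

lemma integral_derivative_UNIV:
  fixes g :: "real \<Rightarrow> 'a::banach"
  assumes d: "\<And>t. (g has_vector_derivative g' t) (at t)" and b: "bochner_integrable g'"
    and lim: "(g \<longlongrightarrow> 0) at_top" "(g \<longlongrightarrow> 0) at_bot"
  shows "integral UNIV g' = 0"
proof -
  have 1: "integral UNIV (\<lambda>t. indicat_real {- real N..real N} t *\<^sub>R g' t) = g (real N) - g (- real N)" for N
  proof -
    have "(g' has_integral (g (real N) - g (- real N))) {- real N..real N}"
      by (rule fundamental_theorem_of_calculus) (simp_all add: has_vector_derivative_at_within[OF d])
    then have "integral {- real N..real N} g' = g (real N) - g (- real N)" by (rule integral_unique)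
    moreover have "integral {- real N..real N} g' = integral UNIV (\<lambda>t. indicat_real {- real N..real N} t *\<^sub>R g' t)"
      by (subst integral_restrict_UNIV[symmetric]) (auto simp: indicator_def intro!: integral_cong)
    ultimately show ?thesis by simp
  qed
  have "(\<lambda>N. integral UNIV (\<lambda>t. indicat_real {- real N..real N} t *\<^sub>R g' t)) \<longlonglongrightarrow> integral UNIV g'"
  proof (rule bochner_dominated_convergence(2)[OF _ bochner_integrableD(1)[OF b] bochner_integrableD(2)[OF b]])
    show "strongly_measurable lebesgue (\<lambda>t. indicat_real {- real N..real N} t *\<^sub>R g' t)" for N
      by (intro strongly_measurable_indicator bochner_integrableD(1)[OF b]) auto
    show "AE t in lebesgue. (\<lambda>N. indicat_real {- real N..real N} t *\<^sub>R g' t) \<longlonglongrightarrow> g' t"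
    proof (rule AE_I2)
      fix t :: real
      obtain N0 :: nat where N0: "\<bar>t\<bar> \<le> real N0" using real_arch_simple by blast
      have "eventually (\<lambda>N. indicat_real {- real N..real N} t *\<^sub>R g' t = g' t) sequentially"
        unfolding eventually_sequentially using N0 by (intro exI[of _ N0]) (auto simp: indicator_def)
      then show "(\<lambda>N. indicat_real {- real N..real N} t *\<^sub>R g' t) \<longlonglongrightarrow> g' t" by (rule tendsto_eventually)
    qed
  qed (auto simp: indicator_def)
  moreover have "(\<lambda>N. g (real N) - g (- real N)) \<longlonglongrightarrow> 0 - 0"
  proof (intro tendsto_diff)
    show "(\<lambda>N. g (real N)) \<longlonglongrightarrow> 0" by (rule filterlim_compose[OF lim(1) filterlim_real_sequentially])
    show "(\<lambda>N. g (- real N)) \<longlonglongrightarrow> 0"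
      by (rule filterlim_compose[OF lim(2) filterlim_compose[OF filterlim_uminus_at_bot_at_top filterlim_real_sequentially]])
  qed
  ultimately show ?thesis using LIMSEQ_unique 1 by simp
qed

lemma inverse_square_tendsto_0:
  fixes C :: real
  shows "((\<lambda>t. C / (1 + t\<^sup>2)) \<longlongrightarrow> 0) at_top" "((\<lambda>t. C / (1 + t\<^sup>2)) \<longlongrightarrow> 0) at_bot"
  by real_asymp+

lemma schwartz_tendsto_0:
  assumes "schwartz f"
  shows "(f \<longlongrightarrow> 0) at_top" "(f \<longlongrightarrow> 0) at_bot"
proof -
  obtain C where C: "\<And>t. norm (nderiv 0 f t) \<le> C / (1 + t\<^sup>2)" using schwartz_decay[OF assms] by blast
  show "(f \<longlongrightarrow> 0) at_top" "(f \<longlongrightarrow> 0) at_bot"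
    by (rule Lim_null_comparison[OF _ inverse_square_tendsto_0(1)[of C]], use C in simp)
      (rule Lim_null_comparison[OF _ inverse_square_tendsto_0(2)[of C]], use C in simp)
qed

lemma has_vector_derivative_cis_linear:
  "((\<lambda>t. cis (c * t)) has_vector_derivative (\<i> * c * cis (c * t))) (at t)"
proof -
  have "((\<lambda>t. exp (\<i> * c * complex_of_real t)) has_vector_derivative \<i> * c * exp (\<i> * c * complex_of_real t)) (at t)"
    by (auto intro!: derivative_eq_intros has_vector_derivative_real_field)
  then show ?thesis by (simp add: cis_conv_exp mult.assoc)
qed

text \<open>Integration by parts: the derivative of the phase times \<open>f\<close> integrates to 0
  over the line.\<close>

lemma fourier_nderiv1:
  fixes f :: "real \<Rightarrow> 'a::{complex_normed_vector,banach}"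
  assumes f: "schwartz f"
  shows "fourier (nderiv 1 f) \<xi> = scaleC (\<i> * \<xi>) (fourier f \<xi>)"
proof -
  have b: "bochner_integrable (\<lambda>t. scaleC (cis (- (\<xi> * t))) (nderiv k f t))" for k
    using schwartz_bochner_integrable[OF f] by (intro bochner_integrable_cis) (auto intro!: continuous_intros)
  have b': "bochner_integrable (\<lambda>t. scaleC (\<i> * \<xi>) (scaleC (cis (- (\<xi> * t))) (f t)))"
    using bochner_integrable_linear[OF b[of 0] bounded_linear_scaleC_right] by simp
  have "integral UNIV (\<lambda>t. scaleC (cis (- (\<xi> * t))) (nderiv 1 f t)
      - scaleC (\<i> * \<xi>) (scaleC (cis (- (\<xi> * t))) (f t))) = 0"
  proof (rule integral_derivative_UNIV)
    show "((\<lambda>t. scaleC (cis (- (\<xi> * t))) (f t)) has_vector_derivative scaleC (cis (- (\<xi> * t))) (nderiv 1 f t)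
      - scaleC (\<i> * \<xi>) (scaleC (cis (- (\<xi> * t))) (f t))) (at t)" for t
      using has_vector_derivative_scaleC[OF has_vector_derivative_cis_linear[of "-\<xi>" t] smoothD[OF schwartz_smooth[OF f], of 0 t]]
      by (simp add: scaleC_scaleC scaleC_minus_left)
    show "bochner_integrable (\<lambda>t. scaleC (cis (- (\<xi> * t))) (nderiv 1 f t)
      - scaleC (\<i> * \<xi>) (scaleC (cis (- (\<xi> * t))) (f t)))"
      by (intro bochner_integrable_diff b b')
    show "((\<lambda>t. scaleC (cis (- (\<xi> * t))) (f t)) \<longlongrightarrow> 0) at_top" "((\<lambda>t. scaleC (cis (- (\<xi> * t))) (f t)) \<longlongrightarrow> 0) at_bot"
      by (rule tendsto_norm_zero_cancel, simp add: norm_scaleC, rule tendsto_norm_zero, rule schwartz_tendsto_0[OF f])+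
  qed
  then show ?thesis
    unfolding fourier_def
    using bochner_integral_diff[OF b[of 1] b']
      bochner_integral_linear[OF b[of 0] bounded_linear_scaleC_right, of "\<i> * \<xi>"] by simp
qed

lemma fourier_decay:
  fixes f :: "real \<Rightarrow> 'a::{complex_normed_vector,banach}"
  assumes "schwartz f"
  shows "\<exists>C. \<forall>\<xi>. \<bar>\<xi>\<bar> ^ k * norm (fourier f \<xi>) \<le> C"
  using assms
proof (induction k arbitrary: f)
  case 0
  then show ?case using norm_fourier_le[OF schwartz_bochner_integrable[of f 0]] by auto
next
  case (Suc k)
  obtain C where C: "\<And>\<xi>. \<bar>\<xi>\<bar> ^ k * norm (fourier (nderiv 1 f) \<xi>) \<le> C"
    using Suc.IH[OF schwartz_nderiv1[OF Suc.prems]] by blast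
  have eq: "\<bar>\<xi>\<bar> ^ Suc k * norm (fourier f \<xi>) = \<bar>\<xi>\<bar> ^ k * norm (fourier (nderiv 1 f) \<xi>)" for \<xi>
    unfolding fourier_nderiv1[OF Suc.prems] by (simp add: norm_scaleC norm_mult)
  show ?case unfolding eq using C by blast
qed

text \<open>Induction on the order k for all derivatives at once. A bound of order k for the next
  derivative, integrated along the segment from 0 by the mean value inequality, gives order k + 1,
  since every derivative vanishes at 0.\<close>

lemma fourier_flat:
  fixes f :: "real \<Rightarrow> 'a::{complex_normed_vector,banach}"
  assumes "dot_schwartz f"
  shows "\<exists>C. \<forall>\<xi>. norm (fourier f \<xi>) \<le> C * \<bar>\<xi>\<bar> ^ k"
proof -
  have f: "schwartz f" and z: "\<And>k. nderiv k (fourier f) 0 = 0"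
    using assms unfolding dot_schwartz_def by auto
  have "\<forall>j. \<exists>C. \<forall>\<xi>. norm (nderiv j (fourier f) \<xi>) \<le> C * \<bar>\<xi>\<bar> ^ k"
  proof (induction k)
    case 0
    show ?case
    proof
      fix j
      have "norm (nderiv j (fourier f) \<xi>) \<le> integral\<^sup>L lebesgue (\<lambda>t. norm ((itimes ^^ j) f t))" for \<xi>
        unfolding nderiv_fourier(2)[OF f]
        using norm_fourier_le[OF schwartz_bochner_integrable[OF schwartz_itimes_funpow[OF f], of 0]] by simp
      then show "\<exists>C. \<forall>\<xi>. norm (nderiv j (fourier f) \<xi>) \<le> C * \<bar>\<xi>\<bar> ^ 0" by auto
    qed
  next
    case (Suc k)
    show ?case
    proof
      fix j
      obtain C where C: "\<And>\<xi>. norm (nderiv (Suc j) (fourier f) \<xi>) \<le> C * \<bar>\<xi>\<bar> ^ k" using Suc by blast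
      have C0: "0 \<le> C" using order_trans[OF norm_ge_zero C[of 1]] by simp
      have "norm (nderiv j (fourier f) \<xi>) \<le> C * \<bar>\<xi>\<bar> ^ Suc k" for \<xi>
      proof -
        have "norm (nderiv j (fourier f) \<xi> - nderiv j (fourier f) 0) \<le> (C * \<bar>\<xi>\<bar> ^ k) * \<bar>\<xi> - 0\<bar>"
        proof (rule vector_derivative_bound)
          show "(nderiv j (fourier f) has_vector_derivative nderiv (Suc j) (fourier f) x) (at x)" for x
            by (rule smoothD[OF nderiv_fourier(1)[OF f]])
          fix x assume "x \<in> closed_segment 0 \<xi>"
          then have "\<bar>x\<bar> \<le> \<bar>\<xi>\<bar>" by (auto simp: closed_segment_eq_real_ivl split: if_splits)
          then have "C * \<bar>x\<bar> ^ k \<le> C * \<bar>\<xi>\<bar> ^ k" using C0 by (intro mult_left_mono power_mono) auto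
          then show "norm (nderiv (Suc j) (fourier f) x) \<le> C * \<bar>\<xi>\<bar> ^ k" using C[of x] by linarith
        qed
        then show ?thesis by (simp add: z mult_ac)
      qed
      then show "\<exists>C. \<forall>\<xi>. norm (nderiv j (fourier f) \<xi>) \<le> C * \<bar>\<xi>\<bar> ^ Suc k" by blast
    qed
  qed
  from this[rule_format, of 0] show ?thesis by simp
qed

text \<open>The k-th derivative of \<open>fourier f\<close> at 0 is the k-th moment up to the factor
  (-i)^k, so flatness at 0 is a statement about moments.\<close>

lemma dot_schwartz_moments:
  fixes f :: "real \<Rightarrow> 'a::{complex_normed_vector,banach}"
  assumes f: "schwartz f" and m: "\<And>k. integral UNIV (\<lambda>t. t ^ k *\<^sub>R f t) = 0"
  shows "dot_schwartz f"
  unfolding dot_schwartz_def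
proof (intro conjI allI f)
  fix k
  have eq: "(itimes ^^ k) f t = scaleC ((- \<i>) ^ k) (t ^ k *\<^sub>R f t)" for t
    by (simp add: itimes_funpow power_mult_distrib[symmetric] scaleC_of_real[symmetric] scaleC_scaleC)
  have e2: "t ^ k *\<^sub>R f t = scaleC (\<i> ^ k) ((itimes ^^ k) f t)" for t
    unfolding eq scaleC_scaleC by (simp add: power_mult_distrib[symmetric])
  have b: "bochner_integrable (\<lambda>t. t ^ k *\<^sub>R f t)"
    unfolding e2
    using schwartz_bochner_integrable[OF schwartz_itimes_funpow[OF f, of k], of 0]
    by (intro bochner_integrable_linear[OF _ bounded_linear_scaleC_right]) simp
  have "nderiv k (fourier f) 0 = integral UNIV (\<lambda>t. scaleC ((- \<i>) ^ k) (t ^ k *\<^sub>R f t))"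
    by (simp add: nderiv_fourier(2)[OF f] fourier_def eq)
  also have "\<dots> = 0" by (simp add: bochner_integral_linear[OF b bounded_linear_scaleC_right] m)
  finally show "nderiv k (fourier f) 0 = 0" .
qed

section \<open>Fourier inversion\<close>

lemma integral_indicator_UNIV:
  fixes f :: "real \<Rightarrow> 'b::banach"
  shows "integral UNIV (\<lambda>t. indicat_real S t *\<^sub>R f t) = integral S f"
  by (subst integral_restrict_UNIV[symmetric]) (auto simp: indicator_def intro!: integral_cong)

lemma bochner_integral_exhaust:
  fixes f :: "real \<Rightarrow> 'b::banach"
  assumes b: "bochner_integrable f" and S: "\<And>N. S N \<in> sets lebesgue"
    and ev: "\<And>t. eventually (\<lambda>N. t \<in> S N) sequentially"
  shows "(\<lambda>N. integral (S N) f) \<longlonglongrightarrow> integral UNIV f"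
proof -
  have "(\<lambda>N. integral UNIV (\<lambda>t. indicat_real (S N) t *\<^sub>R f t)) \<longlonglongrightarrow> integral UNIV f"
  proof (rule bochner_dominated_convergence(2)[OF _ bochner_integrableD(1)[OF b] bochner_integrableD(2)[OF b]])
    show "strongly_measurable lebesgue (\<lambda>t. indicat_real (S N) t *\<^sub>R f t)" for N
      by (intro strongly_measurable_indicator bochner_integrableD(1)[OF b] S)
    show "AE t in lebesgue. (\<lambda>N. indicat_real (S N) t *\<^sub>R f t) \<longlonglongrightarrow> f t"
    proof (rule AE_I2)
      fix t :: real
      have "eventually (\<lambda>N. indicat_real (S N) t *\<^sub>R f t = f t) sequentially"
        using ev[of t] by eventually_elim (simp add: indicator_def)
      then show "(\<lambda>N. indicat_real (S N) t *\<^sub>R f t) \<longlonglongrightarrow> f t" by (rule tendsto_eventually)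
    qed
  qed (auto simp: indicator_def)
  then show ?thesis by (simp add: integral_indicator_UNIV)
qed

lemma nn_integral_affine_lebesgue:
  fixes f :: "real \<Rightarrow> ennreal"
  assumes "f \<in> borel_measurable lebesgue" "c \<noteq> 0"
  shows "(\<integral>\<^sup>+x. f (a + c * x) \<partial>lebesgue) = ennreal (1 / \<bar>c\<bar>) * (\<integral>\<^sup>+x. f x \<partial>lebesgue)"
  unfolding nn_integral_real_affine_lebesgue[OF assms, of a] mult.assoc[symmetric]
  using assms(2) by (simp add: ennreal_mult[symmetric])

lemma integrable_affine_lebesgue:
  fixes f :: "real \<Rightarrow> real"
  assumes f: "integrable lebesgue f" and c: "c \<noteq> 0"
  shows "integrable lebesgue (\<lambda>x. f (a + c * x))"
proof (rule integrableI_bounded)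
  show "(\<lambda>x. f (a + c * x)) \<in> borel_measurable lebesgue"
    by (rule measurable_compose[OF lebesgue_measurable_affine[OF c]]) (use f in auto)
  have "(\<integral>\<^sup>+x. ennreal (norm (f (a + c * x))) \<partial>lebesgue) = ennreal (1 / \<bar>c\<bar>) * (\<integral>\<^sup>+x. ennreal (norm (f x)) \<partial>lebesgue)"
    using f by (intro nn_integral_affine_lebesgue c) auto
  also have "\<dots> < \<infinity>" using f unfolding integrable_iff_bounded by (simp add: ennreal_mult_less_top)
  finally show "(\<integral>\<^sup>+x. ennreal (norm (f (a + c * x))) \<partial>lebesgue) < \<infinity>" .
qed

text \<open>On [-N, N] this is the affine substitution for gauge integrals; integrability of the
  norm then lets N tend to infinity.\<close>

lemma bochner_affine:
  fixes f :: "real \<Rightarrow> 'b::banach"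
  assumes b: "bochner_integrable f" and c: "c \<noteq> 0"
  shows "bochner_integrable (\<lambda>x. f (a + c * x))"
    and "integral UNIV (\<lambda>x. f (a + c * x)) = (1 / \<bar>c\<bar>) *\<^sub>R integral UNIV f"
proof -
  show b': "bochner_integrable (\<lambda>x. f (a + c * x))"
    unfolding bochner_integrable_def
    using strongly_measurable_affine[OF bochner_integrableD(1)[OF b] c]
      integrable_affine_lebesgue[OF bochner_integrableD(2)[OF b] c] by blast
  define S where "S N = (\<lambda>x. (1 / c) *\<^sub>R x + - ((1 / c) *\<^sub>R a)) ` cbox (- real N) (real N)" for N
  have Sx: "x \<in> S N \<longleftrightarrow> \<bar>a + c * x\<bar> \<le> real N" for x N
  proof
    assume "\<bar>a + c * x\<bar> \<le> real N"
    then have "a + c * x \<in> cbox (- real N) (real N)" by auto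
    moreover have "x = (1 / c) *\<^sub>R (a + c * x) + - ((1 / c) *\<^sub>R a)" using c by (simp add: field_simps)
    ultimately show "x \<in> S N" unfolding S_def by (rule rev_image_eqI)
  qed (use c in \<open>auto simp: S_def field_simps\<close>)
  have ev: "eventually (\<lambda>N. \<bar>y\<bar> \<le> real N) sequentially" for y
  proof -
    obtain N0 :: nat where "\<bar>y\<bar> \<le> real N0" using real_arch_simple by blast
    then show ?thesis unfolding eventually_sequentially by (intro exI[of _ N0]) auto
  qed
  have Sm: "S N \<in> sets lebesgue" for N
  proof -
    have "continuous_on (cbox (- real N) (real N)) (\<lambda>x. (1 / c) *\<^sub>R x + - ((1 / c) *\<^sub>R a))"
      by (intro continuous_intros)
    then have "compact (S N)" unfolding S_def by (rule compact_continuous_image) simp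
    then show ?thesis using compact_imp_closed borel_closed sets_completionI_sets by fastforce
  qed
  have "integral (S N) (\<lambda>x. f (a + c * x)) = (1 / \<bar>c\<bar>) *\<^sub>R integral (cbox (- real N) (real N)) f" for N
  proof -
    have "f integrable_on cbox (- real N) (real N)"
      using bochner_integrable_integrable_on[OF b] integrable_on_subcbox by blast
    from has_integral_affinity[OF integrable_integral[OF this] c, of a]
    show ?thesis unfolding S_def[symmetric]
      by (intro integral_unique) (simp add: add.commute)
  qed
  moreover have "(\<lambda>N. integral (S N) (\<lambda>x. f (a + c * x))) \<longlonglongrightarrow> integral UNIV (\<lambda>x. f (a + c * x))"
    by (rule bochner_integral_exhaust[OF b' Sm]) (simp add: Sx ev)
  moreover have "(\<lambda>N. (1 / \<bar>c\<bar>) *\<^sub>R integral (cbox (- real N) (real N)) f) \<longlonglongrightarrow> (1 / \<bar>c\<bar>) *\<^sub>R integral UNIV f"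
    using ev by (intro tendsto_scaleR tendsto_const bochner_integral_exhaust[OF b])
      (auto simp: abs_le_iff minus_le_iff conj_commute)
  ultimately show "integral UNIV (\<lambda>x. f (a + c * x)) = (1 / \<bar>c\<bar>) *\<^sub>R integral UNIV f"
    using LIMSEQ_unique by auto
qed

lemma bochner_integrable_lborel:
  fixes f :: "real \<Rightarrow> complex"
  assumes "integrable lborel f"
  shows "bochner_integrable f" "integral UNIV f = integral\<^sup>L lborel f"
proof -
  have m: "f \<in> borel_measurable borel" using assms by auto
  have "integrable lebesgue f" using assms m by (subst integrable_completion) auto
  then have i: "integrable lebesgue (\<lambda>t. norm (f t))" by simp
  obtain Q :: "complex set" where Q: "countable Q" "UNIV = closure Q"
    using separable[of "UNIV :: complex set"] by (metis top.extremum_uniqueI)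
  have "strongly_measurable lebesgue f"
    unfolding strongly_measurable_separable using measurable_completion[of f lborel borel] m Q by auto
  with i show "bochner_integrable f" by (simp add: bochner_integrable_def)
  show "integral UNIV f = integral\<^sup>L lborel f" by (rule integral_lborel[OF assms])
qed

text \<open>Up to the normalising factor \<open>sqrt (2 * pi)\<close> the integral is the
  characteristic function of the standard normal distribution.\<close>

lemma gaussian_fourier:
  fixes u :: real
  shows "bochner_integrable (\<lambda>x. complex_of_real (exp (- x\<^sup>2 / 2)) * cis (u * x))"
    and "integral UNIV (\<lambda>x. complex_of_real (exp (- x\<^sup>2 / 2)) * cis (u * x))
      = complex_of_real (sqrt (2 * pi) * exp (- u\<^sup>2 / 2))"
proof -
  let ?g = "\<lambda>x. complex_of_real (exp (- x\<^sup>2 / 2)) * cis (u * x)"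
  have eq: "?g = (\<lambda>x. complex_of_real (sqrt (2 * pi)) * (std_normal_density x *\<^sub>R cis (u * x)))"
    by (rule ext) (simp add: std_normal_density_def scaleR_conv_of_real)
  have m: "(\<lambda>x. cis (u * x)) \<in> borel_measurable borel"
    by (intro borel_measurable_continuous_onI continuous_intros continuous_on_cis)
  have i: "integrable lborel (\<lambda>x. std_normal_density x *\<^sub>R cis (u * x))"
  proof (rule Bochner_Integration.integrable_bound[where f=std_normal_density])
    show "integrable lborel std_normal_density" by (rule integrable_normal_density) simp
    show "(\<lambda>x. std_normal_density x *\<^sub>R cis (u * x)) \<in> borel_measurable lborel"
      using m by simp
  qed simp
  have int: "integral\<^sup>L lborel (\<lambda>x. std_normal_density x *\<^sub>R cis (u * x)) = complex_of_real (exp (- u\<^sup>2 / 2))"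
  proof -
    have "char std_normal_distribution u = integral\<^sup>L lborel (\<lambda>x. std_normal_density x *\<^sub>R cis (u * x))"
      unfolding char_def using m
      by (subst integral_density) (auto simp: normal_density_nonneg cis_conv_exp)
    then show ?thesis by (simp add: char_std_normal_distribution)
  qed
  have i': "integrable lborel ?g" unfolding eq by (rule integrable_mult_right[OF i])
  show "bochner_integrable ?g" by (rule bochner_integrable_lborel(1)[OF i'])
  have "integral UNIV ?g = integral\<^sup>L lborel ?g" by (rule bochner_integrable_lborel(2)[OF i'])
  also have "\<dots> = complex_of_real (sqrt (2 * pi)) * complex_of_real (exp (- u\<^sup>2 / 2))"
    unfolding eq using int by (simp only: integral_mult_right_zero)
  finally show "integral UNIV ?g = complex_of_real (sqrt (2 * pi) * exp (- u\<^sup>2 / 2))" by simp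
qed

lemma gaussian_real:
  shows "integrable lebesgue (\<lambda>x::real. exp (- x\<^sup>2 / 2))"
    and "bochner_integrable (\<lambda>x::real. exp (- x\<^sup>2 / 2))"
    and "integral UNIV (\<lambda>x::real. exp (- x\<^sup>2 / 2)) = sqrt (2 * pi)"
proof -
  show i: "integrable lebesgue (\<lambda>x::real. exp (- x\<^sup>2 / 2))"
    using bochner_integrableD(2)[OF gaussian_fourier(1)[of 0]] by simp
  show b: "bochner_integrable (\<lambda>x::real. exp (- x\<^sup>2 / 2))"
    unfolding bochner_integrable_def using i by (auto intro: strongly_measurable_real)
  have "complex_of_real (integral UNIV (\<lambda>x::real. exp (- x\<^sup>2 / 2))) = complex_of_real (sqrt (2 * pi))"
    using bochner_integral_linear[OF b bounded_linear_of_real[where 'a=complex]] gaussian_fourier(2)[of 0]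
    by simp
  then show "integral UNIV (\<lambda>x::real. exp (- x\<^sup>2 / 2)) = sqrt (2 * pi)" by (simp only: of_real_eq_iff)
qed

lemma fourier_continuous:
  fixes f :: "real \<Rightarrow> 'a::{complex_normed_vector,banach}"
  assumes "schwartz f" shows "continuous_on UNIV (fourier f)"
  using smooth_continuous_on[OF nderiv_fourier(1)[OF assms], of 0] by simp

lemma fourier_bochner_integrable:
  fixes f :: "real \<Rightarrow> 'a::{complex_normed_vector,banach}"
  assumes f: "schwartz f"
  shows "bochner_integrable (fourier f)"
proof -
  obtain C0 where C0: "\<And>t. \<bar>t\<bar> ^ 0 * norm (fourier f t) \<le> C0" using fourier_decay[OF f] by blast
  obtain C2 where C2: "\<And>t. \<bar>t\<bar> ^ 2 * norm (fourier f t) \<le> C2" using fourier_decay[OF f] by blast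
  show ?thesis
  proof (rule bochner_integrable_bound)
    show "strongly_measurable lebesgue (fourier f)"
      by (rule strongly_measurable_continuous[OF fourier_continuous[OF f]])
    show "integrable lebesgue (\<lambda>t. (C0 + C2) * (1 / (1 + t\<^sup>2)))"
      using integrable_inverse_1_plus_square_lebesgue by (rule integrable_mult_right)
    show "AE t in lebesgue. norm (fourier f t) \<le> (C0 + C2) * (1 / (1 + t\<^sup>2))"
    proof (rule AE_I2)
      fix t
      have "(1 + t\<^sup>2) * norm (fourier f t) \<le> C0 + C2"
        using C0[of t] C2[of t] by (simp add: algebra_simps)
      then show "norm (fourier f t) \<le> (C0 + C2) * (1 / (1 + t\<^sup>2))"
        by (simp add: pos_le_divide_eq add_pos_nonneg mult.commute)
    qed
  qed
qed

text \<open>A Gaussian factor makes the double integral absolutely convergent, so the order can be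
  exchanged. The inner integral is again a Gaussian, concentrated at \<open>t\<close>; after
  rescaling, the limit is continuity of \<open>f\<close> at \<open>t\<close>.\<close>

theorem fourier_inversion:
  fixes f :: "real \<Rightarrow> 'a::{complex_normed_vector,banach}"
  assumes f: "schwartz f"
  shows "inv_fourier (fourier f) t = f t"
proof -
  have bF: "bochner_integrable (fourier f)" by (rule fourier_bochner_integrable[OF f])
  have bf: "bochner_integrable f" using schwartz_bochner_integrable[OF f, of 0] by simp
  have fc: "continuous_on UNIV f" by (rule schwartz_continuous[OF f])
  obtain M where M: "\<And>t. \<bar>t\<bar> ^ 0 * norm (nderiv 0 f t) \<le> M" using f unfolding schwartz_def by blast
  \<comment> \<open>A Gaussian of width n + 1. It tends to 1 and is bounded by 1, so the norm of
    \<open>fourier f\<close> is the majorant in the first limit.\<close>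
  define w where "w n \<xi> = exp (- (\<xi> / real (Suc n))\<^sup>2 / 2)" for n \<xi>
  have w1: "0 \<le> w n \<xi>" "w n \<xi> \<le> 1" for n \<xi> by (auto simp: w_def)
  have wc: "continuous_on UNIV (w n)" for n unfolding w_def by (intro continuous_intros) auto
  have wi: "integrable lebesgue (w n)" for n
    using integrable_affine_lebesgue[OF gaussian_real(1), of "1 / real (Suc n)" 0]
    unfolding w_def by (simp add: mult.commute)
  define I where "I n = integral UNIV (\<lambda>\<xi>. scaleC (cis (\<xi> * t)) (w n \<xi> *\<^sub>R fourier f \<xi>))" for n
  have lim1: "I \<longlonglongrightarrow> integral UNIV (\<lambda>\<xi>. scaleC (cis (\<xi> * t)) (fourier f \<xi>))"
    unfolding I_def
  proof (rule bochner_dominated_convergence(2)[OF _ _ bochner_integrableD(2)[OF bF]])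
    have Fm: "strongly_measurable lebesgue (fourier f)" using bF by (rule bochner_integrableD)
    have cm: "strongly_measurable lebesgue (\<lambda>\<xi>. cis (\<xi> * t))"
      by (intro strongly_measurable_continuous continuous_on_cis continuous_intros)
    show "strongly_measurable lebesgue (\<lambda>\<xi>. scaleC (cis (\<xi> * t)) (w n \<xi> *\<^sub>R fourier f \<xi>))" for n
      using wi[of n] by (intro strongly_measurable_scaleC strongly_measurable_scaleR Fm cm strongly_measurable_real) auto
    show "strongly_measurable lebesgue (\<lambda>\<xi>. scaleC (cis (\<xi> * t)) (fourier f \<xi>))"
      by (intro strongly_measurable_scaleC Fm cm)
    show "AE \<xi> in lebesgue. norm (scaleC (cis (\<xi> * t)) (w n \<xi> *\<^sub>R fourier f \<xi>)) \<le> norm (fourier f \<xi>)" for n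
      using w1 by (auto simp: norm_scaleC intro!: mult_left_le_one_le)
    show "AE \<xi> in lebesgue. (\<lambda>n. scaleC (cis (\<xi> * t)) (w n \<xi> *\<^sub>R fourier f \<xi>)) \<longlonglongrightarrow> scaleC (cis (\<xi> * t)) (fourier f \<xi>)"
    proof (rule AE_I2)
      fix \<xi> :: real
      have "(\<lambda>n. \<xi> / real (Suc n)) \<longlonglongrightarrow> 0" by real_asymp
      then have "(\<lambda>n. w n \<xi>) \<longlonglongrightarrow> exp (- 0\<^sup>2 / 2)" unfolding w_def by (intro tendsto_intros) auto
      then have "(\<lambda>n. w n \<xi>) \<longlonglongrightarrow> 1" by simp
      then have "(\<lambda>n. scaleC (cis (\<xi> * t)) (w n \<xi> *\<^sub>R fourier f \<xi>)) \<longlonglongrightarrow> scaleC (cis (\<xi> * t)) (1 *\<^sub>R fourier f \<xi>)"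
        by (intro tendsto_intros)
      then show "(\<lambda>n. scaleC (cis (\<xi> * t)) (w n \<xi> *\<^sub>R fourier f \<xi>)) \<longlonglongrightarrow> scaleC (cis (\<xi> * t)) (fourier f \<xi>)"
        by simp
    qed
  qed
  have I_eq: "I n = sqrt (2 * pi) *\<^sub>R integral UNIV (\<lambda>u. exp (- u\<^sup>2 / 2) *\<^sub>R f (t + u / real (Suc n)))" for n
  proof -
    define K where "K \<xi> s = w n \<xi> *\<^sub>R scaleC (cis (\<xi> * (t - s))) (f s)" for \<xi> s
    have Kc: "continuous_on UNIV (\<lambda>(\<xi>,s). K \<xi> s)"
      unfolding K_def case_prod_beta
      by (intro continuous_intros continuous_on_cis continuous_on_compose2[OF wc] continuous_on_compose2[OF fc]) auto
    have "I n = integral UNIV (\<lambda>\<xi>. indicat_real UNIV \<xi> *\<^sub>R integral UNIV (\<lambda>s. K \<xi> s))"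
    proof -
      have "scaleC (cis (\<xi> * t)) (w n \<xi> *\<^sub>R fourier f \<xi>) = integral UNIV (\<lambda>s. K \<xi> s)" for \<xi>
      proof -
        have b: "bochner_integrable (\<lambda>s. scaleC (cis (- (\<xi> * s))) (f s))"
          by (intro bochner_integrable_cis bf continuous_intros)
        have bl: "bounded_linear (\<lambda>x::'a. scaleC (cis (\<xi> * t)) (w n \<xi> *\<^sub>R x))"
          by (intro bounded_linear_compose[OF bounded_linear_scaleC_right] bounded_linear_scaleR_right)
        have "scaleC (cis (\<xi> * t)) (w n \<xi> *\<^sub>R scaleC (cis (- (\<xi> * s))) (f s)) = K \<xi> s" for s
          by (simp add: K_def scaleC_scaleR_right scaleC_scaleC cis_mult algebra_simps)
        then show ?thesis
          using bochner_integral_linear[OF b bl] by (simp add: fourier_def)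
      qed
      then show ?thesis by (simp add: I_def)
    qed
    also have "\<dots> = integral UNIV (\<lambda>s. integral UNIV (\<lambda>\<xi>. indicat_real UNIV \<xi> *\<^sub>R K \<xi> s))"
      by (rule bochner_swap(1)[OF Kc _ wi[of n] bochner_integrableD(2)[OF bf]])
        (auto simp: K_def norm_scaleC w1)
    also have "\<dots> = integral UNIV (\<lambda>s. (real (Suc n) * (sqrt (2 * pi) * exp (- (real (Suc n) * (s - t))\<^sup>2 / 2))) *\<^sub>R f s)"
    proof (intro integral_cong)
      fix s
      let ?N = "real (Suc n)"
      let ?G = "\<lambda>x. complex_of_real (exp (- x\<^sup>2 / 2)) * cis ((?N * (t - s)) * x)"
      have g: "complex_of_real (w n \<xi>) * cis (\<xi> * (t - s)) = ?G (0 + (1 / ?N) * \<xi>)" for \<xi>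
        by (simp add: w_def mult.commute[of \<xi>])
      have bg: "bochner_integrable (\<lambda>\<xi>. complex_of_real (w n \<xi>) * cis (\<xi> * (t - s)))"
        unfolding g by (rule bochner_affine(1)[OF gaussian_fourier(1)]) simp
      have "integral UNIV (\<lambda>\<xi>. complex_of_real (w n \<xi>) * cis (\<xi> * (t - s)))
          = (1 / \<bar>1 / ?N\<bar>) *\<^sub>R integral UNIV ?G"
        unfolding g by (rule bochner_affine(2)[OF gaussian_fourier(1)]) simp
      also have "\<dots> = complex_of_real (?N * (sqrt (2 * pi) * exp (- (?N * (s - t))\<^sup>2 / 2)))"
        unfolding gaussian_fourier(2) by (simp add: scaleR_conv_of_real power2_commute power_mult_distrib)
      finally have e: "integral UNIV (\<lambda>\<xi>. complex_of_real (w n \<xi>) * cis (\<xi> * (t - s)))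
        = complex_of_real (?N * (sqrt (2 * pi) * exp (- (?N * (s - t))\<^sup>2 / 2)))" .
      have "indicat_real UNIV \<xi> *\<^sub>R K \<xi> s = scaleC (complex_of_real (w n \<xi>) * cis (\<xi> * (t - s))) (f s)" for \<xi>
        by (simp add: K_def scaleC_scaleC[symmetric] scaleC_of_real)
      then show "integral UNIV (\<lambda>\<xi>. indicat_real UNIV \<xi> *\<^sub>R K \<xi> s)
          = (?N * (sqrt (2 * pi) * exp (- (?N * (s - t))\<^sup>2 / 2))) *\<^sub>R f s"
        using bochner_integral_linear[OF bg bounded_linear_scaleC_left, of "f s"]
        unfolding e scaleC_of_real by simp
    qed
    also have "\<dots> = sqrt (2 * pi) *\<^sub>R integral UNIV (\<lambda>u. exp (- u\<^sup>2 / 2) *\<^sub>R f (t + u / real (Suc n)))"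
    proof -
      let ?N = "real (Suc n)"
      let ?h = "\<lambda>s. (?N * (sqrt (2 * pi) * exp (- (?N * (s - t))\<^sup>2 / 2))) *\<^sub>R f s"
      have bh: "bochner_integrable ?h"
      proof (rule bochner_integrable_bound)
        show "strongly_measurable lebesgue ?h"
          by (intro strongly_measurable_continuous continuous_intros fc) auto
        show "integrable lebesgue (\<lambda>s. (?N * sqrt (2 * pi)) * norm (f s))"
          using bochner_integrableD(2)[OF bf] by (rule integrable_mult_right)
        show "AE s in lebesgue. norm (?h s) \<le> (?N * sqrt (2 * pi)) * norm (f s)"
          by (intro AE_I2) (auto simp: abs_mult intro!: mult_right_mono mult_left_mono mult_left_le mult_left_le_one_le)
      qed
      have e: "?h (t + (1 / ?N) * u) = (?N * sqrt (2 * pi)) *\<^sub>R (exp (- u\<^sup>2 / 2) *\<^sub>R f (t + u / ?N))" for u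
        by simp
      have "integral UNIV (\<lambda>u. ?h (t + (1 / ?N) * u)) = (1 / \<bar>1 / ?N\<bar>) *\<^sub>R integral UNIV ?h"
        by (rule bochner_affine(2)[OF bh]) simp
      then have "(?N * sqrt (2 * pi)) *\<^sub>R integral UNIV (\<lambda>u. exp (- u\<^sup>2 / 2) *\<^sub>R f (t + u / ?N)) = ?N *\<^sub>R integral UNIV ?h"
        unfolding e integral_cmul by simp
      then have "?N *\<^sub>R (sqrt (2 * pi) *\<^sub>R integral UNIV (\<lambda>u. exp (- u\<^sup>2 / 2) *\<^sub>R f (t + u / ?N))) = ?N *\<^sub>R integral UNIV ?h"
        by (simp only: scaleR_scaleR)
      then show ?thesis by (simp only: scaleR_cancel_left) simp
    qed
    finally show ?thesis .
  qed
  have "(\<lambda>n. integral UNIV (\<lambda>u. exp (- u\<^sup>2 / 2) *\<^sub>R f (t + u / real (Suc n)))) \<longlonglongrightarrow>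
      integral UNIV (\<lambda>u. exp (- u\<^sup>2 / 2) *\<^sub>R f t)"
  proof (rule bochner_dominated_convergence(2)[where h="\<lambda>u. M * exp (- u\<^sup>2 / 2)"])
    show "strongly_measurable lebesgue (\<lambda>u. exp (- u\<^sup>2 / 2) *\<^sub>R f (t + u / real (Suc n)))" for n
      by (intro strongly_measurable_continuous continuous_intros continuous_on_compose2[OF fc]) auto
    show "strongly_measurable lebesgue (\<lambda>u. exp (- u\<^sup>2 / 2) *\<^sub>R f t)"
      by (intro strongly_measurable_continuous continuous_intros) auto
    show "integrable lebesgue (\<lambda>u. M * exp (- u\<^sup>2 / 2))" using gaussian_real(1) by (rule integrable_mult_right)
    show "AE u in lebesgue. norm (exp (- u\<^sup>2 / 2) *\<^sub>R f (t + u / real (Suc n))) \<le> M * exp (- u\<^sup>2 / 2)" for n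
      using M by (intro AE_I2) (simp add: mult.commute mult_right_mono)
    show "AE u in lebesgue. (\<lambda>n. exp (- u\<^sup>2 / 2) *\<^sub>R f (t + u / real (Suc n))) \<longlonglongrightarrow> exp (- u\<^sup>2 / 2) *\<^sub>R f t"
    proof (rule AE_I2)
      fix u :: real
      have "(\<lambda>n. t + u / real (Suc n)) \<longlonglongrightarrow> t" by real_asymp
      moreover have "isCont f t" using fc by (simp add: continuous_on_eq_continuous_at)
      ultimately have "(\<lambda>n. f (t + u / real (Suc n))) \<longlonglongrightarrow> f t" by (rule isCont_tendsto_compose[rotated])
      then show "(\<lambda>n. exp (- u\<^sup>2 / 2) *\<^sub>R f (t + u / real (Suc n))) \<longlonglongrightarrow> exp (- u\<^sup>2 / 2) *\<^sub>R f t"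
        by (intro tendsto_intros)
    qed
  qed
  also have "integral UNIV (\<lambda>u. exp (- u\<^sup>2 / 2) *\<^sub>R f t) = sqrt (2 * pi) *\<^sub>R f t"
    using bochner_integral_linear[OF gaussian_real(2) bounded_linear_scaleR_left] gaussian_real(3) by metis
  \<comment> \<open>One factor \<open>sqrt (2 * pi)\<close> comes from the transform of the
    Gaussian, the other from its integral; together they match the normalisation of
    \<open>inv_fourier\<close>.\<close>
  finally have "I \<longlonglongrightarrow> sqrt (2 * pi) *\<^sub>R (sqrt (2 * pi) *\<^sub>R f t)"
    unfolding I_eq by (intro tendsto_scaleR tendsto_const)
  then have "integral UNIV (\<lambda>\<xi>. scaleC (cis (\<xi> * t)) (fourier f \<xi>)) = sqrt (2 * pi) *\<^sub>R (sqrt (2 * pi) *\<^sub>R f t)"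
    using lim1 LIMSEQ_unique by blast
  then have "integral UNIV (\<lambda>\<xi>. scaleC (cis (\<xi> * t)) (fourier f \<xi>)) = (2 * pi) *\<^sub>R f t"
    by simp
  then show ?thesis unfolding inv_fourier_def by simp
qed

section \<open>Powers of the resolvent\<close>

text \<open>By Baire's theorem one of the closed sets \<open>S k\<close> contains a ball, of radius
  r say. A vector rescaled to length r is the difference of two points of that ball, hence the
  constant 2 k / r. It turns pointwise bounds of orbits on compact time intervals into operator
  bounds.\<close>

theorem uniform_boundedness:
  fixes f :: "'i \<Rightarrow> 'a::banach \<Rightarrow> 'b::real_normed_vector"
  assumes lin: "\<And>i. i \<in> I \<Longrightarrow> bounded_linear (f i)"
    and pw: "\<And>x. \<exists>c. \<forall>i\<in>I. norm (f i x) \<le> c"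
  shows "\<exists>M\<ge>0. \<forall>i\<in>I. \<forall>x. norm (f i x) \<le> M * norm x"
proof -
  define S where "S k = {x. \<forall>i\<in>I. norm (f i x) \<le> real k}" for k
  have clS: "closed (S k)" for k
  proof -
    have "S k = (\<Inter>i\<in>I. {x. norm (f i x) \<le> real k})" by (auto simp: S_def)
    moreover have "closed {x. norm (f i x) \<le> real k}" if "i \<in> I" for i
    proof -
      have "continuous_on UNIV (f i)" using lin[OF that] by (rule linear_continuous_on)
      then show ?thesis by (intro closed_Collect_le continuous_intros) auto
    qed
    ultimately show ?thesis by auto
  qed
  have cover: "(\<Union>k. S k) = UNIV"
  proof -
    have "\<exists>k. x \<in> S k" for x
    proof -
      obtain c where c: "\<forall>i\<in>I. norm (f i x) \<le> c" using pw by blast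
      obtain k :: nat where "c \<le> real k" using real_arch_simple by blast
      then have "x \<in> S k" using c by (auto simp: S_def intro: order_trans)
      then show ?thesis ..
    qed
    then show ?thesis by auto
  qed
  have "\<exists>k. interior (S k) \<noteq> {}"
  proof (rule ccontr)
    assume "\<not> ?thesis"
    then have e: "interior (S k) = {}" for k by blast
    have "Met_TC.mtopology interior_of \<Union>(range S) = {}"
    proof (rule Met_TC.metric_Baire_category_alt)
      show "Met_TC.mcomplete TYPE('a)"
        unfolding Met_TC.mcomplete_def using Cauchy_convergent convergent_def by fastforce
    qed (use clS e in auto)
    then show False using cover by simp
  qed
  then obtain k x0 where "x0 \<in> interior (S k)" by blast
  then obtain r where r: "r > 0" "cball x0 r \<subseteq> S k" using mem_interior_cball by blast
  show ?thesis
  proof (intro exI[of _ "2 * real k / r"] conjI ballI allI)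
    show "0 \<le> 2 * real k / r" using r by simp
    fix i x assume i: "i \<in> I"
    interpret bounded_linear "f i" by (rule lin[OF i])
    show "norm (f i x) \<le> 2 * real k / r * norm x"
    proof (cases "x = 0")
      case False
      define c where "c = r / norm x"
      have c: "c > 0" using r False by (simp add: c_def)
      have "x0 + c *\<^sub>R x \<in> cball x0 r" using False r by (simp add: dist_norm c_def)
      then have "norm (f i (x0 + c *\<^sub>R x)) \<le> real k" using r i by (auto simp: S_def)
      moreover have "x0 \<in> S k" using r by (meson centre_in_cball less_imp_le subsetD)
      then have "norm (f i x0) \<le> real k" using i by (auto simp: S_def)
      ultimately have "norm (f i (x0 + c *\<^sub>R x) - f i x0) \<le> 2 * real k"
        using norm_triangle_ineq4[of "f i (x0 + c *\<^sub>R x)" "f i x0"] by simp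
      then have "c * norm (f i x) \<le> 2 * real k" using c by (simp add: add scaleR)
      then show ?thesis using c False r by (simp add: c_def field_simps)
    qed (simp add: zero)
  qed
qed

lemma power_le_exp: "0 \<le> (x::real) \<Longrightarrow> x ^ n \<le> fact n * exp x"
proof -
  assume x: "0 \<le> x"
  have "x ^ n / fact n \<le> (\<Sum>k<Suc n. x ^ k / fact k)"
    using x by (simp add: sum_nonneg)
  also have "\<dots> \<le> exp x"
  proof -
    have s: "(\<lambda>k. x ^ k / fact k) sums exp x"
      using exp_converges[of x] by (simp add: divide_inverse mult.commute)
    then show ?thesis using x by (intro sum_le_suminf[OF sums_summable[OF s], THEN order_trans])
        (auto simp: sums_unique[OF s, symmetric])
  qed
  finally show ?thesis by (simp add: field_simps)
qed

lemma poly_exp_bound: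
  fixes e :: real assumes e: "e > 0"
  shows "\<exists>B\<ge>0. \<forall>s\<ge>0. (1 + s) ^ m * exp (- e * s) \<le> B / (1 + s\<^sup>2)"
proof -
  \<comment> \<open>From y^(m + 2) <= (m + 2)! exp y at y = e (1 + s); the two surplus powers pay
    for the denominator 1 + s^2.\<close>
  define B where "B = fact (m + 2) * exp e / e ^ (m + 2)"
  have B0: "B \<ge> 0" using e by (simp add: B_def)
  have "(1 + s) ^ m * exp (- e * s) \<le> B / (1 + s\<^sup>2)" if s: "s \<ge> 0" for s
  proof -
    have "(e * (1 + s)) ^ (m + 2) \<le> fact (m + 2) * exp (e * (1 + s))"
      using e s by (intro power_le_exp) simp
    moreover have "exp (e * (1 + s)) = exp e * exp (e * s)"
      by (simp add: exp_add[symmetric] distrib_left)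
    ultimately have "e ^ (m + 2) * (1 + s) ^ (m + 2) \<le> fact (m + 2) * exp e * exp (e * s)"
      by (simp only: power_mult_distrib mult.assoc)
    then have "(1 + s) ^ (m + 2) \<le> B * exp (e * s)"
      using e by (simp add: B_def pos_le_divide_eq mult_ac)
    then have 1: "(1 + s) ^ (m + 2) * exp (- e * s) \<le> B"
      by (simp add: exp_minus pos_divide_le_eq[symmetric] divide_inverse[symmetric])
    have "1 + s\<^sup>2 \<le> (1 + s)\<^sup>2" using s by (simp add: power2_eq_square algebra_simps)
    then have "(1 + s\<^sup>2) * ((1 + s) ^ m * exp (- e * s)) \<le> (1 + s)\<^sup>2 * ((1 + s) ^ m * exp (- e * s))"
      using s by (intro mult_right_mono) auto
    also have "\<dots> = (1 + s) ^ (m + 2) * exp (- e * s)"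
      by (simp add: power_add power2_eq_square mult_ac)
    finally show ?thesis using 1 by (simp add: pos_le_divide_eq add_pos_nonneg mult.commute)
  qed
  with B0 show ?thesis by blast
qed

lemma is_resolvent_unique:
  assumes "is_resolvent A D l R" "is_resolvent A D l R'"
  shows "R = R'"
proof
  fix x
  have "R x \<in> D" "scaleC l (R x) - A (R x) = x" using assms(1) unfolding is_resolvent_def by auto
  then show "R x = R' x" using assms(2) unfolding is_resolvent_def by metis
qed

section \<open>Continuity and growth of the semigroup and of its resolvent powers\<close>

locale growth_semigroup =
  fixes T :: "real \<Rightarrow> 'x::{complex_normed_vector,banach} \<Rightarrow> 'x"
    and A :: "'x \<Rightarrow> 'x" and D :: "'x set" and \<alpha> \<beta> :: real
  assumes growth: "resolvent_growth T A D \<alpha> \<beta>"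
begin

lemma T_bounded_clinear: "t \<ge> 0 \<Longrightarrow> bounded_clinear (T t)"
  and T_0: "T 0 x = x"
  and T_add: "s \<ge> 0 \<Longrightarrow> t \<ge> 0 \<Longrightarrow> T (s + t) x = T s (T t x)"
  and T_continuous: "continuous_on {0..} (\<lambda>t. T t x)"
  using growth unfolding resolvent_growth_def c0_semigroup_def by auto

lemma T_bounded_linear: "t \<ge> 0 \<Longrightarrow> bounded_linear (T t)"
  by (intro bounded_clinear_bounded_linear T_bounded_clinear)

lemma T_locally_bounded: "\<exists>M\<ge>0. \<forall>t\<in>{0..b}. \<forall>x. norm (T t x) \<le> M * norm x"
proof (rule uniform_boundedness)
  show "bounded_linear (T t)" if "t \<in> {0..b}" for t using that by (intro T_bounded_linear) auto
  fix x
  have "continuous_on {0..b} (\<lambda>t. T t x)" using T_continuous by (rule continuous_on_subset) auto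
  then have "compact ((\<lambda>t. T t x) ` {0..b})" by (rule compact_continuous_image) simp
  then have "bounded ((\<lambda>t. T t x) ` {0..b})" by (rule compact_imp_bounded)
  then show "\<exists>c. \<forall>i\<in>{0..b}. norm (T i x) \<le> c" by (auto simp: bounded_iff)
qed

text \<open>The axioms say nothing about \<open>T\<close> at negative times. Freezing time at 0
  there yields functions continuous on the whole line, which an indicator then restricts to the half
  line.\<close>

lemma T_max_continuous: "continuous_on UNIV (\<lambda>t. T (max 0 t) x)"
  by (rule continuous_on_compose2[OF T_continuous]) (auto intro!: continuous_intros)

text \<open>Strong continuity in time combines with the operator bound on compact intervals. Joint
  continuity is what makes integrands such as T(s) applied to f(t + s) strongly measurable.\<close>

lemma T_jointly_continuous: "continuous_on UNIV (\<lambda>(s,x). T (max 0 s) x)"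
proof (rule continuous_at_imp_continuous_on, clarify)
  fix s0 :: real and x0 :: 'x
  obtain M where M: "M \<ge> 0" "\<And>t x. t \<in> {0..\<bar>s0\<bar> + 1} \<Longrightarrow> norm (T t x) \<le> M * norm x"
    using T_locally_bounded by blast
  have "((\<lambda>(s,x). T (max 0 s) x) \<longlongrightarrow> T (max 0 s0) x0) (at (s0, x0))"
  proof (rule Lim_transform_bound[THEN LIM_zero_cancel])
    let ?u = "\<lambda>p::real\<times>'x. M * norm (snd p - x0) + norm (T (max 0 (fst p)) x0 - T (max 0 s0) x0)"
    have "eventually (\<lambda>p::real\<times>'x. dist p (s0, x0) < 1) (at (s0, x0))"
      by (rule eventually_at_ball'[THEN eventually_mono, of 1]) (auto simp: dist_commute)
    then show "\<forall>\<^sub>F p in at (s0, x0). norm ((case p of (s,x) \<Rightarrow> T (max 0 s) x) - T (max 0 s0) x0) \<le> norm (?u p)"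
    proof eventually_elim
      case (elim p)
      obtain s x where p: "p = (s,x)" by (cases p)
      have "dist s s0 < 1" using elim dist_fst_le[of p "(s0,x0)"] by (simp add: p)
      then have "max 0 s \<in> {0..\<bar>s0\<bar> + 1}" by (auto simp: dist_real_def)
      from M(2)[OF this, of "x - x0"]
      have "norm (T (max 0 s) x - T (max 0 s) x0) \<le> M * norm (x - x0)"
        by (simp add: bounded_linear.linear[OF T_bounded_linear, THEN linear_diff])
      then show ?case using M(1) norm_triangle_ineq[of "T (max 0 s) x - T (max 0 s) x0" "T (max 0 s) x0 - T (max 0 s0) x0"]
        by (simp add: p)
    qed
    have "isCont (\<lambda>t. T (max 0 t) x0) (fst (s0,x0))"
      using T_max_continuous by (simp add: continuous_on_eq_continuous_at)
    then have "((\<lambda>p::real\<times>'x. T (max 0 (fst p)) x0) \<longlongrightarrow> T (max 0 s0) x0) (at (s0, x0))"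
      using isCont_tendsto_compose[of "fst (s0,x0)" "\<lambda>t. T (max 0 t) x0" fst "at (s0,x0)"] 
      by (simp add: tendsto_fst[OF tendsto_ident_at, of "(s0,x0)", simplified])
    then have "(?u \<longlongrightarrow> M * norm (x0 - x0) + norm (T (max 0 s0) x0 - T (max 0 s0) x0)) (at (s0, x0))"
      using tendsto_snd[OF tendsto_ident_at, of "(s0,x0)" UNIV] by (intro tendsto_intros) auto
    then show "(?u \<longlongrightarrow> 0) (at (s0, x0))" by simp
  qed
  then show "isCont (\<lambda>(s,x). T (max 0 s) x) (s0, x0)" by (simp add: isCont_def)
qed

abbreviation "RR \<equiv> resolvent A D"

lemma RR_is_resolvent:
  assumes "Re l \<le> 0" "l \<noteq> 0"
  shows "is_resolvent A D l (RR l)"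
proof -
  have "l \<in> resolvent_set A D" using growth assms unfolding resolvent_growth_def by blast
  then obtain R where R: "is_resolvent A D l R" unfolding resolvent_set_def by blast
  show ?thesis unfolding resolvent_def
    by (rule theI[of "is_resolvent A D l", OF R]) (rule is_resolvent_unique[OF _ R])
qed

lemma
  assumes "Re l \<le> 0" "l \<noteq> 0"
  shows RR_bounded_clinear: "bounded_clinear (RR l)"
    and RR_in: "RR l x \<in> D"
    and RR_right: "scaleC l (RR l x) - A (RR l x) = x"
    and RR_left: "x \<in> D \<Longrightarrow> RR l (scaleC l x - A x) = x"
  using RR_is_resolvent[OF assms] unfolding is_resolvent_def by auto

text \<open>One integer power covers both singularities, m^(-\<alpha>) near 0 and growth of order
  \<beta> at infinity. The base (1 + m)^2 / m is at least 1, so \<alpha> + \<beta> may be rounded up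
  to an integer, and powers of the resolvent obey bounds of the same shape.\<close>

lemma RR_bound:
  "\<exists>C P. C \<ge> 0 \<and> (\<forall>l x. Re l \<le> 0 \<longrightarrow> l \<noteq> 0 \<longrightarrow> norm (RR l x) \<le> C * ((1 + cmod l)\<^sup>2 / cmod l) ^ P * norm x)"
proof -
  obtain C where C: "\<And>l x. Re l \<ge> 0 \<Longrightarrow> l \<noteq> 0 \<Longrightarrow>
        cmod l powr \<alpha> * cmod (1 + l) powr (- \<alpha> - \<beta>) * norm (RR (- l) x) \<le> C * norm x"
    and ab: "\<alpha> \<ge> 0" "\<beta> \<ge> 0"
    using growth unfolding resolvent_growth_def by blast
  define P where "P = nat \<lceil>\<alpha> + \<beta>\<rceil>"
  have P: "\<alpha> + \<beta> \<le> real P" using ab unfolding P_def by linarith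
  show ?thesis
  proof (intro exI[of _ "\<bar>C\<bar>"] exI[of _ P] conjI allI impI)
    fix l :: complex and x assume l: "Re l \<le> 0" "l \<noteq> 0"
    define m where "m = cmod l"
    have m: "m > 0" using l by (simp add: m_def)
    have m1: "cmod (1 - l) \<le> 1 + m" using norm_triangle_ineq4[of 1 l] by (simp add: m_def)
    have "1 \<le> Re (1 - l)" using l by simp
    then have m2: "cmod (1 - l) \<ge> 1" using complex_Re_le_cmod[of "1 - l"] by linarith
    have "m powr \<alpha> * cmod (1 - l) powr (- \<alpha> - \<beta>) * norm (RR l x) \<le> C * norm x"
      using C[of "- l" x] l by (simp add: m_def)
    then have "m powr \<alpha> * cmod (1 - l) powr (- (\<alpha> + \<beta>)) * norm (RR l x) \<le> \<bar>C\<bar> * norm x"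
      by (smt (verit) mult_right_mono norm_ge_zero)
    then have "norm (RR l x) \<le> \<bar>C\<bar> * norm x * (m powr (-\<alpha>) * cmod (1 - l) powr (\<alpha> + \<beta>))"
    proof -
      define X Y where "X = m powr \<alpha>" and "Y = cmod (1 - l) powr (\<alpha> + \<beta>)"
      have "X > 0" "Y > 0" using m m2 by (auto simp: X_def Y_def)
      moreover have "X * (1 / Y) * norm (RR l x) \<le> \<bar>C\<bar> * norm x"
        using \<open>m powr \<alpha> * cmod (1 - l) powr (- (\<alpha> + \<beta>)) * norm (RR l x) \<le> \<bar>C\<bar> * norm x\<close>
        unfolding X_def Y_def powr_minus_divide .
      ultimately have "norm (RR l x) \<le> \<bar>C\<bar> * norm x * ((1 / X) * Y)"
        by (simp add: field_simps)
      then show ?thesis unfolding X_def Y_def powr_minus_divide[of m] .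
    qed
    also have "\<dots> \<le> \<bar>C\<bar> * norm x * ((1 + m)\<^sup>2 / m) ^ P"
    proof (rule mult_left_mono)
      have "m powr (-\<alpha>) * cmod (1 - l) powr (\<alpha> + \<beta>) \<le> ((1 + m) / m) powr (\<alpha> + \<beta>) * (1 + m) powr (\<alpha> + \<beta>)"
      proof (rule mult_mono)
        have "m powr (-\<alpha>) = (1 / m) powr \<alpha>" using m by (simp add: powr_divide powr_minus_divide)
        also have "\<dots> \<le> ((1 + m) / m) powr \<alpha>" using m ab by (intro powr_mono2 divide_right_mono) auto
        also have "\<dots> \<le> ((1 + m) / m) powr (\<alpha> + \<beta>)" using m ab by (intro powr_mono) (auto simp: field_simps)
        finally show "m powr (-\<alpha>) \<le> ((1 + m) / m) powr (\<alpha> + \<beta>)" .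
        show "cmod (1 - l) powr (\<alpha> + \<beta>) \<le> (1 + m) powr (\<alpha> + \<beta>)" using m1 ab by (intro powr_mono2) auto
      qed auto
      also have "\<dots> = ((1 + m)\<^sup>2 / m) powr (\<alpha> + \<beta>)" using m by (simp add: powr_mult[symmetric] power2_eq_square)
      also have "\<dots> \<le> ((1 + m)\<^sup>2 / m) powr (real P)"
        using m P by (intro powr_mono) (auto simp: field_simps power2_eq_square)
      also have "\<dots> = ((1 + m)\<^sup>2 / m) ^ P" using m by (simp add: powr_realpow)
      finally show "m powr (-\<alpha>) * cmod (1 - l) powr (\<alpha> + \<beta>) \<le> ((1 + m)\<^sup>2 / m) ^ P" .
    qed auto
    finally show "norm (RR l x) \<le> \<bar>C\<bar> * ((1 + cmod l)\<^sup>2 / cmod l) ^ P * norm x" by (simp add: m_def mult_ac)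
  qed auto
qed

lemma RR_identity:
  assumes "Re l \<le> 0" "l \<noteq> 0" "Re m \<le> 0" "m \<noteq> 0"
  shows "RR l x - RR m x = scaleC (m - l) (RR l (RR m x))"
proof -
  have lin: "RR l (u + v) = RR l u + RR l v" "RR l (scaleC c u) = scaleC c (RR l u)" for u v c
    using RR_bounded_clinear[OF assms(1,2)] unfolding bounded_clinear_def clinear_def by auto
  have "scaleC l (RR m x) - A (RR m x) = scaleC (l - m) (RR m x) + x"
    using RR_right[OF assms(3,4), of x] by (simp add: scaleC_diff_left algebra_simps)
  then have "RR m x = RR l (scaleC (l - m) (RR m x) + x)"
    using RR_left[OF assms(1,2) RR_in[OF assms(3,4)], of x] by simp
  also have "\<dots> = scaleC (l - m) (RR l (RR m x)) + RR l x" by (simp add: lin)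
  finally have "RR m x - RR l x = scaleC (l - m) (RR l (RR m x))" by (simp add: algebra_simps)
  then show ?thesis by (simp add: scaleC_diff_left algebra_simps)
qed

text \<open>The resolvent identity and the local bound give continuity in the parameter. The vector
  may vary along with it, so that the statement can be iterated for powers.\<close>

lemma RR_tendsto:
  assumes l: "Re l \<le> 0" "l \<noteq> 0" and ln: "eventually (\<lambda>i. Re (L i) \<le> 0 \<and> L i \<noteq> 0) F" "(L \<longlongrightarrow> l) F"
    and x: "(X \<longlongrightarrow> x) F"
  shows "((\<lambda>i. RR (L i) (X i)) \<longlongrightarrow> RR l x) F"
proof -
  obtain C P where C: "C \<ge> 0" "\<And>l x. Re l \<le> 0 \<Longrightarrow> l \<noteq> 0 \<Longrightarrow> norm (RR l x) \<le> C * ((1 + cmod l)\<^sup>2 / cmod l) ^ P * norm x"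
    using RR_bound by blast
  define b where "b i = C * ((1 + cmod (L i))\<^sup>2 / cmod (L i)) ^ P" for i
  have b: "(b \<longlongrightarrow> C * ((1 + cmod l)\<^sup>2 / cmod l) ^ P) F"
    unfolding b_def using l by (intro tendsto_intros ln) auto
  let ?u = "\<lambda>i. b i * norm (X i - x) + cmod (l - L i) * (b i * norm (RR l x))"
  show ?thesis
  proof (rule Lim_transform_bound[THEN LIM_zero_cancel])
    show "\<forall>\<^sub>F i in F. norm (RR (L i) (X i) - RR l x) \<le> norm (?u i)"
      using ln(1)
    proof eventually_elim
      case (elim i)
      have lin: "RR (L i) (u - v) = RR (L i) u - RR (L i) v" for u v
        using bounded_linear.linear[OF bounded_clinear_bounded_linear[OF RR_bounded_clinear], of "L i"] elim
        by (simp add: linear_diff)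
      have "norm (RR (L i) (X i - x)) \<le> b i * norm (X i - x)" using C(2)[of "L i"] elim by (simp add: b_def)
      moreover have "norm (RR (L i) x - RR l x) \<le> cmod (l - L i) * (b i * norm (RR l x))"
        using C(2)[of "L i" "RR l x"] elim l by (simp add: RR_identity norm_scaleC b_def mult_left_mono)
      ultimately have "norm (RR (L i) (X i) - RR l x) \<le> ?u i"
        using norm_triangle_ineq[of "RR (L i) (X i - x)" "RR (L i) x - RR l x"] by (simp add: lin)
      then show ?case by simp
    qed
    have "(?u \<longlongrightarrow> (C * ((1 + cmod l)\<^sup>2 / cmod l) ^ P) * norm (x - x)
        + cmod (l - l) * ((C * ((1 + cmod l)\<^sup>2 / cmod l) ^ P) * norm (RR l x))) F"
      by (intro tendsto_intros b ln x)
    then show "(?u \<longlongrightarrow> 0) F" by simp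
  qed
qed

lemma RR_funpow_tendsto:
  assumes l: "Re l \<le> 0" "l \<noteq> 0" and ln: "eventually (\<lambda>i. Re (L i) \<le> 0 \<and> L i \<noteq> 0) F" "(L \<longlongrightarrow> l) F"
    and x: "(X \<longlongrightarrow> x) F"
  shows "((\<lambda>i. (RR (L i) ^^ k) (X i)) \<longlongrightarrow> (RR l ^^ k) x) F"
  by (induction k) (auto intro: x RR_tendsto[OF l ln])

lemma RR_funpow_bounded_clinear:
  assumes l: "Re l \<le> 0" "l \<noteq> 0"
  shows "bounded_clinear (RR l ^^ k)"
proof (induction k)
  case 0
  show ?case by (auto simp: bounded_clinear_def clinear_def intro!: exI[of _ 1])
next
  case (Suc k)
  from RR_bounded_clinear[OF l] obtain K where K: "\<And>x. norm (RR l x) \<le> norm x * K" and c1: "clinear (RR l)"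
    unfolding bounded_clinear_def by blast
  from Suc obtain K' where K': "\<And>x. norm ((RR l ^^ k) x) \<le> norm x * K'" and c2: "clinear (RR l ^^ k)"
    unfolding bounded_clinear_def by blast
  have "norm ((RR l ^^ Suc k) x) \<le> norm x * (K' * \<bar>K\<bar>)" for x
  proof -
    have "norm ((RR l ^^ Suc k) x) \<le> norm ((RR l ^^ k) x) * K" using K by simp
    also have "\<dots> \<le> norm ((RR l ^^ k) x) * \<bar>K\<bar>" by (intro mult_left_mono) auto
    also have "\<dots> \<le> (norm x * K') * \<bar>K\<bar>" by (intro mult_right_mono K') auto
    finally show ?thesis by (simp add: mult.assoc)
  qed
  then show ?case using c1 c2 by (auto simp: bounded_clinear_def clinear_def)
qed

lemma RR_funpow_bound:
  "\<exists>C P. C \<ge> 0 \<and> (\<forall>l x. Re l \<le> 0 \<longrightarrow> l \<noteq> 0 \<longrightarrow> norm ((RR l ^^ k) x) \<le> C * ((1 + cmod l)\<^sup>2 / cmod l) ^ P * norm x)"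
proof -
  obtain C P where C: "C \<ge> 0" "\<And>l x. Re l \<le> 0 \<Longrightarrow> l \<noteq> 0 \<Longrightarrow> norm (RR l x) \<le> C * ((1 + cmod l)\<^sup>2 / cmod l) ^ P * norm x"
    using RR_bound by blast
  have "norm ((RR l ^^ k) x) \<le> C ^ k * ((1 + cmod l)\<^sup>2 / cmod l) ^ (P * k) * norm x" if l: "Re l \<le> 0" "l \<noteq> 0" for l x
  proof (induction k)
    case (Suc k)
    let ?b = "(1 + cmod l)\<^sup>2 / cmod l"
    have "norm ((RR l ^^ Suc k) x) \<le> C * ?b ^ P * norm ((RR l ^^ k) x)" using C(2)[OF l] by simp
    also have "\<dots> \<le> C * ?b ^ P * (C ^ k * ?b ^ (P * k) * norm x)"
      using Suc C(1) by (intro mult_left_mono) auto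
    also have "\<dots> = C ^ Suc k * ?b ^ (P * Suc k) * norm x" by (simp add: power_add mult_ac)
    finally show ?case .
  qed simp
  then show ?thesis using C(1) by (intro exI[of _ "C ^ k"] exI[of _ "P * k"]) auto
qed

end

section \<open>The resolvent as a Laplace transform\<close>

lemma has_vector_derivative_quotient:
  fixes q :: "real \<Rightarrow> 'b::real_normed_vector"
  assumes "(q has_vector_derivative d) (at s)"
  shows "((\<lambda>y. (q y - q s) /\<^sub>R (y - s)) \<longlongrightarrow> d) (at s)"
proof -
  have "((\<lambda>y. norm (q y - q s - (y - s) *\<^sub>R d) / norm (y - s)) \<longlongrightarrow> 0) (at s)"
    using assms unfolding has_vector_derivative_def has_derivative_iff_norm by blast
  moreover have "eventually (\<lambda>y. norm (q y - q s - (y - s) *\<^sub>R d) / norm (y - s)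
      = norm ((q y - q s) /\<^sub>R (y - s) - d)) (at s)"
  proof -
    have "norm (q y - q s - (y - s) *\<^sub>R d) / norm (y - s) = norm ((q y - q s) /\<^sub>R (y - s) - d)"
      if "y \<noteq> s" for y
    proof -
      have "q y - q s - (y - s) *\<^sub>R d = (y - s) *\<^sub>R ((q y - q s) /\<^sub>R (y - s) - d)"
        using that by (simp add: scaleR_diff_right)
      then show ?thesis using that by simp
    qed
    then show ?thesis by (auto simp: eventually_at_filter)
  qed
  ultimately have "((\<lambda>y. norm ((q y - q s) /\<^sub>R (y - s) - d)) \<longlongrightarrow> 0) (at s)"
    by (rule Lim_transform_eventually)
  then show ?thesis by (rule LIM_zero_cancel[OF tendsto_norm_zero_cancel])
qed

context growth_semigroup
begin

lemma T_max_norm_le: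
  assumes "\<And>s. s \<ge> 0 \<Longrightarrow> norm (T s x) \<le> C"
  shows "norm (T (max 0 s) x) \<le> C"
  using assms[of "max 0 s"] by simp

lemma generator_tendsto: "x \<in> D \<Longrightarrow> ((\<lambda>h. (1 / h) *\<^sub>R (T h x - x)) \<longlongrightarrow> - A x) (at_right 0)"
  and generatorI: "((\<lambda>h. (1 / h) *\<^sub>R (T h x - x)) \<longlongrightarrow> y) (at_right 0) \<Longrightarrow> x \<in> D"
  using growth unfolding resolvent_growth_def generator_def by blast+

lemma generator_eq:
  assumes "((\<lambda>h. (1 / h) *\<^sub>R (T h x - x)) \<longlongrightarrow> y) (at_right 0)"
  shows "A x = - y"
  using tendsto_unique[OF _ generator_tendsto[OF generatorI[OF assms]] assms] by (simp add: minus_equation_iff)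

lemma weighted_orbit_bochner:
  assumes q: "continuous_on UNIV q" and g: "integrable lebesgue g" "\<And>s. s \<ge> 0 \<Longrightarrow> cmod (q s) \<le> g s"
    and x: "\<And>s. s \<ge> 0 \<Longrightarrow> norm (T s x) \<le> C"
  shows "bochner_integrable (\<lambda>s. indicat_real {0..} s *\<^sub>R scaleC (q s) (T (max 0 s) x))"
proof (rule bochner_integrable_bound)
  show "strongly_measurable lebesgue (\<lambda>s. indicat_real {0..} s *\<^sub>R scaleC (q s) (T (max 0 s) x))"
    by (intro strongly_measurable_indicator strongly_measurable_continuous continuous_intros q T_max_continuous) auto
  have "C \<ge> 0" using x[of 0] norm_ge_zero[of "T 0 x"] by linarith
  show "integrable lebesgue (\<lambda>s. \<bar>g s\<bar> * C)" using g by simp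
  show "AE s in lebesgue. norm (indicat_real {0..} s *\<^sub>R scaleC (q s) (T (max 0 s) x)) \<le> \<bar>g s\<bar> * C"
  proof (rule AE_I2)
    fix s :: real
    show "norm (indicat_real {0..} s *\<^sub>R scaleC (q s) (T (max 0 s) x)) \<le> \<bar>g s\<bar> * C"
    proof (cases "s \<ge> 0")
      case True
      then have "cmod (q s) * norm (T s x) \<le> \<bar>g s\<bar> * C"
        using g(2)[OF True] x[OF True] by (intro mult_mono) auto
      then show ?thesis using True by (simp add: norm_scaleC)
    qed (use \<open>C \<ge> 0\<close> in simp)
  qed
qed

text \<open>T(h) shifts the orbit, so T(h) V - V consists of q(s - h) - q(s) on [h, \<infinity>)
  minus the piece of q T x on [0, h). Divided by h, the first tends to -q' under the integral and
  the second to q(0) x. The bound on q' over [s - 1, s] dominates the difference quotients for all h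
  < 1.\<close>

lemma weighted_orbit_generator:
  assumes q: "\<And>s. (q has_vector_derivative q' s) (at s)" and q'c: "continuous_on UNIV q'"
    and g: "integrable lebesgue g" "\<And>s. s \<ge> 0 \<Longrightarrow> cmod (q s) \<le> g s"
      "\<And>s \<sigma>. s \<ge> 0 \<Longrightarrow> s - 1 \<le> \<sigma> \<Longrightarrow> \<sigma> \<le> s \<Longrightarrow> cmod (q' \<sigma>) \<le> g s"
    and x: "\<And>s. s \<ge> 0 \<Longrightarrow> norm (T s x) \<le> C"
  defines "V \<equiv> integral UNIV (\<lambda>s. indicat_real {0..} s *\<^sub>R scaleC (q s) (T (max 0 s) x))"
  shows "((\<lambda>h. (1 / h) *\<^sub>R (T h V - V)) \<longlongrightarrow>
      - scaleC (q 0) x - integral UNIV (\<lambda>s. indicat_real {0..} s *\<^sub>R scaleC (q' s) (T (max 0 s) x))) (at_right 0)"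
proof (rule tendsto_at_right_sequentially[where b=1])
  fix S :: "nat \<Rightarrow> real"
  assume S: "\<And>n. 0 < S n" "\<And>n. S n < 1" "S \<longlonglongrightarrow> 0"
  have C0: "C \<ge> 0" using x[of 0] norm_ge_zero[of "T 0 x"] by linarith
  have xm: "norm (T (max 0 s) x) \<le> C" for s by (rule T_max_norm_le[OF x])
  have g0: "g s \<ge> 0" if "s \<ge> 0" for s using g(2)[OF that] norm_ge_zero[of "q s"] by linarith
  have qc: "continuous_on UNIV q"
    by (intro continuous_at_imp_continuous_on ballI has_vector_derivative_continuous[OF q])
  let ?\<phi> = "\<lambda>s. scaleC (q s) (T (max 0 s) x)"
  have \<phi>c: "continuous_on UNIV ?\<phi>" by (intro continuous_intros qc T_max_continuous)
  have Vb: "bochner_integrable (\<lambda>s. indicat_real {0..} s *\<^sub>R ?\<phi> s)"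
    by (rule weighted_orbit_bochner[OF qc g(1,2) x])
  \<comment> \<open>\<open>?Q h\<close> carries the difference quotient of the weight.
    \<open>?P h\<close> is the piece on [0, h) stretched to [0, 1), where it converges pointwise
    under a fixed majorant.\<close>
  let ?Q = "\<lambda>h s. indicat_real {h..} s *\<^sub>R scaleC ((1 / h) *\<^sub>R (q (s - h) - q s)) (T (max 0 s) x)"
  let ?P = "\<lambda>h u. indicat_real {0..<1} u *\<^sub>R ?\<phi> (h * u)"
  have Qle: "norm (?Q h s) \<le> indicat_real {0..} s * g s * C" if h: "0 < h" "h < 1" for h s
  proof (cases "h \<le> s")
    case True
    have "norm (q (s - h) - q s) \<le> g s * \<bar>s - h - s\<bar>"
    proof (rule vector_derivative_bound[OF q])
      fix y assume "y \<in> closed_segment s (s - h)"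
      then have "s - 1 \<le> y" "y \<le> s" using h by (auto simp: closed_segment_eq_real_ivl split: if_splits)
      then show "cmod (q' y) \<le> g s" using g(3)[of s y] True h by simp
    qed
    then have "norm ((1 / h) *\<^sub>R (q (s - h) - q s)) \<le> g s"
      using h by (simp add: pos_divide_le_eq mult.commute)
    then have "norm ((1 / h) *\<^sub>R (q (s - h) - q s)) * norm (T (max 0 s) x) \<le> g s * C"
      using g0[of s] True h by (intro mult_mono xm) auto
    then show ?thesis using True h by (simp add: norm_scaleC)
  qed (use g0 C0 in \<open>auto simp: indicator_def\<close>)
  have gi: "integrable lebesgue (\<lambda>s. indicat_real {0..} s * g s * C)"
    using integrable_mult_left[OF integrable_mult_indicator[OF _ g(1), of "{0..}"], of C] by simp
  have Qm: "strongly_measurable lebesgue (?Q h)" for h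
    by (intro strongly_measurable_indicator strongly_measurable_continuous continuous_intros
        T_max_continuous continuous_on_compose2[OF qc] qc) auto
  have Qb: "bochner_integrable (?Q h)" if h: "0 < h" "h < 1" for h
    by (rule bochner_integrable_bound[OF Qm gi]) (use Qle[OF h] in auto)
  obtain B where B: "\<And>s. s \<in> {0..1} \<Longrightarrow> norm (?\<phi> s) \<le> B"
  proof -
    have "compact (?\<phi> ` {0..1})"
      by (intro compact_continuous_image continuous_on_subset[OF \<phi>c]) auto
    then obtain B where "\<forall>y\<in>?\<phi> ` {0..1}. norm y \<le> B"
      using compact_imp_bounded bounded_iff by blast
    then show ?thesis by (intro that[of B]) auto
  qed
  have B0: "B \<ge> 0" using B[of 0] norm_ge_zero[of "?\<phi> 0"] by (simp del: norm_ge_zero)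
  have Ple: "norm (?P h u) \<le> indicat_real {0..<1} u * B" if h: "0 < h" "h < 1" for h u
  proof (cases "u \<in> {0..<1}")
    case True
    have "h * u \<in> {0..1}" using h True by (auto intro: mult_le_one)
    then show ?thesis using B[of "h * u"] True by simp
  qed (use B0 in auto)
  have i01: "integrable lebesgue (\<lambda>u::real. indicat_real {0..<1} u * B)"
  proof -
    have "integrable lborel (indicat_real {0..<1::real})" by (rule integrable_real_indicator) auto
    then have "integrable lebesgue (indicat_real {0..<1::real})" by (subst integrable_completion) auto
    from integrable_mult_left[OF this] show ?thesis .
  qed
  have Pm: "strongly_measurable lebesgue (?P h)" for h
    by (intro strongly_measurable_indicator strongly_measurable_continuous continuous_on_compose2[OF \<phi>c]
        continuous_intros) auto
  have Pb: "bochner_integrable (?P h)" if h: "0 < h" "h < 1" for h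
    by (rule bochner_integrable_bound[OF Pm i01]) (use Ple[OF h] in auto)
  have main: "(1 / h) *\<^sub>R (T h V - V) = integral UNIV (?Q h) - integral UNIV (?P h)" if h: "0 < h" "h < 1" for h
  proof -
    have h0: "0 \<le> h" using h by simp
    let ?W = "\<lambda>s. indicat_real {h..} s *\<^sub>R scaleC (q (s - h)) (T (max 0 s) x)"
    have shift: "T h (indicat_real {0..} s *\<^sub>R ?\<phi> s) = ?W (h + 1 * s)" for s
    proof -
      interpret bounded_linear "T h" by (rule T_bounded_linear[OF h0])
      show ?thesis
        by (cases "s \<ge> 0") (use h0 in \<open>simp_all add: scaleR zero bounded_clinear_scaleC[OF T_bounded_clinear[OF h0]] T_add\<close>)
    qed
    have Wb: "bochner_integrable ?W"
    proof -
      have "bochner_integrable (\<lambda>s. indicat_real {0..} (-h + 1 * s) *\<^sub>R scaleC (q (-h + 1 * s)) (T h (T (max 0 (-h + 1 * s)) x)))"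
        using bochner_affine(1)[OF bochner_integrable_linear[OF Vb T_bounded_linear[OF h0]], of 1 "-h"]
        by (simp add: bounded_linear.linear[OF T_bounded_linear[OF h0], THEN linear_scale] bounded_clinear_scaleC[OF T_bounded_clinear[OF h0]])
      moreover have "indicat_real {0..} (-h + 1 * s) *\<^sub>R scaleC (q (-h + 1 * s)) (T h (T (max 0 (-h + 1 * s)) x)) = ?W s" for s
        by (cases "h \<le> s") (use h0 T_add[of h "s - h" x] in \<open>auto simp: indicator_def\<close>)
      ultimately show ?thesis by simp
    qed
    have "T h V = integral UNIV (\<lambda>s. T h (indicat_real {0..} s *\<^sub>R ?\<phi> s))"
      unfolding V_def by (rule bochner_integral_linear[OF Vb T_bounded_linear[OF h0], symmetric])
    also have "\<dots> = integral UNIV (\<lambda>s. ?W (h + 1 * s))" unfolding shift ..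
    also have "\<dots> = integral UNIV ?W" using bochner_affine(2)[OF Wb, of 1 h] by simp
    finally have TV: "T h V = integral UNIV ?W" .
    have Pb': "bochner_integrable (\<lambda>s. ?P h (0 + (1 / h) * s))"
      by (rule bochner_affine(1)[OF Pb[OF h]]) (use h in simp)
    have "integral UNIV (\<lambda>s. ?P h (0 + (1 / h) * s)) = h *\<^sub>R integral UNIV (?P h)"
      using bochner_affine(2)[OF Pb[OF h], of "1 / h" 0] h by simp
    moreover have "?P h (0 + (1 / h) * s) = indicat_real {0..<h} s *\<^sub>R ?\<phi> s" for s
      using h by (auto simp: indicator_def field_simps)
    ultimately have P1: "integral UNIV (\<lambda>s. indicat_real {0..<h} s *\<^sub>R ?\<phi> s) = h *\<^sub>R integral UNIV (?P h)"
      and P2: "bochner_integrable (\<lambda>s. indicat_real {0..<h} s *\<^sub>R ?\<phi> s)" using Pb' by simp_all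
    have hQ: "bochner_integrable (\<lambda>s. h *\<^sub>R ?Q h s)"
      by (rule bochner_integrable_linear[OF Qb[OF h] bounded_linear_scaleR_right])
    have "T h V - V = integral UNIV ?W - V" by (simp only: TV)
    also have "\<dots> = integral UNIV (\<lambda>s. ?W s - indicat_real {0..} s *\<^sub>R ?\<phi> s)"
      unfolding V_def by (rule bochner_integral_diff[OF Wb Vb, symmetric])
    also have "(\<lambda>s. ?W s - indicat_real {0..} s *\<^sub>R ?\<phi> s) = (\<lambda>s. h *\<^sub>R ?Q h s - indicat_real {0..<h} s *\<^sub>R ?\<phi> s)"
    proof
      fix s
      consider "h \<le> s" | "0 \<le> s" "s < h" | "s < 0" by linarith
      then show "?W s - indicat_real {0..} s *\<^sub>R ?\<phi> s = h *\<^sub>R ?Q h s - indicat_real {0..<h} s *\<^sub>R ?\<phi> s"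
        by cases (use h in \<open>auto simp: indicator_def scaleC_diff_left scaleC_scaleR_left\<close>)
    qed
    also have "integral UNIV \<dots> = h *\<^sub>R integral UNIV (?Q h) - h *\<^sub>R integral UNIV (?P h)"
      unfolding bochner_integral_diff[OF hQ P2] P1 bochner_integral_linear[OF Qb[OF h] bounded_linear_scaleR_right] ..
    finally show ?thesis using h by (simp add: scaleR_diff_right)
  qed
  have lim1: "(\<lambda>n. integral UNIV (?Q (S n))) \<longlonglongrightarrow>
      integral UNIV (\<lambda>s. indicat_real {0..} s *\<^sub>R scaleC (- q' s) (T (max 0 s) x))"
  proof (rule bochner_dominated_convergence(2)[OF Qm _ gi])
    show "strongly_measurable lebesgue (\<lambda>s. indicat_real {0..} s *\<^sub>R scaleC (- q' s) (T (max 0 s) x))"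
      by (intro strongly_measurable_indicator strongly_measurable_continuous continuous_intros T_max_continuous q'c) auto
    show "AE s in lebesgue. norm (?Q (S n) s) \<le> indicat_real {0..} s * g s * C" for n
      by (rule AE_I2) (rule Qle[OF S(1,2)])
    \<comment> \<open>At s = 0 the indicator of [h, \<infinity>) is 0 for every h > 0 while the
      indicator in the limit is 1, so this point is discarded.\<close>
    have "AE s in lebesgue. s \<noteq> (0::real)"
      by (rule AE_I[where N="{0}"]) auto
    then show "AE s in lebesgue. (\<lambda>n. ?Q (S n) s) \<longlonglongrightarrow> indicat_real {0..} s *\<^sub>R scaleC (- q' s) (T (max 0 s) x)"
    proof eventually_elim
      case (elim s)
      show ?case
      proof (cases "s > 0")
        case True
        have "eventually (\<lambda>n. S n < s) sequentially" using S(3) True by (rule order_tendstoD)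
        then have ev: "eventually (\<lambda>n. scaleC ((1 / S n) *\<^sub>R (q (s - S n) - q s)) (T (max 0 s) x) = ?Q (S n) s) sequentially"
          by eventually_elim (auto simp: indicator_def)
        have "((\<lambda>y. (q y - q s) /\<^sub>R (y - s)) \<longlongrightarrow> q' s) (at s)"
          by (rule has_vector_derivative_quotient[OF q])
        moreover have "filterlim (\<lambda>n. s - S n) (at s) sequentially"
        proof (rule filterlim_atI)
          have "(\<lambda>n. s - S n) \<longlonglongrightarrow> s - 0" by (intro tendsto_intros S(3))
          then show "(\<lambda>n. s - S n) \<longlonglongrightarrow> s" by simp
          have "s - S n \<noteq> s" for n using S(1)[of n] by simp
          then show "eventually (\<lambda>n. s - S n \<noteq> s) sequentially" by simp
        qed
        ultimately have "(\<lambda>n. (q (s - S n) - q s) /\<^sub>R (s - S n - s)) \<longlonglongrightarrow> q' s"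
          by (rule filterlim_compose)
        then have "(\<lambda>n. - ((q (s - S n) - q s) /\<^sub>R (s - S n - s))) \<longlonglongrightarrow> - q' s" by (rule tendsto_minus)
        then have "(\<lambda>n. (1 / S n) *\<^sub>R (q (s - S n) - q s)) \<longlonglongrightarrow> - q' s"
          by (simp add: divide_inverse)
        then have "(\<lambda>n. scaleC ((1 / S n) *\<^sub>R (q (s - S n) - q s)) (T (max 0 s) x)) \<longlonglongrightarrow> scaleC (- q' s) (T (max 0 s) x)"
          by (intro tendsto_intros)
        then show ?thesis using Lim_transform_eventually[OF _ ev] True by simp
      next
        case False
        then have "s < 0" using elim by simp
        moreover have "s \<notin> {S n..}" for n using S(1)[of n] \<open>s < 0\<close> by auto
        ultimately show ?thesis by simp
      qed
    qed
  qed
  have e1: "integral UNIV (\<lambda>s. indicat_real {0..} s *\<^sub>R scaleC (- q' s) (T (max 0 s) x))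
      = - integral UNIV (\<lambda>s. indicat_real {0..} s *\<^sub>R scaleC (q' s) (T (max 0 s) x))"
    by (simp add: scaleC_minus_left integral_neg)
  have lim2: "(\<lambda>n. integral UNIV (?P (S n))) \<longlonglongrightarrow> integral UNIV (\<lambda>u::real. indicat_real {0..<1} u *\<^sub>R scaleC (q 0) x)"
  proof (rule bochner_dominated_convergence(2)[OF Pm _ i01])
    show "strongly_measurable lebesgue (\<lambda>u::real. indicat_real {0..<1} u *\<^sub>R scaleC (q 0) x)"
      by (intro strongly_measurable_indicator strongly_measurable_const) auto
    show "AE u in lebesgue. norm (?P (S n) u) \<le> indicat_real {0..<1} u * B" for n
      by (rule AE_I2) (rule Ple[OF S(1,2)])
    show "AE u in lebesgue. (\<lambda>n. ?P (S n) u) \<longlonglongrightarrow> indicat_real {0..<1} u *\<^sub>R scaleC (q 0) x"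
    proof (rule AE_I2)
      fix u :: real
      have "(\<lambda>n. S n * u) \<longlonglongrightarrow> 0 * u" by (intro tendsto_intros S(3))
      moreover have "isCont ?\<phi> (0 * u)" using \<phi>c by (simp add: continuous_on_eq_continuous_at)
      ultimately have "(\<lambda>n. ?\<phi> (S n * u)) \<longlonglongrightarrow> ?\<phi> (0 * u)" by (rule isCont_tendsto_compose[rotated])
      then have "(\<lambda>n. ?\<phi> (S n * u)) \<longlonglongrightarrow> scaleC (q 0) x" by (simp add: T_0)
      then show "(\<lambda>n. ?P (S n) u) \<longlonglongrightarrow> indicat_real {0..<1} u *\<^sub>R scaleC (q 0) x"
        by (rule tendsto_scaleR[OF tendsto_const])
    qed
  qed
  have e2: "integral UNIV (\<lambda>u::real. indicat_real {0..<1} u *\<^sub>R scaleC (q 0) x) = scaleC (q 0) x"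
  proof -
    have "integral UNIV (\<lambda>u::real. indicat_real {0..<1} u *\<^sub>R scaleC (q 0) x) = integral {0..<1} (\<lambda>u::real. scaleC (q 0) x)"
      by (rule integral_indicator_UNIV)
    also have "\<dots> = integral {0..1} (\<lambda>u::real. scaleC (q 0) x)"
      by (rule integral_spike_set) (auto intro: negligible_subset[of "{1}"])
    finally show ?thesis by simp
  qed
  have eq: "- scaleC (q 0) x - integral UNIV (\<lambda>s. indicat_real {0..} s *\<^sub>R scaleC (q' s) (T (max 0 s) x))
    = - integral UNIV (\<lambda>s. indicat_real {0..} s *\<^sub>R scaleC (q' s) (T (max 0 s) x)) - scaleC (q 0) x" by simp
  show "(\<lambda>n. (1 / S n) *\<^sub>R (T (S n) V - V)) \<longlonglongrightarrow>
      - scaleC (q 0) x - integral UNIV (\<lambda>s. indicat_real {0..} s *\<^sub>R scaleC (q' s) (T (max 0 s) x))"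
    unfolding main[OF S(1,2)] eq
    by (rule tendsto_diff[OF lim1[unfolded e1] lim2[unfolded e2]])
qed simp

text \<open>Along a bounded orbit this kernel represents the power k + 1 of (l + A)^(-1). The factor
  1 / k! makes the derivative of kernel k + 1 equal to -l times itself plus kernel k, which is the
  recursion for these powers.\<close>

definition laplace_kernel :: "complex \<Rightarrow> nat \<Rightarrow> real \<Rightarrow> complex" where
  "laplace_kernel l k s = exp (- (l * complex_of_real s)) * complex_of_real (s ^ k / fact k)"

lemma laplace_kernel_continuous: "continuous_on UNIV (laplace_kernel l k)"
  unfolding laplace_kernel_def by (intro continuous_intros) auto

lemma laplace_kernel_0: "laplace_kernel l k 0 = (if k = 0 then 1 else 0)"
  by (simp add: laplace_kernel_def)

lemma laplace_kernel_derivative: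
  "(laplace_kernel l 0 has_vector_derivative - l * laplace_kernel l 0 s) (at s)"
  "(laplace_kernel l (Suc k) has_vector_derivative - l * laplace_kernel l (Suc k) s + laplace_kernel l k s) (at s)"
proof -
  have e: "((\<lambda>s. exp (- (l * complex_of_real s))) has_vector_derivative - l * exp (- (l * complex_of_real s))) (at s)"
    by (auto intro!: derivative_eq_intros has_vector_derivative_real_field)
  show "(laplace_kernel l 0 has_vector_derivative - l * laplace_kernel l 0 s) (at s)"
    using e by (simp add: laplace_kernel_def[abs_def])
  have "((\<lambda>s. s ^ Suc k / fact (Suc k)) has_vector_derivative s ^ k / fact k) (at s)"
    unfolding has_real_derivative_iff_has_vector_derivative[symmetric]
    using DERIV_cdivide[OF DERIV_pow[of "Suc k" s], of "fact (Suc k)"] by (simp del: power_Suc of_nat_Suc)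
  then have p: "((\<lambda>s. complex_of_real (s ^ Suc k / fact (Suc k))) has_vector_derivative complex_of_real (s ^ k / fact k)) (at s)"
    by (rule bounded_linear.has_vector_derivative[OF bounded_linear_of_real])
  show "(laplace_kernel l (Suc k) has_vector_derivative - l * laplace_kernel l (Suc k) s + laplace_kernel l k s) (at s)"
    using has_vector_derivative_mult[OF e p] unfolding laplace_kernel_def[abs_def]
    by (simp add: algebra_simps del: power_Suc fact_Suc)
qed

text \<open>The window [s - 1, s] is the one that the generator formula for weighted orbits asks
  for. The shift by at most 1 costs the factor \<open>exp (Re l)\<close>, and arguments down to -1
  are covered by (1 + s)^k.\<close>

lemma laplace_kernel_bound:
  assumes l: "Re l > 0"
  shows "\<exists>B\<ge>0. \<forall>s\<ge>0. \<forall>\<sigma>. s - 1 \<le> \<sigma> \<longrightarrow> \<sigma> \<le> s \<longrightarrow> cmod (laplace_kernel l k \<sigma>) \<le> B / (1 + s\<^sup>2)"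
proof -
  obtain B where B: "B \<ge> 0" "\<And>s. s \<ge> 0 \<Longrightarrow> (1 + s) ^ k * exp (- Re l * s) \<le> B / (1 + s\<^sup>2)"
    using poly_exp_bound[OF l] by blast
  have "cmod (laplace_kernel l k \<sigma>) \<le> (exp (Re l) * B) / (1 + s\<^sup>2)"
    if s: "s \<ge> 0" "s - 1 \<le> \<sigma>" "\<sigma> \<le> s" for s \<sigma>
  proof -
    have "cmod (laplace_kernel l k \<sigma>) = exp (- Re l * \<sigma>) * (\<bar>\<sigma>\<bar> ^ k / fact k)"
      by (simp add: laplace_kernel_def norm_mult norm_power norm_divide)
    also have "\<dots> \<le> (exp (Re l) * exp (- Re l * s)) * (1 + s) ^ k"
    proof (rule mult_mono)
      have "- Re l * \<sigma> \<le> Re l + (- Re l * s)"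
        using mult_left_mono[OF s(2), of "Re l"] l by (simp add: algebra_simps)
      then show "exp (- Re l * \<sigma>) \<le> exp (Re l) * exp (- Re l * s)" by (simp add: exp_add[symmetric])
      have "\<bar>\<sigma>\<bar> ^ k / fact k \<le> \<bar>\<sigma>\<bar> ^ k / 1" by (intro divide_left_mono) auto
      also have "\<dots> \<le> (1 + s) ^ k" using s by (auto intro!: power_mono)
      finally show "\<bar>\<sigma>\<bar> ^ k / fact k \<le> (1 + s) ^ k" .
    qed auto
    also have "\<dots> = exp (Re l) * ((1 + s) ^ k * exp (- Re l * s))" by simp
    also have "\<dots> \<le> exp (Re l) * (B / (1 + s\<^sup>2))" by (intro mult_left_mono B(2) s(1)) auto
    finally show ?thesis by simp
  qed
  then show ?thesis using B(1) by (intro exI[of _ "exp (Re l) * B"]) auto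
qed

text \<open>Writing V k for the integral, the generator formula gives (l + A) V k = V (k - 1) and (l
  + A) V 0 = x. The hypothesis concerns the orbit of this one \<open>x\<close>, so the semigroup
  itself may grow. Each R(-l, A) = -(l + A)^(-1) contributes a sign.\<close>

theorem laplace_transform_resolvent:
  assumes l: "Re l > 0" and x: "\<And>s. s \<ge> 0 \<Longrightarrow> norm (T s x) \<le> C"
  shows "integral UNIV (\<lambda>s. indicat_real {0..} s *\<^sub>R scaleC (laplace_kernel l k s) (T (max 0 s) x))
    = scaleC ((-1) ^ Suc k) ((RR (- l) ^^ Suc k) x)"
proof -
  let ?V = "\<lambda>k. integral UNIV (\<lambda>s. indicat_real {0..} s *\<^sub>R scaleC (laplace_kernel l k s) (T (max 0 s) x))"
  have l': "Re (- l) \<le> 0" "- l \<noteq> 0" using l by auto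
  have B: "\<exists>B\<ge>0. \<forall>s\<ge>0. \<forall>\<sigma>. s - 1 \<le> \<sigma> \<longrightarrow> \<sigma> \<le> s \<longrightarrow> cmod (laplace_kernel l k \<sigma>) \<le> B / (1 + s\<^sup>2)" for k
    by (rule laplace_kernel_bound[OF l])
  then obtain B where B: "\<And>k. B k \<ge> 0" "\<And>k s \<sigma>. s \<ge> 0 \<Longrightarrow> s - 1 \<le> \<sigma> \<Longrightarrow> \<sigma> \<le> s \<Longrightarrow> cmod (laplace_kernel l k \<sigma>) \<le> B k / (1 + s\<^sup>2)"
    by metis
  have i: "integrable lebesgue (\<lambda>s. c / (1 + s\<^sup>2))" for c :: real
    using integrable_mult_right[OF integrable_inverse_1_plus_square_lebesgue, of c] by simp
  have b: "bochner_integrable (\<lambda>s. indicat_real {0..} s *\<^sub>R scaleC (laplace_kernel l k s) (T (max 0 s) x))" for k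
    by (rule weighted_orbit_bochner[OF laplace_kernel_continuous i[of "B k"] _ x]) (use B in auto)
  have bl: "bochner_integrable (\<lambda>s. scaleC c (indicat_real {0..} s *\<^sub>R scaleC (laplace_kernel l k s) (T (max 0 s) x)))" for k c
    by (rule bochner_integrable_linear[OF b bounded_linear_scaleC_right])
  have cl: "integral UNIV (\<lambda>s. scaleC c (indicat_real {0..} s *\<^sub>R scaleC (laplace_kernel l k s) (T (max 0 s) x))) = scaleC c (?V k)" for k c
    by (rule bochner_integral_linear[OF b bounded_linear_scaleC_right])
  have dom: "?V k \<in> D" and gen: "scaleC (- l) (?V k) - A (?V k) = - (if k = 0 then x else ?V (k - 1))" for k
  proof -
    let ?q' = "\<lambda>s. - l * laplace_kernel l k s + (if k = 0 then 0 else laplace_kernel l (k - 1) s)"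
    have d: "(laplace_kernel l k has_vector_derivative ?q' s) (at s)" for s
      using laplace_kernel_derivative(1)[of l s] laplace_kernel_derivative(2)[of l "k - 1" s] by (cases k) auto
    have qc: "continuous_on UNIV ?q'"
      by (cases "k = 0") (auto intro!: continuous_intros laplace_kernel_continuous)
    let ?B = "B k + (cmod l * B k + B (k - 1))"
    have "((\<lambda>h. (1 / h) *\<^sub>R (T h (?V k) - ?V k)) \<longlongrightarrow>
      - scaleC (laplace_kernel l k 0) x - integral UNIV (\<lambda>s. indicat_real {0..} s *\<^sub>R scaleC (?q' s) (T (max 0 s) x))) (at_right 0)"
    proof (rule weighted_orbit_generator[OF d qc i[of ?B] _ _ x])
      show "cmod (laplace_kernel l k s) \<le> ?B / (1 + s\<^sup>2)" if "s \<ge> 0" for s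
      proof -
        have "cmod (laplace_kernel l k s) \<le> B k / (1 + s\<^sup>2)" using that by (intro B(2)) auto
        also have "\<dots> \<le> ?B / (1 + s\<^sup>2)" using B(1) by (intro divide_right_mono) auto
        finally show ?thesis .
      qed
      show "cmod (?q' \<sigma>) \<le> ?B / (1 + s\<^sup>2)" if "s \<ge> 0" "s - 1 \<le> \<sigma>" "\<sigma> \<le> s" for s \<sigma>
      proof -
        have "cmod (?q' \<sigma>) \<le> cmod l * cmod (laplace_kernel l k \<sigma>) + cmod (laplace_kernel l (k - 1) \<sigma>)"
          using norm_triangle_ineq[of "- l * laplace_kernel l k \<sigma>" "laplace_kernel l (k - 1) \<sigma>"]
          by (cases "k = 0") (simp_all add: norm_mult)
        also have "\<dots> \<le> cmod l * (B k / (1 + s\<^sup>2)) + B (k - 1) / (1 + s\<^sup>2)"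
          using that by (intro add_mono mult_left_mono B(2)) auto
        also have "\<dots> = (cmod l * B k + B (k - 1)) / (1 + s\<^sup>2)" by (simp add: add_divide_distrib)
        also have "\<dots> \<le> ?B / (1 + s\<^sup>2)" using B(1) by (intro divide_right_mono) auto
        finally show ?thesis .
      qed
    qed
    note lim = this
    have "integral UNIV (\<lambda>s. indicat_real {0..} s *\<^sub>R scaleC (?q' s) (T (max 0 s) x))
        = scaleC (- l) (?V k) + (if k = 0 then 0 else ?V (k - 1))"
    proof (cases "k = 0")
      case True
      then show ?thesis using cl[of "- l" k] by (simp add: scaleC_scaleC scaleC_scaleR_right)
    next
      case False
      have "indicat_real {0..} s *\<^sub>R scaleC (?q' s) (T (max 0 s) x)
         = scaleC (- l) (indicat_real {0..} s *\<^sub>R scaleC (laplace_kernel l k s) (T (max 0 s) x))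
          + indicat_real {0..} s *\<^sub>R scaleC (laplace_kernel l (k - 1) s) (T (max 0 s) x)" for s
        using False by (simp add: scaleC_scaleC scaleC_scaleR_right scaleC_add_left scaleC_diff_left scaleC_minus_left scaleR_add_right scaleR_diff_right)
      then show ?thesis
        using False bochner_integral_add[OF bl[of "- l" k] b[of "k - 1"]] cl[of "- l" k] by simp
    qed
    note lim = lim[unfolded this]
    show "?V k \<in> D" by (rule generatorI[OF lim])
    have "A (?V k) = scaleC (laplace_kernel l k 0) x + scaleC (- l) (?V k) + (if k = 0 then 0 else ?V (k - 1))"
      unfolding generator_eq[OF lim] by simp
    then show "scaleC (- l) (?V k) - A (?V k) = - (if k = 0 then x else ?V (k - 1))"
      by (simp add: laplace_kernel_0)
  qed
  have step: "?V k = - RR (- l) (if k = 0 then x else ?V (k - 1))" for k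
    using RR_left[OF l' dom[of k], unfolded gen]
      bounded_linear.linear[OF bounded_clinear_bounded_linear[OF RR_bounded_clinear[OF l']], THEN linear_neg]
    by metis
  show ?thesis
  proof (induction k)
    case 0
    show ?case using step[of 0] by (simp add: scaleC_minus_one)
  next
    case (Suc k)
    have "?V (Suc k) = - RR (- l) (?V k)" using step[of "Suc k"] by simp
    also have "\<dots> = - scaleC ((-1) ^ Suc k) (RR (- l) ((RR (- l) ^^ Suc k) x))"
      unfolding Suc using bounded_clinear_scaleC[OF RR_bounded_clinear[OF l']] by simp
    also have "\<dots> = scaleC ((-1) ^ Suc (Suc k)) ((RR (- l) ^^ Suc (Suc k)) x)"
      by (simp add: scaleC_minus_left)
    finally show ?case .
  qed
qed

end

section \<open>Resolvent multipliers as convolutions\<close>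

text \<open>Near 0 the transform is flat, away from 0 it decays rapidly. The number 3 bounds 2 +
  |xi| on the unit interval and its ratio to |xi| outside.\<close>

lemma dot_schwartz_fourier_bound:
  fixes f :: "real \<Rightarrow> 'a::{complex_normed_vector,banach}"
  assumes "dot_schwartz f"
  shows "\<exists>C. \<forall>\<xi>. (2 + \<bar>\<xi>\<bar>) ^ a * norm (fourier f \<xi>) \<le> C * \<bar>\<xi>\<bar> ^ b"
proof -
  have f: "schwartz f" using assms by (simp add: dot_schwartz_def)
  obtain C1 where C1: "\<And>\<xi>. norm (fourier f \<xi>) \<le> C1 * \<bar>\<xi>\<bar> ^ b" using fourier_flat[OF assms] by blast
  obtain C2 where C2: "\<And>\<xi>. \<bar>\<xi>\<bar> ^ a * norm (fourier f \<xi>) \<le> C2" using fourier_decay[OF f] by blast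
  have "(2 + \<bar>\<xi>\<bar>) ^ a * norm (fourier f \<xi>) \<le> 3 ^ a * (\<bar>C1\<bar> + \<bar>C2\<bar>) * \<bar>\<xi>\<bar> ^ b" for \<xi>
  proof (cases "\<bar>\<xi>\<bar> \<le> 1")
    case True
    have "(2 + \<bar>\<xi>\<bar>) ^ a * norm (fourier f \<xi>) \<le> 3 ^ a * (\<bar>C1\<bar> * \<bar>\<xi>\<bar> ^ b)"
    proof (rule mult_mono)
      show "norm (fourier f \<xi>) \<le> \<bar>C1\<bar> * \<bar>\<xi>\<bar> ^ b"
        using C1[of \<xi>] by (rule order_trans) (intro mult_right_mono, auto)
      show "(2 + \<bar>\<xi>\<bar>) ^ a \<le> 3 ^ a" using True by (intro power_mono) auto
    qed auto
    also have "\<dots> \<le> 3 ^ a * (\<bar>C1\<bar> + \<bar>C2\<bar>) * \<bar>\<xi>\<bar> ^ b"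
      unfolding mult.assoc by (intro mult_left_mono mult_right_mono) auto
    finally show ?thesis .
  next
    case False
    have "(2 + \<bar>\<xi>\<bar>) ^ a \<le> (3 * \<bar>\<xi>\<bar>) ^ a" using False by (intro power_mono) auto
    then have "(2 + \<bar>\<xi>\<bar>) ^ a * norm (fourier f \<xi>) \<le> 3 ^ a * (\<bar>\<xi>\<bar> ^ a * norm (fourier f \<xi>))"
      unfolding mult.assoc[symmetric] power_mult_distrib by (intro mult_right_mono) auto
    also have "\<dots> \<le> 3 ^ a * ((\<bar>C1\<bar> + \<bar>C2\<bar>) * 1)" using C2[of \<xi>] by (intro mult_left_mono) auto
    also have "\<dots> \<le> 3 ^ a * ((\<bar>C1\<bar> + \<bar>C2\<bar>) * \<bar>\<xi>\<bar> ^ b)"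
      using False by (intro mult_left_mono) (auto intro!: one_le_power)
    finally show ?thesis by (simp add: mult.assoc)
  qed
  then show ?thesis by blast
qed

lemma AE_not_zero: "AE s in lebesgue. s \<noteq> (0::real)"
  by (rule AE_I[where N="{0}"]) auto

lemma integrable_inverse_square_const: "integrable lebesgue (\<lambda>s. c / (1 + s\<^sup>2) :: real)"
  using integrable_mult_right[OF integrable_inverse_1_plus_square_lebesgue, of c] by simp

context growth_semigroup
begin

text \<open>The values of \<open>f\<close> are taken at \<open>t + s\<close>: for a generator \<open>-A\<close>, the operators \<open>R(i\<xi>, A)\<close>
  have an anti-causal kernel. The term \<open>max 0 s\<close> makes the integrand continuous off \<open>0\<close>, since
  \<open>T\<close> is arbitrary at negative times.\<close>
definition orbit_convolution :: "nat \<Rightarrow> ('z \<Rightarrow> 'x) \<Rightarrow> (real \<Rightarrow> 'z) \<Rightarrow> real \<Rightarrow> 'x" where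
  "orbit_convolution k G f t =
    integral UNIV (\<lambda>s. indicat_real {0..} s *\<^sub>R ((s ^ k / fact k) *\<^sub>R T (max 0 s) (G (f (t + s)))))"

text \<open>The bound is uniform in the shift e <= 1 and integrable in xi, so dominated convergence
  can carry the spectral parameter onto the imaginary axis. \<open>G\<close> starts from an
  arbitrary space, later either Y or the scalars.\<close>

lemma resolvent_fourier_bound:
  fixes G :: "'z::{complex_normed_vector,banach} \<Rightarrow> 'x"
  assumes G: "bounded_clinear G" and f: "dot_schwartz f"
  shows "\<exists>C. \<forall>\<xi> e. \<xi> \<noteq> 0 \<longrightarrow> 0 \<le> e \<longrightarrow> e \<le> 1 \<longrightarrow>
    norm ((RR (Complex (- e) \<xi>) ^^ k) (G (fourier f \<xi>))) \<le> C / (1 + \<xi>\<^sup>2)"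
proof -
  obtain C P where C: "C \<ge> 0" "\<And>l x. Re l \<le> 0 \<Longrightarrow> l \<noteq> 0 \<Longrightarrow>
      norm ((RR l ^^ k) x) \<le> C * ((1 + cmod l)\<^sup>2 / cmod l) ^ P * norm x"
    using RR_funpow_bound[of k] by blast
  obtain K where K: "\<And>z. norm (G z) \<le> norm z * K" using G unfolding bounded_clinear_def by blast
  have K0: "norm (G z) \<le> norm z * \<bar>K\<bar>" for z
    using K[of z] by (rule order_trans) (intro mult_left_mono, auto)
  \<comment> \<open>The powers 2 P and P cancel the resolvent bound; the additional 2 leaves 1 / (1
    + xi^2).\<close>
  obtain C2 where C2: "\<And>\<xi>. (2 + \<bar>\<xi>\<bar>) ^ (2 * P + 2) * norm (fourier f \<xi>) \<le> C2 * \<bar>\<xi>\<bar> ^ P"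
    using dot_schwartz_fourier_bound[OF f] by blast
  have "norm ((RR (Complex (- e) \<xi>) ^^ k) (G (fourier f \<xi>))) \<le> (C * \<bar>K\<bar> * C2) / (1 + \<xi>\<^sup>2)"
    if x: "\<xi> \<noteq> 0" and e: "0 \<le> e" "e \<le> 1" for \<xi> e
  proof -
    define l where "l = Complex (- e) \<xi>"
    have l: "Re l \<le> 0" "l \<noteq> 0" using x e by (auto simp: l_def complex_eq_iff)
    have l1: "\<bar>\<xi>\<bar> \<le> cmod l" using abs_Im_le_cmod[of l] by (simp add: l_def)
    have l2: "cmod l \<le> 1 + \<bar>\<xi>\<bar>" using cmod_le[of l] e by (simp add: l_def)
    have "(1 + cmod l)\<^sup>2 / cmod l \<le> (2 + \<bar>\<xi>\<bar>)\<^sup>2 / \<bar>\<xi>\<bar>"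
      using l1 l2 x by (intro frac_le power_mono) auto
    then have "((1 + cmod l)\<^sup>2 / cmod l) ^ P \<le> ((2 + \<bar>\<xi>\<bar>)\<^sup>2 / \<bar>\<xi>\<bar>) ^ P"
      by (intro power_mono) auto
    then have "C * ((1 + cmod l)\<^sup>2 / cmod l) ^ P * norm (G (fourier f \<xi>))
      \<le> C * ((2 + \<bar>\<xi>\<bar>)\<^sup>2 / \<bar>\<xi>\<bar>) ^ P * (norm (fourier f \<xi>) * \<bar>K\<bar>)"
      using C(1) by (intro mult_mono K0 mult_left_mono) auto
    also have "\<dots> = C * \<bar>K\<bar> * ((2 + \<bar>\<xi>\<bar>) ^ (2 * P) * norm (fourier f \<xi>) / \<bar>\<xi>\<bar> ^ P)"
      by (simp add: power_divide power_mult)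
    also have "\<dots> \<le> C * \<bar>K\<bar> * (C2 / (1 + \<xi>\<^sup>2))"
    proof (rule mult_left_mono)
      have C20: "0 \<le> C2" using order_trans[OF _ C2[of 1], of 0] by simp
      have "(2 + \<bar>\<xi>\<bar>) ^ (2 * P) * norm (fourier f \<xi>) \<le> C2 * \<bar>\<xi>\<bar> ^ P / (2 + \<bar>\<xi>\<bar>)\<^sup>2"
        using C2[of \<xi>] by (simp add: pos_le_divide_eq power_add power2_eq_square mult_ac)
      also have "\<dots> \<le> C2 * \<bar>\<xi>\<bar> ^ P / (1 + \<xi>\<^sup>2)"
      proof (rule divide_left_mono)
        show "1 + \<xi>\<^sup>2 \<le> (2 + \<bar>\<xi>\<bar>)\<^sup>2" by (simp add: power2_sum)
        show "0 \<le> C2 * \<bar>\<xi>\<bar> ^ P" using C20 by simp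
        have "0 < 1 + \<xi>\<^sup>2" by (simp add: add_pos_nonneg)
        then show "0 < (2 + \<bar>\<xi>\<bar>)\<^sup>2 * (1 + \<xi>\<^sup>2)" by (intro mult_pos_pos) auto
      qed
      finally show "(2 + \<bar>\<xi>\<bar>) ^ (2 * P) * norm (fourier f \<xi>) / \<bar>\<xi>\<bar> ^ P \<le> C2 / (1 + \<xi>\<^sup>2)"
        using x by (simp add: pos_divide_le_eq mult.commute)
    qed (use C(1) in simp)
    finally show ?thesis using C(2)[OF l, of "G (fourier f \<xi>)"] unfolding l_def by simp
  qed
  then show ?thesis by blast
qed

lemma resolvent_fourier_measurable:
  fixes h :: "real \<Rightarrow> 'x"
  assumes h: "continuous_on UNIV h" and e: "0 \<le> e"
  shows "strongly_measurable lebesgue (\<lambda>\<xi>. (RR (Complex (- e) \<xi>) ^^ k) (h \<xi>))"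
proof (rule strongly_measurable_off_point[of 0])
  show "continuous_on (- {0}) (\<lambda>\<xi>. (RR (Complex (- e) \<xi>) ^^ k) (h \<xi>))"
  proof (intro continuous_at_imp_continuous_on ballI)
    fix \<xi> :: real assume x: "\<xi> \<in> - {0}"
    have hc: "(h \<longlongrightarrow> h \<xi>) (at \<xi>)" using h by (simp add: continuous_on_eq_continuous_at isCont_def)
    have ev: "eventually (\<lambda>y. y \<in> - {0}) (at \<xi>)"
      using x by (intro eventually_at_in_open') auto
    have "((\<lambda>y. (RR (Complex (- e) y) ^^ k) (h y)) \<longlongrightarrow> (RR (Complex (- e) \<xi>) ^^ k) (h \<xi>)) (at \<xi>)"
    proof (rule RR_funpow_tendsto[OF _ _ _ _ hc])
      show "eventually (\<lambda>y. Re (Complex (- e) y) \<le> 0 \<and> Complex (- e) y \<noteq> 0) (at \<xi>)"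
        using ev by eventually_elim (use e in \<open>auto simp: complex_eq_iff\<close>)
      show "(Complex (- e) \<longlongrightarrow> Complex (- e) \<xi>) (at \<xi>)"
        unfolding Complex_eq by (intro tendsto_intros)
    qed (use x e in \<open>auto simp: complex_eq_iff\<close>)
    then show "isCont (\<lambda>\<xi>. (RR (Complex (- e) \<xi>) ^^ k) (h \<xi>)) \<xi>" by (simp add: isCont_def)
  qed
qed

lemma resolvent_fourier_integrable:
  fixes G :: "'z::{complex_normed_vector,banach} \<Rightarrow> 'x"
  assumes G: "bounded_clinear G" and f: "dot_schwartz f"
  shows "bochner_integrable (\<lambda>\<xi>. (RR (\<i> * complex_of_real \<xi>) ^^ k) (G (fourier f \<xi>)))"
proof -
  have fs: "schwartz f" using f by (simp add: dot_schwartz_def)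
  have Gc: "continuous_on UNIV (\<lambda>\<xi>. G (fourier f \<xi>))"
    by (rule bounded_linear.continuous_on[OF bounded_clinear_bounded_linear[OF G] fourier_continuous[OF fs]])
  obtain C where C: "\<And>\<xi> e. \<xi> \<noteq> 0 \<Longrightarrow> 0 \<le> e \<Longrightarrow> e \<le> 1 \<Longrightarrow>
    norm ((RR (Complex (- e) \<xi>) ^^ k) (G (fourier f \<xi>))) \<le> C / (1 + \<xi>\<^sup>2)"
    using resolvent_fourier_bound[OF G f] by blast
  have "bochner_integrable (\<lambda>\<xi>. (RR (Complex (- 0) \<xi>) ^^ k) (G (fourier f \<xi>)))"
  proof (rule bochner_integrable_bound[OF resolvent_fourier_measurable[OF Gc] integrable_inverse_square_const])
    show "AE \<xi> in lebesgue. norm ((RR (Complex (- 0) \<xi>) ^^ k) (G (fourier f \<xi>))) \<le> C / (1 + \<xi>\<^sup>2)"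
      using AE_not_zero by eventually_elim (rule C, auto)
  qed simp
  then show ?thesis by (simp add: Complex_eq)
qed

text \<open>Two limits for e tending to 0 are compared: on the frequency side the resolvents are
  continuous up to the axis away from 0, on the time side the damping tends to 1. \<open>b0\<close>
  makes the Laplace transform converge for each e > 0, \<open>b1\<close> dominates s^k T(s) G once
  the damping is gone.\<close>

theorem multiplier_resolvent_eq_convolution:
  fixes G :: "'z::{complex_normed_vector,banach} \<Rightarrow> 'x"
  assumes G: "bounded_clinear G" and f: "dot_schwartz f"
    and b0: "\<And>s z. s \<ge> 0 \<Longrightarrow> norm (T s (G z)) \<le> C0 * norm z"
    and b1: "\<And>s z. s \<ge> 0 \<Longrightarrow> s ^ k * norm (T s (G z)) \<le> C1 * norm z"
  shows "multiplier_op (\<lambda>\<xi> z. (RR (\<i> * complex_of_real \<xi>) ^^ Suc k) (G z)) f t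
    = scaleC ((-1) ^ Suc k) (orbit_convolution k G f t)"
proof -
  have fs: "schwartz f" using f by (simp add: dot_schwartz_def)
  have fc: "continuous_on UNIV f" by (rule schwartz_continuous[OF fs])
  have bf: "bochner_integrable f" using schwartz_bochner_integrable[OF fs, of 0] by simp
  have bF: "bochner_integrable (fourier f)" by (rule fourier_bochner_integrable[OF fs])
  have Fc: "continuous_on UNIV (fourier f)" by (rule fourier_continuous[OF fs])
  have Gl: "bounded_linear G" by (rule bounded_clinear_bounded_linear[OF G])
  have Gc: "continuous_on UNIV (\<lambda>\<xi>. G (fourier f \<xi>))"
    by (rule bounded_linear.continuous_on[OF Gl Fc])
  have TG: "continuous_on UNIV (\<lambda>p. T (max 0 (fst p)) (G (u (snd p))))" if u: "continuous_on UNIV u" for u :: "real \<Rightarrow> 'z"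
  proof -
    have "continuous_on UNIV (\<lambda>p::real\<times>real. (fst p, G (u (snd p))))"
      by (intro continuous_intros bounded_linear.continuous_on[OF Gl] continuous_on_compose2[OF u]) auto
    from continuous_on_compose2[OF T_jointly_continuous this] show ?thesis by simp
  qed
  define e where "e n = 1 / real (Suc n)" for n
  have e: "0 < e n" "e n \<le> 1" for n by (auto simp: e_def)
  have elim0: "e \<longlonglongrightarrow> 0" unfolding e_def by real_asymp
  define I where "I n = integral UNIV (\<lambda>\<xi>. scaleC (cis (\<xi> * t)) ((RR (Complex (- e n) \<xi>) ^^ Suc k) (G (fourier f \<xi>))))" for n
  obtain C where C: "\<And>\<xi> e. \<xi> \<noteq> 0 \<Longrightarrow> 0 \<le> e \<Longrightarrow> e \<le> 1 \<Longrightarrow>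
    norm ((RR (Complex (- e) \<xi>) ^^ Suc k) (G (fourier f \<xi>))) \<le> C / (1 + \<xi>\<^sup>2)"
    using resolvent_fourier_bound[OF G f, of "Suc k"] by blast
  have cism: "strongly_measurable lebesgue (\<lambda>\<xi>. cis (\<xi> * t))"
    by (intro strongly_measurable_continuous continuous_on_cis continuous_intros)
  have lim1: "I \<longlonglongrightarrow> integral UNIV (\<lambda>\<xi>. scaleC (cis (\<xi> * t)) ((RR (Complex (- 0) \<xi>) ^^ Suc k) (G (fourier f \<xi>))))"
    unfolding I_def
  proof (rule bochner_dominated_convergence(2)[OF _ _ integrable_inverse_square_const])
    show "strongly_measurable lebesgue (\<lambda>\<xi>. scaleC (cis (\<xi> * t)) ((RR (Complex (- e n) \<xi>) ^^ Suc k) (G (fourier f \<xi>))))" for n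
      by (intro strongly_measurable_scaleC cism resolvent_fourier_measurable Gc less_imp_le e)
    show "strongly_measurable lebesgue (\<lambda>\<xi>. scaleC (cis (\<xi> * t)) ((RR (Complex (- 0) \<xi>) ^^ Suc k) (G (fourier f \<xi>))))"
      by (intro strongly_measurable_scaleC cism resolvent_fourier_measurable Gc order_refl)
    show "AE \<xi> in lebesgue. norm (scaleC (cis (\<xi> * t)) ((RR (Complex (- e n) \<xi>) ^^ Suc k) (G (fourier f \<xi>)))) \<le> C / (1 + \<xi>\<^sup>2)" for n
      using AE_not_zero
    proof eventually_elim
      case (elim \<xi>)
      then show ?case using C[of \<xi> "e n"] e[of n] by (simp add: norm_scaleC)
    qed
    show "AE \<xi> in lebesgue. (\<lambda>n. scaleC (cis (\<xi> * t)) ((RR (Complex (- e n) \<xi>) ^^ Suc k) (G (fourier f \<xi>))))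
        \<longlonglongrightarrow> scaleC (cis (\<xi> * t)) ((RR (Complex (- 0) \<xi>) ^^ Suc k) (G (fourier f \<xi>)))"
      using AE_not_zero
    proof eventually_elim
      case (elim \<xi>)
      show ?case
      proof (intro tendsto_scaleC tendsto_const RR_funpow_tendsto)
        show "\<forall>\<^sub>F i in sequentially. Re (Complex (- e i) \<xi>) \<le> 0 \<and> Complex (- e i) \<xi> \<noteq> 0"
          using e elim by (auto simp: complex_eq_iff less_imp_le)
        show "(\<lambda>i. Complex (- e i) \<xi>) \<longlonglongrightarrow> Complex (- 0) \<xi>"
          unfolding Complex_eq by (intro tendsto_intros elim0)
      qed (use elim in \<open>auto simp: complex_eq_iff\<close>)
    qed
  qed
  define L where "L n = integral UNIV (\<lambda>s. indicat_real {0..} s *\<^sub>R scaleC (laplace_kernel (complex_of_real (e n)) k s) (T (max 0 s) (G (f (t + s)))))" for n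
  have I_eq: "I n = scaleC ((-1) ^ Suc k) ((2 * pi) *\<^sub>R L n)" for n
  proof -
    let ?e = "complex_of_real (e n)"
    have Re: "Re ?e > 0" using e[of n] by simp
    obtain B where B: "B \<ge> 0" "\<And>s \<sigma>. s \<ge> 0 \<Longrightarrow> s - 1 \<le> \<sigma> \<Longrightarrow> \<sigma> \<le> s \<Longrightarrow> cmod (laplace_kernel ?e k \<sigma>) \<le> B / (1 + s\<^sup>2)"
      using laplace_kernel_bound[OF Re, of k] by blast
    define K where "K s \<xi> = scaleC (laplace_kernel ?e k s * cis (\<xi> * (t + s))) (T (max 0 s) (G (fourier f \<xi>)))" for s \<xi>
    \<comment> \<open>The imaginary part of the Laplace parameter merges with the inversion phase
      into \<open>cis (\<xi> * (t + s))\<close>. Fourier inversion in the inner integral therefore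
      evaluates \<open>f\<close> at t + s.\<close>
    have lk: "cis (\<xi> * t) * laplace_kernel (?e - \<i> * \<xi>) k s = laplace_kernel ?e k s * cis (\<xi> * (t + s))" for s \<xi>
    proof -
      have "cis (\<xi> * t) * exp (- ((?e - \<i> * \<xi>) * s)) = exp (- (?e * s)) * cis (\<xi> * (t + s))"
        unfolding cis_conv_exp exp_add[symmetric] by (rule arg_cong[where f=exp]) (simp add: algebra_simps)
      then show ?thesis unfolding laplace_kernel_def by (simp only: mult.assoc[symmetric]) (simp add: mult_ac)
    qed
    have Kc: "continuous_on UNIV (\<lambda>(s,\<xi>). K s \<xi>)"
      unfolding K_def case_prod_beta
      by (intro continuous_intros continuous_on_cis TG[OF Fc] continuous_on_compose2[OF laplace_kernel_continuous]) auto
    have K1: "scaleC (cis (\<xi> * t)) ((RR (Complex (- e n) \<xi>) ^^ Suc k) (G (fourier f \<xi>)))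
        = scaleC ((-1) ^ Suc k) (integral UNIV (\<lambda>s. indicat_real {0..} s *\<^sub>R K s \<xi>))" for \<xi>
    proof -
      let ?l = "?e - \<i> * \<xi>"
      have l: "Re ?l > 0" using e[of n] by simp
      have ml: "- ?l = Complex (- e n) \<xi>" by (simp add: complex_eq_iff)
      let ?x = "G (fourier f \<xi>)"
      have x: "norm (T s ?x) \<le> C0 * norm (fourier f \<xi>)" if "s \<ge> 0" for s by (rule b0[OF that])
      let ?k = "\<lambda>s. indicat_real {0..} s *\<^sub>R scaleC (laplace_kernel ?l k s) (T (max 0 s) ?x)"
      obtain B' where B': "\<And>s \<sigma>. s \<ge> 0 \<Longrightarrow> s - 1 \<le> \<sigma> \<Longrightarrow> \<sigma> \<le> s \<Longrightarrow> cmod (laplace_kernel ?l k \<sigma>) \<le> B' / (1 + s\<^sup>2)"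
        using laplace_kernel_bound[OF l, of k] by blast
      have b: "bochner_integrable ?k"
        by (rule weighted_orbit_bochner[OF laplace_kernel_continuous integrable_inverse_square_const[of B'] _ x]) (use B' in auto)
      have "scaleC ((-1) ^ Suc k * cis (\<xi> * t)) (integral UNIV ?k) = scaleC (cis (\<xi> * t)) ((RR (- ?l) ^^ Suc k) ?x)"
      proof -
        have lt: "integral UNIV ?k = scaleC ((-1) ^ Suc k) ((RR (- ?l) ^^ Suc k) ?x)"
          by (rule laplace_transform_resolvent[OF l x])
        have c: "(-1 :: complex) ^ Suc k * cis (\<xi> * t) * (-1) ^ Suc k = cis (\<xi> * t)"
          by (simp add: power_mult_distrib[symmetric] mult_ac)
        show ?thesis unfolding lt scaleC_scaleC c ..
      qed
      moreover have "scaleC (cis (\<xi> * t)) (integral UNIV ?k) = integral UNIV (\<lambda>s. scaleC (cis (\<xi> * t)) (?k s))"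
        by (rule bochner_integral_linear[OF b bounded_linear_scaleC_right, symmetric])
      moreover have "scaleC (cis (\<xi> * t)) (?k s) = indicat_real {0..} s *\<^sub>R K s \<xi>" for s
        unfolding K_def lk[symmetric] by (simp add: scaleC_scaleR_right scaleC_scaleC)
      ultimately show ?thesis unfolding ml scaleC_scaleC[symmetric] by simp
    qed
    have K2: "integral UNIV (\<lambda>\<xi>. K s \<xi>) = (2 * pi) *\<^sub>R scaleC (laplace_kernel ?e k s) (T (max 0 s) (G (f (t + s))))" for s
    proof -
      let ?h = "\<lambda>z. scaleC (laplace_kernel ?e k s) (T (max 0 s) (G z))"
      have hl: "bounded_linear ?h"
        by (intro bounded_linear_compose[OF bounded_linear_scaleC_right] bounded_linear_compose[OF T_bounded_linear Gl]) auto
      have b: "bochner_integrable (\<lambda>\<xi>. scaleC (cis (\<xi> * (t + s))) (fourier f \<xi>))"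
        by (intro bochner_integrable_cis bF continuous_intros)
      have "K s \<xi> = ?h (scaleC (cis (\<xi> * (t + s))) (fourier f \<xi>))" for \<xi>
        by (simp add: K_def bounded_clinear_scaleC[OF G] bounded_clinear_scaleC[OF T_bounded_clinear] scaleC_scaleC)
      then have "integral UNIV (\<lambda>\<xi>. K s \<xi>) = ?h (integral UNIV (\<lambda>\<xi>. scaleC (cis (\<xi> * (t + s))) (fourier f \<xi>)))"
        using bochner_integral_linear[OF b hl] by simp
      also have "integral UNIV (\<lambda>\<xi>. scaleC (cis (\<xi> * (t + s))) (fourier f \<xi>)) = (2 * pi) *\<^sub>R f (t + s)"
        unfolding fourier_inversion[OF fs, of "t + s", symmetric] inv_fourier_def by simp
      also have "?h ((2 * pi) *\<^sub>R f (t + s)) = (2 * pi) *\<^sub>R ?h (f (t + s))"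
        using linear_scale[OF bounded_linear.linear[OF hl]] .
      finally show ?thesis .
    qed
    have Kle: "norm (K s \<xi>) \<le> ((B / (1 + s\<^sup>2)) * \<bar>C0\<bar>) * norm (fourier f \<xi>)" if "s \<in> {0..}" for s \<xi>
    proof -
      have "norm (K s \<xi>) = cmod (laplace_kernel ?e k s) * norm (T s (G (fourier f \<xi>)))"
        using that by (simp add: K_def norm_scaleC norm_mult)
      also have "\<dots> \<le> (B / (1 + s\<^sup>2)) * (\<bar>C0\<bar> * norm (fourier f \<xi>))"
      proof (rule mult_mono)
        show "cmod (laplace_kernel ?e k s) \<le> B / (1 + s\<^sup>2)" using B(2)[of s s] that by simp
        show "norm (T s (G (fourier f \<xi>))) \<le> \<bar>C0\<bar> * norm (fourier f \<xi>)"
          using b0[of s "fourier f \<xi>"] that by (smt (verit) atLeast_iff mult_right_mono norm_ge_zero)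
      qed (use B(1) in auto)
      finally show ?thesis by simp
    qed
    have bK: "bochner_integrable (\<lambda>s. indicat_real {0..} s *\<^sub>R integral UNIV (\<lambda>\<xi>. K s \<xi>))"
      "bochner_integrable (\<lambda>\<xi>. integral UNIV (\<lambda>s. indicat_real {0..} s *\<^sub>R K s \<xi>))"
      "integral UNIV (\<lambda>s. indicat_real {0..} s *\<^sub>R integral UNIV (\<lambda>\<xi>. K s \<xi>))
         = integral UNIV (\<lambda>\<xi>. integral UNIV (\<lambda>s. indicat_real {0..} s *\<^sub>R K s \<xi>))"
      by (rule bochner_swap[OF Kc _ integrable_mult_left[OF integrable_inverse_square_const] bochner_integrableD(2)[OF bF] Kle];
          use B(1) in simp)+
    have "I n = scaleC ((-1) ^ Suc k) (integral UNIV (\<lambda>\<xi>. integral UNIV (\<lambda>s. indicat_real {0..} s *\<^sub>R K s \<xi>)))"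
      unfolding I_def K1 by (rule bochner_integral_linear[OF bK(2) bounded_linear_scaleC_right])
    also have "\<dots> = scaleC ((-1) ^ Suc k) (integral UNIV (\<lambda>s. (2 * pi) *\<^sub>R (indicat_real {0..} s *\<^sub>R scaleC (laplace_kernel ?e k s) (T (max 0 s) (G (f (t + s)))))))"
      unfolding bK(3)[symmetric] K2 by (simp add: mult.commute)
    also have "\<dots> = scaleC ((-1) ^ Suc k) ((2 * pi) *\<^sub>R L n)"
      unfolding L_def integral_cmul ..
    finally show ?thesis .
  qed
  have ftc: "continuous_on UNIV (\<lambda>s. f (t + s))"
    by (rule continuous_on_compose2[OF fc]) (auto intro!: continuous_intros)
  have TGf: "continuous_on UNIV (\<lambda>s. T (max 0 s) (G (f (t + s))))"
  proof -
    have "continuous_on UNIV (\<lambda>s. (s, s) :: real \<times> real)" by (intro continuous_intros)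
    from continuous_on_compose2[OF TG[OF ftc] this] show ?thesis by simp
  qed
  have lim2: "L \<longlonglongrightarrow> orbit_convolution k G f t"
    unfolding L_def orbit_convolution_def
  proof (rule bochner_dominated_convergence(2)[where h="\<lambda>s. \<bar>C1\<bar> * norm (f (t + 1 * s))"])
    show "strongly_measurable lebesgue (\<lambda>s. indicat_real {0..} s *\<^sub>R scaleC (laplace_kernel (complex_of_real (e n)) k s) (T (max 0 s) (G (f (t + s)))))" for n
      by (intro strongly_measurable_indicator strongly_measurable_continuous continuous_intros laplace_kernel_continuous TGf) auto
    show "strongly_measurable lebesgue (\<lambda>s. indicat_real {0..} s *\<^sub>R ((s ^ k / fact k) *\<^sub>R T (max 0 s) (G (f (t + s)))))"
      by (intro strongly_measurable_indicator strongly_measurable_continuous continuous_intros TGf) auto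
    show "integrable lebesgue (\<lambda>s. \<bar>C1\<bar> * norm (f (t + 1 * s)))"
      by (intro integrable_mult_right integrable_affine_lebesgue bochner_integrableD(2)[OF bf]) auto
    show "AE s in lebesgue. norm (indicat_real {0..} s *\<^sub>R scaleC (laplace_kernel (complex_of_real (e n)) k s) (T (max 0 s) (G (f (t + s)))))
        \<le> \<bar>C1\<bar> * norm (f (t + 1 * s))" for n
    proof (rule AE_I2)
      fix s :: real
      show "norm (indicat_real {0..} s *\<^sub>R scaleC (laplace_kernel (complex_of_real (e n)) k s) (T (max 0 s) (G (f (t + s)))))
        \<le> \<bar>C1\<bar> * norm (f (t + 1 * s))"
      proof (cases "s \<ge> 0")
        case True
        have "exp (- (e n * s)) \<le> 1" using e[of n] True by simp
        then have "exp (- (e n * s)) * (s ^ k / fact k) \<le> 1 * s ^ k"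
        proof (rule mult_mono)
          have "s ^ k / fact k \<le> s ^ k / 1" using True by (intro divide_left_mono) auto
          then show "s ^ k / fact k \<le> s ^ k" by simp
        qed (use True in auto)
        then have "exp (- (e n * s)) * (s ^ k / fact k) * norm (T s (G (f (t + s)))) \<le> s ^ k * norm (T s (G (f (t + s))))"
          by (intro mult_right_mono) auto
        also have "\<dots> \<le> C1 * norm (f (t + s))" by (rule b1[OF True])
        also have "\<dots> \<le> \<bar>C1\<bar> * norm (f (t + s))" by (intro mult_right_mono) auto
        finally show ?thesis using True by (simp add: laplace_kernel_def norm_scaleC norm_mult norm_divide norm_power)
      qed simp
    qed
    show "AE s in lebesgue. (\<lambda>n. indicat_real {0..} s *\<^sub>R scaleC (laplace_kernel (complex_of_real (e n)) k s) (T (max 0 s) (G (f (t + s)))))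
        \<longlonglongrightarrow> indicat_real {0..} s *\<^sub>R ((s ^ k / fact k) *\<^sub>R T (max 0 s) (G (f (t + s))))"
    proof (rule AE_I2)
      fix s :: real
      have "(\<lambda>n. laplace_kernel (complex_of_real (e n)) k s) \<longlonglongrightarrow> exp (- (complex_of_real 0 * complex_of_real s)) * complex_of_real (s ^ k / fact k)"
        unfolding laplace_kernel_def by (intro tendsto_intros elim0)
      then have "(\<lambda>n. laplace_kernel (complex_of_real (e n)) k s) \<longlonglongrightarrow> complex_of_real (s ^ k / fact k)" by simp
      then show "(\<lambda>n. indicat_real {0..} s *\<^sub>R scaleC (laplace_kernel (complex_of_real (e n)) k s) (T (max 0 s) (G (f (t + s)))))
        \<longlonglongrightarrow> indicat_real {0..} s *\<^sub>R ((s ^ k / fact k) *\<^sub>R T (max 0 s) (G (f (t + s))))"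
        unfolding scaleC_of_real[symmetric, of "s ^ k / fact k"] by (intro tendsto_intros)
    qed
  qed
  have "I \<longlonglongrightarrow> scaleC ((-1) ^ Suc k) ((2 * pi) *\<^sub>R orbit_convolution k G f t)"
    unfolding I_eq[abs_def] by (intro tendsto_intros lim2)
  then have "integral UNIV (\<lambda>\<xi>. scaleC (cis (\<xi> * t)) ((RR (Complex (- 0) \<xi>) ^^ Suc k) (G (fourier f \<xi>))))
      = scaleC ((-1) ^ Suc k) ((2 * pi) *\<^sub>R orbit_convolution k G f t)"
    using lim1 LIMSEQ_unique by blast
  then show ?thesis
    unfolding multiplier_op_def inv_fourier_def by (simp add: Complex_eq scaleC_scaleR_right del: funpow.simps)
qed

end

section \<open>Convolution inequalities\<close>

lemma AE_lebesgue_translate: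
  assumes "AE x in lebesgue. P x"
  shows "AE s in lebesgue. P (t + s :: real)"
proof -
  obtain N where N: "{x. \<not> P x} \<subseteq> N" "N \<in> null_sets lebesgue"
    using assms by (auto elim!: AE_E simp: null_sets_def)
  have m: "(indicator N :: real \<Rightarrow> ennreal) \<in> borel_measurable lebesgue" using N(2) by auto
  have "(\<integral>\<^sup>+s. indicator N (t + 1 * s) \<partial>lebesgue) = ennreal (1 / \<bar>1\<bar>) * (\<integral>\<^sup>+x. indicator N x \<partial>lebesgue)"
    by (rule nn_integral_affine_lebesgue[OF m]) simp
  also have "\<dots> = 0" using N(2) by (auto simp: null_sets_def)
  finally have "AE s in lebesgue. (indicator N (t + 1 * s) :: ennreal) = 0"
    using measurable_compose[OF lebesgue_measurable_affine m, of 1 t] by (subst (asm) nn_integral_0_iff_AE) auto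
  then show ?thesis by eventually_elim (use N(1) in \<open>auto simp: indicator_def split: if_splits\<close>)
qed

lemma AE_lborel_lebesgue: "AE x in lborel. P x \<Longrightarrow> AE x in lebesgue. P x"
  by (rule AE_completion)

text \<open>A crude weighted mean inequality through the maximum; optimal constants are of no
  interest below, so the right-hand side carries no weights.\<close>

lemma weighted_product_le:
  fixes a b c w1 w2 w3 :: real
  assumes "0 \<le> a" "0 \<le> b" "0 \<le> c" "0 \<le> w1" "0 \<le> w2" "0 \<le> w3" "w1 + w2 + w3 = 1"
  shows "a powr w1 * b powr w2 * c powr w3 \<le> a + b + c"
proof -
  define M where "M = max a (max b c)"
  have M: "a \<le> M" "b \<le> M" "c \<le> M" "0 \<le> M" "M \<le> a + b + c" using assms by (auto simp: M_def)
  have "a powr w1 * b powr w2 * c powr w3 \<le> M powr w1 * M powr w2 * M powr w3"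
    using assms M by (intro mult_mono powr_mono2) auto
  also have "\<dots> = M powr (w1 + w2 + w3)" by (simp add: powr_add)
  also have "\<dots> = M" using assms(7) M by simp
  finally show ?thesis using M by simp
qed

text \<open>The classical splitting x y = u^(1/q) (x^p y^r / u)^(1/q) (x^p)^(1/p - 1/q) (y^r)^(1/r -
  1/q), where the last three exponents are nonnegative with sum 1. The parameter \<open>u\<close>
  will be a convolution of the p-th and r-th powers; in this way no Hoelder inequality with three
  exponents is called for.\<close>

lemma young_pointwise:
  fixes x y u p q r :: real
  assumes x: "0 \<le> x" and y: "0 \<le> y" and u: "0 < u" and pq: "1 \<le> p" "p \<le> q" "1 \<le> r"
    and e: "1 / p + 1 / r = 1 + 1 / q"
  shows "x * y \<le> u powr (1 / q) * (x powr p * y powr r / u + x powr p + y powr r)"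
proof (cases "x = 0 \<or> y = 0")
  case False
  then have xy: "x > 0" "y > 0" using x y by auto
  have q: "q > 0" using pq by simp
  have w2: "1 / p - 1 / q \<ge> 0" using pq by (simp add: frac_le)
  have "1 / r - 1 / q = 1 - 1 / p" using e by linarith
  moreover have "1 / p \<le> 1" using pq by simp
  ultimately have w3: "1 / r - 1 / q \<ge> 0" by simp
  have "u powr (1 / q) * ((x powr p * y powr r / u) powr (1 / q) * (x powr p) powr (1 / p - 1 / q) * (y powr r) powr (1 / r - 1 / q))
     = (u powr (1 / q) * (1 / u) powr (1 / q)) * (x powr (p / q) * x powr (p * (1 / p - 1 / q))) * (y powr (r / q) * y powr (r * (1 / r - 1 / q)))"
    using xy u by (simp add: powr_powr powr_mult powr_divide)
  also have "u powr (1 / q) * (1 / u) powr (1 / q) = 1" using u by (simp add: powr_divide)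
  also have "x powr (p / q) * x powr (p * (1 / p - 1 / q)) = x"
    unfolding powr_add[symmetric] using pq xy by (simp add: right_diff_distrib)
  also have "y powr (r / q) * y powr (r * (1 / r - 1 / q)) = y"
    unfolding powr_add[symmetric] using pq xy by (simp add: right_diff_distrib)
  finally have "x * y = u powr (1 / q) * ((x powr p * y powr r / u) powr (1 / q) * (x powr p) powr (1 / p - 1 / q) * (y powr r) powr (1 / r - 1 / q))"
    by simp
  also have "\<dots> \<le> u powr (1 / q) * (x powr p * y powr r / u + x powr p + y powr r)"
    using u q w2 w3 e by (intro mult_left_mono weighted_product_le) auto
  finally show ?thesis .
next
  case True
  have "0 \<le> u powr (1 / q) * (x powr p * y powr r / u + x powr p + y powr r)" using u by auto
  then show ?thesis using True by auto
qed

text \<open>Tonelli is applied over \<open>lborel\<close>, so a Lebesgue measurable \<open>F\<close>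
  is exchanged for a nonnegative Borel function. Null sets are translation invariant, hence the
  integrals over s agree for every t.\<close>

lemma nn_integral_kernel_borel:
  fixes F :: "real \<Rightarrow> real"
  assumes F: "F \<in> borel_measurable lebesgue" "\<And>x. 0 \<le> F x" and h: "h \<in> borel_measurable borel"
  obtains F' where "F' \<in> borel_measurable borel" "\<And>x. 0 \<le> F' x" "AE x in lebesgue. F x = F' x"
    "\<And>t. (\<integral>\<^sup>+s. ennreal (h s * F (t + s)) \<partial>lebesgue) = (\<integral>\<^sup>+s. ennreal (h s * F' (t + s)) \<partial>lborel)"
proof -
  obtain F0 where F0: "F0 \<in> borel_measurable lborel" "AE x in lborel. F x = F0 x"
    using completion_ex_borel_measurable_real[OF F(1)] by blast
  define F' where "F' x = max 0 (F0 x)" for x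
  have m: "F' \<in> borel_measurable borel" using F0(1) unfolding F'_def by simp
  have ae: "AE x in lebesgue. F x = F' x"
    using AE_lborel_lebesgue[OF F0(2)]
  proof eventually_elim
    case (elim x)
    then show ?case using F(2)[of x] by (simp add: F'_def)
  qed
  have "(\<integral>\<^sup>+s. ennreal (h s * F (t + s)) \<partial>lebesgue) = (\<integral>\<^sup>+s. ennreal (h s * F' (t + s)) \<partial>lborel)" for t
  proof -
    have "(\<integral>\<^sup>+s. ennreal (h s * F (t + s)) \<partial>lebesgue) = (\<integral>\<^sup>+s. ennreal (h s * F' (t + s)) \<partial>lebesgue)"
      by (rule nn_integral_cong_AE) (use AE_lebesgue_translate[OF ae, of t] in \<open>auto elim: eventually_mono\<close>)
    also have "\<dots> = (\<integral>\<^sup>+s. ennreal (h s * F' (t + s)) \<partial>lborel)"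
      using m h by (subst nn_integral_completion) auto
    finally show ?thesis .
  qed
  with m ae show ?thesis by (intro that[of F']) (auto simp: F'_def)
qed

text \<open>The conclusion keeps the pointwise majorant \<open>u\<close>, because finiteness almost
  everywhere and the L^q bound are both read off from its integral. The three terms of the pointwise
  inequality integrate to 1, 1 and H, hence the constant 2 + H.\<close>

lemma young_convolution:
  fixes F h :: "real \<Rightarrow> real" and p q r :: real
  assumes F: "F \<in> borel_measurable lebesgue" "\<And>x. 0 \<le> F x" "integrable lebesgue (\<lambda>x. F x powr p)"
    and h: "h \<in> borel_measurable borel" "\<And>x. 0 \<le> h x" "integrable lebesgue (\<lambda>x. h x powr r)"
    and pq: "1 \<le> p" "p \<le> q" "1 \<le> r" and e: "1 / p + 1 / r = 1 + 1 / q"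
  defines "A \<equiv> (\<integral>x. F x powr p \<partial>lebesgue) powr (1 / p)" and "H \<equiv> (\<integral>x. h x powr r \<partial>lebesgue)"
  shows "\<exists>u\<in>borel_measurable borel. (\<integral>\<^sup>+t. u t \<partial>lborel) \<le> ennreal H \<and>
    (\<forall>t. u t < \<infinity> \<longrightarrow> (\<integral>\<^sup>+s. ennreal (h s * F (t + s)) \<partial>lebesgue) \<le> ennreal (A * (2 + H) * enn2real (u t) powr (1 / q)))"
proof -
  obtain F' where F': "F' \<in> borel_measurable borel" "\<And>x. 0 \<le> F' x" "AE x in lebesgue. F x = F' x"
    "\<And>t. (\<integral>\<^sup>+s. ennreal (h s * F (t + s)) \<partial>lebesgue) = (\<integral>\<^sup>+s. ennreal (h s * F' (t + s)) \<partial>lborel)"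
    using nn_integral_kernel_borel[OF F(1,2) h(1)] by blast
  note [measurable] = F'(1) h(1)
  have H0: "0 \<le> H" unfolding H_def by (intro integral_nonneg_AE) auto
  have p0: "p > 0" using pq by simp
  define a where "a = (\<integral>x. F x powr p \<partial>lebesgue)"
  have a0: "0 \<le> a" unfolding a_def by (intro integral_nonneg_AE) auto
  have mF': "(\<lambda>x. F' x powr p) \<in> borel_measurable lebesgue"
    using measurable_completion[of "\<lambda>x. F' x powr p" lborel borel] by simp
  have iF': "integrable lborel (\<lambda>x. F' x powr p)"
  proof -
    have "integrable lebesgue (\<lambda>x. F' x powr p)"
      by (rule integrable_cong_AE_imp[OF F(3)]) (use F'(3) mF' in \<open>auto elim: eventually_mono\<close>)
    then show ?thesis by (subst (asm) integrable_completion) auto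
  qed
  have a_eq: "a = (\<integral>x. F' x powr p \<partial>lborel)"
  proof -
    have "a = (\<integral>x. F' x powr p \<partial>lebesgue)" unfolding a_def
      by (rule integral_cong_AE) (use F(3) F'(3) mF' in \<open>auto elim: eventually_mono\<close>)
    then show ?thesis by (subst (asm) integral_completion) auto
  qed
  have ih: "integrable lborel (\<lambda>x. h x powr r)" using h(3) by (subst (asm) integrable_completion) auto
  have H_eq: "H = (\<integral>x. h x powr r \<partial>lborel)" unfolding H_def by (subst integral_completion) auto
  have nnh: "(\<integral>\<^sup>+s. ennreal (h s powr r) \<partial>lborel) = ennreal H"
    unfolding H_eq by (rule nn_integral_eq_integral[OF ih]) auto
  have nnF: "(\<integral>\<^sup>+s. ennreal (F' (t + s) powr p) \<partial>lborel) = ennreal a" for t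
  proof -
    have "(\<integral>\<^sup>+s. ennreal (F' s powr p) \<partial>lborel) = ennreal a"
      unfolding a_eq by (rule nn_integral_eq_integral[OF iF']) auto
    then show ?thesis using nn_integral_real_affine[of "\<lambda>s. ennreal (F' s powr p)" 1 t] by simp
  qed
  show ?thesis
  proof (cases "a = 0")
    case True
    have "(\<integral>\<^sup>+s. ennreal (h s * F' (t + s)) \<partial>lborel) = 0" for t
    proof -
      have "(\<integral>\<^sup>+s. ennreal (F' (t + s) powr p) \<partial>lborel) = 0" using nnF[of t] True by simp
      then have "AE s in lborel. ennreal (F' (t + s) powr p) = 0"
        by (subst (asm) nn_integral_0_iff_AE) auto
      then have "AE s in lborel. ennreal (h s * F' (t + s)) = 0"
        by eventually_elim auto
      then show ?thesis by (subst nn_integral_0_iff_AE) auto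
    qed
    then show ?thesis unfolding F'(4) by (intro bexI[of _ "\<lambda>_. 0"]) auto
  next
    case False
    then have a: "a > 0" using a0 by simp
    have A: "A > 0" "A powr p = a" using a p0 by (auto simp: A_def a_def[symmetric] powr_powr)
    \<comment> \<open>Division by A gives the p-th power of \<open>F'\<close> the integral 1, so
      that by Tonelli \<open>u\<close> has integral H.\<close>
    define u where "u t = (\<integral>\<^sup>+s. ennreal ((F' (t + s) / A) powr p * h s powr r) \<partial>lborel)" for t
    have um: "u \<in> borel_measurable borel" unfolding u_def by measurable
    have FA: "(F' x / A) powr p = F' x powr p / a" for x
      using A F'(2)[of x] by (simp add: powr_divide)
    have "(\<integral>\<^sup>+t. u t \<partial>lborel) = (\<integral>\<^sup>+s. (\<integral>\<^sup>+t. ennreal ((F' (t + s) / A) powr p * h s powr r) \<partial>lborel) \<partial>lborel)"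
      unfolding u_def by (rule lborel_pair.Fubini') measurable
    also have "\<dots> = (\<integral>\<^sup>+s. ennreal (h s powr r) \<partial>lborel)"
    proof (rule nn_integral_cong)
      fix s
      have "(\<integral>\<^sup>+t. ennreal ((F' (t + s) / A) powr p * h s powr r) \<partial>lborel)
        = (\<integral>\<^sup>+t. ennreal (h s powr r / a) * ennreal (F' (s + t) powr p) \<partial>lborel)"
        using a by (intro nn_integral_cong) (simp add: FA ennreal_mult[symmetric] mult_ac add.commute)
      also have "\<dots> = ennreal (h s powr r / a) * ennreal a"
        by (subst nn_integral_cmult) (simp_all add: nnF)
      also have "\<dots> = ennreal (h s powr r)" using a by (simp add: ennreal_mult[symmetric])
      finally show "(\<integral>\<^sup>+t. ennreal ((F' (t + s) / A) powr p * h s powr r) \<partial>lborel) = ennreal (h s powr r)" .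
    qed
    also have "\<dots> = ennreal H" by (rule nnh)
    finally have uH: "(\<integral>\<^sup>+t. u t \<partial>lborel) \<le> ennreal H" by simp
    have "(\<integral>\<^sup>+s. ennreal (h s * F' (t + s)) \<partial>lborel) \<le> ennreal (A * (2 + H) * enn2real (u t) powr (1 / q))"
      if ut: "u t < \<infinity>" for t
    proof (cases "u t = 0")
      case True
      then have "AE s in lborel. ennreal ((F' (t + s) / A) powr p * h s powr r) = 0"
        unfolding u_def by (subst (asm) nn_integral_0_iff_AE) auto
      then have "AE s in lborel. ennreal (h s * F' (t + s)) = 0"
        by eventually_elim (use A F'(2) h(2) in \<open>auto simp: ennreal_eq_0_iff mult_le_0_iff not_le[symmetric] order_antisym_conv\<close>)
      then have "(\<integral>\<^sup>+s. ennreal (h s * F' (t + s)) \<partial>lborel) = 0"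
        by (subst nn_integral_0_iff_AE) auto
      then show ?thesis by simp
    next
      case False
      define U where "U = enn2real (u t)"
      have U: "u t = ennreal U" "U > 0"
        using ut False by (auto simp: U_def less_top enn2real_positive_iff zero_less_iff_neq_zero)
      have "(\<integral>\<^sup>+s. ennreal (h s * F' (t + s)) \<partial>lborel)
        \<le> (\<integral>\<^sup>+s. ennreal (A * U powr (1 / q)) * (ennreal (1 / U) * ennreal ((F' (t + s) / A) powr p * h s powr r)
              + ennreal (1 / a) * ennreal (F' (t + s) powr p) + ennreal (h s powr r)) \<partial>lborel)"
      proof (rule nn_integral_mono)
        fix s
        let ?x = "F' (t + s) / A" and ?y = "h s"
        have "?x * ?y \<le> U powr (1 / q) * (?x powr p * ?y powr r / U + ?x powr p + ?y powr r)"
          using A(1) F'(2) h(2) by (intro young_pointwise U pq e) auto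
        then have "A * (?x * ?y) \<le> A * (U powr (1 / q) * (?x powr p * ?y powr r / U + ?x powr p + ?y powr r))"
          using A(1) by (intro mult_left_mono) auto
        then have "h s * F' (t + s) \<le> (A * U powr (1 / q)) * ((1 / U) * (?x powr p * ?y powr r) + (1 / a) * F' (t + s) powr p + ?y powr r)"
          using A(1) by (simp add: FA mult_ac)
        then show "ennreal (h s * F' (t + s)) \<le> ennreal (A * U powr (1 / q)) * (ennreal (1 / U) * ennreal (?x powr p * ?y powr r)
              + ennreal (1 / a) * ennreal (F' (t + s) powr p) + ennreal (h s powr r))"
          using A(1) U(2) a by (simp add: ennreal_mult[symmetric] ennreal_plus[symmetric] del: ennreal_plus)
      qed
      also have "\<dots> = ennreal (A * U powr (1 / q)) * (ennreal (1 / U) * u t + ennreal (1 / a) * ennreal a + ennreal H)"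
        by (simp add: nn_integral_cmult nn_integral_add u_def nnF nnh)
      also have "\<dots> = ennreal (A * U powr (1 / q)) * ennreal (2 + H)"
      proof -
        have "ennreal (1 / U) * u t = 1" "ennreal (1 / a) * ennreal a = 1"
          using U a by (simp_all add: ennreal_mult[symmetric])
        moreover have "1 + 1 + ennreal H = ennreal (2 + H)" using H0 by simp
        ultimately show ?thesis by (simp only:)
      qed
      also have "\<dots> = ennreal ((A * U powr (1 / q)) * (2 + H))"
        using A(1) H0 by (intro ennreal_mult[symmetric]) auto
      also have "(A * U powr (1 / q)) * (2 + H) = A * (2 + H) * U powr (1 / q)" by simp
      finally show ?thesis by (simp add: U_def)
    qed
    with um uH show ?thesis unfolding F'(4) by blast
  qed
qed

text \<open>The endpoint q = \<infinity>, valid at every t. Bounding the product of the normalised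
  factors by the sum of their powers gives the non-optimal constant 1 + H.\<close>

lemma hoelder_convolution:
  fixes F h :: "real \<Rightarrow> real" and p r :: real
  assumes F: "F \<in> borel_measurable lebesgue" "\<And>x. 0 \<le> F x" "integrable lebesgue (\<lambda>x. F x powr p)"
    and h: "h \<in> borel_measurable borel" "\<And>x. 0 \<le> h x" "integrable lebesgue (\<lambda>x. h x powr r)"
    and pr: "1 \<le> p" "1 \<le> r" and e: "1 / p + 1 / r = 1"
  defines "A \<equiv> (\<integral>x. F x powr p \<partial>lebesgue) powr (1 / p)" and "H \<equiv> (\<integral>x. h x powr r \<partial>lebesgue)"
  shows "(\<integral>\<^sup>+s. ennreal (h s * F (t + s)) \<partial>lebesgue) \<le> ennreal (A * (1 + H))"
proof -
  obtain F' where F': "F' \<in> borel_measurable borel" "\<And>x. 0 \<le> F' x" "AE x in lebesgue. F x = F' x"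
    "\<And>t. (\<integral>\<^sup>+s. ennreal (h s * F (t + s)) \<partial>lebesgue) = (\<integral>\<^sup>+s. ennreal (h s * F' (t + s)) \<partial>lborel)"
    using nn_integral_kernel_borel[OF F(1,2) h(1)] by blast
  note [measurable] = F'(1) h(1)
  have H0: "0 \<le> H" unfolding H_def by (intro integral_nonneg_AE) auto
  have p0: "p > 0" using pr by simp
  define a where "a = (\<integral>x. F x powr p \<partial>lebesgue)"
  have a0: "0 \<le> a" unfolding a_def by (intro integral_nonneg_AE) auto
  have nnF: "(\<integral>\<^sup>+s. ennreal (F (t + 1 * s) powr p) \<partial>lebesgue) = ennreal a"
    using F(1) nn_integral_eq_integral[OF F(3)]
    by (subst nn_integral_affine_lebesgue) (simp_all add: a_def)
  have nnh: "(\<integral>\<^sup>+s. ennreal (h s powr r) \<partial>lebesgue) = ennreal H"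
    unfolding H_def by (rule nn_integral_eq_integral[OF h(3)]) auto
  have hm: "h \<in> borel_measurable lebesgue" using measurable_completion[of h lborel borel] h(1) by simp
  have Fm: "(\<lambda>s. F (t + 1 * s)) \<in> borel_measurable lebesgue"
    using measurable_compose[OF lebesgue_measurable_affine[of 1 t] F(1)] by simp
  show ?thesis
  proof (cases "a = 0")
    case True
    have "(\<integral>\<^sup>+s. ennreal (F (t + 1 * s) powr p) \<partial>lebesgue) = 0" using nnF True by simp
    then have "AE s in lebesgue. ennreal (F (t + 1 * s) powr p) = 0"
      using Fm by (subst nn_integral_0_iff_AE[symmetric]) auto
    then have "AE s in lebesgue. ennreal (h s * F (t + s)) = 0"
      by eventually_elim auto
    then show ?thesis using Fm hm by (subst nn_integral_0_iff_AE[THEN iffD2]) auto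
  next
    case False
    then have a: "a > 0" using a0 by simp
    have A: "A > 0" "A powr p = a" using a p0 by (auto simp: A_def a_def[symmetric] powr_powr)
    have "(\<integral>\<^sup>+s. ennreal (h s * F (t + s)) \<partial>lebesgue)
      \<le> (\<integral>\<^sup>+s. ennreal A * (ennreal (1 / a) * ennreal (F (t + 1 * s) powr p) + ennreal (h s powr r)) \<partial>lebesgue)"
    proof (rule nn_integral_mono)
      fix s
      let ?x = "F (t + s) / A" and ?y = "h s"
      have "?x * ?y = (?x powr p) powr (1 / p) * (?y powr r) powr (1 / r) * 0 powr 0 \<or> ?x * ?y = (?x powr p) powr (1 / p) * (?y powr r) powr (1 / r)"
        using A F(2)[of "t + s"] h(2)[of s] pr by (simp add: powr_powr)
      then have "?x * ?y = (?x powr p) powr (1 / p) * (?y powr r) powr (1 / r) * 1 powr 0"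
        using A F(2)[of "t + s"] h(2)[of s] pr by (simp add: powr_powr)
      also have "\<dots> \<le> ?x powr p + ?y powr r"
      proof -
        have "(?x powr p) powr (1 / p) * (?y powr r) powr (1 / r) * (?y powr r) powr 0 \<le> ?x powr p + ?y powr r"
        proof -
          have "(?x powr p) powr (1 / p) * (?y powr r) powr (1 / r) \<le> max (?x powr p) (?y powr r) powr (1 / p) * max (?x powr p) (?y powr r) powr (1 / r)"
            using pr by (intro mult_mono powr_mono2) auto
          also have "\<dots> = max (?x powr p) (?y powr r)" unfolding powr_add[symmetric] e by (simp add: le_max_iff_disj)
          also have "\<dots> \<le> ?x powr p + ?y powr r" by (simp add: max_def)
          finally show ?thesis by (cases "?y = 0") auto
        qed
        then show ?thesis by (cases "?y = 0") auto
      qed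
      finally have "A * (?x * ?y) \<le> A * (?x powr p + ?y powr r)" using A(1) by (intro mult_left_mono) auto
      then have "h s * F (t + s) \<le> A * ((1 / a) * F (t + 1 * s) powr p + ?y powr r)"
        using A F(2)[of "t + s"] by (simp add: powr_divide mult_ac)
      then show "ennreal (h s * F (t + s)) \<le> ennreal A * (ennreal (1 / a) * ennreal (F (t + 1 * s) powr p) + ennreal (h s powr r))"
        using A(1) a by (simp add: ennreal_mult[symmetric] ennreal_plus[symmetric] del: ennreal_plus)
    qed
    also have "\<dots> = ennreal A * (ennreal (1 / a) * ennreal a + ennreal H)"
      using Fm hm by (simp add: nn_integral_cmult nn_integral_add nnF[simplified] nnh)
    also have "\<dots> = ennreal (A * (1 + H))"
    proof -
      have "ennreal (1 / a) * ennreal a = 1" using a by (simp add: ennreal_mult[symmetric])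
      moreover have "1 + ennreal H = ennreal (1 + H)" using H0 by simp
      moreover have "ennreal A * ennreal (1 + H) = ennreal (A * (1 + H))"
        using A(1) H0 by (intro ennreal_mult[symmetric]) auto
      ultimately show ?thesis by (simp only:)
    qed
    finally show ?thesis .
  qed
qed

text \<open>\<open>h\<close> majorises s^m T(s) J. Its bound \<open>H0\<close> serves the pair (1,
  \<infinity>); integrability of a power of \<open>h\<close>, assumed in the individual lemmas,
  serves the other pairs. \<open>C0\<close> bounds T(s) J itself, as the Laplace transform
  requires.\<close>

locale orbit_kernel = growth_semigroup T A D \<alpha> \<beta>
  for T :: "real \<Rightarrow> 'x::{complex_normed_vector,banach} \<Rightarrow> 'x" and A D \<alpha> \<beta> +
  fixes J :: "'z::{complex_normed_vector,banach} \<Rightarrow> 'x" and m :: nat and h :: "real \<Rightarrow> real" and C0 H0 :: real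
  assumes J: "bounded_clinear J"
    and b0: "\<And>s z. s \<ge> 0 \<Longrightarrow> norm (T s (J z)) \<le> C0 * norm z"
    and hb: "\<And>s z. s \<ge> 0 \<Longrightarrow> s ^ m * norm (T s (J z)) \<le> h s * norm z"
    and hm: "h \<in> borel_measurable borel" and h0: "\<And>s. 0 \<le> h s" and hH: "\<And>s. h s \<le> H0"
begin

definition kern :: "real \<Rightarrow> 'z \<Rightarrow> 'x" where
  "kern s z = indicat_real {0..} s *\<^sub>R ((s ^ m / fact m) *\<^sub>R T (max 0 s) (J z))"

definition majorant :: "(real \<Rightarrow> 'z) \<Rightarrow> real \<Rightarrow> ennreal" where
  "majorant f t = (\<integral>\<^sup>+s. ennreal (h s * norm (f (t + s))) \<partial>lebesgue)"

text \<open>The value 0 where the majorant is infinite keeps the norm estimate by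
  \<open>majorant\<close> valid at every t; linearity is asked only almost everywhere. The sign
  turns the convolution into the multiplier operator of the power m + 1.\<close>

definition conv_op :: "(real \<Rightarrow> 'z) \<Rightarrow> real \<Rightarrow> 'x" where
  "conv_op f t = (if majorant f t < \<infinity> then scaleC ((-1) ^ Suc m) (orbit_convolution m J f t) else 0)"

lemma orbit_convolution_kern: "orbit_convolution m J f t = integral UNIV (\<lambda>s. kern s (f (t + s)))"
  by (simp add: orbit_convolution_def kern_def)

lemma hm_lebesgue: "h \<in> borel_measurable lebesgue"
  using measurable_completion[of h lborel borel] hm by simp

lemma J_linear: "bounded_linear J"
  by (rule bounded_clinear_bounded_linear[OF J])

lemma kern_bound: "norm (kern s z) \<le> h s * norm z"
proof (cases "s \<ge> 0")
  case True
  have "s ^ m / fact m \<le> s ^ m / 1" using True by (intro divide_left_mono) auto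
  then have "(s ^ m / fact m) * norm (T s (J z)) \<le> s ^ m * norm (T s (J z))"
    by (intro mult_right_mono) auto
  then show ?thesis using hb[OF True, of z] True by (simp add: kern_def)
qed (use h0 in \<open>simp add: kern_def\<close>)

lemma kern_add: "kern s (a + scaleC c b) = kern s a + scaleC c (kern s b)"
proof -
  have "T (max 0 s) (J (a + scaleC c b)) = T (max 0 s) (J a) + scaleC c (T (max 0 s) (J b))"
    using T_bounded_clinear[of "max 0 s"] J by (auto simp: bounded_clinear_def clinear_def)
  then show ?thesis by (simp add: kern_def scaleR_add_right scaleC_scaleR_right)
qed

lemma TJ_continuous: "continuous_on UNIV (\<lambda>(s,z). (s ^ m / fact m) *\<^sub>R T (max 0 s) (J z))"
proof -
  have "continuous_on UNIV (\<lambda>p::real\<times>'z. (fst p, J (snd p)))"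
    by (intro continuous_intros bounded_linear.continuous_on[OF J_linear])
  from continuous_on_compose2[OF T_jointly_continuous this] show ?thesis
    unfolding case_prod_beta by (intro continuous_intros) auto
qed

lemma kern_measurable:
  assumes "strongly_measurable lebesgue f"
  shows "strongly_measurable lebesgue (\<lambda>s. kern s (f (t + s)))"
proof -
  have "strongly_measurable lebesgue (\<lambda>s. f (t + 1 * s))" by (rule strongly_measurable_affine[OF assms]) simp
  then have "strongly_measurable lebesgue (\<lambda>s. (s ^ m / fact m) *\<^sub>R T (max 0 s) (J (f (t + s))))"
    by (intro strongly_measurable_compose2[OF strongly_measurable_continuous[OF continuous_on_id] _ TJ_continuous]) simp
  then show ?thesis unfolding kern_def by (intro strongly_measurable_indicator) auto
qed

lemma majorant_integrable:
  assumes f: "strongly_measurable lebesgue f" and N: "majorant f t < \<infinity>"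
  shows "integrable lebesgue (\<lambda>s. h s * norm (f (t + s)))"
proof (rule integrableI_bounded)
  have "strongly_measurable lebesgue (\<lambda>s. f (t + 1 * s))" by (rule strongly_measurable_affine[OF f]) simp
  then have "(\<lambda>s. norm (f (t + s))) \<in> borel_measurable lebesgue" using strongly_measurable_norm by auto
  then show "(\<lambda>s. h s * norm (f (t + s))) \<in> borel_measurable lebesgue" using hm_lebesgue by auto
  show "(\<integral>\<^sup>+ x. ennreal (norm (h x * norm (f (t + x)))) \<partial>lebesgue) < \<infinity>"
    using N h0 by (simp add: majorant_def abs_mult)
qed

lemma kern_integrable:
  assumes "strongly_measurable lebesgue f" "majorant f t < \<infinity>"
  shows "bochner_integrable (\<lambda>s. kern s (f (t + s)))"
  by (rule bochner_integrable_bound[OF kern_measurable[OF assms(1)] majorant_integrable[OF assms]])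
    (simp add: kern_bound)

lemma conv_op_bound:
  assumes f: "strongly_measurable lebesgue f"
  shows "ennreal (norm (conv_op f t)) \<le> majorant f t"
proof (cases "majorant f t < \<infinity>")
  case True
  have "norm (conv_op f t) = norm (integral UNIV (\<lambda>s. kern s (f (t + s))))"
    using True by (simp add: conv_op_def norm_scaleC norm_power orbit_convolution_kern del: power_Suc)
  also have "\<dots> \<le> integral\<^sup>L lebesgue (\<lambda>s. h s * norm (f (t + s)))"
    by (rule bochner_integral_bound[OF kern_integrable[OF f True] majorant_integrable[OF f True]]) (simp add: kern_bound)
  also have "ennreal \<dots> = majorant f t"
    unfolding majorant_def using majorant_integrable[OF f True] h0 by (intro nn_integral_eq_integral[symmetric]) auto
  finally show ?thesis using ennreal_leI by fastforce
qed (simp add: conv_op_def)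

lemma majorant_finite_L1:
  assumes "bochner_integrable g" shows "majorant g t < \<infinity>"
proof -
  have i: "integrable lebesgue (\<lambda>s. H0 * norm (g (t + 1 * s)))"
    by (intro integrable_mult_right integrable_affine_lebesgue bochner_integrableD(2)[OF assms]) simp
  have "majorant g t \<le> (\<integral>\<^sup>+s. ennreal (norm (H0 * norm (g (t + 1 * s)))) \<partial>lebesgue)"
    unfolding majorant_def
  proof (intro nn_integral_mono ennreal_leI)
    fix s
    have "h s * norm (g (t + s)) \<le> H0 * norm (g (t + s))" by (intro mult_right_mono hH) auto
    then show "h s * norm (g (t + s)) \<le> norm (H0 * norm (g (t + 1 * s)))" by simp
  qed
  also have "\<dots> < \<infinity>" using i unfolding integrable_iff_bounded by blast
  finally show ?thesis .
qed

text \<open>Substituting u = t + s moves the translation from \<open>g\<close>, which is merely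
  integrable, onto the kernel. For fixed u the kernel is continuous in t at \<open>t0\<close> unless
  u = t0, a null set, and \<open>H0 * norm (g u)\<close> dominates.\<close>

lemma orbit_convolution_continuous:
  assumes g: "bochner_integrable g"
  shows "continuous_on UNIV (orbit_convolution m J g)"
proof (rule continuous_at_imp_continuous_on, rule ballI)
  fix t0 :: real
  have gm: "strongly_measurable lebesgue g" by (rule bochner_integrableD(1)[OF g])
  have eq: "orbit_convolution m J g t = integral UNIV (\<lambda>u. kern (u - t) (g u))"
    and km: "strongly_measurable lebesgue (\<lambda>u. kern (u - t) (g u))" for t
  proof -
    have kb: "bochner_integrable (\<lambda>s. kern s (g (t + s)))" by (rule kern_integrable[OF gm majorant_finite_L1[OF g]])
    show "orbit_convolution m J g t = integral UNIV (\<lambda>u. kern (u - t) (g u))"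
      using bochner_affine(2)[OF kb, of 1 "-t"] by (simp add: orbit_convolution_kern)
    show "strongly_measurable lebesgue (\<lambda>u. kern (u - t) (g u))"
      using bochner_integrableD(1)[OF bochner_affine(1)[OF kb, of 1 "-t"]] by simp
  qed
  have "orbit_convolution m J g \<midarrow>t0\<rightarrow> orbit_convolution m J g t0"
    unfolding tendsto_at_iff_sequentially comp_def
  proof (intro allI impI)
    fix X :: "nat \<Rightarrow> real" assume X: "X \<longlonglongrightarrow> t0"
    show "(\<lambda>n. orbit_convolution m J g (X n)) \<longlonglongrightarrow> orbit_convolution m J g t0"
      unfolding eq
    proof (rule bochner_dominated_convergence(2)[OF km km integrable_mult_right[OF bochner_integrableD(2)[OF g], of H0]])
      show "AE u in lebesgue. norm (kern (u - X n) (g u)) \<le> H0 * norm (g u)" for n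
        using kern_bound hH by (intro AE_I2) (meson mult_right_mono norm_ge_zero order_trans)
      have "AE u in lebesgue. u \<noteq> t0" by (rule AE_I[where N="{t0}"]) auto
      then show "AE u in lebesgue. (\<lambda>n. kern (u - X n) (g u)) \<longlonglongrightarrow> kern (u - t0) (g u)"
      proof eventually_elim
        case (elim u)
        have uX: "(\<lambda>n. u - X n) \<longlonglongrightarrow> u - t0" by (intro tendsto_intros X)
        have "isCont (\<lambda>(s,z). (s ^ m / fact m) *\<^sub>R T (max 0 s) (J z)) (u - t0, g u)"
          using TJ_continuous by (simp add: continuous_on_eq_continuous_at)
        from isCont_tendsto_compose[OF this tendsto_Pair[OF uX tendsto_const]]
        have c: "(\<lambda>n. ((u - X n) ^ m / fact m) *\<^sub>R T (max 0 (u - X n)) (J (g u)))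
            \<longlonglongrightarrow> ((u - t0) ^ m / fact m) *\<^sub>R T (max 0 (u - t0)) (J (g u))" by simp
        have "(\<lambda>n. indicat_real {0..} (u - X n)) \<longlonglongrightarrow> indicat_real {0..} (u - t0)"
        proof (cases "u - t0 > 0")
          case True
          from order_tendstoD(1)[OF uX this]
          have "eventually (\<lambda>n. indicat_real {0..} (u - X n) = indicat_real {0..} (u - t0)) sequentially"
            by eventually_elim (use True in \<open>auto simp: indicator_def\<close>)
          then show ?thesis by (rule tendsto_eventually)
        next
          case False
          then have neg: "u - t0 < 0" using elim by simp
          from order_tendstoD(2)[OF uX this]
          have "eventually (\<lambda>n. indicat_real {0..} (u - X n) = indicat_real {0..} (u - t0)) sequentially"
            by eventually_elim (use neg in \<open>auto simp: indicator_def\<close>)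
          then show ?thesis by (rule tendsto_eventually)
        qed
        then show ?case unfolding kern_def by (rule tendsto_scaleR[OF _ c])
      qed
    qed
  qed
  then show "isCont (orbit_convolution m J g) t0" by (simp add: isCont_def)
qed

lemma majorant_measurable:
  assumes f: "strongly_measurable lebesgue f"
  shows "majorant f \<in> borel_measurable borel"
proof -
  obtain F' where F': "F' \<in> borel_measurable borel" "\<And>x. 0 \<le> F' x" "AE x in lebesgue. norm (f x) = F' x"
    "\<And>t. (\<integral>\<^sup>+s. ennreal (h s * norm (f (t + s))) \<partial>lebesgue) = (\<integral>\<^sup>+s. ennreal (h s * F' (t + s)) \<partial>lborel)"
    by (rule nn_integral_kernel_borel[OF strongly_measurable_norm[OF f] norm_ge_zero hm]) (rule that)
  note [measurable] = F'(1) hm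
  show ?thesis unfolding majorant_def[abs_def] F'(4) by measurable
qed

lemma in_Lp_locally_integrable:
  assumes p: "1 \<le> p" and f: "in_Lp p f"
  shows "bochner_integrable (\<lambda>t. indicat_real {- real j..real j} t *\<^sub>R f t)"
proof (rule bochner_integrable_bound)
  have fm: "strongly_measurable lebesgue f" and fi: "integrable lebesgue (\<lambda>t. norm (f t) powr p)"
    using f by (auto simp: in_Lp_def)
  show "strongly_measurable lebesgue (\<lambda>t. indicat_real {- real j..real j} t *\<^sub>R f t)"
    by (intro strongly_measurable_indicator fm) auto
  have "integrable lborel (indicat_real {- real j..real j})" by (rule integrable_real_indicator) auto
  then have "integrable lebesgue (indicat_real {- real j..real j})" by (subst integrable_completion) auto
  then show "integrable lebesgue (\<lambda>t. indicat_real {- real j..real j} t + norm (f t) powr p)"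
    using fi by (rule Bochner_Integration.integrable_add)
  show "AE t in lebesgue. norm (indicat_real {- real j..real j} t *\<^sub>R f t) \<le> indicat_real {- real j..real j} t + norm (f t) powr p"
  proof (rule AE_I2)
    fix t
    have "norm (f t) \<le> 1 + norm (f t) powr p"
    proof (cases "norm (f t) \<le> 1")
      case False
      then have "norm (f t) powr 1 \<le> norm (f t) powr p" using p by (intro powr_mono) auto
      then show ?thesis using False by simp
    qed (simp add: add_increasing2)
    then show "norm (indicat_real {- real j..real j} t *\<^sub>R f t) \<le> indicat_real {- real j..real j} t + norm (f t) powr p"
      by (auto simp: indicator_def)
  qed
qed

text \<open>An L^p function need not be integrable, but its restrictions to [-j, j] are. Their
  convolutions are continuous and converge wherever the majorant is finite, which is a Borel
  set.\<close>

lemma conv_op_measurable: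
  assumes p: "1 \<le> p" and f: "in_Lp p f"
  shows "strongly_measurable lebesgue (conv_op f)"
proof -
  have fm: "strongly_measurable lebesgue f" using f by (auto simp: in_Lp_def)
  define g where "g j t = indicat_real {- real j..real j} t *\<^sub>R f t" for j t
  have gb: "bochner_integrable (g j)" for j
    unfolding g_def[abs_def] by (rule in_Lp_locally_integrable[OF p f])
  have gle: "norm (g j t) \<le> norm (f t)" for j t by (simp add: g_def indicator_def)
  have glim: "(\<lambda>j. g j t) \<longlonglongrightarrow> f t" for t
  proof -
    obtain N0 :: nat where N0: "\<bar>t\<bar> \<le> real N0" using real_arch_simple by blast
    have "eventually (\<lambda>j. g j t = f t) sequentially"
      unfolding eventually_sequentially using N0 by (intro exI[of _ N0]) (auto simp: g_def indicator_def)
    then show ?thesis by (rule tendsto_eventually)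
  qed
  define Gd where "Gd = {t. majorant f t < \<infinity>}"
  have "Gd = majorant f -` {..<\<infinity>} \<inter> space borel" by (auto simp: Gd_def)
  then have "Gd \<in> sets borel" using measurable_sets[OF majorant_measurable[OF fm], of "{..<\<infinity>}"] by simp
  then have Gm: "Gd \<in> sets lebesgue" by simp
  show ?thesis
  proof (rule strongly_measurable_limit)
    show "strongly_measurable lebesgue (\<lambda>t. if t \<in> Gd then scaleC ((-1) ^ Suc m) (orbit_convolution m J (g j) t) else 0)" for j
      by (intro strongly_measurable_if Gm strongly_measurable_const strongly_measurable_continuous
          continuous_intros orbit_convolution_continuous gb)
    fix t :: real
    show "(\<lambda>j. if t \<in> Gd then scaleC ((-1) ^ Suc m) (orbit_convolution m J (g j) t) else 0) \<longlonglongrightarrow> conv_op f t"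
    proof (cases "t \<in> Gd")
      case True
      then have N: "majorant f t < \<infinity>" by (simp add: Gd_def)
      have "(\<lambda>j. orbit_convolution m J (g j) t) \<longlonglongrightarrow> orbit_convolution m J f t"
        unfolding orbit_convolution_kern
      proof (rule bochner_dominated_convergence(2)[OF kern_measurable[OF bochner_integrableD(1)[OF gb]] kern_measurable[OF fm] majorant_integrable[OF fm N]])
        show "AE s in lebesgue. norm (kern s (g j (t + s))) \<le> h s * norm (f (t + s))" for j
          by (intro AE_I2 order_trans[OF kern_bound] mult_left_mono gle h0)
        show "AE s in lebesgue. (\<lambda>j. kern s (g j (t + s))) \<longlonglongrightarrow> kern s (f (t + s))"
        proof (rule AE_I2)
          fix s
          have "bounded_linear (\<lambda>z. kern s z)" unfolding kern_def
            by (intro bounded_linear_compose[OF bounded_linear_scaleR_right] bounded_linear_compose[OF T_bounded_linear] J_linear) simp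
          then show "(\<lambda>j. kern s (g j (t + s))) \<longlonglongrightarrow> kern s (f (t + s))"
            by (rule bounded_linear.tendsto[OF _ glim])
        qed
      qed
      then have "(\<lambda>j. scaleC ((-1) ^ Suc m) (orbit_convolution m J (g j) t)) \<longlonglongrightarrow> scaleC ((-1) ^ Suc m) (orbit_convolution m J f t)"
        by (rule tendsto_scaleC[OF tendsto_const])
      then show ?thesis using True N by (simp add: conv_op_def)
    next
      case False
      then show ?thesis by (simp add: conv_op_def Gd_def)
    qed
  qed
qed

lemma conv_op_linear:
  assumes f: "strongly_measurable lebesgue f" and g: "strongly_measurable lebesgue g"
    and N: "majorant f t < \<infinity>" "majorant g t < \<infinity>"
  shows "conv_op (\<lambda>s. f s + scaleC c (g s)) t = conv_op f t + scaleC c (conv_op g t)"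
proof -
  let ?f = "\<lambda>s. f s + scaleC c (g s)"
  have i: "integrable lebesgue (\<lambda>s. h s * norm (f (t + s)) + cmod c * (h s * norm (g (t + s))))"
    by (intro Bochner_Integration.integrable_add integrable_mult_right majorant_integrable f g N)
  have "majorant ?f t \<le> (\<integral>\<^sup>+s. ennreal (norm (h s * norm (f (t + s)) + cmod c * (h s * norm (g (t + s))))) \<partial>lebesgue)"
    unfolding majorant_def
  proof (intro nn_integral_mono ennreal_leI)
    fix s
    have "norm (?f (t + s)) \<le> norm (f (t + s)) + cmod c * norm (g (t + s))"
      by (rule norm_triangle_le) (simp add: norm_scaleC)
    from mult_left_mono[OF this h0[of s]]
    show "h s * norm (?f (t + s)) \<le> norm (h s * norm (f (t + s)) + cmod c * (h s * norm (g (t + s))))"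
      by (simp add: algebra_simps)
  qed
  also have "\<dots> < \<infinity>" using i unfolding integrable_iff_bounded by blast
  finally have N': "majorant ?f t < \<infinity>" .
  have bf: "bochner_integrable (\<lambda>s. kern s (f (t + s)))" and bg: "bochner_integrable (\<lambda>s. kern s (g (t + s)))"
    by (rule kern_integrable[OF f N(1)], rule kern_integrable[OF g N(2)])
  have "orbit_convolution m J ?f t = orbit_convolution m J f t + scaleC c (orbit_convolution m J g t)"
    unfolding orbit_convolution_kern kern_add
    by (simp add: bochner_integral_add[OF bf bochner_integrable_linear[OF bg bounded_linear_scaleC_right]]
        bochner_integral_linear[OF bg bounded_linear_scaleC_right])
  then show ?thesis using N N' by (simp add: conv_op_def scaleC_add_right scaleC_scaleC mult.commute)
qed

lemma conv_op_multiplier_op: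
  assumes f: "dot_schwartz f"
  shows "conv_op f t = multiplier_op (\<lambda>\<xi> z. (RR (\<i> * complex_of_real \<xi>) ^^ Suc m) (J z)) f t"
proof -
  have "bochner_integrable f" using schwartz_bochner_integrable[of f 0] f by (simp add: dot_schwartz_def)
  then have N: "majorant f t < \<infinity>" by (rule majorant_finite_L1)
  have "s ^ m * norm (T s (J z)) \<le> H0 * norm z" if "s \<ge> 0" for s z
    using hb[OF that, of z] mult_right_mono[OF hH[of s] norm_ge_zero[of z]] by linarith
  from multiplier_resolvent_eq_convolution[OF J f b0 this, where t=t] show ?thesis
    using N by (simp add: conv_op_def del: funpow.simps)
qed

lemma conv_op_Linfty:
  assumes r: "1 \<le> p" "1 \<le> r" "1 / p + 1 / r = 1" "integrable lebesgue (\<lambda>x. h x powr r)"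
  shows "\<exists>C. \<forall>f. in_Lp p f \<longrightarrow> (AE t in lebesgue. majorant f t < \<infinity>) \<and> Lq_bounded \<infinity> (conv_op f) (C * Lp_norm p f)"
proof (intro exI allI impI)
  fix f :: "real \<Rightarrow> 'z" assume f: "in_Lp p f"
  have fm: "strongly_measurable lebesgue f" and fi: "integrable lebesgue (\<lambda>t. norm (f t) powr p)"
    using f by (auto simp: in_Lp_def)
  let ?H = "\<integral>x. h x powr r \<partial>lebesgue"
  have N: "majorant f t \<le> ennreal ((1 + ?H) * Lp_norm p f)" for t
    unfolding majorant_def Lp_norm_def
    using hoelder_convolution[OF strongly_measurable_norm[OF fm] norm_ge_zero fi hm h0 r(4,1,2,3), of t] by (simp add: mult.commute)
  have H: "0 \<le> ?H" by (intro integral_nonneg_AE) auto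
  have "norm (conv_op f t) \<le> (1 + ?H) * Lp_norm p f" for t
    using order_trans[OF conv_op_bound[OF fm] N, of t] H by (subst (asm) ennreal_le_iff) (auto simp: Lp_norm_def)
  moreover have "majorant f t < \<infinity>" for t using N[of t] by (rule le_less_trans) simp
  ultimately show "(AE t in lebesgue. majorant f t < \<infinity>) \<and> Lq_bounded \<infinity> (conv_op f) ((1 + ?H) * Lp_norm p f)"
    using conv_op_measurable[OF r(1) f] by (simp add: Lq_bounded_def)
qed

lemma conv_op_L1_Linfty:
  shows "\<exists>C. \<forall>f. in_Lp 1 f \<longrightarrow> (AE t in lebesgue. majorant f t < \<infinity>) \<and> Lq_bounded \<infinity> (conv_op f) (C * Lp_norm 1 f)"
proof (intro exI allI impI)
  fix f :: "real \<Rightarrow> 'z" assume f: "in_Lp 1 f"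
  have fm: "strongly_measurable lebesgue f" and fi: "integrable lebesgue (\<lambda>t. norm (f t))"
    using f by (auto simp: in_Lp_def)
  have bf: "bochner_integrable f" using fm fi by (simp add: bochner_integrable_def)
  have "norm (conv_op f t) \<le> H0 * Lp_norm 1 f" for t
  proof -
    have N: "majorant f t < \<infinity>" by (rule majorant_finite_L1[OF bf])
    have "norm (conv_op f t) = norm (integral UNIV (\<lambda>s. kern s (f (t + s))))"
      using N by (simp add: conv_op_def norm_scaleC norm_power orbit_convolution_kern del: power_Suc)
    also have "\<dots> \<le> integral\<^sup>L lebesgue (\<lambda>s. H0 * norm (f (t + 1 * s)))"
    proof (rule bochner_integral_bound[OF kern_integrable[OF fm N]])
      show "integrable lebesgue (\<lambda>s. H0 * norm (f (t + 1 * s)))"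
        by (intro integrable_mult_right integrable_affine_lebesgue fi) simp
      show "AE s in lebesgue. norm (kern s (f (t + s))) \<le> H0 * norm (f (t + 1 * s))"
        using kern_bound hH by (intro AE_I2) (simp, meson mult_right_mono norm_ge_zero order_trans)
    qed
    also have "\<dots> = H0 * integral\<^sup>L lebesgue (\<lambda>s. norm (f (t + 1 * s)))" by simp
    also have "integral\<^sup>L lebesgue (\<lambda>s. norm (f (t + 1 * s))) = integral\<^sup>L lebesgue (\<lambda>s. norm (f s))"
      using lebesgue_integral_real_affine[of 1 "\<lambda>s. norm (f s)" t] by simp
    finally show ?thesis by (simp add: Lp_norm_def integral_nonneg_AE)
  qed
  moreover have "majorant f t < \<infinity>" for t by (rule majorant_finite_L1[OF bf])
  ultimately show "(AE t in lebesgue. majorant f t < \<infinity>) \<and> Lq_bounded \<infinity> (conv_op f) (H0 * Lp_norm 1 f)"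
    using conv_op_measurable[OF _ f] by (simp add: Lq_bounded_def)
qed

lemma conv_op_Lq:
  assumes r: "1 \<le> p" "p \<le> q" "1 \<le> r" "1 / p + 1 / r = 1 + 1 / q" "integrable lebesgue (\<lambda>x. h x powr r)"
  shows "\<exists>C. \<forall>f. in_Lp p f \<longrightarrow> (AE t in lebesgue. majorant f t < \<infinity>) \<and> Lq_bounded (ereal q) (conv_op f) (C * Lp_norm p f)"
proof (intro exI allI impI)
  fix f :: "real \<Rightarrow> 'z" assume f: "in_Lp p f"
  have fm: "strongly_measurable lebesgue f" and fi: "integrable lebesgue (\<lambda>t. norm (f t) powr p)"
    using f by (auto simp: in_Lp_def)
  define H where "H = (\<integral>x. h x powr r \<partial>lebesgue)"
  define B where "B = Lp_norm p f"
  have H: "0 \<le> H" unfolding H_def by (intro integral_nonneg_AE) auto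
  have B: "0 \<le> B" by (simp add: B_def Lp_norm_def)
  have q: "q > 0" using r by simp
  obtain u where u: "u \<in> borel_measurable borel" "(\<integral>\<^sup>+t. u t \<partial>lborel) \<le> ennreal H"
    "\<And>t. u t < \<infinity> \<Longrightarrow> majorant f t \<le> ennreal (B * (2 + H) * enn2real (u t) powr (1 / q))"
    using young_convolution[OF strongly_measurable_norm[OF fm] norm_ge_zero fi hm h0 r(5,1,2,3,4)]
    unfolding majorant_def B_def H_def Lp_norm_def by blast
  have "(\<integral>\<^sup>+t. u t \<partial>lborel) \<noteq> \<infinity>" using u(2) by (auto simp: top_unique)
  then have "AE t in lborel. u t \<noteq> \<infinity>" using u(1) by (intro nn_integral_PInf_AE) auto
  then have uf: "AE t in lebesgue. u t < \<infinity>" using AE_lborel_lebesgue by (auto simp: less_top)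
  have c1: "AE t in lebesgue. majorant f t < \<infinity>"
    using uf by eventually_elim (rule le_less_trans[OF u(3)], auto)
  \<comment> \<open>The infinite values of \<open>u\<close> form a null set; passing to reals sends
    them to 0, so that \<open>v\<close> stays below \<open>u\<close> and keeps the bound on the
    integral.\<close>
  define v where "v t = enn2real (u t)" for t
  have vm: "v \<in> borel_measurable borel" unfolding v_def[abs_def] using u(1) by measurable
  have nnv: "(\<integral>\<^sup>+t. ennreal (v t) \<partial>lborel) \<le> ennreal H"
  proof (rule order_trans[OF nn_integral_mono u(2)])
    show "ennreal (v t) \<le> u t" for t unfolding v_def by (cases "u t") auto
  qed
  have iv: "integrable lborel v"
    using vm le_less_trans[OF nnv, of \<infinity>] by (intro integrableI_nonneg) (auto simp: v_def)
  have iv': "integrable lebesgue v" using iv vm by (subst integrable_completion) auto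
  have intv: "integral\<^sup>L lebesgue v \<le> H"
  proof -
    have "integral\<^sup>L lebesgue v = integral\<^sup>L lborel v" using vm by (subst integral_completion) auto
    moreover have "ennreal (integral\<^sup>L lborel v) \<le> ennreal H"
      using nnv nn_integral_eq_integral[OF iv] by (simp add: v_def)
    ultimately show ?thesis using H by simp
  qed
  have le: "AE t in lebesgue. norm (conv_op f t) powr q \<le> (B * (2 + H)) powr q * v t"
    using uf
  proof eventually_elim
    case (elim t)
    have "ennreal (norm (conv_op f t)) \<le> ennreal (B * (2 + H) * v t powr (1 / q))"
      using order_trans[OF conv_op_bound[OF fm] u(3)[OF elim]] by (simp add: v_def)
    then have "norm (conv_op f t) \<le> B * (2 + H) * v t powr (1 / q)"
      using B H by (subst (asm) ennreal_le_iff) auto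
    then have "norm (conv_op f t) powr q \<le> (B * (2 + H) * v t powr (1 / q)) powr q"
      using q by (intro powr_mono2) auto
    also have "\<dots> = (B * (2 + H)) powr q * v t"
      using B H q by (simp add: powr_mult powr_powr v_def)
    finally show ?case .
  qed
  have cm: "strongly_measurable lebesgue (conv_op f)" by (rule conv_op_measurable[OF r(1) f])
  have nm: "(\<lambda>t. norm (conv_op f t) powr q) \<in> borel_measurable lebesgue"
    using strongly_measurable_norm[OF cm] by measurable
  have ci: "integrable lebesgue (\<lambda>t. norm (conv_op f t) powr q)"
    by (rule Bochner_Integration.integrable_bound[OF integrable_mult_right[OF iv', of "(B * (2 + H)) powr q"] nm])
      (use le in \<open>auto elim!: eventually_mono intro: order_trans[OF _ abs_ge_self]\<close>)
  have "(\<integral>t. norm (conv_op f t) powr q \<partial>lebesgue) \<le> (\<integral>t. (B * (2 + H)) powr q * v t \<partial>lebesgue)"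
    by (rule integral_mono_AE[OF ci integrable_mult_right[OF iv'] le])
  also have "\<dots> \<le> (B * (2 + H)) powr q * H" using intv by (simp add: mult_left_mono)
  finally have "Lp_norm q (conv_op f) \<le> ((B * (2 + H)) powr q * H) powr (1 / q)"
    unfolding Lp_norm_def using q by (intro powr_mono2) (auto intro: integral_nonneg_AE)
  also have "\<dots> = (2 + H) * H powr (1 / q) * B"
    using B H q by (simp add: powr_mult powr_powr)
  finally have "Lp_norm q (conv_op f) \<le> (2 + H) * H powr (1 / q) * B" .
  then show "(AE t in lebesgue. majorant f t < \<infinity>) \<and>
    Lq_bounded (ereal q) (conv_op f) (((2 + (\<integral>x. h x powr r \<partial>lebesgue)) * (\<integral>x. h x powr r \<partial>lebesgue) powr (1 / q)) * Lp_norm p f)"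
    using c1 cm ci by (simp add: Lq_bounded_def in_Lp_def B_def H_def)
qed

end

section \<open>From decay to multipliers\<close>

lemma integrable_powr_decay:
  fixes b :: real
  assumes b: "b > 1"
  shows "integrable lebesgue (\<lambda>s. (1 + \<bar>s\<bar>) powr (- b))"
proof -
  define g where "g x = indicat_real {1..} x * x powr (- b)" for x
  have "((\<lambda>x. x powr (- b)) has_integral - (1 powr (- b + 1)) / (- b + 1)) {1..}"
    using b by (intro has_integral_powr_to_inf) auto
  then have "(\<lambda>x. x powr (- b)) absolutely_integrable_on {1..}"
    by (intro nonnegative_absolutely_integrable_1) auto
  then have gi: "integrable lebesgue g" unfolding set_integrable_def g_def[abs_def] by simp
  have "integrable lebesgue (\<lambda>s. g (1 + 1 * s) + g (1 + (-1) * s))"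
    by (intro Bochner_Integration.integrable_add integrable_affine_lebesgue gi) auto
  then show ?thesis
  proof (rule Bochner_Integration.integrable_bound)
    show "(\<lambda>s. (1 + \<bar>s\<bar>) powr (- b)) \<in> borel_measurable lebesgue"
      using measurable_completion[of "\<lambda>s. (1 + \<bar>s\<bar>) powr (- b)" lborel borel] by simp
    show "AE s in lebesgue. norm ((1 + \<bar>s\<bar>) powr (- b)) \<le> norm (g (1 + 1 * s) + g (1 + (-1) * s))"
      by (rule AE_I2) (auto simp: g_def indicator_def abs_if)
  qed
qed

context growth_semigroup
begin

lemma resolvent_multiplier_basic:
  fixes J :: "'z::{complex_normed_vector,banach} \<Rightarrow> 'x"
  assumes J: "bounded_clinear J"
  shows "\<xi> \<noteq> 0 \<Longrightarrow> bounded_clinear (\<lambda>z. (RR (\<i> * complex_of_real \<xi>) ^^ k) (J z))"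
    and "strongly_measurable lebesgue (\<lambda>\<xi>. (RR (\<i> * complex_of_real \<xi>) ^^ k) x)"
    and "\<exists>a g. a \<ge> 0 \<and> integrable lborel g \<and>
        (\<forall>\<xi>. \<xi> \<noteq> 0 \<longrightarrow> \<bar>\<xi>\<bar> powr a * (1 + \<bar>\<xi>\<bar>) powr (- 2 * a) *
          onorm (\<lambda>z. (RR (\<i> * complex_of_real \<xi>) ^^ k) (J z)) \<le> g \<xi>)"
proof -
  have Jc: "clinear J" and "\<exists>K. \<forall>z. norm (J z) \<le> norm z * K"
    using J unfolding bounded_clinear_def by auto
  then obtain K where K: "\<And>z. norm (J z) \<le> norm z * K" by blast
  have K': "norm (J z) \<le> norm z * \<bar>K\<bar>" for z
    using K[of z] by (rule order_trans) (intro mult_left_mono, auto)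
  have RRJ: "norm ((RR l ^^ k) (J z)) \<le> B * \<bar>K\<bar> * norm z"
    if "\<And>x. norm ((RR l ^^ k) x) \<le> B * norm x" "0 \<le> B" for l z B
  proof -
    have "norm ((RR l ^^ k) (J z)) \<le> B * norm (J z)" by (rule that(1))
    also have "\<dots> \<le> B * (norm z * \<bar>K\<bar>)" by (intro mult_left_mono K' that(2))
    finally show ?thesis by (simp add: mult_ac)
  qed
  obtain C P where C: "C \<ge> 0" "\<And>l x. Re l \<le> 0 \<Longrightarrow> l \<noteq> 0 \<Longrightarrow>
      norm ((RR l ^^ k) x) \<le> C * ((1 + cmod l)\<^sup>2 / cmod l) ^ P * norm x"
    using RR_funpow_bound[of k] by blast
  show "bounded_clinear (\<lambda>z. (RR (\<i> * complex_of_real \<xi>) ^^ k) (J z))" if "\<xi> \<noteq> 0"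
  proof -
    let ?l = "\<i> * complex_of_real \<xi>"
    have l: "Re ?l \<le> 0" "?l \<noteq> 0" using that by auto
    have "clinear (RR ?l ^^ k)" using RR_funpow_bounded_clinear[OF l] by (simp add: bounded_clinear_def)
    moreover have "norm ((RR ?l ^^ k) (J z)) \<le> norm z * (C * ((1 + cmod ?l)\<^sup>2 / cmod ?l) ^ P * \<bar>K\<bar>)" for z
      using RRJ[of ?l "C * ((1 + cmod ?l)\<^sup>2 / cmod ?l) ^ P" z] C(2)[OF l] C(1) by (simp add: mult_ac)
    ultimately show ?thesis using Jc unfolding bounded_clinear_def clinear_def by auto
  qed
  show "strongly_measurable lebesgue (\<lambda>\<xi>. (RR (\<i> * complex_of_real \<xi>) ^^ k) x)"
    using resolvent_fourier_measurable[of "\<lambda>_. x" 0 k] by (simp add: Complex_eq)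
  show "\<exists>a g. a \<ge> 0 \<and> integrable lborel g \<and>
        (\<forall>\<xi>. \<xi> \<noteq> 0 \<longrightarrow> \<bar>\<xi>\<bar> powr a * (1 + \<bar>\<xi>\<bar>) powr (- 2 * a) *
          onorm (\<lambda>z. (RR (\<i> * complex_of_real \<xi>) ^^ k) (J z)) \<le> g \<xi>)"
  \<comment> \<open>With a = P + 2 the weight |xi|^a (1 + |xi|)^(-2 a) cancels the resolvent bound
    of order P and leaves |xi|^2 / (1 + |xi|)^4, which is at most 1 / (1 + xi^2).\<close>
  proof (intro exI[of _ "real (P + 2)"] exI[of _ "\<lambda>\<xi>. C * \<bar>K\<bar> / (1 + \<xi>\<^sup>2)"] conjI allI impI)
    show "integrable lborel (\<lambda>\<xi>. C * \<bar>K\<bar> / (1 + \<xi>\<^sup>2))"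
      using integrable_inverse_square_const[of "C * \<bar>K\<bar>"] by (subst (asm) integrable_completion) auto
    fix \<xi> :: real assume x: "\<xi> \<noteq> 0"
    let ?l = "\<i> * complex_of_real \<xi>"
    have l: "Re ?l \<le> 0" "?l \<noteq> 0" using x by auto
    have cl: "cmod ?l = \<bar>\<xi>\<bar>" by (simp add: norm_mult)
    let ?y = "1 + \<bar>\<xi>\<bar>"
    have y: "?y > 0" by simp
    have on: "onorm (\<lambda>z. (RR ?l ^^ k) (J z)) \<le> C * (?y\<^sup>2 / \<bar>\<xi>\<bar>) ^ P * \<bar>K\<bar>"
      using C by (intro onorm_bound RRJ) (auto simp: C(2)[OF l, unfolded cl] intro!: mult_nonneg_nonneg)
    have e1: "\<bar>\<xi>\<bar> powr real (P + 2) = \<bar>\<xi>\<bar> ^ (P + 2)" using x by (intro powr_realpow) auto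
    have e2: "?y powr (- 2 * real (P + 2)) = 1 / ?y ^ (2 * (P + 2))"
    proof -
      have "- 2 * real (P + 2) = - real (2 * (P + 2))" by simp
      then show ?thesis using y by (simp only: powr_minus_divide powr_realpow)
    qed
    have "onorm (\<lambda>z. (RR ?l ^^ k) (J z)) \<le> C * (?y\<^sup>2 / \<bar>\<xi>\<bar>) ^ P * \<bar>K\<bar>" by (rule on)
    then have "\<bar>\<xi>\<bar> ^ (P + 2) * (1 / ?y ^ (2 * (P + 2))) * onorm (\<lambda>z. (RR ?l ^^ k) (J z))
      \<le> \<bar>\<xi>\<bar> ^ (P + 2) * (1 / ?y ^ (2 * (P + 2))) * (C * (?y\<^sup>2 / \<bar>\<xi>\<bar>) ^ P * \<bar>K\<bar>)"
      by (intro mult_left_mono) auto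
    also have "\<bar>\<xi>\<bar> ^ (P + 2) * (1 / ?y ^ (2 * (P + 2))) * (C * (?y\<^sup>2 / \<bar>\<xi>\<bar>) ^ P * \<bar>K\<bar>) = C * \<bar>K\<bar> * (\<bar>\<xi>\<bar>\<^sup>2 / ?y ^ 4)"
    proof -
      have gen: "X * (1 / (Y1 * Y2)) * (C * Q * L) = C * L * (Z / Y2)"
        if "X * Q = Z * Y1" "Y1 > 0" "Y2 > 0" for X Y1 Y2 Q L Z :: real
      proof -
        have "X * (1 / (Y1 * Y2)) * (C * Q * L) = C * L * ((X * Q) / (Y1 * Y2))" by simp
        also have "\<dots> = C * L * (Z / Y2)" unfolding that(1) using that(2) by simp
        finally show ?thesis .
      qed
      have xq: "\<bar>\<xi>\<bar> ^ (P + 2) * (?y\<^sup>2 / \<bar>\<xi>\<bar>) ^ P = \<bar>\<xi>\<bar>\<^sup>2 * ?y ^ (2 * P)"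
        using x by (simp add: power_add power_divide power_mult power2_eq_square)
      have y4: "?y ^ (2 * (P + 2)) = ?y ^ (2 * P) * ?y ^ 4"
        unfolding power_add[symmetric] by (rule arg_cong[where f="\<lambda>j. ?y ^ j"]) simp
      show ?thesis unfolding y4 by (rule gen[OF xq]) (use y in auto)
    qed
    also have "\<dots> \<le> C * \<bar>K\<bar> * (1 / (1 + \<xi>\<^sup>2))"
    proof (rule mult_left_mono)
      have "\<bar>\<xi>\<bar>\<^sup>2 * (1 + \<xi>\<^sup>2) \<le> ?y\<^sup>2 * ?y\<^sup>2"
        by (intro mult_mono) (auto simp: power2_eq_square algebra_simps)
      also have "\<dots> = ?y ^ 4" by (simp add: power_add[symmetric])
      finally show "\<bar>\<xi>\<bar>\<^sup>2 / ?y ^ 4 \<le> 1 / (1 + \<xi>\<^sup>2)" using y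
        by (simp add: divide_le_eq pos_le_divide_eq add_pos_nonneg)
    qed (use C(1) in auto)
    finally show "\<bar>\<xi>\<bar> powr real (P + 2) * ?y powr (- 2 * real (P + 2)) * onorm (\<lambda>z. (RR ?l ^^ k) (J z)) \<le> C * \<bar>K\<bar> / (1 + \<xi>\<^sup>2)"
      unfolding e1 e2 by simp
  qed auto
qed

end

context orbit_kernel
begin

text \<open>The extension to L^p demanded by \<open>fourier_multiplier\<close> is
  \<open>conv_op\<close> itself. Finiteness of the majorant is part of the estimate because
  additivity of the integral rests on it.\<close>

theorem conv_op_fourier_multiplier:
  assumes p: "1 \<le> p"
    and est: "\<exists>C. \<forall>f. in_Lp p f \<longrightarrow> (AE t in lebesgue. majorant f t < \<infinity>) \<and> Lq_bounded q (conv_op f) (C * Lp_norm p f)"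
  shows "fourier_multiplier p q (\<lambda>\<xi> z. (RR (\<i> * complex_of_real \<xi>) ^^ Suc m) (J z))"
proof -
  obtain C where C: "\<And>f. in_Lp p f \<Longrightarrow> AE t in lebesgue. majorant f t < \<infinity>"
    "\<And>f. in_Lp p f \<Longrightarrow> Lq_bounded q (conv_op f) (C * Lp_norm p f)"
    using est by blast
  show ?thesis
    unfolding fourier_multiplier_def
  proof (intro conjI)
    show "\<forall>\<xi>. \<xi> \<noteq> 0 \<longrightarrow> bounded_clinear (\<lambda>z. (RR (\<i> * complex_of_real \<xi>) ^^ Suc m) (J z))"
      using resolvent_multiplier_basic(1)[OF J, where k="Suc m"] by blast
    show "\<forall>z. strongly_measurable lebesgue (\<lambda>\<xi>. (RR (\<i> * complex_of_real \<xi>) ^^ Suc m) (J z))"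
      using resolvent_multiplier_basic(2)[OF J, where k="Suc m"] by blast
    show "\<exists>a g. a \<ge> 0 \<and> integrable lborel g \<and>
        (\<forall>\<xi>. \<xi> \<noteq> 0 \<longrightarrow> \<bar>\<xi>\<bar> powr a * (1 + \<bar>\<xi>\<bar>) powr (- 2 * a) *
          onorm (\<lambda>z. (RR (\<i> * complex_of_real \<xi>) ^^ Suc m) (J z)) \<le> g \<xi>)"
      by (rule resolvent_multiplier_basic(3)[OF J])
    show "\<exists>E C. (\<forall>f. in_Lp p f \<longrightarrow> Lq_bounded q (E f) (C * Lp_norm p f)) \<and>
        (\<forall>f g c. in_Lp p f \<longrightarrow> in_Lp p g \<longrightarrow>
           (AE t in lebesgue. E (\<lambda>s. f s + scaleC c (g s)) t = E f t + scaleC c (E g t))) \<and>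
        (\<forall>f. dot_schwartz f \<longrightarrow> (AE t in lebesgue. E f t = multiplier_op (\<lambda>\<xi> z. (RR (\<i> * complex_of_real \<xi>) ^^ Suc m) (J z)) f t))"
    proof (intro exI[of _ conv_op] exI[of _ C] conjI allI impI)
      show "Lq_bounded q (conv_op f) (C * Lp_norm p f)" if "in_Lp p f" for f by (rule C(2)[OF that])
      show "AE t in lebesgue. conv_op (\<lambda>s. f s + scaleC c (g s)) t = conv_op f t + scaleC c (conv_op g t)"
        if f: "in_Lp p f" and g: "in_Lp p g" for f g c
        using C(1)[OF f] C(1)[OF g]
        by eventually_elim (rule conv_op_linear, use f g in \<open>auto simp: in_Lp_def\<close>)
      show "AE t in lebesgue. conv_op f t = multiplier_op (\<lambda>\<xi> z. (RR (\<i> * complex_of_real \<xi>) ^^ Suc m) (J z)) f t"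
        if "dot_schwartz f" for f by (intro AE_I2 conv_op_multiplier_op that)
    qed
  qed
qed

end

context growth_semigroup
begin

theorem decay_imp_fourier_multiplier:
  fixes J :: "'z::{complex_normed_vector,banach} \<Rightarrow> 'x"
  assumes J: "bounded_clinear J" and dec: "\<And>t z. t \<ge> 0 \<Longrightarrow> t ^ n * norm (T t (J z)) \<le> C * norm z"
    and m: "m \<le> n" and p: "1 \<le> p"
    and pq: "p = 1 \<and> q = \<infinity> \<or> (\<exists>r\<ge>1. real (n - m) * r > 1 \<and>
        (q = \<infinity> \<and> 1 / p + 1 / r = 1 \<or> (\<exists>q'. q = ereal q' \<and> p \<le> q' \<and> 1 / p + 1 / r = 1 + 1 / q')))"
  shows "fourier_multiplier p q (\<lambda>\<xi> z. (RR (\<i> * complex_of_real \<xi>) ^^ Suc m) (J z))"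
proof -
  define d where "d = n - m"
  obtain M where M: "M \<ge> 0" "\<And>t x. t \<in> {0..1} \<Longrightarrow> norm (T t x) \<le> M * norm x"
    using T_locally_bounded[of 1] by blast
  obtain K where K: "\<And>z. norm (J z) \<le> norm z * K" using J unfolding bounded_clinear_def by blast
  define B where "B = \<bar>C\<bar> + M * \<bar>K\<bar>"
  have B: "0 \<le> B" "\<bar>C\<bar> \<le> B" "M * \<bar>K\<bar> \<le> B" using M(1) by (auto simp: B_def)
  have small: "norm (T s (J z)) \<le> B * norm z" if "0 \<le> s" "s \<le> 1" for s z
  proof -
    have "norm (T s (J z)) \<le> M * norm (J z)" using that by (intro M(2)) auto
    also have "\<dots> \<le> M * (norm z * \<bar>K\<bar>)"
      using M(1) K[of z] by (intro mult_left_mono) (auto intro: order_trans[OF _ mult_left_mono])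
    also have "\<dots> = (M * \<bar>K\<bar>) * norm z" by simp
    also have "\<dots> \<le> B * norm z" using B by (intro mult_right_mono) auto
    finally show ?thesis .
  qed
  have large: "s ^ n * norm (T s (J z)) \<le> B * norm z" if "1 \<le> s" for s z
    using dec[of s z] that mult_right_mono[OF B(2) norm_ge_zero[of z]]
      mult_right_mono[OF abs_ge_self[of C] norm_ge_zero[of z]] by linarith
  \<comment> \<open>The factor 2 makes the base at least 1 on [0, 1], where T(s) J is merely
    bounded, and at least 1 / s beyond, where the decay is used.\<close>
  define h where "h s = B * (2 / (1 + \<bar>s\<bar>)) ^ d" for s :: real
  have one: "1 \<le> 2 / (1 + \<bar>s\<bar>)" if "0 \<le> s" "s \<le> 1" for s :: real
    using that by (simp add: pos_le_divide_eq)
  interpret orbit_kernel T A D \<alpha> \<beta> J m h B "B * 2 ^ d"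
  proof
    show "bounded_clinear J" by (rule J)
    fix s :: real and z :: 'z assume s: "s \<ge> 0"
    show "norm (T s (J z)) \<le> B * norm z"
    proof (cases "s \<le> 1")
      case False
      have "1 * norm (T s (J z)) \<le> s ^ n * norm (T s (J z))" using False by (intro mult_right_mono one_le_power) auto
      then show ?thesis using large[of s z] False by simp
    qed (use small s in auto)
    show "s ^ m * norm (T s (J z)) \<le> h s * norm z"
    proof (cases "s \<le> 1")
      case True
      have "s ^ m * norm (T s (J z)) \<le> 1 * (B * norm z)"
        using s True B by (intro mult_mono small power_le_one) auto
      also have "\<dots> \<le> (2 / (1 + \<bar>s\<bar>)) ^ d * (B * norm z)"
        using one[OF s True] B by (intro mult_right_mono one_le_power) auto
      finally show ?thesis by (simp add: h_def mult_ac)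
    next
      case False
      have sn: "s ^ n = s ^ m * s ^ d" using m by (simp add: d_def power_add[symmetric])
      have "s ^ m * norm (T s (J z)) = (1 / s) ^ d * (s ^ n * norm (T s (J z)))"
        using False by (simp add: sn power_divide)
      also have "\<dots> \<le> (2 / (1 + \<bar>s\<bar>)) ^ d * (B * norm z)"
        using False B by (intro mult_mono large power_mono) (auto simp: field_simps)
      finally show ?thesis by (simp add: h_def mult_ac)
    qed
  next
    show "h \<in> borel_measurable borel" unfolding h_def[abs_def] by measurable
    show "0 \<le> h s" for s using B by (simp add: h_def)
    show "h s \<le> B * 2 ^ d" for s
    proof -
      have "(2 / (1 + \<bar>s\<bar>)) ^ d \<le> 2 ^ d" by (intro power_mono) (auto simp: field_simps)
      then show ?thesis using B unfolding h_def by (intro mult_left_mono) auto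
    qed
  qed
  have ih: "integrable lebesgue (\<lambda>s. h s powr r)" if r: "r \<ge> 1" "real (n - m) * r > 1" for r
  proof -
    have eq: "h s powr r = (B powr r * 2 powr (real d * r)) * (1 + \<bar>s\<bar>) powr (- (real d * r))" for s
    proof -
      have "h s = B * (2 / (1 + \<bar>s\<bar>)) powr real d" by (simp add: h_def powr_realpow)
      then have "h s powr r = B powr r * (2 / (1 + \<bar>s\<bar>)) powr (real d * r)"
        using B by (simp add: powr_mult powr_powr)
      also have "(2 / (1 + \<bar>s\<bar>)) powr (real d * r) = 2 powr (real d * r) * (1 + \<bar>s\<bar>) powr (- (real d * r))"
        by (simp add: powr_divide powr_minus_divide)
      finally show ?thesis by simp
    qed
    show ?thesis unfolding eq
      by (rule integrable_mult_right[OF integrable_powr_decay]) (rule r(2)[folded d_def])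
  qed
  show ?thesis
  proof (rule conv_op_fourier_multiplier[OF p])
    from pq consider "p = 1" "q = \<infinity>"
      | r where "r \<ge> 1" "real (n - m) * r > 1" "q = \<infinity>" "1 / p + 1 / r = 1"
      | r q' where "r \<ge> 1" "real (n - m) * r > 1" "q = ereal q'" "p \<le> q'" "1 / p + 1 / r = 1 + 1 / q'"
      by blast
    then show "\<exists>C. \<forall>f. in_Lp p f \<longrightarrow> (AE t in lebesgue. majorant f t < \<infinity>) \<and> Lq_bounded q (conv_op f) (C * Lp_norm p f)"
    proof cases
      case 1 then show ?thesis using conv_op_L1_Linfty by simp
    next
      case 2 then show ?thesis unfolding 2(3) using conv_op_Linfty[OF p 2(1,4) ih[OF 2(1,2)]] by blast
    next
      case 3 then show ?thesis unfolding 3(3) using conv_op_Lq[OF p 3(4,1,5) ih[OF 3(1,2)]] by blast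
    qed
  qed
qed

theorem decay_imp_fourier_multiplier_cases:
  fixes J :: "'z::{complex_normed_vector,banach} \<Rightarrow> 'x"
  assumes J: "bounded_clinear J" and dec: "\<And>t z. t \<ge> 0 \<Longrightarrow> t ^ n * norm (T t (J z)) \<le> C * norm z"
    and c: "(n \<ge> 2 \<and> 1 \<le> k \<and> k \<le> n - 1 \<and> 1 \<le> p \<and> ereal p \<le> q) \<or>
          (k = n \<and> n \<ge> 1 \<and> 1 \<le> p \<and> ereal p < q) \<or>
          (k = n + 1 \<and> p = 1 \<and> q = \<infinity>)"
  shows "fourier_multiplier p q (\<lambda>\<xi> z. (RR (\<i> * complex_of_real \<xi>) ^^ k) (J z))"
proof -
  from c have k: "k = Suc (k - 1)" "k - 1 \<le> n" and p: "1 \<le> p" and pq: "ereal p \<le> q" by auto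
  have d: "real (n - (k - 1)) \<ge> 1" if "\<not> (p = 1 \<and> q = \<infinity>)"
    using c that by auto
  have d2: "real (n - (k - 1)) \<ge> 2" if "\<not> (p = 1 \<and> q = \<infinity>)" "\<not> ereal p < q"
    using c that by auto
  have "p = 1 \<and> q = \<infinity> \<or> (\<exists>r\<ge>1. real (n - (k - 1)) * r > 1 \<and>
        (q = \<infinity> \<and> 1 / p + 1 / r = 1 \<or> (\<exists>q'. q = ereal q' \<and> p \<le> q' \<and> 1 / p + 1 / r = 1 + 1 / q')))"
  proof (cases "p = 1 \<and> q = \<infinity>")
    case False
    note d = d[OF False] and d2 = d2[OF False]
    have prod: "real (n - (k - 1)) * r > 1" if "r \<ge> 1" "ereal p < q \<Longrightarrow> r > 1" for r
    proof (cases "ereal p < q")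
      case True
      have "1 * 1 < real (n - (k - 1)) * r" using d that(2)[OF True]
        by (intro mult_le_less_imp_less) auto
      then show ?thesis by (simp only: mult_1)
    next
      case F: False
      have "2 * 1 \<le> real (n - (k - 1)) * r" using d2[OF F] that(1) by (intro mult_mono) auto
      then show ?thesis by linarith
    qed
    show ?thesis
    proof (cases "q = \<infinity>")
      case True
      then have p1: "p > 1" using False p by auto
      define r where "r = p / (p - 1)"
      have "r > 1" "1 / p + 1 / r = 1" using p1 by (auto simp: r_def field_simps)
      moreover have "real (n - (k - 1)) * r > 1" by (rule prod) (use \<open>r > 1\<close> in auto)
      ultimately show ?thesis using True less_imp_le by blast
    next
      case qf: False
      then obtain q' where q': "q = ereal q'" "p \<le> q'" using pq by (cases q) auto
      \<comment> \<open>This is 1 / r in Young's relation; it lies below 1 when p < q.\<close>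
      define w where "w = 1 + 1 / q' - 1 / p"
      have "1 / q' > 0" "1 / p \<le> 1" using p q' by auto
      then have w: "w > 0" unfolding w_def by linarith
      have w1: "w \<le> 1" using p q' by (simp add: w_def frac_le)
      have w2: "w < 1" if "ereal p < q" using p q' that by (simp add: w_def frac_less2)
      define r where "r = 1 / w"
      have r: "r \<ge> 1" "ereal p < q \<Longrightarrow> r > 1" using w w1 w2 by (auto simp: r_def)
      moreover have "1 / p + 1 / r = 1 + 1 / q'" by (simp add: r_def w_def)
      moreover have "real (n - (k - 1)) * r > 1" by (rule prod) (use r in auto)
      ultimately show ?thesis using q' by blast
    qed
  qed simp
  from decay_imp_fourier_multiplier[OF J dec k(2) p this] show ?thesis by (subst k(1)) simp
qed

end

section \<open>A Schwartz function whose positive moments vanish\<close>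

text \<open>Decay beyond every exponential, for all derivatives. Under x = exp u it becomes flatness
  at x = 0 together with rapid decay at infinity, which is how Schwartz functions vanishing on the
  negative axis arise. The witness \<open>G\<close> lists the derivatives.\<close>

definition rapid :: "(real \<Rightarrow> real) \<Rightarrow> bool" where
  "rapid V \<longleftrightarrow> (\<exists>G. G 0 = V \<and> (\<forall>k u. (G k has_real_derivative G (Suc k) u) (at u)) \<and>
     (\<forall>(k::nat) (a::real). \<exists>C. \<forall>u. \<bar>G k u\<bar> * exp (a * \<bar>u\<bar>) \<le> C))"

lemma rapidI:
  assumes "G 0 = V" "\<And>k u. (G k has_real_derivative G (Suc k) u) (at u)"
    "\<And>(k::nat) (a::real). \<exists>C. \<forall>u. \<bar>G k u\<bar> * exp (a * \<bar>u\<bar>) \<le> C"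
  shows "rapid V"
  unfolding rapid_def using assms by blast

lemma rapid_bound:
  assumes "rapid V" shows "\<exists>C\<ge>0. \<forall>u. \<bar>V u\<bar> \<le> C * exp (- (a * \<bar>u\<bar>))"
proof -
  obtain C where C: "\<And>u. \<bar>V u\<bar> * exp (a * \<bar>u\<bar>) \<le> C" using assms unfolding rapid_def by metis
  have "\<bar>V u\<bar> \<le> C * exp (- (a * \<bar>u\<bar>))" for u
    using C[of u] by (simp add: exp_minus field_simps)
  moreover have "0 \<le> C" using order_trans[OF abs_ge_zero, of "V 0" C] C[of 0] by simp
  ultimately show ?thesis by blast
qed

lemma rapid_derivative:
  assumes "rapid V" shows "rapid (deriv V)" "(V has_real_derivative deriv V u) (at u)"
proof -
  obtain G where G: "G 0 = V" "\<And>k u. (G k has_real_derivative G (Suc k) u) (at u)"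
     "\<And>(k::nat) (a::real). \<exists>C. \<forall>u. \<bar>G k u\<bar> * exp (a * \<bar>u\<bar>) \<le> C"
    using assms unfolding rapid_def by blast
  have d: "(V has_real_derivative G 1 u) (at u)" for u using G(2)[of 0 u] G(1) by simp
  then have "deriv V = G 1" by (intro ext DERIV_imp_deriv)
  then show "rapid (deriv V)" "(V has_real_derivative deriv V u) (at u)"
    using d G(2,3) by (auto intro!: rapidI[of "\<lambda>k. G (Suc k)"])
qed

lemma rapid_diff_cmult:
  assumes "rapid V" "rapid W" shows "rapid (\<lambda>u. V u - c * W u)"
proof -
  obtain G where G: "G 0 = V" "\<And>k u. (G k has_real_derivative G (Suc k) u) (at u)"
     "\<And>(k::nat) (a::real). \<exists>C. \<forall>u. \<bar>G k u\<bar> * exp (a * \<bar>u\<bar>) \<le> C"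
    using assms(1) unfolding rapid_def by blast
  obtain H where H: "H 0 = W" "\<And>k u. (H k has_real_derivative H (Suc k) u) (at u)"
     "\<And>(k::nat) (a::real). \<exists>C. \<forall>u. \<bar>H k u\<bar> * exp (a * \<bar>u\<bar>) \<le> C"
    using assms(2) unfolding rapid_def by blast
  show ?thesis
  proof (rule rapidI[of "\<lambda>k u. G k u - c * H k u"])
    show "((\<lambda>u. G k u - c * H k u) has_real_derivative G (Suc k) u - c * H (Suc k) u) (at u)" for k u
      by (auto intro!: derivative_eq_intros G(2) H(2))
    fix k :: nat and a :: real
    obtain C1 where C1: "\<And>u. \<bar>G k u\<bar> * exp (a * \<bar>u\<bar>) \<le> C1" using G(3) by blast
    obtain C2 where C2: "\<And>u. \<bar>H k u\<bar> * exp (a * \<bar>u\<bar>) \<le> C2" using H(3) by blast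
    have "\<bar>G k u - c * H k u\<bar> * exp (a * \<bar>u\<bar>) \<le> C1 + \<bar>c\<bar> * C2" for u
    proof -
      have "\<bar>G k u - c * H k u\<bar> \<le> \<bar>G k u\<bar> + \<bar>c\<bar> * \<bar>H k u\<bar>"
        using abs_triangle_ineq4[of "G k u" "c * H k u"] by (simp add: abs_mult)
      then have "\<bar>G k u - c * H k u\<bar> * exp (a * \<bar>u\<bar>) \<le> (\<bar>G k u\<bar> + \<bar>c\<bar> * \<bar>H k u\<bar>) * exp (a * \<bar>u\<bar>)"
        by (rule mult_right_mono) simp
      also have "\<dots> = \<bar>G k u\<bar> * exp (a * \<bar>u\<bar>) + \<bar>c\<bar> * (\<bar>H k u\<bar> * exp (a * \<bar>u\<bar>))"
        by (simp add: algebra_simps)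
      also have "\<dots> \<le> C1 + \<bar>c\<bar> * C2" by (intro add_mono C1 mult_left_mono C2) auto
      finally show ?thesis .
    qed
    then show "\<exists>C. \<forall>u. \<bar>G k u - c * H k u\<bar> * exp (a * \<bar>u\<bar>) \<le> C" by blast
  qed (simp add: G(1) H(1))
qed

lemma poly_exp_growth: "\<exists>C b. 0 \<le> C \<and> 0 \<le> b \<and> (\<forall>u. \<bar>poly p u\<bar> \<le> C * exp (b * \<bar>u::real\<bar>))"
proof (induction p)
  case 0
  show ?case by (intro exI[of _ 0]) auto
next
  case (pCons c p)
  then obtain C b where C: "0 \<le> C" "0 \<le> b" "\<And>u. \<bar>poly p u\<bar> \<le> C * exp (b * \<bar>u\<bar>)" by blast
  have "\<bar>poly (pCons c p) u\<bar> \<le> (\<bar>c\<bar> + C) * exp ((b + 1) * \<bar>u\<bar>)" for u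
  proof -
    have "\<bar>poly (pCons c p) u\<bar> \<le> \<bar>c\<bar> + \<bar>u\<bar> * \<bar>poly p u\<bar>"
      by (simp add: abs_mult[symmetric])
    also have "\<dots> \<le> \<bar>c\<bar> * exp ((b + 1) * \<bar>u\<bar>) + exp \<bar>u\<bar> * (C * exp (b * \<bar>u\<bar>))"
    proof (intro add_mono mult_mono C(3))
      show "\<bar>c\<bar> \<le> \<bar>c\<bar> * exp ((b + 1) * \<bar>u\<bar>)" using C(2) by (simp add: mult_le_cancel_left1)
      show "\<bar>u\<bar> \<le> exp \<bar>u\<bar>" using exp_ge_add_one_self[of "\<bar>u\<bar>"] by linarith
    qed auto
    also have "\<dots> = (\<bar>c\<bar> + C) * exp ((b + 1) * \<bar>u\<bar>)"
      by (simp add: exp_add algebra_simps)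
    finally show ?thesis .
  qed
  then show ?case using C by (intro exI[of _ "\<bar>c\<bar> + C"] exI[of _ "b + 1"]) auto
qed

text \<open>In the variable x = exp u this is, up to normalisation, Stieltjes' perturbation of the
  lognormal density, all of whose moments vanish. The zeroth one vanishes too, so it cannot give an
  approximate identity; its tail integral repairs that.\<close>

definition gsin :: "real \<Rightarrow> real" where
  "gsin u = exp (- u\<^sup>2 / 2) * sin (2 * pi * u)"

lemma gaussian_poly_bound:
  "\<exists>C. \<forall>u. \<bar>poly p u\<bar> * exp (- u\<^sup>2 / 2) * exp (a * \<bar>u::real\<bar>) \<le> C"
proof -
  obtain C b where C: "0 \<le> C" "0 \<le> b" "\<And>u. \<bar>poly p u\<bar> \<le> C * exp (b * \<bar>u\<bar>)" using poly_exp_growth by blast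
  have "\<bar>poly p u\<bar> * exp (- u\<^sup>2 / 2) * exp (a * \<bar>u\<bar>) \<le> C * exp ((a + b)\<^sup>2 / 2)" for u
  proof -
    have "\<bar>poly p u\<bar> * exp (- u\<^sup>2 / 2) * exp (a * \<bar>u\<bar>) \<le> (C * exp (b * \<bar>u\<bar>)) * exp (- u\<^sup>2 / 2) * exp (a * \<bar>u\<bar>)"
      by (intro mult_right_mono C(3)) auto
    also have "\<dots> = C * exp (- \<bar>u\<bar>\<^sup>2 / 2 + (a + b) * \<bar>u\<bar>)"
      by (simp add: mult.assoc exp_add[symmetric] algebra_simps)
    also have "- \<bar>u\<bar>\<^sup>2 / 2 + (a + b) * \<bar>u\<bar> \<le> (a + b)\<^sup>2 / 2"
    proof -
      have "0 \<le> (\<bar>u\<bar> - (a + b))\<^sup>2" by simp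
      then show ?thesis by (simp add: power2_diff field_simps)
    qed
    finally show ?thesis using C(1) by (simp add: mult_left_mono)
  qed
  then show ?thesis by blast
qed

lemma rapid_gsin: "rapid gsin"
proof -
  \<comment> \<open>The k-th derivative of \<open>gsin\<close> is the Gaussian times P k sin + Q k
    cos; the product rule generates the pair of polynomials.\<close>
  define PQ where "PQ = rec_nat (1 :: real poly, 0 :: real poly)
    (\<lambda>_ (P, Q). (pderiv P - [:0, 1:] * P - smult (2 * pi) Q, pderiv Q - [:0, 1:] * Q + smult (2 * pi) P))"
  define P where "P k = fst (PQ k)" for k
  define Q where "Q k = snd (PQ k)" for k
  have P0: "P 0 = 1" "Q 0 = 0" by (simp_all add: P_def Q_def PQ_def)
  have PS: "P (Suc k) = pderiv (P k) - [:0, 1:] * P k - smult (2 * pi) (Q k)"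
    and QS: "Q (Suc k) = pderiv (Q k) - [:0, 1:] * Q k + smult (2 * pi) (P k)" for k
    by (simp_all add: P_def Q_def PQ_def case_prod_beta)
  show ?thesis
  proof (rule rapidI[of "\<lambda>k u. exp (- u\<^sup>2 / 2) * (poly (P k) u * sin (2 * pi * u) + poly (Q k) u * cos (2 * pi * u))"])
    show "(\<lambda>u. exp (- u\<^sup>2 / 2) * (poly (P 0) u * sin (2 * pi * u) + poly (Q 0) u * cos (2 * pi * u))) = gsin"
      by (simp add: P0 gsin_def fun_eq_iff)
    show "((\<lambda>u. exp (- u\<^sup>2 / 2) * (poly (P k) u * sin (2 * pi * u) + poly (Q k) u * cos (2 * pi * u))) has_real_derivative
        exp (- u\<^sup>2 / 2) * (poly (P (Suc k)) u * sin (2 * pi * u) + poly (Q (Suc k)) u * cos (2 * pi * u))) (at u)" for k u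
      by (auto intro!: derivative_eq_intros simp: PS QS algebra_simps)
    fix k :: nat and a :: real
    obtain C1 where C1: "\<And>u. \<bar>poly (P k) u\<bar> * exp (- u\<^sup>2 / 2) * exp (a * \<bar>u\<bar>) \<le> C1" using gaussian_poly_bound by blast
    obtain C2 where C2: "\<And>u. \<bar>poly (Q k) u\<bar> * exp (- u\<^sup>2 / 2) * exp (a * \<bar>u\<bar>) \<le> C2" using gaussian_poly_bound by blast
    have "\<bar>exp (- u\<^sup>2 / 2) * (poly (P k) u * sin (2 * pi * u) + poly (Q k) u * cos (2 * pi * u))\<bar> * exp (a * \<bar>u\<bar>) \<le> C1 + C2" for u
    proof -
      have "\<bar>poly (P k) u * sin (2 * pi * u) + poly (Q k) u * cos (2 * pi * u)\<bar>
        \<le> \<bar>poly (P k) u\<bar> * \<bar>sin (2 * pi * u)\<bar> + \<bar>poly (Q k) u\<bar> * \<bar>cos (2 * pi * u)\<bar>"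
        by (metis abs_mult abs_triangle_ineq)
      also have "\<dots> \<le> \<bar>poly (P k) u\<bar> + \<bar>poly (Q k) u\<bar>"
        by (intro add_mono mult_left_le) auto
      finally have "(exp (- u\<^sup>2 / 2) * exp (a * \<bar>u\<bar>)) * \<bar>poly (P k) u * sin (2 * pi * u) + poly (Q k) u * cos (2 * pi * u)\<bar>
        \<le> (exp (- u\<^sup>2 / 2) * exp (a * \<bar>u\<bar>)) * (\<bar>poly (P k) u\<bar> + \<bar>poly (Q k) u\<bar>)"
        by (rule mult_left_mono) simp
      also have "\<dots> \<le> C1 + C2" using C1[of u] C2[of u] by (simp add: algebra_simps)
      finally show ?thesis by (simp add: abs_mult mult_ac)
    qed
    then show "\<exists>C. \<forall>u. \<bar>exp (- u\<^sup>2 / 2) * (poly (P k) u * sin (2 * pi * u) + poly (Q k) u * cos (2 * pi * u))\<bar> * exp (a * \<bar>u\<bar>) \<le> C"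
      by blast
  qed
qed

lemma rapid_continuous: "rapid V \<Longrightarrow> continuous_on UNIV V"
  using rapid_derivative(2) by (intro DERIV_continuous_on) auto

lemma rapid_exp_bochner:
  assumes V: "rapid V"
  shows "bochner_integrable (\<lambda>u. exp (c * u) * V u)"
proof -
  obtain C where C: "C \<ge> 0" "\<And>u. \<bar>V u\<bar> \<le> C * exp (- ((\<bar>c\<bar> + 1) * \<bar>u\<bar>))" using rapid_bound[OF V] by blast
  show ?thesis
  proof (rule bochner_integrable_bound)
    show "strongly_measurable lebesgue (\<lambda>u. exp (c * u) * V u)"
      by (intro strongly_measurable_continuous continuous_intros rapid_continuous V)
    show "integrable lebesgue (\<lambda>u. 3 * C / (1 + u\<^sup>2))" by (rule integrable_inverse_square_const)
    show "AE u in lebesgue. norm (exp (c * u) * V u) \<le> 3 * C / (1 + u\<^sup>2)"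
    proof (rule AE_I2)
      fix u :: real
      have "c * u \<le> \<bar>c\<bar> * \<bar>u\<bar>" by (metis abs_ge_self abs_mult)
      then have "exp (c * u) * \<bar>V u\<bar> \<le> exp (\<bar>c\<bar> * \<bar>u\<bar>) * (C * exp (- ((\<bar>c\<bar> + 1) * \<bar>u\<bar>)))"
        by (intro mult_mono C(2)) auto
      also have "\<dots> = C * exp (- \<bar>u\<bar>)"
        by (simp add: exp_add[symmetric] algebra_simps)
      also have "\<dots> \<le> C * (3 / (1 + u\<^sup>2))"
      proof (rule mult_left_mono)
        have "\<bar>u\<bar> ^ 2 \<le> fact 2 * exp \<bar>u\<bar>" by (rule power_le_exp) simp
        moreover have "1 \<le> exp \<bar>u\<bar>" by simp
        ultimately have "1 + u\<^sup>2 \<le> 3 * exp \<bar>u\<bar>" unfolding fact_2 power2_abs by linarith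
        then show "exp (- \<bar>u\<bar>) \<le> 3 / (1 + u\<^sup>2)"
          by (simp add: exp_minus pos_le_divide_eq add_pos_nonneg inverse_eq_divide pos_divide_le_eq)
      qed (rule C(1))
      finally show "norm (exp (c * u) * V u) \<le> 3 * C / (1 + u\<^sup>2)" by (simp add: abs_mult mult.commute[of C 3])
    qed
  qed
qed

lemma gsin_odd: "gsin (- u) = - gsin u"
  by (simp add: gsin_def)

text \<open>Integration by parts reduces \<open>\<integral> exp (m u) gtail u du\<close> to the same integral with \<open>gsin\<close>.
  Completing the square there moves the Gaussian by the integer \<open>m\<close>, a period of the sine, so that
  oddness gives \<open>0\<close>.\<close>
definition gtail :: "real \<Rightarrow> real" where
  "gtail u = integral {u..} gsin"

lemma gsin_integrable_on: "gsin integrable_on {u..}"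
proof -
  have "integrable lebesgue (\<lambda>u. norm (exp (0 * u) * gsin u))"
    by (rule bochner_integrableD(2)[OF rapid_exp_bochner[OF rapid_gsin]])
  then have "integrable lebesgue (\<lambda>u. norm (gsin u))" by simp
  then have "integrable lebesgue gsin"
    by (rule integrable_norm_cancel)
      (rule strongly_measurable_borel[OF strongly_measurable_continuous[OF rapid_continuous[OF rapid_gsin]]])
  then have "gsin absolutely_integrable_on UNIV" by (simp add: set_integrable_def)
  then have "gsin absolutely_integrable_on {u..}" by (rule set_integrable_subset) auto
  then show ?thesis by (simp add: absolutely_integrable_on_def)
qed

lemma gtail_split: "u \<le> w \<Longrightarrow> gtail u = integral {u..w} gsin + gtail w"
proof -
  assume uw: "u \<le> w"
  have i: "gsin integrable_on {u..w}"
    by (intro integrable_continuous_interval continuous_on_subset[OF rapid_continuous[OF rapid_gsin]]) auto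
  have "{u..} = {u..w} \<union> {w..}" using uw by auto
  moreover have "negligible ({u..w} \<inter> {w..})" by (rule negligible_subset[of "{w}"]) auto
  ultimately show ?thesis unfolding gtail_def using integral_Un[OF i gsin_integrable_on] by simp
qed

lemma gtail_derivative: "(gtail has_real_derivative - gsin u) (at u)"
proof -
  have "((\<lambda>x. integral {u - 1..x} gsin) has_real_derivative gsin u) (at u within {u - 1..u + 1})"
    by (intro integral_has_real_derivative continuous_on_subset[OF rapid_continuous[OF rapid_gsin]]) auto
  then have "((\<lambda>x. integral {u - 1..x} gsin) has_real_derivative gsin u) (at u)"
    by (subst (asm) at_within_Icc_at) auto
  then have "((\<lambda>x. gtail (u - 1) - integral {u - 1..x} gsin) has_real_derivative - gsin u) (at u)"
    by (auto intro!: derivative_eq_intros)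
  then show ?thesis
  proof (rule has_field_derivative_transform_within_open)
    show "open {u - 1<..}" by simp
    fix x assume "x \<in> {u - 1<..}"
    then show "gtail (u - 1) - integral {u - 1..x} gsin = gtail x" using gtail_split[of "u - 1" x] by simp
  qed simp
qed

text \<open>An antiderivative of an odd function is even. This transfers the decay at +\<infinity>,
  visible from the definition, to -\<infinity>, where it reflects that \<open>gsin\<close> has
  integral 0.\<close>

lemma gtail_even: "gtail (- u) = gtail u"
proof -
  have "\<forall>x. ((\<lambda>u. gtail u - gtail (- u)) has_real_derivative 0) (at x)"
  proof
    fix x
    have "((\<lambda>u. gtail (- u)) has_real_derivative - gsin (- x) * (- 1)) (at x)"
      by (rule DERIV_chain2[OF gtail_derivative]) (auto intro!: derivative_eq_intros)
    then show "((\<lambda>u. gtail u - gtail (- u)) has_real_derivative 0) (at x)"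
      using DERIV_diff[OF gtail_derivative[of x]] by (fastforce simp: gsin_odd)
  qed
  from DERIV_isconst_all[OF this, of u 0] show ?thesis by simp
qed

lemma rapid_gtail: "rapid gtail"
proof -
  obtain H where H: "H 0 = gsin" "\<And>k u. (H k has_real_derivative H (Suc k) u) (at u)"
     "\<And>(k::nat) (a::real). \<exists>C. \<forall>u. \<bar>H k u\<bar> * exp (a * \<bar>u\<bar>) \<le> C"
    using rapid_gsin unfolding rapid_def by blast
  show ?thesis
  proof (rule rapidI[of "\<lambda>k. case k of 0 \<Rightarrow> gtail | Suc j \<Rightarrow> (\<lambda>u. - H j u)"])
    show "((case k of 0 \<Rightarrow> gtail | Suc j \<Rightarrow> (\<lambda>u. - H j u)) has_real_derivative
        (case Suc k of 0 \<Rightarrow> gtail | Suc j \<Rightarrow> (\<lambda>u. - H j u)) u) (at u)" for k u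
      using gtail_derivative[of u] by (cases k) (auto intro!: derivative_eq_intros H(2) simp: H(1))
    fix k :: nat and a :: real
    show "\<exists>C. \<forall>u. \<bar>(case k of 0 \<Rightarrow> gtail | Suc j \<Rightarrow> (\<lambda>u. - H j u)) u\<bar> * exp (a * \<bar>u\<bar>) \<le> C"
    proof (cases k)
      case 0
      define b where "b = \<bar>a\<bar> + 1"
      have b: "b > 0" "a \<le> b" by (auto simp: b_def)
      obtain C where C: "C \<ge> 0" "\<And>u. \<bar>gsin u\<bar> \<le> C * exp (- (b * \<bar>u\<bar>))" using rapid_bound[OF rapid_gsin] by blast
      have pos: "\<bar>gtail u\<bar> \<le> C * exp (- b * u) / b" if "u \<ge> 0" for u
      proof -
        have e: "((\<lambda>x. C * exp (- b * x)) has_integral C * (exp (- b * u) / b)) {u..}"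
          by (intro has_integral_mult_right has_integral_exp_minus_to_infinity b)
        have "norm (gtail u) \<le> integral {u..} (\<lambda>x. C * exp (- b * x))"
          unfolding gtail_def
        proof (rule integral_norm_bound_integral[OF gsin_integrable_on])
          show "(\<lambda>x. C * exp (- b * x)) integrable_on {u..}" using e by blast
          show "norm (gsin x) \<le> C * exp (- b * x)" if "x \<in> {u..}" for x
            using C(2)[of x] that \<open>u \<ge> 0\<close> by simp
        qed
        also have "\<dots> = C * (exp (- b * u) / b)" using e by (rule integral_unique)
        finally show ?thesis by simp
      qed
      have "\<bar>gtail u\<bar> * exp (a * \<bar>u\<bar>) \<le> C / b" for u
      proof -
        have "gtail u = gtail \<bar>u\<bar>" using gtail_even[of u] by (cases "u \<ge> 0") auto
        then have "\<bar>gtail u\<bar> * exp (a * \<bar>u\<bar>) \<le> (C * exp (- b * \<bar>u\<bar>) / b) * exp (b * \<bar>u\<bar>)"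
          using pos[of "\<bar>u\<bar>"] b C(1) by (intro mult_mono) (auto intro: mult_right_mono)
        also have "\<dots> = C / b" by (simp add: exp_minus)
        finally show ?thesis .
      qed
      then show ?thesis using 0 by auto
    next
      case (Suc j)
      then show ?thesis using H(3)[of j a] by simp
    qed
  qed simp
qed

lemma integral_gsin_shift: "integral UNIV (\<lambda>u. exp (real m * u) * gsin u) = 0"
proof -
  have b: "bochner_integrable gsin" using rapid_exp_bochner[OF rapid_gsin, of 0] by simp
  have z: "integral UNIV gsin = 0"
    using bochner_affine(2)[OF b, of "-1" 0] by (simp add: gsin_odd integral_neg)
  have sh: "exp (real m * u) * gsin u = exp ((real m)\<^sup>2 / 2) * gsin (- real m + 1 * u)" for u
  proof -
    have "sin (2 * pi * (- real m + u)) = sin (2 * pi * u)"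
    proof -
      have "sin (2 * pi * u) = sin (2 * pi * (- real m + u) + 2 * real m * pi)" by (simp add: algebra_simps)
      also have "\<dots> = sin (2 * pi * (- real m + u))"
        unfolding sin_add using sin_2npi[of m] cos_2npi[of m] by simp
      finally show ?thesis ..
    qed
    moreover have "exp (real m * u) * exp (- u\<^sup>2 / 2) = exp ((real m)\<^sup>2 / 2) * exp (- (- real m + u)\<^sup>2 / 2)"
      unfolding exp_add[symmetric] by (rule arg_cong[where f=exp]) (simp add: power2_eq_square field_simps)
    ultimately show ?thesis by (simp add: gsin_def)
  qed
  have b': "bochner_integrable (\<lambda>u. gsin (- real m + 1 * u))" by (rule bochner_affine(1)[OF b]) simp
  show ?thesis unfolding sh
    using bochner_integral_linear[OF b' bounded_linear_mult_right, of "exp ((real m)\<^sup>2 / 2)"]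
      bochner_affine(2)[OF b, of 1 "- real m"] z by simp
qed

lemma rapid_exp_tendsto_0:
  assumes V: "rapid V"
  shows "((\<lambda>u. exp (c * u) * V u) \<longlongrightarrow> 0) at_top" "((\<lambda>u. exp (c * u) * V u) \<longlongrightarrow> 0) at_bot"
proof -
  obtain C where C: "C \<ge> 0" "\<And>u. \<bar>V u\<bar> \<le> C * exp (- ((\<bar>c\<bar> + 1) * \<bar>u\<bar>))" using rapid_bound[OF V] by blast
  have le: "norm (exp (c * u) * V u) \<le> C * exp (- \<bar>u\<bar>)" for u
  proof -
    have "c * u \<le> \<bar>c\<bar> * \<bar>u\<bar>" by (metis abs_ge_self abs_mult)
    then have "exp (c * u) * \<bar>V u\<bar> \<le> exp (\<bar>c\<bar> * \<bar>u\<bar>) * (C * exp (- ((\<bar>c\<bar> + 1) * \<bar>u\<bar>)))"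
      by (intro mult_mono C(2)) auto
    also have "\<dots> = C * exp (- \<bar>u\<bar>)" by (simp add: exp_add[symmetric] algebra_simps)
    finally show ?thesis by (simp add: abs_mult)
  qed
  have "((\<lambda>u::real. C * exp (- \<bar>u\<bar>)) \<longlongrightarrow> 0) at_top" "((\<lambda>u::real. C * exp (- \<bar>u\<bar>)) \<longlongrightarrow> 0) at_bot"
    by real_asymp+
  then show "((\<lambda>u. exp (c * u) * V u) \<longlongrightarrow> 0) at_top" "((\<lambda>u. exp (c * u) * V u) \<longlongrightarrow> 0) at_bot"
    using le by (auto intro: Lim_null_comparison[rotated] always_eventually)
qed

lemma gtail_moment_0:
  assumes "m \<ge> 1" shows "integral UNIV (\<lambda>u. exp (real m * u) * gtail u) = 0"
proof -
  have b1: "bochner_integrable (\<lambda>u. real m * (exp (real m * u) * gtail u))"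
    by (rule bochner_integrable_linear[OF rapid_exp_bochner[OF rapid_gtail] bounded_linear_mult_right])
  have b2: "bochner_integrable (\<lambda>u. exp (real m * u) * gsin u)" by (rule rapid_exp_bochner[OF rapid_gsin])
  have "integral UNIV (\<lambda>u. real m * (exp (real m * u) * gtail u) - exp (real m * u) * gsin u) = 0"
  proof (rule integral_derivative_UNIV[OF _ bochner_integrable_diff[OF b1 b2] rapid_exp_tendsto_0[OF rapid_gtail, of "real m"]])
    show "((\<lambda>u. exp (real m * u) * gtail u) has_vector_derivative
        real m * (exp (real m * t) * gtail t) - exp (real m * t) * gsin t) (at t)" for t
      unfolding has_real_derivative_iff_has_vector_derivative[symmetric]
      by (auto intro!: derivative_eq_intros gtail_derivative)
  qed
  then have "real m * integral UNIV (\<lambda>u. exp (real m * u) * gtail u) = 0"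
    using bochner_integral_diff[OF b1 b2] integral_gsin_shift[of m]
      bochner_integral_linear[OF rapid_exp_bochner[OF rapid_gtail, of "real m"] bounded_linear_mult_right, of "real m"]
    by simp
  then show ?thesis using assms by simp
qed

text \<open>u * gtail u - gsin u is an antiderivative of \<open>gtail\<close> minus 2 pi times the
  Gaussian with a cosine factor. So the integral is 2 pi times the transform of the Gaussian at 2
  pi, which is positive.\<close>

lemma gtail_integral_nonzero: "integral UNIV gtail \<noteq> 0"
proof -
  let ?gc = "\<lambda>u. exp (- u\<^sup>2 / 2) * cos (2 * pi * u)"
  have bc: "bochner_integrable ?gc" and ic: "integral UNIV ?gc = sqrt (2 * pi) * exp (- (2 * pi)\<^sup>2 / 2)"
    using bochner_integrable_linear[OF gaussian_fourier(1)[of "2 * pi"] bounded_linear_Re]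
      bochner_integral_linear[OF gaussian_fourier(1)[of "2 * pi"] bounded_linear_Re]
    unfolding gaussian_fourier(2) by simp_all
  have bt: "bochner_integrable gtail" using rapid_exp_bochner[OF rapid_gtail, of 0] by simp
  have bc': "bochner_integrable (\<lambda>u. 2 * pi * ?gc u)"
    by (rule bochner_integrable_linear[OF bc bounded_linear_mult_right])
  have d: "((\<lambda>u. u * gtail u - gsin u) has_vector_derivative gtail t - 2 * pi * ?gc t) (at t)" for t
    unfolding has_real_derivative_iff_has_vector_derivative[symmetric] gsin_def[abs_def]
    by (auto intro!: derivative_eq_intros gtail_derivative simp: gsin_def algebra_simps)
  have le: "norm (u * gtail u - gsin u) \<le> \<bar>exp (1 * u) * gtail u\<bar> + \<bar>exp (- 1 * u) * gtail u\<bar> + \<bar>exp (0 * u) * gsin u\<bar>" for u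
  proof -
    have "\<bar>u\<bar> \<le> exp u + exp (- u)"
      by (rule abs_leI; use exp_ge_add_one_self[of u] exp_ge_add_one_self[of "- u"] exp_gt_zero[of u] exp_gt_zero[of "- u"] in linarith)
    then have "\<bar>u\<bar> * \<bar>gtail u\<bar> \<le> (exp u + exp (- u)) * \<bar>gtail u\<bar>" by (intro mult_right_mono) auto
    moreover have "norm (u * gtail u - gsin u) \<le> \<bar>u\<bar> * \<bar>gtail u\<bar> + \<bar>gsin u\<bar>"
      using abs_triangle_ineq4[of "u * gtail u" "gsin u"] by (simp add: abs_mult)
    ultimately show ?thesis by (simp add: abs_mult algebra_simps)
  qed
  have lim: "((\<lambda>u. \<bar>exp (1 * u) * gtail u\<bar> + \<bar>exp (- 1 * u) * gtail u\<bar> + \<bar>exp (0 * u) * gsin u\<bar>) \<longlongrightarrow> \<bar>0\<bar> + \<bar>0\<bar> + \<bar>0\<bar>) F"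
    if "F = at_top \<or> F = at_bot" for F
  proof -
    have "((\<lambda>u. exp (c * u) * gtail u) \<longlongrightarrow> 0) F" "((\<lambda>u. exp (c * u) * gsin u) \<longlongrightarrow> 0) F" for c
      using that rapid_exp_tendsto_0[OF rapid_gtail, of c] rapid_exp_tendsto_0[OF rapid_gsin, of c] by blast+
    then show ?thesis by (intro tendsto_add tendsto_rabs)
  qed
  have lim': "((\<lambda>u. u * gtail u - gsin u) \<longlongrightarrow> 0) F" if "F = at_top \<or> F = at_bot" for F
    by (rule Lim_null_comparison[OF always_eventually[OF allI[OF le]]]) (use lim[OF that] in simp)
  have "integral UNIV (\<lambda>u. gtail u - 2 * pi * ?gc u) = 0"
    by (rule integral_derivative_UNIV[OF d bochner_integrable_diff[OF bt bc']]) (auto intro: lim')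
  then have "integral UNIV gtail = 2 * pi * (sqrt (2 * pi) * exp (- (2 * pi)\<^sup>2 / 2))"
    using bochner_integral_diff[OF bt bc'] bochner_integral_linear[OF bc bounded_linear_mult_right, of "2 * pi"] ic
    by simp
  then show ?thesis by simp
qed

text \<open>The substitution \<open>x = exp u\<close> turns the moments of \<open>gtail (ln x) / x\<close> into exponential moments
  of \<open>gtail\<close>; the function \<open>wfam k (ln x) / x ^ Suc k\<close> is its \<open>k\<close>-th derivative.\<close>
primrec wfam :: "nat \<Rightarrow> real \<Rightarrow> real" where
  "wfam 0 = gtail"
| "wfam (Suc k) = (\<lambda>u. deriv (wfam k) u - (real k + 1) * wfam k u)"

lemma rapid_wfam: "rapid (wfam k)"
  by (induction k) (auto intro!: rapid_gtail rapid_diff_cmult rapid_derivative(1))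

definition thetak :: "nat \<Rightarrow> real \<Rightarrow> real" where
  "thetak k x = (if x > 0 then wfam k (ln x) / x ^ Suc k else 0)"

text \<open>A bound by exp (-j |u|) at u = ln x yields both the factor x^j, useful near 0, and the
  factor x^(-j), useful near infinity.\<close>

lemma rapid_ln_bound:
  assumes "rapid V"
  shows "\<exists>C\<ge>0. \<forall>x>0. \<bar>V (ln x)\<bar> \<le> C * x ^ j \<and> \<bar>V (ln x)\<bar> * x ^ j \<le> C"
proof -
  obtain C where C: "C \<ge> 0" "\<And>u. \<bar>V u\<bar> \<le> C * exp (- (real j * \<bar>u\<bar>))" using rapid_bound[OF assms] by blast
  have "\<bar>V (ln x)\<bar> \<le> C * x ^ j \<and> \<bar>V (ln x)\<bar> * x ^ j \<le> C" if x: "x > 0" for x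
  proof
    have xj: "x ^ j = exp (real j * ln x)" using x by (simp add: exp_of_nat_mult)
    have m: "- (real j * \<bar>ln x\<bar>) \<le> real j * ln x" "real j * ln x \<le> real j * \<bar>ln x\<bar>"
      using mult_left_mono[of "- \<bar>ln x\<bar>" "ln x" "real j"] mult_left_mono[of "ln x" "\<bar>ln x\<bar>" "real j"] by auto
    have "\<bar>V (ln x)\<bar> \<le> C * exp (- (real j * \<bar>ln x\<bar>))" by (rule C(2))
    also have "\<dots> \<le> C * x ^ j" unfolding xj using m(1) C(1) by (intro mult_left_mono) auto
    finally show "\<bar>V (ln x)\<bar> \<le> C * x ^ j" .
    have "\<bar>V (ln x)\<bar> * x ^ j \<le> (C * exp (- (real j * \<bar>ln x\<bar>))) * exp (real j * ln x)"
      unfolding xj by (intro mult_right_mono C(2)) auto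
    also have "\<dots> = C * exp (- (real j * \<bar>ln x\<bar>) + real j * ln x)" by (simp only: exp_add mult.assoc)
    also have "\<dots> \<le> C * 1" using m(2) C(1) by (intro mult_left_mono) auto
    finally show "\<bar>V (ln x)\<bar> * x ^ j \<le> C" by simp
  qed
  then show ?thesis using C(1) by blast
qed

lemma thetak_derivative: "(thetak k has_real_derivative thetak (Suc k) x) (at x)"
proof -
  consider "x > 0" | "x < 0" | "x = 0" by linarith
  then show ?thesis
  proof cases
    case 1
    have d1: "((\<lambda>x. wfam k (ln x)) has_real_derivative deriv (wfam k) (ln x) * (1 / x)) (at x)"
      by (rule DERIV_chain2[OF rapid_derivative(2)[OF rapid_wfam]]) (use 1 in \<open>auto intro!: derivative_eq_intros\<close>)
    have "((\<lambda>x. wfam k (ln x) / x ^ Suc k) has_real_derivative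
      (deriv (wfam k) (ln x) * (1 / x) * x ^ Suc k - wfam k (ln x) * (real (Suc k) * x ^ (Suc k - Suc 0))) / (x ^ Suc k * x ^ Suc k)) (at x)"
      by (rule DERIV_divide[OF d1 DERIV_pow]) (use 1 in simp)
    also have "(deriv (wfam k) (ln x) * (1 / x) * x ^ Suc k - wfam k (ln x) * (real (Suc k) * x ^ (Suc k - Suc 0))) / (x ^ Suc k * x ^ Suc k)
      = thetak (Suc k) x"
      using 1 by (simp add: thetak_def field_simps)
    finally show ?thesis
      by (rule has_field_derivative_transform_within_open[of _ _ _ "{0<..}"]) (use 1 in \<open>auto simp: thetak_def\<close>)
  next
    case 2
    have "((\<lambda>_. 0) has_real_derivative 0) (at x)" by simp
    then have "(thetak k has_real_derivative 0) (at x)"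
      by (rule has_field_derivative_transform_within_open[of _ _ _ "{..<0}"]) (use 2 in \<open>auto simp: thetak_def\<close>)
    then show ?thesis using 2 by (simp add: thetak_def)
  next
    case 3
    \<comment> \<open>Of the k + 3 powers, k + 1 cancel the denominator of \<open>thetak\<close> and
      two remain for the quadratic remainder at 0.\<close>
    obtain C where C: "C \<ge> 0" "\<And>x. x > 0 \<Longrightarrow> \<bar>wfam k (ln x)\<bar> \<le> C * x ^ (k + 3)"
      using rapid_ln_bound[OF rapid_wfam] by blast
    have "(thetak k has_vector_derivative 0) (at x)"
    proof (rule has_vector_derivative_quadratic)
      fix y :: real
      have "\<bar>thetak k y\<bar> \<le> C * y\<^sup>2"
      proof (cases "y > 0")
        case True
        have "\<bar>thetak k y\<bar> = \<bar>wfam k (ln y)\<bar> / y ^ Suc k" using True by (simp add: thetak_def)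
        also have "\<dots> \<le> C * y ^ (k + 3) / y ^ Suc k" using True by (intro divide_right_mono C(2)) auto
        also have "\<dots> = C * y\<^sup>2" using True by (simp add: power_add power2_eq_square eval_nat_numeral)
        finally show ?thesis .
      qed (use C(1) in \<open>simp add: thetak_def\<close>)
      then show "norm (thetak k y - thetak k x - (y - x) *\<^sub>R 0) \<le> C * (y - x)\<^sup>2"
        by (simp add: 3 thetak_def[of k 0])
    qed
    then show ?thesis using 3 by (simp add: thetak_def has_real_derivative_iff_has_vector_derivative)
  qed
qed

lemma thetak_bound: "\<exists>C. \<forall>t. \<bar>t\<bar> ^ j * \<bar>thetak k t\<bar> \<le> C"
proof -
  \<comment> \<open>Both exponents are truncated subtractions: \<open>C\<close> is used when j is at
    least k + 1, \<open>B\<close> otherwise.\<close>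
  obtain C where C: "C \<ge> 0" "\<And>x. x > 0 \<Longrightarrow> \<bar>wfam k (ln x)\<bar> * x ^ (j - Suc k) \<le> C"
    using rapid_ln_bound[OF rapid_wfam] by blast
  obtain B where B: "B \<ge> 0" "\<And>x. x > 0 \<Longrightarrow> \<bar>wfam k (ln x)\<bar> \<le> B * x ^ (Suc k - j)"
    using rapid_ln_bound[OF rapid_wfam] by blast
  have "\<bar>t\<bar> ^ j * \<bar>thetak k t\<bar> \<le> C + B" for t
  proof (cases "t > 0")
    case True
    have e: "\<bar>t\<bar> ^ j * \<bar>thetak k t\<bar> = \<bar>wfam k (ln t)\<bar> * (t ^ j / t ^ Suc k)" using True by (simp add: thetak_def)
    show ?thesis
    proof (cases "Suc k \<le> j")
      case le: True
      have "t ^ j / t ^ Suc k = t ^ (j - Suc k)" using True le by (simp add: power_diff del: power_Suc)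
      then show ?thesis using C(2)[OF True] B(1) unfolding e by simp
    next
      case False
      then have "t ^ j / t ^ Suc k = 1 / t ^ (Suc k - j)" using True by (simp add: power_diff del: power_Suc)
      then have "\<bar>t\<bar> ^ j * \<bar>thetak k t\<bar> = \<bar>wfam k (ln t)\<bar> / t ^ (Suc k - j)" unfolding e by simp
      also have "\<dots> \<le> B" using B(2)[OF True] True by (simp add: pos_divide_le_eq)
      finally show ?thesis using C(1) by simp
    qed
  qed (use C(1) B(1) in \<open>simp add: thetak_def\<close>)
  then show ?thesis by blast
qed

definition theta :: "real \<Rightarrow> real" where "theta = thetak 0"

lemma schwartz_theta: "schwartz (\<lambda>x. complex_of_real (theta x))"
proof (rule schwartzI[of "\<lambda>k x. complex_of_real (thetak k x)"])
  show "((\<lambda>x. complex_of_real (thetak k x)) has_vector_derivative complex_of_real (thetak (Suc k) t)) (at t)" for k t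
    using thetak_derivative[of k t] unfolding has_real_derivative_iff_has_vector_derivative
    by (rule bounded_linear.has_vector_derivative[OF bounded_linear_of_real])
  show "\<exists>C. \<forall>t. \<bar>t\<bar> ^ j * norm (complex_of_real (thetak k t)) \<le> C" for j k
    using thetak_bound[of j k] by simp
qed (simp add: theta_def)

lemma theta_moment: "integral UNIV (\<lambda>x. x ^ m * theta x) = integral UNIV (\<lambda>u. exp (real m * u) * gtail u)"
proof -
  let ?f = "\<lambda>x. x ^ m * theta x"
  \<comment> \<open>The Jacobian exp u cancels the division by x in \<open>theta\<close>.\<close>
  have e: "\<bar>exp u\<bar> * ?f (exp u) = exp (real m * u) * gtail u" for u
    by (simp add: theta_def thetak_def exp_of_nat_mult)
  have r: "range (exp :: real \<Rightarrow> real) = {0<..}" 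
  proof
    show "{0<..} \<subseteq> range (exp :: real \<Rightarrow> real)"
    proof
      fix x :: real assume "x \<in> {0<..}"
      then show "x \<in> range exp" by (intro image_eqI[of x exp "ln x"]) auto
    qed
  qed auto
  have bi: "bochner_integrable (\<lambda>u. exp (real m * u) * gtail u)" by (rule rapid_exp_bochner[OF rapid_gtail])
  have "integrable lebesgue (\<lambda>u. exp (real m * u) * gtail u)"
    by (rule integrable_norm_cancel[OF bochner_integrableD(2)[OF bi] strongly_measurable_borel[OF bochner_integrableD(1)[OF bi]]])
  then have "(\<lambda>u. \<bar>exp u\<bar> * ?f (exp u)) absolutely_integrable_on UNIV"
    unfolding e by (simp add: set_integrable_def)
  then have "integral (range exp) ?f = integral UNIV (\<lambda>u. \<bar>exp u\<bar> * ?f (exp u))"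
    using has_absolute_integral_change_of_variables_1'[of UNIV exp exp ?f "integral UNIV (\<lambda>u. \<bar>exp u\<bar> * ?f (exp u))"]
    by (auto intro!: derivative_eq_intros simp: inj_on_def)
  then have "integral {0<..} ?f = integral UNIV (\<lambda>u. exp (real m * u) * gtail u)"
    unfolding e r .
  moreover have "integral {0<..} ?f = integral UNIV ?f"
  proof -
    have "(\<lambda>x. if x \<in> {0<..} then ?f x else 0) = ?f" by (auto simp: theta_def thetak_def)
    then show ?thesis using integral_restrict_UNIV[of "{0<..}" ?f] by simp
  qed
  ultimately show ?thesis by simp
qed

lemma theta_moments_vanish: "m \<ge> 1 \<Longrightarrow> integral UNIV (\<lambda>x. x ^ m * theta x) = 0"
  unfolding theta_moment by (rule gtail_moment_0)

lemma theta_integral_nonzero: "integral UNIV theta \<noteq> 0"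
  using theta_moment[of 0] gtail_integral_nonzero by simp

section \<open>Affine images of Schwartz functions, their moments, and the bumps\<close>

lemma power_one_plus_le: "(1 + x) ^ j \<le> 2 ^ j * (1 + x ^ j)" if "x \<ge> 0" for x :: real
proof -
  have "(1 + x) ^ j \<le> (2 * max 1 x) ^ j" using that by (intro power_mono) auto
  also have "\<dots> = 2 ^ j * max 1 x ^ j" by (simp add: power_mult_distrib)
  also have "\<dots> \<le> 2 ^ j * (1 + x ^ j)" using that by (intro mult_left_mono) (auto simp: max_def)
  finally show ?thesis .
qed

lemma schwartz_affine:
  assumes f: "schwartz f" and c: "c \<noteq> 0"
  shows "schwartz (\<lambda>v. f (a + c * v))"
proof (rule schwartzI[of "\<lambda>k v. c ^ k *\<^sub>R nderiv k f (a + c * v)"])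
  show "((\<lambda>v. c ^ k *\<^sub>R nderiv k f (a + c * v)) has_vector_derivative c ^ Suc k *\<^sub>R nderiv (Suc k) f (a + c * t)) (at t)" for k t
  proof -
    have "((\<lambda>v. a + c * v) has_vector_derivative c) (at t)"
      unfolding has_real_derivative_iff_has_vector_derivative[symmetric] by (auto intro!: derivative_eq_intros)
    from vector_diff_chain_at[OF this smoothD[OF schwartz_smooth[OF f], of k]]
    have "((\<lambda>v. nderiv k f (a + c * v)) has_vector_derivative c *\<^sub>R nderiv (Suc k) f (a + c * t)) (at t)"
      by (simp add: comp_def)
    from bounded_linear.has_vector_derivative[OF bounded_linear_scaleR_right[of "c ^ k"] this]
    show ?thesis by (simp add: mult.commute)
  qed
  fix j k
  obtain C1 where C1: "\<And>t. \<bar>t\<bar> ^ 0 * norm (nderiv k f t) \<le> C1" using f unfolding schwartz_def by blast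
  obtain C2 where C2: "\<And>t. \<bar>t\<bar> ^ j * norm (nderiv k f t) \<le> C2" using f unfolding schwartz_def by blast
  let ?K = "((1 + \<bar>a\<bar>) / \<bar>c\<bar>) ^ j * 2 ^ j * \<bar>c\<bar> ^ k"
  have "\<bar>t\<bar> ^ j * norm (c ^ k *\<^sub>R nderiv k f (a + c * t)) \<le> ?K * (C1 + C2)" for t
  proof -
    let ?s = "a + c * t"
    have "\<bar>t\<bar> = \<bar>?s - a\<bar> / \<bar>c\<bar>" using c by (simp add: abs_mult)
    also have "\<dots> \<le> ((1 + \<bar>a\<bar>) * (1 + \<bar>?s\<bar>)) / \<bar>c\<bar>"
    proof (rule divide_right_mono)
      have "\<bar>?s - a\<bar> \<le> \<bar>?s\<bar> + \<bar>a\<bar>" by (rule abs_triangle_ineq4)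
      also have "\<dots> \<le> (1 + \<bar>a\<bar>) * (1 + \<bar>?s\<bar>)" by (simp add: algebra_simps)
      finally show "\<bar>?s - a\<bar> \<le> (1 + \<bar>a\<bar>) * (1 + \<bar>?s\<bar>)" .
    qed simp
    finally have "\<bar>t\<bar> ^ j \<le> (((1 + \<bar>a\<bar>) / \<bar>c\<bar>) * (1 + \<bar>?s\<bar>)) ^ j" by (intro power_mono) auto
    also have "\<dots> \<le> ((1 + \<bar>a\<bar>) / \<bar>c\<bar>) ^ j * (2 ^ j * (1 + \<bar>?s\<bar> ^ j))"
      unfolding power_mult_distrib by (intro mult_left_mono power_one_plus_le) auto
    finally have "\<bar>t\<bar> ^ j * norm (c ^ k *\<^sub>R nderiv k f ?s) \<le> (((1 + \<bar>a\<bar>) / \<bar>c\<bar>) ^ j * (2 ^ j * (1 + \<bar>?s\<bar> ^ j))) * norm (c ^ k *\<^sub>R nderiv k f ?s)"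
      by (rule mult_right_mono) simp
    also have "\<dots> = ?K * (norm (nderiv k f ?s) + \<bar>?s\<bar> ^ j * norm (nderiv k f ?s))"
      by (simp add: power_abs algebra_simps)
    also have "\<dots> \<le> ?K * (C1 + C2)"
      using C1[of ?s] C2[of ?s] by (intro mult_left_mono add_mono) auto
    finally show ?thesis .
  qed
  then show "\<exists>C. \<forall>t. \<bar>t\<bar> ^ j * norm (c ^ k *\<^sub>R nderiv k f (a + c * t)) \<le> C" by blast
qed simp

lemma schwartz_bounded_linear:
  assumes f: "schwartz f" and h: "bounded_linear h"
  shows "schwartz (\<lambda>t. h (f t))"
proof (rule schwartzI[of "\<lambda>k t. h (nderiv k f t)"])
  show "((\<lambda>t. h (nderiv k f t)) has_vector_derivative h (nderiv (Suc k) f t)) (at t)" for k t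
    by (rule bounded_linear.has_vector_derivative[OF h smoothD[OF schwartz_smooth[OF f]]])
  fix j k
  obtain K where K: "K > 0" "\<And>x. norm (h x) \<le> norm x * K" using bounded_linear.pos_bounded[OF h] by blast
  obtain C where C: "\<And>t. \<bar>t\<bar> ^ j * norm (nderiv k f t) \<le> C" using f unfolding schwartz_def by blast
  have "\<bar>t\<bar> ^ j * norm (h (nderiv k f t)) \<le> C * K" for t
  proof -
    have "\<bar>t\<bar> ^ j * norm (h (nderiv k f t)) \<le> \<bar>t\<bar> ^ j * (norm (nderiv k f t) * K)"
      by (intro mult_left_mono K) auto
    also have "\<dots> \<le> C * K" using C[of t] K(1) by (simp add: mult.assoc[symmetric] mult_right_mono)
    finally show ?thesis .
  qed
  then show "\<exists>C. \<forall>t. \<bar>t\<bar> ^ j * norm (h (nderiv k f t)) \<le> C" by blast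
qed simp

lemma schwartz_diff:
  assumes f: "schwartz f" and g: "schwartz g"
  shows "schwartz (\<lambda>t. f t - g t)"
proof (rule schwartzI[of "\<lambda>k t. nderiv k f t - nderiv k g t"])
  show "((\<lambda>t. nderiv k f t - nderiv k g t) has_vector_derivative nderiv (Suc k) f t - nderiv (Suc k) g t) (at t)" for k t
    by (intro has_vector_derivative_diff smoothD schwartz_smooth f g)
  fix j k
  obtain C1 where C1: "\<And>t. \<bar>t\<bar> ^ j * norm (nderiv k f t) \<le> C1" using f unfolding schwartz_def by blast
  obtain C2 where C2: "\<And>t. \<bar>t\<bar> ^ j * norm (nderiv k g t) \<le> C2" using g unfolding schwartz_def by blast
  have "\<bar>t\<bar> ^ j * norm (nderiv k f t - nderiv k g t) \<le> C1 + C2" for t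
  proof -
    have "\<bar>t\<bar> ^ j * norm (nderiv k f t - nderiv k g t) \<le> \<bar>t\<bar> ^ j * (norm (nderiv k f t) + norm (nderiv k g t))"
      by (intro mult_left_mono norm_triangle_ineq4) auto
    then show ?thesis using C1[of t] C2[of t] by (simp add: algebra_simps)
  qed
  then show "\<exists>C. \<forall>t. \<bar>t\<bar> ^ j * norm (nderiv k f t - nderiv k g t) \<le> C" by blast
qed simp

lemma schwartz_moment_bochner:
  fixes f :: "real \<Rightarrow> 'a::{complex_normed_vector,banach}"
  assumes f: "schwartz f"
  shows "bochner_integrable (\<lambda>t. t ^ k *\<^sub>R f t)"
proof -
  obtain C1 where C1: "\<And>t. \<bar>t\<bar> ^ k * norm (nderiv 0 f t) \<le> C1" using f unfolding schwartz_def by blast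
  obtain C2 where C2: "\<And>t. \<bar>t\<bar> ^ (k + 2) * norm (nderiv 0 f t) \<le> C2" using f unfolding schwartz_def by blast
  show ?thesis
  proof (rule bochner_integrable_bound)
    show "strongly_measurable lebesgue (\<lambda>t. t ^ k *\<^sub>R f t)"
      by (intro strongly_measurable_continuous continuous_intros schwartz_continuous f)
    show "integrable lebesgue (\<lambda>t. (C1 + C2) / (1 + t\<^sup>2))" by (rule integrable_inverse_square_const)
    show "AE t in lebesgue. norm (t ^ k *\<^sub>R f t) \<le> (C1 + C2) / (1 + t\<^sup>2)"
    proof (rule AE_I2)
      fix t :: real
      have "(1 + t\<^sup>2) * norm (t ^ k *\<^sub>R f t) \<le> C1 + C2"
      proof -
        have "\<bar>t\<bar> ^ (k + 2) = t\<^sup>2 * \<bar>t\<bar> ^ k" by (simp add: power_add power2_eq_square)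
        then have "t\<^sup>2 * (\<bar>t\<bar> ^ k * norm (f t)) \<le> C2" using C2[of t] by (simp only: mult.assoc nderiv_0)
        then show ?thesis using C1[of t] by (simp add: power_abs distrib_right)
      qed
      then show "norm (t ^ k *\<^sub>R f t) \<le> (C1 + C2) / (1 + t\<^sup>2)"
        by (simp add: pos_le_divide_eq add_pos_nonneg mult.commute)
    qed
  qed
qed

text \<open>After the substitution w = a + c t the power of t is a polynomial in w, so the integral
  is a combination of moments of \<open>f\<close>.\<close>

lemma moments_vanish_affine:
  fixes f :: "real \<Rightarrow> 'a::{complex_normed_vector,banach}"
  assumes f: "schwartz f" and m: "\<And>k. integral UNIV (\<lambda>t. t ^ k *\<^sub>R f t) = 0" and c: "c \<noteq> 0"
  shows "integral UNIV (\<lambda>t. t ^ k *\<^sub>R f (a + c * t)) = 0"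
proof -
  define g where "g w = (\<Sum>i\<le>k. (real (k choose i) * (- a) ^ (k - i) / c ^ k) *\<^sub>R (w ^ i *\<^sub>R f w))" for w
  have b: "bochner_integrable (\<lambda>w. q *\<^sub>R (w ^ i *\<^sub>R f w))" for q i
    by (rule bochner_integrable_linear[OF schwartz_moment_bochner[OF f] bounded_linear_scaleR_right])
  have bg: "bochner_integrable g"
  proof -
    have "bochner_integrable (\<lambda>w. \<Sum>i\<in>I. (real (k choose i) * (- a) ^ (k - i) / c ^ k) *\<^sub>R (w ^ i *\<^sub>R f w))"
      if "finite I" for I
      using that
    proof induction
      case empty
      have "bochner_integrable (\<lambda>w. 0 *\<^sub>R (w ^ 0 *\<^sub>R f w))" by (rule b)
      then show ?case by simp
    next
      case (insert i I)
      show ?case unfolding sum.insert[OF insert.hyps] by (intro bochner_integrable_add b insert.IH)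
    qed
    then show ?thesis unfolding g_def[abs_def] by simp
  qed
  have geq: "g w = ((w - a) / c) ^ k *\<^sub>R f w" for w
  proof -
    have "(w - a) ^ k = (\<Sum>i\<le>k. real (k choose i) * w ^ i * (- a) ^ (k - i))"
      using binomial_ring[of w "- a" k] by simp
    then have "((w - a) / c) ^ k = (\<Sum>i\<le>k. (real (k choose i) * (- a) ^ (k - i) / c ^ k) * w ^ i)"
      by (simp add: power_divide sum_divide_distrib mult_ac)
    then show ?thesis unfolding g_def by (simp add: scaleR_sum_left)
  qed
  have "integral UNIV g = (\<Sum>i\<le>k. integral UNIV (\<lambda>w. (real (k choose i) * (- a) ^ (k - i) / c ^ k) *\<^sub>R (w ^ i *\<^sub>R f w)))"
    unfolding g_def by (rule integral_sum[OF finite_atMost bochner_integrable_integrable_on[OF b]])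
  also have "\<dots> = 0"
    by (intro sum.neutral ballI) (simp only: bochner_integral_linear[OF schwartz_moment_bochner[OF f] bounded_linear_scaleR_right] m scaleR_zero_right)
  finally have "integral UNIV g = 0" .
  moreover have "t ^ k *\<^sub>R f (a + c * t) = g (a + c * t)" for t unfolding geq using c by simp
  ultimately show ?thesis using bochner_affine(2)[OF bg c, of a] by simp
qed

text \<open>The first term is an approximate identity as \<open>N \<rightarrow> \<infinity>\<close>; the second one cancels its integral
  and is negligible against integrable orbits.\<close>
definition bump :: "real \<Rightarrow> real \<Rightarrow> real" where
  "bump N u = N * theta (N * u) - (1 / N) * theta (u / N)"

lemma
  assumes N: "N > 0"
  shows schwartz_bump: "schwartz (\<lambda>u. complex_of_real (bump N u))"
    and bump_moments: "integral UNIV (\<lambda>u. u ^ k *\<^sub>R complex_of_real (bump N u)) = 0"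
proof -
  let ?th = "\<lambda>x. complex_of_real (theta x)"
  have s1: "schwartz (\<lambda>u. N *\<^sub>R ?th (0 + N * u))" and s2: "schwartz (\<lambda>u. (1 / N) *\<^sub>R ?th (0 + (1 / N) * u))"
    by (rule schwartz_bounded_linear[OF schwartz_affine[OF schwartz_theta] bounded_linear_scaleR_right], use N in simp)+
  have e: "complex_of_real (bump N u) = N *\<^sub>R ?th (0 + N * u) - (1 / N) *\<^sub>R ?th (0 + (1 / N) * u)" for u
    by (simp add: bump_def scaleR_conv_of_real)
  show "schwartz (\<lambda>u. complex_of_real (bump N u))" unfolding e by (rule schwartz_diff[OF s1 s2])
  have b: "bochner_integrable (\<lambda>x. x ^ k *\<^sub>R ?th x)" by (rule schwartz_moment_bochner[OF schwartz_theta])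
  define I where "I = integral UNIV (\<lambda>x. x ^ k *\<^sub>R ?th x)"
  have I0: "I = 0" if "k \<ge> 1"
  proof -
    have "integral UNIV (\<lambda>x. complex_of_real (x ^ k * theta x)) = 0"
    proof -
      have bR: "bochner_integrable (\<lambda>x. Re (x ^ k *\<^sub>R ?th x))" by (rule bochner_integrable_linear[OF b bounded_linear_Re])
      then have "bochner_integrable (\<lambda>x. x ^ k * theta x)" by simp
      from bochner_integral_linear[OF this bounded_linear_of_real[where 'a=complex]]
      show ?thesis by (simp add: theta_moments_vanish[OF that] del: of_real_mult of_real_power)
    qed
    then show ?thesis unfolding I_def by (simp add: scaleR_conv_of_real)
  qed
  have sc: "bochner_integrable (\<lambda>u. u ^ k *\<^sub>R (c *\<^sub>R ?th (0 + c * u)))"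
    "integral UNIV (\<lambda>u. u ^ k *\<^sub>R (c *\<^sub>R ?th (0 + c * u))) = (1 / c ^ k) *\<^sub>R I" if c: "c > 0" for c
  proof -
    have e: "u ^ k *\<^sub>R (c *\<^sub>R ?th (0 + c * u)) = (c / c ^ k) *\<^sub>R ((0 + c * u) ^ k *\<^sub>R ?th (0 + c * u))" for u
      using c by (simp add: power_mult_distrib)
    have ba: "bochner_integrable (\<lambda>u. (0 + c * u) ^ k *\<^sub>R ?th (0 + c * u))"
      by (rule bochner_affine(1)[OF b]) (use c in simp)
    have ia: "integral UNIV (\<lambda>u. (0 + c * u) ^ k *\<^sub>R ?th (0 + c * u)) = (1 / \<bar>c\<bar>) *\<^sub>R I"
      unfolding I_def by (rule bochner_affine(2)[OF b]) (use c in simp)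
    show "bochner_integrable (\<lambda>u. u ^ k *\<^sub>R (c *\<^sub>R ?th (0 + c * u)))"
      unfolding e by (rule bochner_integrable_linear[OF ba bounded_linear_scaleR_right])
    show "integral UNIV (\<lambda>u. u ^ k *\<^sub>R (c *\<^sub>R ?th (0 + c * u))) = (1 / c ^ k) *\<^sub>R I"
      unfolding e bochner_integral_linear[OF ba bounded_linear_scaleR_right] ia using c by simp
  qed
  have Ni: "1 / N > 0" using N by simp
  have "integral UNIV (\<lambda>u. u ^ k *\<^sub>R complex_of_real (bump N u)) = (1 / N ^ k) *\<^sub>R I - (1 / (1 / N) ^ k) *\<^sub>R I"
    unfolding e scaleR_diff_right
    by (simp only: bochner_integral_diff[OF sc(1)[OF N] sc(1)[OF Ni]] sc(2)[OF N] sc(2)[OF Ni])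
  \<comment> \<open>For k = 0 the two rescaled copies of \<open>theta\<close> have equal integrals
    and cancel; for larger k each moment vanishes by itself.\<close>
  also have "\<dots> = 0" by (cases "k = 0") (use I0 in auto)
  finally show "integral UNIV (\<lambda>u. u ^ k *\<^sub>R complex_of_real (bump N u)) = 0" .
qed

lemma dot_schwartz_bump:
  fixes y :: "'a::{complex_normed_vector,banach}"
  assumes N: "N > 0"
  shows "dot_schwartz (\<lambda>v. scaleC (complex_of_real (bump N (a - v))) y)"
proof -
  let ?b = "\<lambda>v. complex_of_real (bump N (a + (- 1) * v))"
  have s: "schwartz ?b" by (rule schwartz_affine[OF schwartz_bump[OF N]]) simp
  have m: "integral UNIV (\<lambda>v. v ^ k *\<^sub>R ?b v) = 0" for k
    by (rule moments_vanish_affine[OF schwartz_bump[OF N] bump_moments[OF N]]) simp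
  have "dot_schwartz (\<lambda>v. scaleC (?b v) y)"
  proof (rule dot_schwartz_moments)
    show "schwartz (\<lambda>v. scaleC (?b v) y)" by (rule schwartz_bounded_linear[OF s bounded_linear_scaleC_left])
    show "integral UNIV (\<lambda>v. v ^ k *\<^sub>R scaleC (?b v) y) = 0" for k
      using bochner_integral_linear[OF schwartz_moment_bochner[OF s, of k] bounded_linear_scaleC_left, of y] m[of k]
      by (simp add: scaleC_scaleR_left)
  qed
  then show ?thesis by simp
qed

section \<open>Combs of approximate identities\<close>

lemma bochner_L1_on_integrable:
  assumes "bochner_L1_on {0..} f"
  shows "integrable lebesgue (\<lambda>t. if t \<in> {0..} then norm (f t) else 0)"
proof -
  have "integrable (lebesgue_on {0..}) (\<lambda>t. norm (f t))" using assms unfolding bochner_L1_on_def by blast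
  then show ?thesis using Lebesgue_Measure.integrable_restrict_UNIV[of "{0..}" "\<lambda>t. norm (f t)"] by simp
qed

lemma integrable_indicator_Icc: "integrable lebesgue (indicat_real {a..b::real})"
proof -
  have "integrable lborel (indicat_real {a..b})" by (rule integrable_real_indicator) (auto simp: emeasure_lborel_Icc_eq)
  then show ?thesis by (subst integrable_completion) auto
qed

lemma integral_indicator_Icc: "a \<le> b \<Longrightarrow> integral\<^sup>L lebesgue (indicat_real {a..b::real}) = b - a"
  by simp

text \<open>The scalar that the averaged bumps put in front of T(v) J y: the translate by q = j / N
  acts on T(q) y, and T(v - q) T(q) = T(v) leaves the kernel value (v - q)^n / n!, averaged over
  j.\<close>

definition translate_weight :: "nat \<Rightarrow> nat \<Rightarrow> real \<Rightarrow> real" where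
  "translate_weight n N v = (1 / real N) *
     (\<Sum>j<N. indicat_real {0..} (v - real j / real N) * ((v - real j / real N) ^ n / fact n))"

lemma translate_weight_measurable: "translate_weight n N \<in> borel_measurable borel"
  unfolding translate_weight_def[abs_def] by measurable

text \<open>The shifts j / N lie in [0, 1) and powers are monotone, so every averaged term lies
  between the kernel values at v - 1 and at v.\<close>

lemma translate_weight_bounds:
  assumes N: "N > 0"
  shows "0 \<le> translate_weight n N v"
    and "translate_weight n N v \<le> indicat_real {0..} v * (v ^ n / fact n)"
    and "1 \<le> v \<Longrightarrow> (v - 1) ^ n / fact n \<le> translate_weight n N v"
proof -
  let ?t = "\<lambda>j. indicat_real {0..} (v - real j / real N) * ((v - real j / real N) ^ n / fact n)"
  have t0: "0 \<le> ?t j" for j by (auto simp: indicator_def)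
  show "0 \<le> translate_weight n N v"
    unfolding translate_weight_def by (intro mult_nonneg_nonneg sum_nonneg t0) auto
  have "?t j \<le> indicat_real {0..} v * (v ^ n / fact n)" for j
  proof (cases "v - real j / real N \<ge> 0")
    case True
    then have "0 \<le> v" by (rule order_trans) simp
    moreover have "(v - real j / real N) ^ n \<le> v ^ n" using True by (intro power_mono) auto
    ultimately show ?thesis using True by (simp add: divide_right_mono)
  qed (auto simp: indicator_def)
  then have "(\<Sum>j<N. ?t j) \<le> (\<Sum>j<N. indicat_real {0..} v * (v ^ n / fact n))" by (intro sum_mono)
  then have "(1 / real N) * (\<Sum>j<N. ?t j) \<le> (1 / real N) * (real N * (indicat_real {0..} v * (v ^ n / fact n)))"
    by (intro mult_left_mono) auto
  then show "translate_weight n N v \<le> indicat_real {0..} v * (v ^ n / fact n)"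
    using N unfolding translate_weight_def by simp
  assume v: "1 \<le> v"
  have "(v - 1) ^ n / fact n \<le> ?t j" if "j < N" for j
  proof -
    have "real j / real N \<le> 1" using that N by simp
    then have "v - 1 \<le> v - real j / real N" "0 \<le> v - real j / real N" using v by auto
    then have "(v - 1) ^ n \<le> (v - real j / real N) ^ n" using v by (intro power_mono) auto
    then show ?thesis using \<open>0 \<le> v - real j / real N\<close> by (simp add: divide_right_mono)
  qed
  then have "(\<Sum>j<N. (v - 1) ^ n / fact n) \<le> (\<Sum>j<N. ?t j)" by (intro sum_mono) auto
  then have "(1 / real N) * (real N * ((v - 1) ^ n / fact n)) \<le> (1 / real N) * (\<Sum>j<N. ?t j)"
    by (intro mult_left_mono) auto
  then show "(v - 1) ^ n / fact n \<le> translate_weight n N v"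
    using N unfolding translate_weight_def by simp
qed

text \<open>The weight changes with m, so continuity of one function is not enough. For \<tau> > 1
  all indicators equal 1 near \<tau>, and uniform continuity of z^n on a compact interval bounds all
  the averaged differences by the same amount.\<close>

lemma translate_weight_shift:
  assumes \<tau>: "1 < \<tau>"
  shows "(\<lambda>m. translate_weight n (Suc m) (\<tau> - w / real (Suc m)) - translate_weight n (Suc m) \<tau>) \<longlonglongrightarrow> 0"
proof (rule LIMSEQ_I)
  fix e :: real assume e: "e > 0"
  have "uniformly_continuous_on {0..\<tau> + 1} (\<lambda>z::real. z ^ n)"
    by (intro compact_uniformly_continuous continuous_intros) auto
  then obtain d where d: "d > 0" "\<And>x y. x \<in> {0..\<tau> + 1} \<Longrightarrow> y \<in> {0..\<tau> + 1} \<Longrightarrow> dist y x < d \<Longrightarrow> dist (y ^ n) (x ^ n) < e / 2"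
    unfolding uniformly_continuous_on_def using e by (metis half_gt_zero)
  have "(\<lambda>m. w / real (Suc m)) \<longlonglongrightarrow> 0" by real_asymp
  then obtain m0 where m0: "\<And>m. m \<ge> m0 \<Longrightarrow> norm (w / real (Suc m) - 0) < min d (min (\<tau> - 1) 1)"
    using LIMSEQ_D[of _ 0 "min d (min (\<tau> - 1) 1)"] d(1) \<tau> by (metis min_less_iff_conj diff_gt_0_iff_gt zero_less_one)
  show "\<exists>no. \<forall>m\<ge>no. norm (translate_weight n (Suc m) (\<tau> - w / real (Suc m)) - translate_weight n (Suc m) \<tau> - 0) < e"
  proof (intro exI[of _ m0] allI impI)
    fix m assume m: "m0 \<le> m"
    define N where "N = Suc m"
    define v where "v = \<tau> - w / real N"
    have w: "\<bar>w / real N\<bar> < d" "\<bar>w / real N\<bar> < \<tau> - 1" "\<bar>w / real N\<bar> < 1"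
      using m0[OF m] by (simp_all add: N_def)
    have "1 < v" "v < \<tau> + 1" using w(2,3) unfolding v_def abs_less_iff by linarith+
    moreover have "dist v \<tau> < d" using w(1) by (simp add: v_def dist_real_def)
    ultimately have v: "1 < v" "v < \<tau> + 1" "dist v \<tau> < d" by auto
    have one: "translate_weight n N u = (1 / real N) * (\<Sum>j<N. (u - real j / real N) ^ n / fact n)" if "1 < u" for u
    proof -
      have "0 \<le> u - real j / real N" if "j < N" for j
      proof -
        have "real j / real N \<le> 1" using that by simp
        then show ?thesis using \<open>1 < u\<close> by linarith
      qed
      then show ?thesis unfolding translate_weight_def by (intro arg_cong[where f="\<lambda>s. 1 / real N * s"] sum.cong) auto
    qed
    have "translate_weight n N v - translate_weight n N \<tau>
        = (1 / real N) * (\<Sum>j<N. ((v - real j / real N) ^ n - (\<tau> - real j / real N) ^ n) / fact n)"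
      unfolding one[OF v(1)] one[OF \<tau>] by (simp add: sum_subtractf diff_divide_distrib)
    also have "\<bar>\<dots>\<bar> \<le> (1 / real N) * (\<Sum>j<N. e / 2)"
      unfolding abs_mult
    proof (rule mult_mono)
      show "\<bar>\<Sum>j<N. ((v - real j / real N) ^ n - (\<tau> - real j / real N) ^ n) / fact n\<bar> \<le> (\<Sum>j<N. e / 2)"
      proof (rule order_trans[OF sum_abs sum_mono])
        fix j assume "j \<in> {..<N}"
        then have "real j / real N \<le> 1" "0 \<le> real j / real N" by auto
        then have "v - real j / real N \<in> {0..\<tau> + 1}" "\<tau> - real j / real N \<in> {0..\<tau> + 1}"
          using v \<tau> unfolding atLeastAtMost_iff by linarith+
        moreover have "dist (v - real j / real N) (\<tau> - real j / real N) < d" using v(3) by (simp add: dist_real_def)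
        ultimately have "\<bar>(v - real j / real N) ^ n - (\<tau> - real j / real N) ^ n\<bar> < e / 2"
          using d(2) by (metis dist_real_def)
        moreover have "\<bar>x / fact n\<bar> \<le> \<bar>x\<bar>" for x :: real
          by (simp add: abs_divide divide_le_eq mult_left_le fact_ge_1 mult_le_cancel_left1)
        ultimately show "\<bar>((v - real j / real N) ^ n - (\<tau> - real j / real N) ^ n) / fact n\<bar> \<le> e / 2"
          by (meson less_imp_le order_trans)
      qed
    qed (use e in auto)
    also have "\<dots> = e / 2" by (simp add: N_def)
    also have "\<dots> < e" using e by simp
    finally show "norm (translate_weight n (Suc m) (\<tau> - w / real (Suc m)) - translate_weight n (Suc m) \<tau> - 0) < e"
      by (simp add: v_def N_def)
  qed
qed

text \<open>Each term is compared with the increment of arctan over a unit interval, and the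
  increments telescope to at most pi. The factor 3 is the price for moving the argument by at most
  1.\<close>

lemma sum_inverse_square_bound:
  fixes z :: real
  shows "(\<Sum>j<N. 1 / (1 + (z - real j)\<^sup>2)) \<le> 3 * pi"
proof -
  have "1 / (1 + (z - real j)\<^sup>2) \<le> 3 * (arctan (real (Suc j) - z) - arctan (real j - z))" for j
  proof -
    have "\<exists>\<xi>. real j - z < \<xi> \<and> \<xi> < real (Suc j) - z \<and>
      arctan (real (Suc j) - z) - arctan (real j - z) = ((real (Suc j) - z) - (real j - z)) * (inverse (1 + \<xi>\<^sup>2))"
      by (rule MVT2) (auto intro!: derivative_eq_intros)
    then obtain \<xi> where \<xi>: "real j - z < \<xi>" "\<xi> < real (Suc j) - z"
      "arctan (real (Suc j) - z) - arctan (real j - z) = 1 / (1 + \<xi>\<^sup>2)"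
      by (auto simp: inverse_eq_divide)
    define a where "a = real j - z"
    have "\<xi>\<^sup>2 \<le> 2 * a\<^sup>2 + 2"
    proof -
      have "(\<xi> - a)\<^sup>2 \<le> 1" using \<xi> by (intro power_le_one) (auto simp: a_def)
      moreover have "\<xi>\<^sup>2 \<le> 2 * a\<^sup>2 + 2 * (\<xi> - a)\<^sup>2"
        using zero_le_power2[of "\<xi> - 2 * a"] by (simp add: power2_eq_square algebra_simps)
      ultimately show ?thesis by linarith
    qed
    then have "1 + \<xi>\<^sup>2 \<le> 3 * (1 + a\<^sup>2)" using zero_le_power2[of a] unfolding distrib_left by linarith
    moreover have "0 < 1 + \<xi>\<^sup>2" "0 < 1 + a\<^sup>2" by (auto simp: add_pos_nonneg)
    ultimately have "1 / (1 + a\<^sup>2) \<le> 3 * (1 / (1 + \<xi>\<^sup>2))" by (simp add: field_simps)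
    then show ?thesis unfolding \<xi>(3) a_def by (simp add: power2_commute)
  qed
  then have "(\<Sum>j<N. 1 / (1 + (z - real j)\<^sup>2)) \<le> (\<Sum>j<N. 3 * (arctan (real (Suc j) - z) - arctan (real j - z)))"
    by (intro sum_mono)
  also have "\<dots> = 3 * (arctan (real N - z) - arctan (real 0 - z))"
    unfolding sum_distrib_left[symmetric] using sum_lessThan_telescope[of "\<lambda>j. arctan (real j - z)" N] by simp
  also have "\<dots> \<le> 3 * pi" using arctan_bounded[of "real N - z"] arctan_bounded[of "real 0 - z"] by simp
  finally show ?thesis .
qed

section \<open>Bounds for combs in L^1 and in the supremum norm\<close>

lemma theta_continuous: "continuous_on UNIV theta"
proof -
  have "continuous_on UNIV (\<lambda>x. Re (complex_of_real (theta x)))"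
    by (intro continuous_intros schwartz_continuous schwartz_theta)
  then show ?thesis by simp
qed

lemma theta_decay: "\<exists>C\<ge>0. \<forall>t. \<bar>theta t\<bar> \<le> C / (1 + t\<^sup>2)"
  using schwartz_decay[OF schwartz_theta, of 0] by simp

lemma bump_continuous: "continuous_on UNIV (bump N)"
  unfolding bump_def[abs_def]
  by (cases "N = 0") (auto intro!: continuous_intros continuous_on_compose2[OF theta_continuous])

lemma theta_bochner: "bochner_integrable theta"
proof -
  obtain C where C: "\<And>t. \<bar>theta t\<bar> \<le> C / (1 + t\<^sup>2)" using theta_decay by blast
  show ?thesis
    by (rule bochner_integrable_bound[OF strongly_measurable_continuous[OF theta_continuous] integrable_inverse_square_const])
      (rule AE_I2, use C in simp)
qed

lemma theta_abs_integrable: "integrable lebesgue (\<lambda>t. \<bar>theta t\<bar>)"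
  using bochner_integrableD(2)[OF theta_bochner] by simp

text \<open>Both terms of the bump are rescalings of \<open>theta\<close> that preserve the L^1
  norm.\<close>

lemma bump_abs_integral:
  assumes N: "N > 0"
  shows "integrable lebesgue (\<lambda>v. \<bar>bump N (a - v)\<bar>)"
    and "integral\<^sup>L lebesgue (\<lambda>v. \<bar>bump N (a - v)\<bar>) \<le> 2 * integral\<^sup>L lebesgue (\<lambda>t. \<bar>theta t\<bar>)"
proof -
  let ?I = "integral\<^sup>L lebesgue (\<lambda>t. \<bar>theta t\<bar>)"
  have sc: "integrable lebesgue (\<lambda>v. c * \<bar>theta (c * a + (- c) * v)\<bar>)"
    "integral\<^sup>L lebesgue (\<lambda>v. c * \<bar>theta (c * a + (- c) * v)\<bar>) = ?I" if c: "c > 0" for c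
  proof -
    show "integrable lebesgue (\<lambda>v. c * \<bar>theta (c * a + (- c) * v)\<bar>)"
      using c by (intro integrable_mult_right integrable_affine_lebesgue[of "\<lambda>t. \<bar>theta t\<bar>"] theta_abs_integrable) auto
    show "integral\<^sup>L lebesgue (\<lambda>v. c * \<bar>theta (c * a + (- c) * v)\<bar>) = ?I"
      using lebesgue_integral_real_affine[of "- c" "\<lambda>t. \<bar>theta t\<bar>" "c * a"] c by simp
  qed
  have Ni: "1 / N > 0" using N by simp
  have le: "\<bar>bump N (a - v)\<bar> \<le> N * \<bar>theta (N * a + (- N) * v)\<bar> + (1 / N) * \<bar>theta ((1 / N) * a + (- (1 / N)) * v)\<bar>" for v
  proof -
    have "\<bar>bump N (a - v)\<bar> \<le> \<bar>N * theta (N * (a - v))\<bar> + \<bar>(1 / N) * theta ((a - v) / N)\<bar>"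
      unfolding bump_def by (rule abs_triangle_ineq4)
    then show ?thesis using N by (simp add: abs_mult right_diff_distrib diff_divide_distrib)
  qed
  have m: "(\<lambda>v. \<bar>bump N (a - v)\<bar>) \<in> borel_measurable lebesgue"
  proof -
    have "continuous_on UNIV (\<lambda>v. \<bar>bump N (a - v)\<bar>)"
      by (intro continuous_intros continuous_on_compose2[OF bump_continuous]) auto
    then show ?thesis by (intro strongly_measurable_borel strongly_measurable_continuous)
  qed
  have i2: "integrable lebesgue (\<lambda>v. N * \<bar>theta (N * a + (- N) * v)\<bar> + (1 / N) * \<bar>theta ((1 / N) * a + (- (1 / N)) * v)\<bar>)"
    by (intro Bochner_Integration.integrable_add sc N Ni)
  show i: "integrable lebesgue (\<lambda>v. \<bar>bump N (a - v)\<bar>)"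
    by (rule Bochner_Integration.integrable_bound[OF i2 m]) (use le in \<open>auto intro: order_trans[OF _ abs_ge_self]\<close>)
  have "integral\<^sup>L lebesgue (\<lambda>v. \<bar>bump N (a - v)\<bar>) \<le>
      integral\<^sup>L lebesgue (\<lambda>v. N * \<bar>theta (N * a + (- N) * v)\<bar> + (1 / N) * \<bar>theta ((1 / N) * a + (- (1 / N)) * v)\<bar>)"
    by (rule integral_mono[OF i i2]) (rule le)
  also have "\<dots> = 2 * ?I"
    using Bochner_Integration.integral_add[OF sc(1)[OF N] sc(1)[OF Ni]] sc(2)[OF N] sc(2)[OF Ni] by simp
  finally show "integral\<^sup>L lebesgue (\<lambda>v. \<bar>bump N (a - v)\<bar>) \<le> 2 * ?I" .
qed

text \<open>Averaging over \<open>N\<close> translates keeps the bumps bounded in \<open>L\<^sup>1\<close> and \<open>L\<^sup>\<infinity>\<close>, hence in every \<open>L\<^sup>p\<close>.\<close>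
definition comb :: "nat \<Rightarrow> real \<Rightarrow> real" where
  "comb N v = (\<Sum>j<N. (1 / real N) * \<bar>bump (real N) (- (real j / real N) - v)\<bar>)"

lemma comb_L1:
  assumes N: "N > 0"
  shows "integrable lebesgue (comb N)"
    and "integral\<^sup>L lebesgue (comb N) \<le> 2 * integral\<^sup>L lebesgue (\<lambda>t. \<bar>theta t\<bar>)"
proof -
  let ?I = "2 * integral\<^sup>L lebesgue (\<lambda>t. \<bar>theta t\<bar>)"
  have N': "real N > 0" using N by simp
  have i: "integrable lebesgue (\<lambda>v. (1 / real N) * \<bar>bump (real N) (- (real j / real N) - v)\<bar>)" for j
    by (intro integrable_mult_right bump_abs_integral N')
  show "integrable lebesgue (comb N)"
    unfolding comb_def[abs_def] by (intro Bochner_Integration.integrable_sum i)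
  have "integral\<^sup>L lebesgue (comb N) = (\<Sum>j<N. integral\<^sup>L lebesgue (\<lambda>v. (1 / real N) * \<bar>bump (real N) (- (real j / real N) - v)\<bar>))"
    unfolding comb_def[abs_def] by (rule Bochner_Integration.integral_sum) (rule i)
  also have "\<dots> \<le> (\<Sum>j<N. (1 / real N) * ?I)"
  proof (rule sum_mono)
    fix j
    have "(1 / real N) * integral\<^sup>L lebesgue (\<lambda>v. \<bar>bump (real N) (- (real j / real N) - v)\<bar>) \<le> (1 / real N) * ?I"
      by (intro mult_left_mono bump_abs_integral N') auto
    then show "integral\<^sup>L lebesgue (\<lambda>v. (1 / real N) * \<bar>bump (real N) (- (real j / real N) - v)\<bar>) \<le> (1 / real N) * ?I"
      by simp
  qed
  also have "\<dots> = ?I" using N by simp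
  finally show "integral\<^sup>L lebesgue (comb N) \<le> ?I" .
qed

lemma comb_nonneg: "0 \<le> comb N v"
  unfolding comb_def by (intro sum_nonneg mult_nonneg_nonneg) auto

text \<open>The narrow parts contribute theta(-N v - j) for consecutive integers j, so decay of
  \<open>theta\<close> reduces their sum to inverse squares at integer spacing, uniformly in v and
  N. The N wide parts contribute at most C / N each.\<close>

lemma comb_bounded: "\<exists>B\<ge>0. \<forall>N>0. \<forall>v. comb N v \<le> B"
proof -
  obtain C where C: "C \<ge> 0" "\<And>t. \<bar>theta t\<bar> \<le> C / (1 + t\<^sup>2)" using theta_decay by blast
  have C1: "\<bar>theta t\<bar> \<le> C" for t
  proof -
    have "C / (1 + t\<^sup>2) \<le> C / 1" using C(1) by (intro divide_left_mono) (auto simp: add_pos_nonneg)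
    then show ?thesis using C(2)[of t] by simp
  qed
  have "comb N v \<le> C * (3 * pi) + C" if N: "N > 0" for N v
  proof -
    have N': "real N \<ge> 1" using N by simp
    have "(1 / real N) * \<bar>bump (real N) (- (real j / real N) - v)\<bar> \<le> C * (1 / (1 + (- real N * v - real j)\<^sup>2)) + C / real N" for j
    proof -
      let ?u = "- (real j / real N) - v"
      have "\<bar>bump (real N) ?u\<bar> \<le> real N * \<bar>theta (real N * ?u)\<bar> + (1 / real N) * \<bar>theta (?u / real N)\<bar>"
        using abs_triangle_ineq4[of "real N * theta (real N * ?u)" "(1 / real N) * theta (?u / real N)"]
        by (simp add: bump_def abs_mult)
      also have "\<dots> \<le> real N * (C / (1 + (real N * ?u)\<^sup>2)) + 1 * C"
        using N' by (intro add_mono mult_mono C(2) C1) auto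
      finally have "(1 / real N) * \<bar>bump (real N) ?u\<bar> \<le> (1 / real N) * (real N * (C / (1 + (real N * ?u)\<^sup>2)) + 1 * C)"
        by (rule mult_left_mono) simp
      also have "\<dots> = C * (1 / (1 + (real N * ?u)\<^sup>2)) + C / real N" using N by (simp add: field_simps)
      also have "real N * ?u = - real N * v - real j" using N by (simp add: field_simps)
      finally show ?thesis .
    qed
    then have "comb N v \<le> (\<Sum>j<N. C * (1 / (1 + (- real N * v - real j)\<^sup>2)) + C / real N)"
      unfolding comb_def by (intro sum_mono)
    also have "\<dots> = C * (\<Sum>j<N. 1 / (1 + (- real N * v - real j)\<^sup>2)) + C"
      using N by (simp add: sum.distrib sum_distrib_left)
    also have "\<dots> \<le> C * (3 * pi) + C" by (intro add_mono mult_left_mono sum_inverse_square_bound C(1)) simp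
    finally show ?thesis .
  qed
  then show ?thesis using C(1) by (intro exI[of _ "C * (3 * pi) + C"]) auto
qed

text \<open>A class that contains the Schwartz functions, is closed under finite sums and lies in
  every L^p; membership of the test functions in L^p is checked through it.\<close>

definition decaying :: "(real \<Rightarrow> 'b::real_normed_vector) \<Rightarrow> bool" where
  "decaying f \<longleftrightarrow> continuous_on UNIV f \<and> (\<exists>C\<ge>0. \<forall>t. norm (f t) \<le> C / (1 + t\<^sup>2))"

lemma decaying_in_Lp:
  assumes p: "1 \<le> p" and f: "decaying f"
  shows "in_Lp p f"
  unfolding in_Lp_def
proof
  obtain C where C: "C \<ge> 0" "\<And>t. norm (f t) \<le> C / (1 + t\<^sup>2)" and c: "continuous_on UNIV f"
    using f unfolding decaying_def by blast
  show sm: "strongly_measurable lebesgue f" by (rule strongly_measurable_continuous[OF c])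
  show "integrable lebesgue (\<lambda>t. norm (f t) powr p)"
  proof (rule Bochner_Integration.integrable_bound[OF integrable_inverse_square_const[of "C powr p"]])
    show "(\<lambda>t. norm (f t) powr p) \<in> borel_measurable lebesgue" using strongly_measurable_norm[OF sm] by measurable
    show "AE t in lebesgue. norm (norm (f t) powr p) \<le> norm (C powr p / (1 + t\<^sup>2))"
    proof (rule AE_I2)
      fix t :: real
      have t: "1 + t\<^sup>2 \<ge> 1" by simp
      have "norm (f t) powr p \<le> (C / (1 + t\<^sup>2)) powr p" using p C(2) by (intro powr_mono2) auto
      also have "\<dots> = C powr p / (1 + t\<^sup>2) powr p" using C(1) by (simp add: powr_divide)
      also have "\<dots> \<le> C powr p / (1 + t\<^sup>2) powr 1"
      proof (rule divide_left_mono)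
        show "(1 + t\<^sup>2) powr 1 \<le> (1 + t\<^sup>2) powr p" using p t by (intro powr_mono) auto
        show "0 < (1 + t\<^sup>2) powr p * (1 + t\<^sup>2) powr 1" using t by (intro mult_pos_pos) (simp_all only: powr_gt_zero; linarith)+
      qed simp
      finally show "norm (norm (f t) powr p) \<le> norm (C powr p / (1 + t\<^sup>2))"
        by simp
    qed
  qed
qed

lemma decaying_add: "decaying f \<Longrightarrow> decaying g \<Longrightarrow> decaying (\<lambda>t. f t + g t)"
  unfolding decaying_def
proof (elim conjE exE, intro conjI)
  fix C B assume C: "0 \<le> C" "\<forall>t. norm (f t) \<le> C / (1 + t\<^sup>2)" and B: "0 \<le> B" "\<forall>t. norm (g t) \<le> B / (1 + t\<^sup>2)"
  have "norm (f t + g t) \<le> (C + B) / (1 + t\<^sup>2)" for t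
    using norm_triangle_ineq[of "f t" "g t"] C(2)[rule_format, of t] B(2)[rule_format, of t] by (simp add: add_divide_distrib)
  then show "\<exists>C\<ge>0. \<forall>t. norm (f t + g t) \<le> C / (1 + t\<^sup>2)" using C(1) B(1) by (intro exI[of _ "C + B"]) auto
qed (auto intro: continuous_intros)

lemma decaying_sum: "finite I \<Longrightarrow> (\<And>j. j \<in> I \<Longrightarrow> decaying (f j)) \<Longrightarrow> decaying (\<lambda>t. \<Sum>j\<in>I. f j t)"
proof (induction rule: finite_induct)
  case empty
  show ?case by (auto simp: decaying_def intro!: exI[of _ 0])
qed (auto simp: decaying_add)

lemma schwartz_decaying: "schwartz f \<Longrightarrow> decaying f"
  using schwartz_continuous schwartz_decay[of f 0] by (auto simp: decaying_def)

text \<open>The extension is linear only up to null sets that depend on the functions; a finite sum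
  collects finitely many of them.\<close>

lemma AE_linear_sum:
  fixes E :: "(real \<Rightarrow> 'y::{complex_normed_vector,banach}) \<Rightarrow> real \<Rightarrow> 'x::{complex_normed_vector,banach}"
  assumes lin: "\<And>f g c. in_Lp p f \<Longrightarrow> in_Lp p g \<Longrightarrow> AE t in lebesgue. E (\<lambda>s. f s + scaleC c (g s)) t = E f t + scaleC c (E g t)"
    and p: "1 \<le> p" and F: "\<And>j. decaying (F j)"
  shows "AE t in lebesgue. E (\<lambda>s. \<Sum>j<(k::nat). F j s) t = (\<Sum>j<k. E (F j) t)"
proof (induction k)
  case 0
  have "decaying (\<lambda>s. 0 :: 'y)" by (auto simp: decaying_def intro!: exI[of _ 0])
  then have z: "in_Lp p (\<lambda>s. 0 :: 'y)" by (rule decaying_in_Lp[OF p])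
  \<comment> \<open>E 0 = E 0 + E 0 almost everywhere, which settles the empty sum.\<close>
  show ?case using lin[OF z z, of 1] by simp
next
  case (Suc k)
  have "decaying (\<lambda>s. \<Sum>j<k. F j s)" by (rule decaying_sum) (auto intro: F)
  then have "AE t in lebesgue. E (\<lambda>s. (\<Sum>j<k. F j s) + scaleC 1 (F k s)) t = E (\<lambda>s. \<Sum>j<k. F j s) t + scaleC 1 (E (F k) t)"
    by (intro lin decaying_in_Lp p F)
  with Suc show ?case by eventually_elim simp
qed

section \<open>From multipliers to decay\<close>

context growth_semigroup
begin

text \<open>Averaging over [t - 1, t] turns integrability into a pointwise bound: there T(t) x is at
  most M times T(s) x in norm, and t <= 2 s because t >= 2. The two bounds are the hypotheses of the
  convolution formula for this one orbit.\<close>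

lemma orbit_sup:
  assumes i: "integrable lebesgue (\<lambda>t. if t \<in> {0..} then norm ((t ^ n) *\<^sub>R T t x) else 0)"
  shows "\<exists>C\<ge>0. \<forall>s\<ge>0. norm (T s x) \<le> C \<and> s ^ n * norm (T s x) \<le> C"
proof -
  let ?g = "\<lambda>t. if t \<in> {0..} then norm ((t ^ n) *\<^sub>R T t x) else 0"
  obtain M where M: "M \<ge> 0" "\<And>t z. t \<in> {0..2} \<Longrightarrow> norm (T t z) \<le> M * norm z"
    using T_locally_bounded[of 2] by blast
  define K where "K = 2 ^ n * M * integral\<^sup>L lebesgue ?g"
  define K' where "K' = 2 ^ n * (M * norm x)"
  have gn: "0 \<le> ?g t" for t by simp
  have K0: "K \<ge> 0" unfolding K_def by (intro mult_nonneg_nonneg integral_nonneg M) auto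
  have K'0: "K' \<ge> 0" unfolding K'_def using M by simp
  have large: "t ^ n * norm (T t x) \<le> K" if t: "t \<ge> 2" for t
  proof -
    have "indicat_real {t - 1..t} s * (t ^ n * norm (T t x)) \<le> 2 ^ n * M * ?g s" for s
    proof (cases "s \<in> {t - 1..t}")
      case True
      then have s: "t - 1 \<le> s" "s \<le> t" "0 \<le> s" using t by auto
      have "norm (T t x) = norm (T (t - s) (T s x))" using T_add[of "t - s" s x] s by simp
      also have "\<dots> \<le> M * norm (T s x)" using s by (intro M) auto
      finally have 1: "norm (T t x) \<le> M * norm (T s x)" .
      have "t ^ n \<le> (2 * s) ^ n" using s t by (intro power_mono) auto
      then have "t ^ n * norm (T t x) \<le> (2 * s) ^ n * (M * norm (T s x))" using 1 s by (intro mult_mono) auto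
      also have "\<dots> = 2 ^ n * M * ?g s" using s by (simp add: power_mult_distrib)
      finally show ?thesis using True by simp
    next
      case False
      then show ?thesis using M(1) gn[of s] by (simp add: zero_le_mult_iff)
    qed
    then have "integral\<^sup>L lebesgue (\<lambda>s. indicat_real {t - 1..t} s * (t ^ n * norm (T t x)))
        \<le> integral\<^sup>L lebesgue (\<lambda>s. 2 ^ n * M * ?g s)"
      by (intro integral_mono integrable_mult_left integrable_mult_right i integrable_indicator_Icc)
    also have "\<dots> = K" unfolding K_def by (rule integral_mult_right_zero)
    also have "integral\<^sup>L lebesgue (\<lambda>s. indicat_real {t - 1..t} s * (t ^ n * norm (T t x))) = t ^ n * norm (T t x)"
      using integral_indicator_Icc[of "t - 1" t] by (simp only: integral_mult_left_zero) simp
    finally show ?thesis .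
  qed
  have "norm (T s x) \<le> K + K' + M * norm x \<and> s ^ n * norm (T s x) \<le> K + K' + M * norm x" if s: "s \<ge> 0" for s
  proof (cases "s \<ge> 2")
    case True
    have "1 * norm (T s x) \<le> s ^ n * norm (T s x)" using True by (intro mult_right_mono one_le_power) auto
    then show ?thesis using large[OF True] K'0 M(1) norm_ge_zero[of x] mult_nonneg_nonneg[of M "norm x"] by linarith
  next
    case False
    then have 1: "norm (T s x) \<le> M * norm x" using s by (intro M) auto
    have "s ^ n * norm (T s x) \<le> 2 ^ n * (M * norm x)" using False s 1 by (intro mult_mono power_mono) auto
    then show ?thesis using 1 K0 K'0 mult_nonneg_nonneg[OF M(1) norm_ge_zero[of x]] unfolding K'_def by linarith
  qed
  moreover have "0 \<le> K + K' + M * norm x" using K0 K'0 M(1) by simp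
  ultimately show ?thesis by blast
qed

text \<open>Bounds are known for the orbit of \<open>y\<close> only, not uniformly on the unit ball
  of Y. Writing the test function as a scalar function times \<open>y\<close> moves \<open>y\<close>
  into the operator G c = c J y on the scalars, for which a bound on one orbit is an operator
  bound.\<close>

lemma multiplier_resolvent_tensor:
  fixes J :: "'z::{complex_normed_vector,banach} \<Rightarrow> 'x" and \<phi> :: "real \<Rightarrow> complex"
  assumes J: "bounded_clinear J" and \<phi>: "dot_schwartz \<phi>"
    and b: "\<And>s. s \<ge> 0 \<Longrightarrow> norm (T s (J y)) \<le> C" "\<And>s. s \<ge> 0 \<Longrightarrow> s ^ n * norm (T s (J y)) \<le> C"
  shows "multiplier_op (\<lambda>\<xi> z. (RR (\<i> * complex_of_real \<xi>) ^^ Suc n) (J z)) (\<lambda>v. scaleC (\<phi> v) y) t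
    = scaleC ((-1) ^ Suc n) (integral UNIV (\<lambda>s. indicat_real {0..} s *\<^sub>R ((s ^ n / fact n) *\<^sub>R
        scaleC (\<phi> (t + s)) (T (max 0 s) (J y)))))"
proof -
  define G where "G c = scaleC c (J y)" for c :: complex
  have G: "bounded_clinear G"
    unfolding bounded_clinear_def clinear_def G_def scaleC_complex_def
    by (auto simp: scaleC_add_left scaleC_scaleC norm_scaleC intro!: exI[of _ "norm (J y)"])
  have s: "schwartz \<phi>" using \<phi> by (simp add: dot_schwartz_def)
  have bi: "bochner_integrable (\<lambda>t. scaleC (cis (- (\<xi> * t))) (\<phi> t))" for \<xi>
    using schwartz_bochner_integrable[OF s, of 0] by (intro bochner_integrable_cis continuous_intros) simp
  have F: "fourier (\<lambda>v. scaleC (\<phi> v) y) \<xi> = scaleC (fourier \<phi> \<xi>) y" for \<xi>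
    using bochner_integral_linear[OF bi bounded_linear_scaleC_left, of \<xi> y]
    unfolding fourier_def by (simp add: scaleC_scaleC scaleC_complex_def)
  have GT: "T r (G c) = scaleC c (T r (J y))" if "r \<ge> 0" for r c
    unfolding G_def by (rule bounded_clinear_scaleC[OF T_bounded_clinear[OF that]])
  have "multiplier_op (\<lambda>\<xi> z. (RR (\<i> * complex_of_real \<xi>) ^^ Suc n) (J z)) (\<lambda>v. scaleC (\<phi> v) y) t
      = multiplier_op (\<lambda>\<xi> z. (RR (\<i> * complex_of_real \<xi>) ^^ Suc n) (G z)) \<phi> t"
    unfolding multiplier_op_def F G_def bounded_clinear_scaleC[OF J] ..
  also have "\<dots> = scaleC ((-1) ^ Suc n) (orbit_convolution n G \<phi> t)"
  proof (rule multiplier_resolvent_eq_convolution[OF G \<phi>])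
    fix s z assume s: "(s::real) \<ge> 0"
    show "norm (T s (G z)) \<le> C * norm z"
      using b(1)[OF s] by (simp add: GT s norm_scaleC mult.commute[of C] mult_left_mono)
    show "s ^ n * norm (T s (G z)) \<le> C * norm z"
      using mult_left_mono[OF b(2)[OF s], of "cmod z"] by (simp add: GT s norm_scaleC mult_ac)
  qed
  finally show ?thesis unfolding orbit_convolution_def by (simp add: GT)
qed

text \<open>J (Z q) = T(q) J y advances the orbit by q, and the bump is centred at -q. In the
  variable v = q + s all terms therefore share the factor \<open>bump N (\<tau> - v)\<close> and the
  vector T(v) J y. The evaluation point is -\<tau> because the kernel is anti-causal.\<close>

lemma comb_multiplier:
  fixes J :: "'z::{complex_normed_vector,banach} \<Rightarrow> 'x"
  assumes J: "bounded_clinear J"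
    and b: "\<And>s. s \<ge> 0 \<Longrightarrow> norm (T s (J y)) \<le> C" "\<And>s. s \<ge> 0 \<Longrightarrow> s ^ n * norm (T s (J y)) \<le> C"
    and Z: "\<And>r. r \<in> {0..1} \<Longrightarrow> J (Z r) = T r (J y)" and N: "N > 0"
  shows "(\<Sum>j<N. multiplier_op (\<lambda>\<xi> z. (RR (\<i> * complex_of_real \<xi>) ^^ Suc n) (J z))
      (\<lambda>v. scaleC (complex_of_real (bump (real N) (- (real j / real N) - v))) ((1 / real N) *\<^sub>R Z (real j / real N))) (- \<tau>))
    = scaleC ((-1) ^ Suc n) (integral UNIV (\<lambda>v. bump (real N) (\<tau> - v) *\<^sub>R (translate_weight n N v *\<^sub>R T (max 0 v) (J y))))"
proof -
  have N': "real N > 0" using N by simp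
  define q where "q j = real j / real N" for j
  have q: "q j \<ge> 0" "j < N \<Longrightarrow> q j \<le> 1" for j using N by (auto simp: q_def)
  define h where "h j v = (1 / real N * (indicat_real {0..} (v - q j) * ((v - q j) ^ n / fact n)) * bump (real N) (\<tau> - v))
      *\<^sub>R T (max 0 v) (J y)" for j v
  have C0: "C \<ge> 0" using order_trans[OF norm_ge_zero b(1)[of 0]] by simp
  have hb: "bochner_integrable (h j)" for j
  proof (rule bochner_integrable_bound)
    have "(\<lambda>v. 1 / real N * indicat_real {0..} (v - q j)) \<in> borel_measurable lborel" by measurable
    from measurable_completion[OF this] have 1: "strongly_measurable lebesgue (\<lambda>v. 1 / real N * indicat_real {0..} (v - q j))"
      by (rule strongly_measurable_real)
    have "continuous_on UNIV (\<lambda>v. ((v - q j) ^ n / fact n) * bump (real N) (\<tau> - v))"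
      by (intro continuous_intros continuous_on_compose2[OF bump_continuous]) auto
    then have 2: "strongly_measurable lebesgue (\<lambda>v. ((v - q j) ^ n / fact n) * bump (real N) (\<tau> - v))"
      by (rule strongly_measurable_continuous)
    have "strongly_measurable lebesgue (\<lambda>v. (1 / real N * indicat_real {0..} (v - q j)) *\<^sub>R
        ((((v - q j) ^ n / fact n) * bump (real N) (\<tau> - v)) *\<^sub>R T (max 0 v) (J y)))"
      by (rule strongly_measurable_scaleR[OF 1 strongly_measurable_scaleR[OF 2 strongly_measurable_continuous[OF T_max_continuous]]])
    then show "strongly_measurable lebesgue (h j)" unfolding h_def[abs_def] by (simp add: mult_ac)
    show "integrable lebesgue (\<lambda>v. C * \<bar>bump (real N) (\<tau> - v)\<bar>)"
      by (intro integrable_mult_right bump_abs_integral N')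
    show "AE v in lebesgue. norm (h j v) \<le> C * \<bar>bump (real N) (\<tau> - v)\<bar>"
    proof (rule AE_I2)
      fix v :: real
      show "norm (h j v) \<le> C * \<bar>bump (real N) (\<tau> - v)\<bar>"
      proof (cases "v - q j \<ge> 0")
        case True
        then have v: "0 \<le> v" using q(1)[of j] by linarith
        have "(v - q j) ^ n * norm (T v (J y)) \<le> v ^ n * norm (T v (J y))"
          using True q(1)[of j] by (intro mult_right_mono power_mono) auto
        also have "\<dots> \<le> C" by (rule b(2)[OF v])
        finally have 1: "(v - q j) ^ n * norm (T v (J y)) \<le> C" .
        have "(1 / real N) * (1 / fact n) \<le> 1 * (1 :: real)"
          using N by (intro mult_mono) auto
        then have "((1 / real N) * (1 / fact n)) * ((v - q j) ^ n * norm (T v (J y))) \<le> 1 * C"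
          using 1 True by (intro mult_mono) auto
        then have "((1 / real N) * (1 / fact n)) * ((v - q j) ^ n * norm (T v (J y))) * \<bar>bump (real N) (\<tau> - v)\<bar>
            \<le> 1 * C * \<bar>bump (real N) (\<tau> - v)\<bar>"
          by (rule mult_right_mono) simp
        then show ?thesis using True v by (simp add: h_def abs_mult mult_ac)
      qed (use C0 in \<open>simp add: h_def\<close>)
    qed
  qed
  have one: "multiplier_op (\<lambda>\<xi> z. (RR (\<i> * complex_of_real \<xi>) ^^ Suc n) (J z))
      (\<lambda>v. scaleC (complex_of_real (bump (real N) (- q j - v))) ((1 / real N) *\<^sub>R Z (q j))) (- \<tau>)
    = scaleC ((-1) ^ Suc n) (integral UNIV (h j))" if j: "j < N" for j
  proof -
    let ?\<phi> = "\<lambda>v. complex_of_real (bump (real N) (- q j - v))"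
    have \<phi>: "dot_schwartz ?\<phi>"
      using dot_schwartz_bump[OF N', of "- q j" "1::complex"] by (simp add: scaleC_complex_def)
    have qj: "q j \<in> {0..1}" using q j by auto
    have Jy: "J ((1 / real N) *\<^sub>R Z (q j)) = (1 / real N) *\<^sub>R T (q j) (J y)"
      using linear_cmul[OF bounded_linear.linear[OF bounded_clinear_bounded_linear[OF J]]] Z[OF qj] by simp
    have TJ: "T s (J ((1 / real N) *\<^sub>R Z (q j))) = (1 / real N) *\<^sub>R T (s + q j) (J y)" if s: "s \<ge> 0" for s
      using linear_cmul[OF bounded_linear.linear[OF T_bounded_linear[OF s]]] T_add[OF s q(1)] by (simp add: Jy)
    have le: "(1 / real N) * u \<le> C" if "u \<le> C" for u
    proof -
      have "(1 / real N) * u \<le> (1 / real N) * C" using that by (intro mult_left_mono) auto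
      also have "\<dots> \<le> 1 * C" using N C0 by (intro mult_right_mono) auto
      finally show ?thesis by simp
    qed
    have b1: "norm (T s (J ((1 / real N) *\<^sub>R Z (q j)))) \<le> C" if s: "s \<ge> 0" for s
      using le[OF b(1)[of "s + q j"]] s q(1)[of j] by (simp add: TJ)
    have b2: "s ^ n * norm (T s (J ((1 / real N) *\<^sub>R Z (q j)))) \<le> C" if s: "s \<ge> 0" for s
    proof -
      have "s ^ n * norm (T (s + q j) (J y)) \<le> (s + q j) ^ n * norm (T (s + q j) (J y))"
        using s q(1)[of j] by (intro mult_right_mono power_mono) auto
      also have "\<dots> \<le> C" using s q(1)[of j] by (intro b(2)) auto
      finally show ?thesis using le[of "s ^ n * norm (T (s + q j) (J y))"] s by (simp add: TJ)
    qed
    have e: "indicat_real {0..} s *\<^sub>R ((s ^ n / fact n) *\<^sub>R scaleC (?\<phi> (- \<tau> + s)) (T (max 0 s) (J ((1 / real N) *\<^sub>R Z (q j)))))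
        = h j (q j + 1 * s)" for s
    proof (cases "s \<ge> 0")
      case True
      then show ?thesis using q(1)[of j]
        by (simp add: TJ h_def scaleC_of_real algebra_simps)
    qed (simp add: h_def)
    have "integral UNIV (\<lambda>s. h j (q j + 1 * s)) = (1 / \<bar>1\<bar>) *\<^sub>R integral UNIV (h j)"
      by (rule bochner_affine(2)[OF hb]) simp
    moreover have "multiplier_op (\<lambda>\<xi> z. (RR (\<i> * complex_of_real \<xi>) ^^ Suc n) (J z))
      (\<lambda>v. scaleC (complex_of_real (bump (real N) (- q j - v))) ((1 / real N) *\<^sub>R Z (q j))) (- \<tau>)
      = scaleC ((-1) ^ Suc n) (integral UNIV (\<lambda>s. h j (q j + 1 * s)))"
      unfolding e[symmetric] by (rule multiplier_resolvent_tensor[OF J \<phi>]; (rule b1 b2); assumption)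
    ultimately show ?thesis by (simp only:) simp
  qed
  have "(\<Sum>j<N. multiplier_op (\<lambda>\<xi> z. (RR (\<i> * complex_of_real \<xi>) ^^ Suc n) (J z))
      (\<lambda>v. scaleC (complex_of_real (bump (real N) (- q j - v))) ((1 / real N) *\<^sub>R Z (q j))) (- \<tau>))
    = (\<Sum>j<N. scaleC ((-1) ^ Suc n) (integral UNIV (h j)))"
    by (intro sum.cong refl one) simp
  also have "\<dots> = scaleC ((-1) ^ Suc n) (\<Sum>j<N. integral UNIV (h j))"
    by (rule bounded_bilinear.sum_right[OF bounded_bilinear_scaleC, symmetric])
  also have "(\<Sum>j<N. integral UNIV (h j)) = integral UNIV (\<lambda>v. \<Sum>j<N. h j v)"
    by (rule integral_sum[symmetric]) (auto intro: bochner_integrable_integrable_on hb)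
  also have "(\<lambda>v. \<Sum>j<N. h j v) = (\<lambda>v. bump (real N) (\<tau> - v) *\<^sub>R (translate_weight n N v *\<^sub>R T (max 0 v) (J y)))"
    unfolding h_def translate_weight_def q_def
    by (simp add: scaleR_sum_left[symmetric] sum_distrib_left[symmetric] sum_distrib_right[symmetric] mult_ac
        sum_divide_distrib[symmetric])
  finally show ?thesis unfolding q_def .
qed

text \<open>With w = N (\<tau> - v) the narrow part of the bump leaves theta(w) times the weighted
  orbit at \<tau> - w / N, dominated by a multiple of |theta|. The wide part is 1 / N times an
  integral that stays bounded by integrability of t^n T(t) x. The weight at \<tau> still varies with
  m, so the limit is stated for a difference.\<close>

lemma comb_limit:
  assumes i: "integrable lebesgue (\<lambda>t. if t \<in> {0..} then norm ((t ^ n) *\<^sub>R T t x) else 0)"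
    and \<tau>: "1 < \<tau>"
  shows "(\<lambda>m. integral UNIV (\<lambda>v. bump (real (Suc m)) (\<tau> - v) *\<^sub>R (translate_weight n (Suc m) v *\<^sub>R T (max 0 v) x))
      - (integral UNIV theta * translate_weight n (Suc m) \<tau>) *\<^sub>R T \<tau> x) \<longlonglongrightarrow> 0"
proof -
  let ?g = "\<lambda>t. if t \<in> {0..} then norm ((t ^ n) *\<^sub>R T t x) else 0"
  let ?W = "\<lambda>m. translate_weight n (Suc m)"
  obtain C where C: "C \<ge> 0" "\<And>s. s \<ge> 0 \<Longrightarrow> norm (T s x) \<le> C" "\<And>s. s \<ge> 0 \<Longrightarrow> s ^ n * norm (T s x) \<le> C"
    using orbit_sup[OF i] by blast
  define \<gamma> where "\<gamma> m v = ?W m v *\<^sub>R T (max 0 v) x" for m v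
  have gm: "strongly_measurable lebesgue (\<gamma> m)" for m
  proof -
    have "translate_weight n (Suc m) \<in> borel_measurable lebesgue"
      using translate_weight_measurable by (simp add: measurable_completion)
    then show ?thesis unfolding \<gamma>_def[abs_def]
      by (intro strongly_measurable_scaleR strongly_measurable_real strongly_measurable_continuous T_max_continuous)
  qed
  have gg: "norm (\<gamma> m v) \<le> ?g v" for m v
  proof -
    have "?W m v * norm (T (max 0 v) x) \<le> indicat_real {0..} v * (v ^ n / fact n) * norm (T (max 0 v) x)"
      by (intro mult_right_mono translate_weight_bounds) auto
    also have "\<dots> \<le> ?g v"
    proof (cases "v \<ge> 0")
      case True
      have "v ^ n / fact n \<le> v ^ n / 1" using True by (intro divide_left_mono) (auto simp: fact_ge_1)
      then show ?thesis using True mult_right_mono[OF _ norm_ge_zero[of "T v x"]] by force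
    qed simp
    finally show ?thesis using translate_weight_bounds(1)[of "Suc m" n v] by (simp add: \<gamma>_def)
  qed
  have gC: "norm (\<gamma> m v) \<le> C" for m v
    using gg[of m v] C(1) C(3)[of v] by (auto split: if_splits)
  obtain B where B: "B \<ge> 0" "\<And>t. \<bar>theta t\<bar> \<le> B / (1 + t\<^sup>2)" using theta_decay by blast
  have B1: "\<bar>theta t\<bar> \<le> B" for t
  proof -
    have "B / (1 + t\<^sup>2) \<le> B / 1" using B(1) by (intro divide_left_mono) (auto simp: add_pos_nonneg)
    then show ?thesis using B(2)[of t] by simp
  qed
  have gi: "integrable lebesgue (\<lambda>v. B * ?g v)"
    by (intro integrable_mult_right i)
  \<comment> \<open>\<open>P\<close> is the narrow part after the substitution, \<open>Q\<close> the
    wide part without its factor 1 / N.\<close>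
  define P where "P m w = theta w *\<^sub>R \<gamma> m (\<tau> - w / real (Suc m))" for m w
  define Q where "Q m v = theta ((\<tau> - v) / real (Suc m)) *\<^sub>R \<gamma> m v" for m v
  have th_sm: "strongly_measurable lebesgue theta" by (rule strongly_measurable_continuous[OF theta_continuous])
  have thi: "integrable lebesgue (\<lambda>w. \<bar>theta w\<bar> * c)" for c by (intro integrable_mult_left theta_abs_integrable)
  have Pb: "bochner_integrable (P m)" for m
  proof (rule bochner_integrable_bound[OF _ thi[of C]])
    have "strongly_measurable lebesgue (\<lambda>w. \<gamma> m (\<tau> + (- (1 / real (Suc m))) * w))"
      by (rule strongly_measurable_affine[OF gm]) simp
    then show "strongly_measurable lebesgue (P m)"
      unfolding P_def[abs_def] by (intro strongly_measurable_scaleR th_sm) simp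
    show "AE w in lebesgue. norm (P m w) \<le> \<bar>theta w\<bar> * C"
      by (rule AE_I2) (simp add: P_def mult_left_mono gC del: of_nat_Suc)
  qed
  have Qle: "norm (Q m w) \<le> B * ?g w" for m w
    unfolding Q_def norm_scaleR[of "theta u" for u] by (rule mult_mono[OF B1 gg B(1) norm_ge_zero])
  have Qb: "bochner_integrable (Q m)" for m
  proof (rule bochner_integrable_bound[OF _ gi])
    have "continuous_on UNIV (\<lambda>v. theta ((\<tau> - v) / real (Suc m)))"
      by (intro continuous_intros continuous_on_compose2[OF theta_continuous]) auto
    then show "strongly_measurable lebesgue (Q m)"
      unfolding Q_def[abs_def] by (intro strongly_measurable_scaleR gm strongly_measurable_continuous)
    show "AE w in lebesgue. norm (Q m w) \<le> B * ?g w"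
      by (rule AE_I2) (rule Qle)
  qed
  have Pa: "integral UNIV (\<lambda>v. P m (real (Suc m) * \<tau> + (- real (Suc m)) * v)) = (1 / \<bar>- real (Suc m)\<bar>) *\<^sub>R integral UNIV (P m)"
    and Pab: "bochner_integrable (\<lambda>v. P m (real (Suc m) * \<tau> + (- real (Suc m)) * v))" for m
    by (rule bochner_affine[OF Pb]; simp)+
  have split: "bump (real (Suc m)) (\<tau> - v) *\<^sub>R \<gamma> m v
      = real (Suc m) *\<^sub>R P m (real (Suc m) * \<tau> + (- real (Suc m)) * v) - (1 / real (Suc m)) *\<^sub>R Q m v" for m v
  proof -
    have "\<tau> - (real (Suc m) * \<tau> + (- real (Suc m)) * v) / real (Suc m) = v"
      by (simp add: field_simps del: of_nat_Suc)
    then show ?thesis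
      unfolding bump_def P_def Q_def by (simp add: scaleR_diff_left right_diff_distrib del: of_nat_Suc)
  qed
  have int: "integral UNIV (\<lambda>v. bump (real (Suc m)) (\<tau> - v) *\<^sub>R \<gamma> m v)
      = integral UNIV (P m) - (1 / real (Suc m)) *\<^sub>R integral UNIV (Q m)" for m
  proof -
    have "integral UNIV (\<lambda>v. bump (real (Suc m)) (\<tau> - v) *\<^sub>R \<gamma> m v)
      = real (Suc m) *\<^sub>R integral UNIV (\<lambda>v. P m (real (Suc m) * \<tau> + (- real (Suc m)) * v)) - (1 / real (Suc m)) *\<^sub>R integral UNIV (Q m)"
      unfolding split
      by (simp only: bochner_integral_diff[OF bochner_integrable_linear[OF Pab bounded_linear_scaleR_right] bochner_integrable_linear[OF Qb bounded_linear_scaleR_right]]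
          bochner_integral_linear[OF Pab bounded_linear_scaleR_right] bochner_integral_linear[OF Qb bounded_linear_scaleR_right])
    then show ?thesis unfolding Pa by (simp del: of_nat_Suc)
  qed
  have Qlim: "(\<lambda>m. (1 / real (Suc m)) *\<^sub>R integral UNIV (Q m)) \<longlonglongrightarrow> 0"
  proof (rule Lim_null_comparison)
    show "\<forall>\<^sub>F m in sequentially. norm ((1 / real (Suc m)) *\<^sub>R integral UNIV (Q m)) \<le> (1 / real (Suc m)) * integral\<^sup>L lebesgue (\<lambda>v. B * ?g v)"
    proof (rule always_eventually, rule allI)
      fix m
      have "norm (integral UNIV (Q m)) \<le> integral\<^sup>L lebesgue (\<lambda>v. B * ?g v)"
        by (rule bochner_integral_bound[OF Qb gi], rule AE_I2) (rule Qle)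
      then show "norm ((1 / real (Suc m)) *\<^sub>R integral UNIV (Q m)) \<le> (1 / real (Suc m)) * integral\<^sup>L lebesgue (\<lambda>v. B * ?g v)"
        unfolding norm_scaleR by (intro mult_mono) auto
    qed
    show "(\<lambda>m. (1 / real (Suc m)) * integral\<^sup>L lebesgue (\<lambda>v. B * ?g v)) \<longlonglongrightarrow> 0"
      using tendsto_mult_right[OF LIMSEQ_inverse_real_of_nat, of "integral\<^sup>L lebesgue (\<lambda>v. B * ?g v)"]
      by (simp add: inverse_eq_divide)
  qed
  have cb: "bochner_integrable (\<lambda>w. theta w *\<^sub>R z)" for z :: 'x
    by (rule bochner_integrable_linear[OF theta_bochner bounded_linear_scaleR_left])
  have Plim: "(\<lambda>m. integral UNIV (\<lambda>w. P m w - theta w *\<^sub>R (?W m \<tau> *\<^sub>R T \<tau> x))) \<longlonglongrightarrow> integral UNIV (\<lambda>w::real. 0 :: 'x)"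
  proof (rule bochner_dominated_convergence(2)[where h="\<lambda>w. \<bar>theta w\<bar> * (C + C)"])
    show "strongly_measurable lebesgue (\<lambda>w. 0 :: 'x)" by (rule strongly_measurable_const)
    show "integrable lebesgue (\<lambda>w. \<bar>theta w\<bar> * (C + C))" by (rule thi)
    show "strongly_measurable lebesgue (\<lambda>w. P m w - theta w *\<^sub>R (?W m \<tau> *\<^sub>R T \<tau> x))" for m
      by (intro strongly_measurable_diff bochner_integrableD Pb cb)
    have gt: "?W m \<tau> *\<^sub>R T \<tau> x = \<gamma> m \<tau>" for m using \<tau> by (simp add: \<gamma>_def)
    show "AE w in lebesgue. norm (P m w - theta w *\<^sub>R (?W m \<tau> *\<^sub>R T \<tau> x)) \<le> \<bar>theta w\<bar> * (C + C)" for m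
      unfolding gt P_def scaleR_diff_right[symmetric] norm_scaleR
      by (intro AE_I2 mult_left_mono order_trans[OF norm_triangle_ineq4] add_mono gC) auto
    show "AE w in lebesgue. (\<lambda>m. P m w - theta w *\<^sub>R (?W m \<tau> *\<^sub>R T \<tau> x)) \<longlonglongrightarrow> 0"
    proof (rule AE_I2)
      fix w :: real
      let ?v = "\<lambda>m. \<tau> - w / real (Suc m)"
      have vl: "?v \<longlonglongrightarrow> \<tau>" by real_asymp
      have "(\<lambda>m. norm (T (max 0 (?v m)) x - T \<tau> x)) \<longlonglongrightarrow> 0"
      proof -
        have "isCont (\<lambda>v. T (max 0 v) x) \<tau>" using T_max_continuous[of x] by (simp add: continuous_on_eq_continuous_at)
        then have "(\<lambda>m. T (max 0 (?v m)) x) \<longlonglongrightarrow> T (max 0 \<tau>) x" using vl by (rule isCont_tendsto_compose)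
        then show ?thesis using \<tau> tendsto_norm_zero[OF LIM_zero] by force
      qed
      moreover have "(\<lambda>m. \<bar>?W m (?v m) - ?W m \<tau>\<bar>) \<longlonglongrightarrow> 0"
        using tendsto_rabs_zero[OF translate_weight_shift[OF \<tau>]] .
      ultimately have lim: "(\<lambda>m. \<bar>?W m (?v m) - ?W m \<tau>\<bar> * C + \<tau> ^ n / fact n * norm (T (max 0 (?v m)) x - T \<tau> x)) \<longlonglongrightarrow> 0 * C + \<tau> ^ n / fact n * 0"
        by (intro tendsto_intros)
      have "(\<lambda>m. \<gamma> m (?v m) - \<gamma> m \<tau>) \<longlonglongrightarrow> 0"
      proof (rule Lim_null_comparison[OF always_eventually])
        show "\<forall>m. norm (\<gamma> m (?v m) - \<gamma> m \<tau>) \<le> \<bar>?W m (?v m) - ?W m \<tau>\<bar> * C + \<tau> ^ n / fact n * norm (T (max 0 (?v m)) x - T \<tau> x)"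
        proof
          fix m
          have "\<gamma> m (?v m) - \<gamma> m \<tau> = (?W m (?v m) - ?W m \<tau>) *\<^sub>R T (max 0 (?v m)) x + ?W m \<tau> *\<^sub>R (T (max 0 (?v m)) x - T \<tau> x)"
            using \<tau> by (simp add: \<gamma>_def algebra_simps del: of_nat_Suc)
          also have "norm \<dots> \<le> \<bar>?W m (?v m) - ?W m \<tau>\<bar> * C + \<tau> ^ n / fact n * norm (T (max 0 (?v m)) x - T \<tau> x)"
          proof (rule order_trans[OF norm_triangle_ineq], unfold norm_scaleR, intro add_mono mult_mono order_refl C(2))
            show "\<bar>?W m \<tau>\<bar> \<le> \<tau> ^ n / fact n" using translate_weight_bounds(1,2)[of "Suc m" n \<tau>] \<tau> by simp
          qed (use \<tau> in auto)
          finally show "norm (\<gamma> m (?v m) - \<gamma> m \<tau>) \<le> \<bar>?W m (?v m) - ?W m \<tau>\<bar> * C + \<tau> ^ n / fact n * norm (T (max 0 (?v m)) x - T \<tau> x)" .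
        qed
      qed (use lim in simp)
      then have "(\<lambda>m. theta w *\<^sub>R (\<gamma> m (?v m) - \<gamma> m \<tau>)) \<longlonglongrightarrow> theta w *\<^sub>R 0" by (intro tendsto_intros)
      then show "(\<lambda>m. P m w - theta w *\<^sub>R (?W m \<tau> *\<^sub>R T \<tau> x)) \<longlonglongrightarrow> 0"
        unfolding gt P_def scaleR_diff_right by simp
    qed
  qed
  have e: "integral UNIV (\<lambda>v. bump (real (Suc m)) (\<tau> - v) *\<^sub>R (?W m v *\<^sub>R T (max 0 v) x)) - (integral UNIV theta * ?W m \<tau>) *\<^sub>R T \<tau> x
      = integral UNIV (\<lambda>w. P m w - theta w *\<^sub>R (?W m \<tau> *\<^sub>R T \<tau> x)) - (1 / real (Suc m)) *\<^sub>R integral UNIV (Q m)" for m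
    using int[of m] bochner_integral_diff[OF Pb cb, of m "?W m \<tau> *\<^sub>R T \<tau> x"]
      bochner_integral_linear[OF theta_bochner bounded_linear_scaleR_left, of "?W m \<tau> *\<^sub>R T \<tau> x"]
    by (simp add: \<gamma>_def)
  show ?thesis unfolding e using tendsto_diff[OF Plim Qlim] by simp
qed

end

text \<open>Bounds in L^1 and L^\<infinity> give all L^p: for c = comb / B in [0, 1] one has c^p <=
  c. Only domination by the comb enters, so the constant depends neither on N nor on the vectors
  attached to the bumps.\<close>

lemma comb_Lp:
  fixes F :: "nat \<Rightarrow> real \<Rightarrow> 'a::{complex_normed_vector,banach}"
  assumes p: "1 \<le> p"
  shows "\<exists>K>0. \<forall>N>0. \<forall>\<kappa>\<ge>0. \<forall>f :: real \<Rightarrow> 'a. strongly_measurable lebesgue f \<longrightarrow>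
    (\<forall>v. norm (f v) \<le> \<kappa> * comb N v) \<longrightarrow> Lp_norm p f \<le> K * \<kappa>"
proof -
  obtain B0 where B0: "B0 \<ge> 0" "\<And>N v. N > 0 \<Longrightarrow> comb N v \<le> B0" using comb_bounded by blast
  \<comment> \<open>B >= 1 serves twice: as a nonzero divisor, and to ensure comb / B <=
    comb.\<close>
  define B where "B = B0 + 1"
  have B1: "B \<ge> 1" using B0(1) by (simp add: B_def)
  have B2: "comb N v \<le> B" if "N > 0" for N v using B0(2)[OF that, of v] by (simp add: B_def)
  note B = B1 B2
  define I where "I = 2 * integral\<^sup>L lebesgue (\<lambda>t. \<bar>theta t\<bar>)"
  have "Lp_norm p f \<le> (B * (I powr (1 / p) + 1)) * \<kappa>"
    if N: "N > 0" and k: "\<kappa> \<ge> 0" and m: "strongly_measurable lebesgue f" and le: "\<And>v. norm (f v) \<le> \<kappa> * comb N v"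
    for N \<kappa> and f :: "real \<Rightarrow> 'a"
  proof -
    have pw: "norm (f v) powr p \<le> (\<kappa> * B) powr p * comb N v" for v
    proof -
      define c where "c = comb N v / B"
      have c: "0 \<le> c" "c \<le> 1" using comb_nonneg[of N v] B(1) B(2)[OF N, of v] by (auto simp: c_def)
      have "norm (f v) \<le> (\<kappa> * B) * c" using le[of v] B(1) by (simp add: c_def)
      then have "norm (f v) powr p \<le> ((\<kappa> * B) * c) powr p" using p by (intro powr_mono2) auto
      also have "\<dots> = (\<kappa> * B) powr p * c powr p" using k B(1) c by (intro powr_mult)
      also have "\<dots> \<le> (\<kappa> * B) powr p * comb N v"
      proof (rule mult_left_mono)
        have "c powr p \<le> c powr 1" using c p by (intro powr_mono') auto
        also have "\<dots> \<le> comb N v" using c B(1) comb_nonneg[of N v] by (simp add: c_def divide_le_eq mult_le_cancel_left1)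
        finally show "c powr p \<le> comb N v" .
      qed simp
      finally show ?thesis .
    qed
    have ic: "integrable lebesgue (\<lambda>v. (\<kappa> * B) powr p * comb N v)" by (intro integrable_mult_right comb_L1 N)
    have "(\<lambda>v. norm (f v) powr p) \<in> borel_measurable lebesgue" using strongly_measurable_norm[OF m] by measurable
    then have i: "integrable lebesgue (\<lambda>v. norm (f v) powr p)"
      by (rule Bochner_Integration.integrable_bound[OF ic]) (use pw in \<open>auto intro: order_trans[OF _ abs_ge_self]\<close>)
    have "integral\<^sup>L lebesgue (\<lambda>v. norm (f v) powr p) \<le> integral\<^sup>L lebesgue (\<lambda>v. (\<kappa> * B) powr p * comb N v)"
      by (rule integral_mono[OF i ic pw])
    also have "\<dots> = (\<kappa> * B) powr p * integral\<^sup>L lebesgue (comb N)" by simp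
    also have "\<dots> \<le> (\<kappa> * B) powr p * I" using comb_L1(2)[OF N] by (intro mult_left_mono) (auto simp: I_def)
    finally have "Lp_norm p f \<le> ((\<kappa> * B) powr p * I) powr (1 / p)"
      unfolding Lp_norm_def using p by (intro powr_mono2) auto
    also have "\<dots> = ((\<kappa> * B) powr p) powr (1 / p) * I powr (1 / p)" by (rule powr_mult)
    also have "((\<kappa> * B) powr p) powr (1 / p) = \<kappa> * B" using p k B(1) by (simp add: powr_powr)
    also have "\<kappa> * B * I powr (1 / p) \<le> \<kappa> * B * (I powr (1 / p) + 1)" using k B(1) by (intro mult_left_mono) auto
    finally show ?thesis by (simp add: mult_ac)
  qed
  moreover have "B * (I powr (1 / p) + 1) > 0" using B(1) by (intro mult_pos_pos add_nonneg_pos) auto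
  ultimately show ?thesis by blast
qed

lemma Lq_bounded_strongly_measurable: "Lq_bounded q g K \<Longrightarrow> strongly_measurable lebesgue g"
  unfolding Lq_bounded_def in_Lp_def by (auto split: if_splits)

text \<open>The local L^1 bound is delivered as an integrable majorant. For finite q it is B on the
  unit interval plus B (norm e / B)^r: the first term covers the points with norm e <= B, the second
  the others, and each integrates to at most B.\<close>

lemma Lq_bounded_local_L1:
  assumes e: "Lq_bounded q e B" and B: "B > 0" and q: "1 \<le> q"
  shows "\<exists>h. integrable lebesgue h \<and> integral\<^sup>L lebesgue h \<le> 2 * B \<and>
    (AE t in lebesgue. indicat_real {b..b+1} t * norm (e t) \<le> h t)"
proof (cases "q = \<infinity>")
  case True
  have "AE t in lebesgue. norm (e t) \<le> B" using e True by (simp add: Lq_bounded_def)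
  then have "AE t in lebesgue. indicat_real {b..b+1} t * norm (e t) \<le> B * indicat_real {b..b+1} t"
    by eventually_elim (auto simp: indicator_def)
  then show ?thesis using B integrable_indicator_Icc[of b "b+1"] integral_indicator_Icc[of b "b+1"]
    by (intro exI[of _ "\<lambda>t. B * indicat_real {b..b+1} t"] conjI) auto
next
  case False
  define r where "r = real_of_ereal q"
  have r: "1 \<le> r" using q False by (cases q) (auto simp: r_def)
  have i: "integrable lebesgue (\<lambda>t. norm (e t) powr r)" and n: "Lp_norm r e \<le> B"
    using e False by (auto simp: Lq_bounded_def in_Lp_def r_def)
  define I where "I = integral\<^sup>L lebesgue (\<lambda>t. norm (e t) powr r)"
  have I0: "I \<ge> 0" by (simp add: I_def)
  have "I = (I powr (1 / r)) powr r" using r I0 by (simp add: powr_powr)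
  also have "\<dots> \<le> B powr r" using n r by (intro powr_mono2) (auto simp: Lp_norm_def I_def)
  finally have IB: "I \<le> B powr r" .
  define h where "h t = B * indicat_real {b..b+1} t + (B / B powr r) * norm (e t) powr r" for t
  have hi: "integrable lebesgue (\<lambda>t. B * indicat_real {b..b+1} t)" "integrable lebesgue (\<lambda>t. (B / B powr r) * norm (e t) powr r)"
    using integrable_indicator_Icc[of b "b+1"] i by (auto intro!: integrable_mult_right)
  have "integral\<^sup>L lebesgue h = B * 1 + (B / B powr r) * I"
    unfolding h_def[abs_def] Bochner_Integration.integral_add[OF hi] I_def using integral_indicator_Icc[of b "b+1"] by simp
  also have "\<dots> \<le> B * 1 + (B / B powr r) * B powr r" using B IB by (intro add_left_mono mult_left_mono) auto
  also have "\<dots> = 2 * B" using B by simp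
  finally have "integral\<^sup>L lebesgue h \<le> 2 * B" .
  moreover have "indicat_real {b..b+1} t * norm (e t) \<le> h t" for t
  proof (cases "norm (e t) \<le> B")
    case True
    have "0 \<le> (B / B powr r) * norm (e t) powr r" using B by simp
    moreover have "indicat_real {b..b+1} t * norm (e t) \<le> B * indicat_real {b..b+1} t"
      using True by (auto simp: indicator_def)
    ultimately show ?thesis unfolding h_def by linarith
  next
    case False
    define c where "c = norm (e t) / B"
    have c: "c \<ge> 1" using False B by (simp add: c_def)
    have ec: "norm (e t) = B * c" using B by (simp add: c_def)
    have "indicat_real {b..b+1} t * norm (e t) \<le> B * c powr 1" using B c by (auto simp: ec indicator_def)
    also have "\<dots> \<le> B * c powr r" using B c r by (intro mult_left_mono powr_mono) auto
    also have "\<dots> = (B / B powr r) * norm (e t) powr r" using B c by (simp add: ec powr_mult)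
    also have "\<dots> \<le> h t" using B by (simp add: h_def indicator_def)
    finally show ?thesis .
  qed
  ultimately show ?thesis using hi unfolding h_def by (intro exI[of _ h] conjI AE_I2) (auto simp: h_def[abs_def])
qed

text \<open>For finite q there is no pointwise bound on \<open>e2\<close>, so the lower bound
  \<open>l\<close> is averaged over a unit interval. Truncating the norm at \<open>l\<close>
  supplies the majorant for dominated convergence while the errors \<delta> vanish
  pointwise.\<close>

lemma limit_average_bound:
  fixes e1 e2 :: "nat \<Rightarrow> real \<Rightarrow> 'a::real_normed_vector"
  assumes e1: "\<And>m. Lq_bounded \<infinity> (e1 m) B1" and e2: "\<And>m. Lq_bounded q (e2 m) B2"
    and B: "B2 > 0" "B1 > 0" and q: "1 \<le> q" and l: "0 \<le> l"
    and le: "AE t in lebesgue. t \<in> {b..b+1} \<longrightarrow> (\<forall>m. l \<le> norm (e1 m t + e2 m t) + \<delta> m t)"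
    and \<delta>: "\<And>t. t \<in> {b<..<b+1} \<Longrightarrow> (\<lambda>m. \<delta> m t) \<longlonglongrightarrow> 0"
  shows "l \<le> 2 * B1 + 2 * B2"
proof -
  let ?i = "indicat_real {b..b+1}"
  define u where "u m t = ?i t * min (norm (e1 m t + e2 m t)) l" for m t
  have um: "u m \<in> borel_measurable lebesgue" for m
  proof -
    have "strongly_measurable lebesgue (\<lambda>t. e1 m t + e2 m t)"
      using e1 e2 by (intro strongly_measurable_add) (rule Lq_bounded_strongly_measurable, fast)+
    then show ?thesis unfolding u_def[abs_def]
      by (intro borel_measurable_times borel_measurable_min borel_measurable_const borel_measurable_indicator
          strongly_measurable_norm) auto
  qed
  have li: "integrable lebesgue (\<lambda>t. ?i t * l)" by (intro integrable_mult_left integrable_indicator_Icc)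
  have "(\<lambda>m. integral\<^sup>L lebesgue (u m)) \<longlonglongrightarrow> integral\<^sup>L lebesgue (\<lambda>t. ?i t * l)"
  proof (rule integral_dominated_convergence[OF _ um li])
    show "(\<lambda>t. ?i t * l) \<in> borel_measurable lebesgue" by (rule borel_measurable_integrable[OF li])
    show "AE t in lebesgue. norm (u m t) \<le> ?i t * l" for m
      using l by (intro AE_I2) (auto simp: u_def indicator_def)
    have "AE t in lebesgue. t \<noteq> b" "AE t in lebesgue. t \<noteq> b + 1"
      by (rule AE_I[where N="{b}"]; auto) (rule AE_I[where N="{b+1}"]; auto)
    with le show "AE t in lebesgue. (\<lambda>m. u m t) \<longlonglongrightarrow> ?i t * l"
    proof eventually_elim
      case (elim t)
      show ?case
      proof (cases "t \<in> {b..b+1}")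
        case True
        with elim have t: "t \<in> {b<..<b+1}" by auto
        have lim: "(\<lambda>m. l - \<bar>\<delta> m t\<bar>) \<longlonglongrightarrow> l"
          using tendsto_diff[OF tendsto_const tendsto_rabs_zero[OF \<delta>[OF t]], of l] by simp
        have low: "l - \<bar>\<delta> m t\<bar> \<le> min (norm (e1 m t + e2 m t)) l" for m
        proof -
          have "l \<le> norm (e1 m t + e2 m t) + \<delta> m t" using elim(1) True by blast
          then show ?thesis by linarith
        qed
        have "(\<lambda>m. min (norm (e1 m t + e2 m t)) l) \<longlonglongrightarrow> l"
          by (rule tendsto_sandwich[OF always_eventually always_eventually lim tendsto_const]) (use low in auto)
        then show ?thesis using True by (simp add: u_def)
      qed (simp add: u_def)
    qed
  qed
  moreover have "integral\<^sup>L lebesgue (u m) \<le> 2 * B1 + 2 * B2" for m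
  proof -
    obtain h1 where h1: "integrable lebesgue h1" "integral\<^sup>L lebesgue h1 \<le> 2 * B1"
      "AE t in lebesgue. ?i t * norm (e1 m t) \<le> h1 t" using Lq_bounded_local_L1[OF e1 B(2), of b] by auto
    obtain h2 where h2: "integrable lebesgue h2" "integral\<^sup>L lebesgue h2 \<le> 2 * B2"
      "AE t in lebesgue. ?i t * norm (e2 m t) \<le> h2 t" using Lq_bounded_local_L1[OF e2 B(1) q, of b] by auto
    have ui: "integrable lebesgue (u m)"
      by (rule Bochner_Integration.integrable_bound[OF li um]) (use l in \<open>auto simp: u_def indicator_def\<close>)
    have "integral\<^sup>L lebesgue (u m) \<le> integral\<^sup>L lebesgue (\<lambda>t. h1 t + h2 t)"
    proof (rule integral_mono_AE[OF ui Bochner_Integration.integrable_add[OF h1(1) h2(1)]])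
      from h1(3) h2(3) show "AE t in lebesgue. u m t \<le> h1 t + h2 t"
      proof eventually_elim
        case (elim t)
        have "u m t \<le> ?i t * (norm (e1 m t) + norm (e2 m t))"
          unfolding u_def using norm_triangle_ineq[of "e1 m t" "e2 m t"] by (intro mult_left_mono) auto
        then show ?case using elim by (simp add: distrib_left)
      qed
    qed
    then show ?thesis using h1 h2 by simp
  qed
  ultimately have "integral\<^sup>L lebesgue (\<lambda>t. ?i t * l) \<le> 2 * B1 + 2 * B2" by (intro LIMSEQ_le_const2) auto
  then show ?thesis using integral_indicator_Icc[of b "b+1"] by (simp add: mult.commute)
qed

lemma Cc_infty_bounded:
  assumes "Cc_infty \<psi>"
  shows "continuous_on UNIV \<psi>" "\<exists>B\<ge>0. \<forall>t. norm (\<psi> t) \<le> B"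
proof -
  show c: "continuous_on UNIV \<psi>" using smooth_continuous_on[of \<psi> 0] assms by (simp add: Cc_infty_def)
  have "compact (\<psi> ` closure {t. \<psi> t \<noteq> 0})"
    using assms by (intro compact_continuous_image continuous_on_subset[OF c]) (auto simp: Cc_infty_def)
  then obtain B where B: "\<And>z. z \<in> \<psi> ` closure {t. \<psi> t \<noteq> 0} \<Longrightarrow> norm z \<le> B"
    using compact_imp_bounded bounded_iff by metis
  have "norm (\<psi> t) \<le> max 0 B" for t
  proof (cases "\<psi> t = 0")
    case False
    then have "t \<in> closure {t. \<psi> t \<noteq> 0}" by (intro subsetD[OF closure_subset]) simp
    then have "\<psi> t \<in> \<psi> ` closure {t. \<psi> t \<noteq> 0}" by (rule imageI)
    then show ?thesis using B by (simp add: max.coboundedI2)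
  qed simp
  then show "\<exists>B\<ge>0. \<forall>t. norm (\<psi> t) \<le> B" by (meson max.cobounded1)
qed

context growth_semigroup
begin

text \<open>Boundedness of \<psi> makes both frequency integrals absolutely convergent, so the two
  halves can be added under the integral.\<close>

lemma multiplier_split:
  fixes J :: "'z::{complex_normed_vector,banach} \<Rightarrow> 'x"
  assumes J: "bounded_clinear J" and f: "dot_schwartz f" and \<psi>: "Cc_infty \<psi>"
  shows "multiplier_op (\<lambda>\<xi> z. scaleC (\<psi> \<xi>) ((RR (\<i> * complex_of_real \<xi>) ^^ k) (J z))) f t
     + multiplier_op (\<lambda>\<xi> z. scaleC (1 - \<psi> \<xi>) ((RR (\<i> * complex_of_real \<xi>) ^^ k) (J z))) f t
     = multiplier_op (\<lambda>\<xi> z. (RR (\<i> * complex_of_real \<xi>) ^^ k) (J z)) f t"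
proof -
  let ?h = "\<lambda>\<xi>. (RR (\<i> * complex_of_real \<xi>) ^^ k) (J (fourier f \<xi>))"
  have h: "bochner_integrable ?h" by (rule resolvent_fourier_integrable[OF J f])
  have g: "bochner_integrable (\<lambda>\<xi>. scaleC (cis (\<xi> * t)) (scaleC (\<phi> \<xi>) (?h \<xi>)))"
    if "continuous_on UNIV \<phi>" "\<And>\<xi>. norm (\<phi> \<xi>) \<le> B" for \<phi> and B
  proof (rule bochner_integrable_cis)
    show "bochner_integrable (\<lambda>\<xi>. scaleC (\<phi> \<xi>) (?h \<xi>))"
    proof (rule bochner_integrable_bound)
      show "strongly_measurable lebesgue (\<lambda>\<xi>. scaleC (\<phi> \<xi>) (?h \<xi>))"
        by (rule strongly_measurable_scaleC[OF strongly_measurable_continuous[OF that(1)] bochner_integrableD(1)[OF h]])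
      show "integrable lebesgue (\<lambda>\<xi>. B * norm (?h \<xi>))" by (intro integrable_mult_right bochner_integrableD(2)[OF h])
      show "AE \<xi> in lebesgue. norm (scaleC (\<phi> \<xi>) (?h \<xi>)) \<le> B * norm (?h \<xi>)"
        by (intro AE_I2) (simp add: norm_scaleC mult_right_mono that(2))
    qed
  qed (intro continuous_intros)
  obtain B where B: "\<And>\<xi>. norm (\<psi> \<xi>) \<le> B" using Cc_infty_bounded(2)[OF \<psi>] by blast
  have c: "continuous_on UNIV \<psi>" by (rule Cc_infty_bounded(1)[OF \<psi>])
  have g1: "bochner_integrable (\<lambda>\<xi>. scaleC (cis (\<xi> * t)) (scaleC (\<psi> \<xi>) (?h \<xi>)))" by (rule g[OF c B])
  have "norm (1 - \<psi> \<xi>) \<le> 1 + B" for \<xi> using norm_triangle_ineq4[of 1 "\<psi> \<xi>"] B[of \<xi>] by simp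
  then have g2: "bochner_integrable (\<lambda>\<xi>. scaleC (cis (\<xi> * t)) (scaleC (1 - \<psi> \<xi>) (?h \<xi>)))"
    by (intro g continuous_intros c)
  have "scaleC (cis (\<xi> * t)) (scaleC (\<psi> \<xi>) (?h \<xi>)) + scaleC (cis (\<xi> * t)) (scaleC (1 - \<psi> \<xi>) (?h \<xi>))
      = scaleC (cis (\<xi> * t)) (?h \<xi>)" for \<xi>
    by (simp add: scaleC_add_right[symmetric] scaleC_add_left[symmetric])
  then show ?thesis
    unfolding multiplier_op_def inv_fourier_def scaleR_add_right[symmetric] bochner_integral_add[OF g1 g2, symmetric]
    by simp
qed

end

lemma Lq_bounded_mono: "Lq_bounded q g K \<Longrightarrow> K \<le> K' \<Longrightarrow> Lq_bounded q g K'"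
  unfolding Lq_bounded_def by (auto split: if_splits)

context growth_semigroup
begin

text \<open>Integrability of the orbit serves the existence of limits alone; the constant comes from
  the multiplier bounds, the combs, \<open>CT\<close>, \<open>J\<close>, the integral of
  \<open>theta\<close> and T on [0, 3]. Being independent of y, it will survive the passage to the
  closure.\<close>

lemma multiplier_imp_decay_integrable:
  fixes J :: "'z::{complex_normed_vector,banach} \<Rightarrow> 'x"
  assumes J: "bounded_clinear J"
    and inv: "\<And>t y. t \<in> {0..1} \<Longrightarrow> \<exists>y'. J y' = T t (J y) \<and> norm y' \<le> CT * norm y"
    and m1: "fourier_multiplier 1 \<infinity> (\<lambda>\<xi> z. scaleC (\<psi> \<xi>) ((RR (\<i> * complex_of_real \<xi>) ^^ Suc n) (J z)))"
    and m2: "fourier_multiplier p q (\<lambda>\<xi> z. scaleC (1 - \<psi> \<xi>) ((RR (\<i> * complex_of_real \<xi>) ^^ Suc n) (J z)))"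
    and \<psi>: "Cc_infty \<psi>" and p: "1 \<le> p" and pq: "ereal p \<le> q"
  shows "\<exists>K. \<forall>y. integrable lebesgue (\<lambda>t. if t \<in> {0..} then norm ((t ^ n) *\<^sub>R T t (J y)) else 0) \<longrightarrow>
    (\<forall>t\<ge>0. t ^ n * norm (T t (J y)) \<le> K * norm y)"
proof -
  let ?M = "\<lambda>\<xi> z. (RR (\<i> * complex_of_real \<xi>) ^^ Suc n) (J z)"
  obtain E1 c1 where
    E1: "\<And>f. in_Lp 1 f \<Longrightarrow> Lq_bounded \<infinity> (E1 f) (c1 * Lp_norm 1 f)"
    and E1l: "\<And>f g c. in_Lp 1 f \<Longrightarrow> in_Lp 1 g \<Longrightarrow> AE t in lebesgue. E1 (\<lambda>s. f s + scaleC c (g s)) t = E1 f t + scaleC c (E1 g t)"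
    and E1m: "\<And>f. dot_schwartz f \<Longrightarrow> AE t in lebesgue. E1 f t = multiplier_op (\<lambda>\<xi> z. scaleC (\<psi> \<xi>) (?M \<xi> z)) f t"
    using m1 unfolding fourier_multiplier_def by blast
  obtain E2 c2 where
    E2: "\<And>f. in_Lp p f \<Longrightarrow> Lq_bounded q (E2 f) (c2 * Lp_norm p f)"
    and E2l: "\<And>f g c. in_Lp p f \<Longrightarrow> in_Lp p g \<Longrightarrow> AE t in lebesgue. E2 (\<lambda>s. f s + scaleC c (g s)) t = E2 f t + scaleC c (E2 g t)"
    and E2m: "\<And>f. dot_schwartz f \<Longrightarrow> AE t in lebesgue. E2 f t = multiplier_op (\<lambda>\<xi> z. scaleC (1 - \<psi> \<xi>) (?M \<xi> z)) f t"
    using m2 unfolding fourier_multiplier_def by blast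
  obtain K1 where K1: "K1 > 0" "\<And>N \<kappa> f. N > 0 \<Longrightarrow> \<kappa> \<ge> 0 \<Longrightarrow> strongly_measurable lebesgue (f :: real \<Rightarrow> 'z) \<Longrightarrow>
      (\<And>v. norm (f v) \<le> \<kappa> * comb N v) \<Longrightarrow> Lp_norm 1 f \<le> K1 * \<kappa>"
    using comb_Lp[of 1, where 'a='z] by fastforce
  obtain K2 where K2: "K2 > 0" "\<And>N \<kappa> f. N > 0 \<Longrightarrow> \<kappa> \<ge> 0 \<Longrightarrow> strongly_measurable lebesgue (f :: real \<Rightarrow> 'z) \<Longrightarrow>
      (\<And>v. norm (f v) \<le> \<kappa> * comb N v) \<Longrightarrow> Lp_norm p f \<le> K2 * \<kappa>"
    using comb_Lp[OF p, where 'a='z] by fastforce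
  obtain M0 where M0: "M0 \<ge> 0" "\<And>t z. t \<in> {0..3} \<Longrightarrow> norm (T t z) \<le> M0 * norm z"
    using T_locally_bounded[of 3] by blast
  \<comment> \<open>Adding 1 makes M positive, so that it can be divided by.\<close>
  define M where "M = M0 + 1"
  have M: "M > 0" "norm (T t z) \<le> M * norm z" if "t \<in> {0..3}" for t z
    using M0(1) M0(2)[OF that, of z] by (auto simp: M_def distrib_right intro: add_increasing2)
  have M': "M > 0" using M0(1) by (simp add: M_def)
  obtain KJ where KJ: "\<And>z. norm (J z) \<le> norm z * KJ" using J unfolding bounded_clinear_def by blast
  define c0 where "c0 = \<bar>integral UNIV theta\<bar>"
  have c0: "c0 > 0" using theta_integral_nonzero by (simp add: c0_def)
  define CT' where "CT' = max CT 1"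
  have CT': "CT' > 0" "CT \<le> CT'" by (auto simp: CT'_def)
  define b1 where "b1 = (\<bar>c1\<bar> + 1) * (K1 * CT')"
  define b2 where "b2 = (\<bar>c2\<bar> + 1) * (K2 * CT')"
  have b: "b1 > 0" "b2 > 0" using K1(1) K2(1) CT'(1) by (auto simp: b1_def b2_def)
  define K where "K = 3 ^ n * fact n * M / c0 * (2 * b1 + 2 * b2)"
  have main: "c0 * ((t0 - 2) ^ n / fact n) * (norm (T t0 (J y)) / M) \<le> (2 * b1 + 2 * b2) * norm y"
    if i: "integrable lebesgue (\<lambda>t. if t \<in> {0..} then norm ((t ^ n) *\<^sub>R T t (J y)) else 0)"
      and y: "y \<noteq> 0" and t0: "t0 \<ge> 3" for y t0
  proof -
    define x where "x = J y"
    obtain C where C: "\<And>s. s \<ge> 0 \<Longrightarrow> norm (T s (J y)) \<le> C" "\<And>s. s \<ge> 0 \<Longrightarrow> s ^ n * norm (T s (J y)) \<le> C"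
      using orbit_sup[OF i] by blast
    have "\<exists>Z. \<forall>r\<in>{0..1}. J (Z r) = T r (J y) \<and> norm (Z r) \<le> CT * norm y"
      using inv by (intro bchoice) blast
    then obtain Z where Z: "\<And>r. r \<in> {0..1} \<Longrightarrow> J (Z r) = T r (J y)" "\<And>r. r \<in> {0..1} \<Longrightarrow> norm (Z r) \<le> CT * norm y"
      by blast
    have Zn: "norm (Z r) \<le> CT' * norm y" if "r \<in> {0..1}" for r
      using Z(2)[OF that] CT'(2) by (meson mult_right_mono norm_ge_zero order_trans)
    define F where "F m j v = scaleC (complex_of_real (bump (real (Suc m)) (- (real j / real (Suc m)) - v)))
        ((1 / real (Suc m)) *\<^sub>R Z (real j / real (Suc m)))" for m j v
    define f where "f m v = (\<Sum>j<Suc m. F m j v)" for m v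
    have ds: "dot_schwartz (F m j)" for m j
      unfolding F_def[abs_def] by (rule dot_schwartz_bump) simp
    have dec: "decaying (F m j)" for m j
      using ds by (intro schwartz_decaying) (simp add: dot_schwartz_def)
    have fdec: "decaying (f m)" for m unfolding f_def[abs_def] by (rule decaying_sum) (auto intro: dec)
    have fc: "norm (f m v) \<le> (CT' * norm y) * comb (Suc m) v" for m v
    proof -
      have "norm (F m j v) \<le> (CT' * norm y) * ((1 / real (Suc m)) * \<bar>bump (real (Suc m)) (- (real j / real (Suc m)) - v)\<bar>)"
        if "j < Suc m" for j
      proof -
        have "real j / real (Suc m) \<in> {0..1}" using that by simp
        from mult_right_mono[OF Zn[OF this], of "(1 / real (Suc m)) * \<bar>bump (real (Suc m)) (- (real j / real (Suc m)) - v)\<bar>"]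
        show ?thesis by (simp add: F_def norm_scaleC mult_ac del: of_nat_Suc)
      qed
      then show ?thesis
        unfolding f_def comb_def sum_distrib_left by (intro order_trans[OF norm_sum sum_mono]) auto
    qed
    have k0: "CT' * norm y \<ge> 0" using CT'(1) by simp
    have fm: "strongly_measurable lebesgue (f m)" for m
      using fdec[of m] by (simp add: decaying_def strongly_measurable_continuous)
    have le1: "Lq_bounded \<infinity> (E1 (f m)) (b1 * norm y)" for m
    proof (rule Lq_bounded_mono[OF E1])
      show "in_Lp 1 (f m)" by (rule decaying_in_Lp[OF _ fdec]) simp
      have "c1 * Lp_norm 1 (f m) \<le> (\<bar>c1\<bar> + 1) * (K1 * (CT' * norm y))"
        by (intro mult_mono K1(2)[OF _ k0 fm fc]) (auto simp: Lp_norm_def)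
      then show "c1 * Lp_norm 1 (f m) \<le> b1 * norm y" by (simp add: b1_def mult.assoc)
    qed
    have le2: "Lq_bounded q (E2 (f m)) (b2 * norm y)" for m
    proof (rule Lq_bounded_mono[OF E2])
      show "in_Lp p (f m)" by (rule decaying_in_Lp[OF p fdec])
      have "c2 * Lp_norm p (f m) \<le> (\<bar>c2\<bar> + 1) * (K2 * (CT' * norm y))"
        by (intro mult_mono K2(2)[OF _ k0 fm fc]) (auto simp: Lp_norm_def)
      then show "c2 * Lp_norm p (f m) \<le> b2 * norm y" by (simp add: b2_def mult.assoc)
    qed
    define H where "H m \<tau> = integral UNIV (\<lambda>v. bump (real (Suc m)) (\<tau> - v) *\<^sub>R (translate_weight n (Suc m) v *\<^sub>R T (max 0 v) x))" for m \<tau>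
    \<comment> \<open>Countably many pairs (m, j) occur, so one null set serves all of them and m
      can tend to infinity pointwise.\<close>
    have EH: "AE t in lebesgue. \<forall>m. E1 (f m) t + E2 (f m) t = scaleC ((-1) ^ Suc n) (H m (- t))"
      unfolding AE_all_countable
    proof
      fix m
      have "AE t in lebesgue. \<forall>j. E1 (F m j) t = multiplier_op (\<lambda>\<xi> z. scaleC (\<psi> \<xi>) (?M \<xi> z)) (F m j) t"
        unfolding AE_all_countable using E1m[OF ds] by blast
      moreover have "AE t in lebesgue. \<forall>j. E2 (F m j) t = multiplier_op (\<lambda>\<xi> z. scaleC (1 - \<psi> \<xi>) (?M \<xi> z)) (F m j) t"
        unfolding AE_all_countable using E2m[OF ds] by blast
      moreover have "AE t in lebesgue. E1 (f m) t = (\<Sum>j<Suc m. E1 (F m j) t)"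
        unfolding f_def[abs_def] by (rule AE_linear_sum[OF E1l _ dec]) auto
      moreover have "AE t in lebesgue. E2 (f m) t = (\<Sum>j<Suc m. E2 (F m j) t)"
        unfolding f_def[abs_def] by (rule AE_linear_sum[OF E2l p dec])
      ultimately show "AE t in lebesgue. E1 (f m) t + E2 (f m) t = scaleC ((-1) ^ Suc n) (H m (- t))"
      proof eventually_elim
        case (elim t)
        have "E1 (f m) t + E2 (f m) t = (\<Sum>j<Suc m. E1 (F m j) t + E2 (F m j) t)"
          unfolding elim(3,4) by (simp only: sum.distrib)
        also have "\<dots> = (\<Sum>j<Suc m. multiplier_op ?M (F m j) t)"
          using elim(1,2) multiplier_split[OF J ds \<psi>, of "Suc n"] by (simp only:)
        also have "\<dots> = scaleC ((-1) ^ Suc n) (H m (- t))"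
          using comb_multiplier[OF J C Z(1), of "Suc m" "- t"] unfolding F_def[abs_def] H_def x_def by simp
        finally show ?case .
      qed
    qed
    define \<delta> where "\<delta> m t = norm (H m (- t) - (integral UNIV theta * translate_weight n (Suc m) (- t)) *\<^sub>R T (- t) x)" for m t
    \<comment> \<open>For \<tau> in [t0 - 1, t0] the orbit at t0 is at most M times the orbit at
      \<tau>, and the weight at \<tau> is at least (\<tau> - 1)^n / n!; hence the base t0 -
      2.\<close>
    define L where "L = c0 * ((t0 - 2) ^ n / fact n) * (norm (T t0 x) / M)"
    have L0: "L \<ge> 0" unfolding L_def using c0 t0 M' by simp
    have "L \<le> 2 * (b1 * norm y) + 2 * (b2 * norm y)"
    proof (rule limit_average_bound[OF le1 le2 _ _ _ L0])
      show "0 < b1 * norm y" "0 < b2 * norm y" using b y by auto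
      show "1 \<le> q" using p pq by (metis ereal_less_eq(3) one_ereal_def order_trans)
      show "(\<lambda>m. \<delta> m t) \<longlonglongrightarrow> 0" if "t \<in> {- t0<..<- t0 + 1}" for t
        unfolding \<delta>_def H_def x_def
        by (rule tendsto_norm_zero, rule comb_limit[OF i]) (use that t0 in auto)
      show "AE t in lebesgue. t \<in> {- t0..- t0 + 1} \<longrightarrow> (\<forall>m. L \<le> norm (E1 (f m) t + E2 (f m) t) + \<delta> m t)"
        using EH
      proof eventually_elim
        case (elim t)
        show ?case
        proof (intro impI allI)
          fix m assume t: "t \<in> {- t0..- t0 + 1}"
          define \<tau> where "\<tau> = - t"
          have \<tau>: "t0 - 1 \<le> \<tau>" "\<tau> \<le> t0" using t by (auto simp: \<tau>_def)
          let ?W = "translate_weight n (Suc m) \<tau>"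
          have "norm (T t0 x) = norm (T (t0 - \<tau>) (T \<tau> x))" using T_add[of "t0 - \<tau>" \<tau> x] \<tau> t0 by simp
          also have "\<dots> \<le> M * norm (T \<tau> x)" using \<tau> t0 by (intro M) auto
          finally have T1: "norm (T t0 x) / M \<le> norm (T \<tau> x)" using M' by (simp add: divide_le_eq mult.commute)
          have "(t0 - 2) ^ n / fact n \<le> (\<tau> - 1) ^ n / fact n"
            using \<tau> t0 by (intro divide_right_mono power_mono) auto
          also have "\<dots> \<le> ?W" using \<tau> t0 by (intro translate_weight_bounds) auto
          finally have "(t0 - 2) ^ n / fact n \<le> ?W" .
          then have "((t0 - 2) ^ n / fact n) * (norm (T t0 x) / M) \<le> ?W * norm (T \<tau> x)"
            using T1 M' t0 by (intro mult_mono translate_weight_bounds) auto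
          then have "L \<le> c0 * (?W * norm (T \<tau> x))"
            unfolding L_def mult.assoc using c0 by (intro mult_left_mono) auto
          also have "\<dots> = norm ((integral UNIV theta * ?W) *\<^sub>R T \<tau> x)"
            using translate_weight_bounds(1)[of "Suc m" n \<tau>] by (simp add: c0_def abs_mult)
          also have "\<dots> \<le> norm (H m \<tau>) + \<delta> m t"
            unfolding \<delta>_def \<tau>_def[symmetric] by (metis norm_minus_commute norm_triangle_sub)
          also have "norm (H m \<tau>) = norm (E1 (f m) t + E2 (f m) t)"
            using elim by (simp add: \<tau>_def norm_scaleC norm_power)
          finally show "L \<le> norm (E1 (f m) t + E2 (f m) t) + \<delta> m t" .
        qed
      qed
    qed
    then show ?thesis by (simp add: L_def x_def algebra_simps)
  qed
  have "t ^ n * norm (T t (J y)) \<le> (K + 3 ^ n * (M * \<bar>KJ\<bar>)) * norm y"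
    if i: "integrable lebesgue (\<lambda>t. if t \<in> {0..} then norm ((t ^ n) *\<^sub>R T t (J y)) else 0)" and t: "t \<ge> 0" for y t
  proof -
    have K0: "0 \<le> K * norm y" unfolding K_def using M' c0 b by simp
    have K0': "0 \<le> 3 ^ n * (M * \<bar>KJ\<bar>) * norm y" using M' by simp
    consider "y = 0" | "t \<le> 3" | "t \<ge> 3" "y \<noteq> 0" by fastforce
    then show ?thesis
    proof cases
      case 1
      then have "T t (J y) = 0"
        using linear_0[OF bounded_linear.linear[OF bounded_clinear_bounded_linear[OF J]]]
          linear_0[OF bounded_linear.linear[OF T_bounded_linear[OF t]]] by simp
      then show ?thesis using 1 by simp
    next
      case 2
      have "norm (J y) \<le> \<bar>KJ\<bar> * norm y" using KJ[of y] abs_ge_self[of KJ]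
        by (metis mult.commute mult_right_mono norm_ge_zero order_trans)
      then have "norm (T t (J y)) \<le> M * (\<bar>KJ\<bar> * norm y)"
        using M(2)[of t "J y"] 2 t M' by (auto intro: order_trans mult_left_mono)
      then have "t ^ n * norm (T t (J y)) \<le> 3 ^ n * (M * (\<bar>KJ\<bar> * norm y))"
        using 2 t by (intro mult_mono power_mono) auto
      then show ?thesis using K0 by (simp add: distrib_right mult.assoc)
    next
      case 3
      \<comment> \<open>t <= 3 (t - 2) holds from t = 3 on; smaller times are covered by the local
        bound of T.\<close>
      have "t ^ n \<le> (3 * (t - 2)) ^ n" using 3 by (intro power_mono) auto
      then have "t ^ n * norm (T t (J y)) \<le> (3 * (t - 2)) ^ n * norm (T t (J y))" by (rule mult_right_mono) simp
      also have "\<dots> = (3 ^ n * fact n * M / c0) * (c0 * ((t - 2) ^ n / fact n) * (norm (T t (J y)) / M))"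
        unfolding power_mult_distrib using M' c0 by simp
      also have "\<dots> \<le> (3 ^ n * fact n * M / c0) * ((2 * b1 + 2 * b2) * norm y)"
        using main[OF i 3(2,1)] M' c0 by (intro mult_left_mono) auto
      also have "\<dots> = K * norm y" by (simp add: K_def)
      finally show ?thesis using K0' by (simp add: distrib_right)
    qed
  qed
  then show ?thesis by blast
qed

text \<open>For fixed t the estimate is a closed condition on y, so it passes from the dense
  subspace to all of Y. On [0, 1] the bound in the norm of Y becomes \<open>CT * M\<close>, because
  T is uniformly bounded there.\<close>

theorem multiplier_imp_decay:
  fixes J :: "'z::{complex_normed_vector,banach} \<Rightarrow> 'x"
  assumes J: "bounded_clinear J" and adm: "admissible T J n"
    and m1: "fourier_multiplier 1 \<infinity> (\<lambda>\<xi> z. scaleC (\<psi> \<xi>) ((RR (\<i> * complex_of_real \<xi>) ^^ Suc n) (J z)))"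
    and m2: "fourier_multiplier p q (\<lambda>\<xi> z. scaleC (1 - \<psi> \<xi>) ((RR (\<i> * complex_of_real \<xi>) ^^ Suc n) (J z)))"
    and \<psi>: "Cc_infty \<psi>" and p: "1 \<le> p" and pq: "ereal p \<le> q"
  shows "\<exists>C. \<forall>t\<ge>0. \<forall>y. t ^ n * norm (T t (J y)) \<le> C * norm y"
proof -
  obtain CT Y0 where CT: "CT \<ge> 0" "\<And>t y. t \<ge> 0 \<Longrightarrow> \<exists>y'. T t (J y) = J y'"
      "\<And>t y y'. t \<ge> 0 \<Longrightarrow> T t (J y) = J y' \<Longrightarrow> norm y' \<le> CT * onorm (T t) * norm y"
    and Y0: "closure Y0 = UNIV" "\<And>y. y \<in> Y0 \<Longrightarrow> bochner_L1_on {0..} (\<lambda>t. (t ^ n) *\<^sub>R T t (J y))"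
    using adm unfolding admissible_def by blast
  obtain M where M: "M \<ge> 0" "\<And>t z. t \<in> {0..1} \<Longrightarrow> norm (T t z) \<le> M * norm z"
    using T_locally_bounded[of 1] by blast
  have inv: "\<exists>y'. J y' = T t (J y) \<and> norm y' \<le> (CT * M) * norm y" if t: "t \<in> {0..1}" for t y
  proof -
    obtain y' where y': "T t (J y) = J y'" using CT(2) t by fastforce
    have "norm y' \<le> CT * onorm (T t) * norm y" using CT(3)[OF _ y'] t by simp
    also have "\<dots> \<le> CT * M * norm y"
      using CT(1) M(1) M(2)[OF t] by (intro mult_right_mono mult_left_mono onorm_bound) auto
    finally show ?thesis using y' by metis
  qed
  obtain K where K: "\<And>y t. integrable lebesgue (\<lambda>t. if t \<in> {0..} then norm ((t ^ n) *\<^sub>R T t (J y)) else 0) \<Longrightarrow>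
      t \<ge> 0 \<Longrightarrow> t ^ n * norm (T t (J y)) \<le> K * norm y"
    using multiplier_imp_decay_integrable[OF J inv m1 m2 \<psi> p pq] by blast
  have "t ^ n * norm (T t (J y)) \<le> K * norm y" if t: "t \<ge> 0" for t y
  proof -
    let ?S = "{y. t ^ n * norm (T t (J y)) \<le> K * norm y}"
    have "continuous_on UNIV (\<lambda>y. T t (J y))"
      by (intro bounded_linear.continuous_on[OF T_bounded_linear[OF t]]
          bounded_linear.continuous_on[OF bounded_clinear_bounded_linear[OF J]] continuous_intros)
    then have "closed ?S" by (intro closed_Collect_le continuous_intros)
    moreover have "Y0 \<subseteq> ?S" using K[OF bochner_L1_on_integrable[OF Y0(2)] t] by auto
    ultimately have "closure Y0 \<subseteq> ?S" by (intro closure_minimal)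
    then show ?thesis using Y0(1) by auto
  qed
  then show ?thesis by blast
qed

end

text \<open>Serves the low-frequency condition when the cut-off \<psi> is chosen to be 0.\<close>

lemma fourier_multiplier_zero: "fourier_multiplier p q (\<lambda>\<xi> y. 0)"
proof -
  have "in_Lp r (\<lambda>t. 0 :: 'b::{complex_normed_vector,banach})" for r
    by (simp add: in_Lp_def strongly_measurable_const)
  then have "Lq_bounded q (\<lambda>t. 0 :: 'b::{complex_normed_vector,banach}) (0 * s)" for s
    by (simp add: Lq_bounded_def Lp_norm_def strongly_measurable_const)
  then show ?thesis
    unfolding fourier_multiplier_def
    by (intro conjI allI impI exI[of _ "\<lambda>_ _. 0"] exI[of _ "0::real"] exI[of _ "\<lambda>_::real. 0::real"])
      (auto simp: bounded_clinear_def clinear_def strongly_measurable_const multiplier_op_def inv_fourier_def onorm_zero intro!: exI[of _ "0::real"])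
qed

lemma Cc_infty_zero: "Cc_infty (\<lambda>_. 0)"
  using smoothI(1)[of "\<lambda>_ _. 0" "\<lambda>_. 0"] by (simp add: Cc_infty_def)

theorem theorem4p6:
  fixes T :: "real \<Rightarrow> 'x::{complex_normed_vector,banach} \<Rightarrow> 'x"
    and A :: "'x \<Rightarrow> 'x" and D :: "'x set"
    and J :: "'y::{complex_normed_vector,banach} \<Rightarrow> 'x"
    and \<alpha> \<beta> :: real and n :: nat
  assumes growth: "resolvent_growth T A D \<alpha> \<beta>"
    and embed: "bounded_clinear J" "inj J"
    and adm: "admissible T J n"
  defines "R \<equiv> \<lambda>k \<xi>. (resolvent A D (\<i> * complex_of_real \<xi>) ^^ k) \<circ> J"
  shows
    "((\<exists>C. \<forall>t\<ge>0. \<forall>y. t ^ n * norm (T t (J y)) \<le> C * norm y) \<longleftrightarrow>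
      (\<exists>(\<psi>::real \<Rightarrow> complex) (p::real) (q::ereal). Cc_infty \<psi> \<and> 1 \<le> p \<and> ereal p \<le> q \<and>
         (\<forall>k\<in>{n - 1, n, n + 1}. k \<ge> 1 \<longrightarrow>
            fourier_multiplier 1 \<infinity> (\<lambda>\<xi> y. scaleC (\<psi> \<xi>) (R k \<xi> y)) \<and>
            fourier_multiplier p q (\<lambda>\<xi> y. scaleC (1 - \<psi> \<xi>) (R k \<xi> y))))) \<and>
     ((\<exists>C. \<forall>t\<ge>0. \<forall>y. t ^ n * norm (T t (J y)) \<le> C * norm y) \<longrightarrow>
      (\<forall>k (p::real) (q::ereal).
         ((n \<ge> 2 \<and> 1 \<le> k \<and> k \<le> n - 1 \<and> 1 \<le> p \<and> ereal p \<le> q) \<or>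
          (k = n \<and> n \<ge> 1 \<and> 1 \<le> p \<and> ereal p < q) \<or>
          (k = n + 1 \<and> p = 1 \<and> q = \<infinity>))
         \<longrightarrow> fourier_multiplier p q (R k)))"
proof -
  interpret growth_semigroup T A D \<alpha> \<beta> by unfold_locales (rule growth)
  have R: "R k \<xi> y = (resolvent A D (\<i> * complex_of_real \<xi>) ^^ k) (J y)" for k \<xi> y
    by (simp add: R_def)
  have Rf: "R k = (\<lambda>\<xi> y. (resolvent A D (\<i> * complex_of_real \<xi>) ^^ k) (J y))" for k
    by (simp add: R_def comp_def)
  have cases: "fourier_multiplier p q (R k)"
    if "\<exists>C. \<forall>t\<ge>0. \<forall>y. t ^ n * norm (T t (J y)) \<le> C * norm y"
      and "(n \<ge> 2 \<and> 1 \<le> k \<and> k \<le> n - 1 \<and> 1 \<le> p \<and> ereal p \<le> q) \<or>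
          (k = n \<and> n \<ge> 1 \<and> 1 \<le> p \<and> ereal p < q) \<or>
          (k = n + 1 \<and> p = 1 \<and> q = \<infinity>)" for k and p :: real and q :: ereal
  proof -
    obtain C where "\<And>t y. t \<ge> 0 \<Longrightarrow> t ^ n * norm (T t (J y)) \<le> C * norm y" using \<open>\<exists>C. _ C\<close> by blast
    from decay_imp_fourier_multiplier_cases[OF embed(1) this that(2)] show ?thesis unfolding Rf .
  qed
  show ?thesis
  proof (intro conjI iffI impI allI)
    assume dec: "\<exists>C. \<forall>t\<ge>0. \<forall>y. t ^ n * norm (T t (J y)) \<le> C * norm y"
    \<comment> \<open>All three powers fall under the cases at the pair (1, \<infinity>): k = n - 1
      >= 1 forces n >= 2, and k = n is covered because 1 < \<infinity>.\<close>
    have "fourier_multiplier 1 \<infinity> (R k)" if "k \<in> {n - 1, n, n + 1}" "k \<ge> 1" for k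
      by (rule cases[OF dec]) (use that in auto)
    then show "\<exists>(\<psi>::real \<Rightarrow> complex) (p::real) (q::ereal). Cc_infty \<psi> \<and> 1 \<le> p \<and> ereal p \<le> q \<and>
         (\<forall>k\<in>{n - 1, n, n + 1}. k \<ge> 1 \<longrightarrow>
            fourier_multiplier 1 \<infinity> (\<lambda>\<xi> y. scaleC (\<psi> \<xi>) (R k \<xi> y)) \<and>
            fourier_multiplier p q (\<lambda>\<xi> y. scaleC (1 - \<psi> \<xi>) (R k \<xi> y)))"
      \<comment> \<open>With \<psi> = 0, p = 1 and q = \<infinity> the second condition concerns the
        bare resolvent powers and the first one the zero multiplier.\<close>
      by (intro exI[of _ "\<lambda>_. 0"] exI[of _ 1] exI[of _ \<infinity>]) (simp add: Cc_infty_zero fourier_multiplier_zero)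
  next
    assume "\<exists>(\<psi>::real \<Rightarrow> complex) (p::real) (q::ereal). Cc_infty \<psi> \<and> 1 \<le> p \<and> ereal p \<le> q \<and>
         (\<forall>k\<in>{n - 1, n, n + 1}. k \<ge> 1 \<longrightarrow>
            fourier_multiplier 1 \<infinity> (\<lambda>\<xi> y. scaleC (\<psi> \<xi>) (R k \<xi> y)) \<and>
            fourier_multiplier p q (\<lambda>\<xi> y. scaleC (1 - \<psi> \<xi>) (R k \<xi> y)))"
    then obtain \<psi> :: "real \<Rightarrow> complex" and p :: real and q :: ereal
      where \<psi>: "Cc_infty \<psi>" and p: "1 \<le> p" and pq: "ereal p \<le> q"
        and m: "fourier_multiplier 1 \<infinity> (\<lambda>\<xi> y. scaleC (\<psi> \<xi>) (R (Suc n) \<xi> y))"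
          "fourier_multiplier p q (\<lambda>\<xi> y. scaleC (1 - \<psi> \<xi>) (R (Suc n) \<xi> y))" by auto
    show "\<exists>C. \<forall>t\<ge>0. \<forall>y. t ^ n * norm (T t (J y)) \<le> C * norm y"
      by (rule multiplier_imp_decay[OF embed(1) adm m[unfolded R] \<psi> p pq])
  qed (rule cases)
qed

end
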